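(* Let $w$ be a doubling weight, $0<p<1$, $f\in L_p[-1,1]$, and let $r\in\mathbb{N}$ be such that $r>1/p$. Then, for $0<\alpha<r-1/p$, we have $$E_n(f)_{p,w_n}=O(n^{-\alpha})\iff\omega_\varphi^r(f,n^{-1})_{p,w_n}=O(n^{-\alpha})\qquad(n\to\infty).$$
   Context: A doubling weight is a nonnegative $w\in L_1[-1,1]$, extended by $0$ outside $[-1,1]$, for which there is a constant $L$ (the doubling constant of $w$) with $\int_{2I}w\le L\int_I w$ for all intervals $I\subset[-1,1]$, where $2I$ is the interval with the same center as $I$ and twice its length. Let $\varphi(x)=\sqrt{1-x^2}$, $\rho_n(x)=n^{-1}\sqrt{1-x^2}+n^{-2}$, and $w_n(x)=\frac{1}{\rho_n(x)}\int_{x-\rho_n(x)}^{x+\rho_n(x)}w(u)\,du$. For a weight $v$ on $[-1,1]$: $\|g\|_{p,v}=\left(\int_{-1}^1|g|^p v\right)^{1/p}$. $\Pi_n$ is the set of algebraic polynomials of degree $\le n-1$ and $E_n(f)_{p,v}=\inf_{P\in\Pi_n}\|f-P\|_{p,v}$. Symmetric difference: $\Delta_h^r(f,x)=\sum_{i=0}^r\binom ri(-1)^{r-i}f(x-rh/2+ih)$ if $x\pm rh/2\in[-1,1]$, and $0$ otherwise. Modulus: $\omega_\varphi^r(f,t)_{p,v}=\sup_{0<h\le t}\|\Delta_{h\varphi(\cdot)}^r(f,\cdot)\|_{p,v}$. *)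

theory Defs
  imports "HOL-Analysis.Analysis" "HOL-Computational_Algebra.Polynomial"
begin

text \<open>A weight on \<open>[-1,1]\<close> is represented by its extension by zero to the whole line.
  In the doubling condition, \<open>{a - (b - a)/2 .. b + (b - a)/2}\<close> is the interval with the same
  centre as \<open>{a..b}\<close> and twice its length.\<close>

definition doubling_constant :: "(real \<Rightarrow> real) \<Rightarrow> real \<Rightarrow> bool" where
  "doubling_constant w L \<longleftrightarrow>
     (\<forall>a b. -1 \<le> a \<and> a < b \<and> b \<le> 1 \<longrightarrow>
        (LINT u:{a - (b - a) / 2 .. b + (b - a) / 2}|lebesgue. w u)
          \<le> L * (LINT u:{a..b}|lebesgue. w u))"

definition doubling_weight :: "(real \<Rightarrow> real) \<Rightarrow> bool" where
  "doubling_weight w \<longleftrightarrow>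
     (\<forall>x\<in>{-1..1}. 0 \<le> w x) \<and> (\<forall>x. x \<notin> {-1..1} \<longrightarrow> w x = 0) \<and>
     set_integrable lebesgue {-1..1} w \<and>
     (\<exists>L. doubling_constant w L)"

definition phi :: "real \<Rightarrow> real" where
  "phi x = sqrt (1 - x\<^sup>2)"

definition rho :: "nat \<Rightarrow> real \<Rightarrow> real" where
  "rho n x = sqrt (1 - x\<^sup>2) / real n + 1 / (real n)\<^sup>2"

definition avg_weight :: "(real \<Rightarrow> real) \<Rightarrow> nat \<Rightarrow> real \<Rightarrow> real" where
  "avg_weight w n x = 1 / rho n x * (LINT u:{x - rho n x .. x + rho n x}|lebesgue. w u)"

definition in_Lp :: "real \<Rightarrow> (real \<Rightarrow> real) \<Rightarrow> bool" where
  "in_Lp p f \<longleftrightarrow> set_borel_measurable lebesgue {-1..1} f \<and>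
     set_integrable lebesgue {-1..1} (\<lambda>x. \<bar>f x\<bar> powr p)"

text \<open>There is no real power on \<open>ennreal\<close>; the exponents used here are positive, so
  \<open>\<infinity>\<close> is sent to \<open>\<infinity>\<close>.\<close>

definition ennreal_powr :: "ennreal \<Rightarrow> real \<Rightarrow> ennreal" where
  "ennreal_powr a s = (if a = \<infinity> then \<infinity> else ennreal (enn2real a powr s))"

text \<open>Norms are taken in \<open>[0,\<infinity>]\<close>, so that the suprema and infima below have no spurious
  values.\<close>

definition Lp_norm :: "real \<Rightarrow> (real \<Rightarrow> real) \<Rightarrow> (real \<Rightarrow> real) \<Rightarrow> ennreal" where
  "Lp_norm p v g =
     ennreal_powr (\<integral>\<^sup>+x\<in>{-1..1}. ennreal (\<bar>g x\<bar> powr p * v x) \<partial>lebesgue) (1 / p)"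

definition Poly_space :: "nat \<Rightarrow> real poly set" where
  "Poly_space n = {P. P = 0 \<or> degree P < n}"

definition best_approx :: "nat \<Rightarrow> (real \<Rightarrow> real) \<Rightarrow> real \<Rightarrow> (real \<Rightarrow> real) \<Rightarrow> ennreal" where
  "best_approx n f p v = (INF P\<in>Poly_space n. Lp_norm p v (\<lambda>x. f x - poly P x))"

definition central_difference :: "nat \<Rightarrow> real \<Rightarrow> (real \<Rightarrow> real) \<Rightarrow> real \<Rightarrow> real" where
  "central_difference r h f x =
     (if x - real r * h / 2 \<in> {-1..1} \<and> x + real r * h / 2 \<in> {-1..1}
      then \<Sum>i=0..r. real (r choose i) * (-1) ^ (r - i) * f (x - real r * h / 2 + real i * h)
      else 0)"

definition modulus ::
  "nat \<Rightarrow> (real \<Rightarrow> real) \<Rightarrow> real \<Rightarrow> real \<Rightarrow> (real \<Rightarrow> real) \<Rightarrow> ennreal" where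
  "modulus r f t p v = (SUP h\<in>{0<..t}. Lp_norm p v (\<lambda>x. central_difference r (h * phi x) f x))"

text \<open>The relation \<open>a n = O(b n)\<close> as \<open>n \<rightarrow> \<infinity>\<close>, for \<open>[0,\<infinity>]\<close>-valued \<open>a\<close>; the library's
  Landau symbols need values in a normed field.\<close>

definition ennreal_bigo :: "(nat \<Rightarrow> ennreal) \<Rightarrow> (nat \<Rightarrow> real) \<Rightarrow> bool" where
  "ennreal_bigo a b \<longleftrightarrow> (\<exists>C>0. \<forall>\<^sub>F n in sequentially. a n \<le> ennreal (C * \<bar>b n\<bar>))"

end

theory Submission
  imports Defs
begin

text \<open>For \<open>p \<le> 1\<close> one works with \<open>\<bar>g\<bar> powr p\<close>, which is subadditive in \<open>g\<close>. After the substitution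
  \<open>x = cos \<theta>\<close> the weight \<open>w\<^sub>n\<close> becomes slowly varying: by doubling, its values at \<open>\<theta>\<close> and \<open>\<tau>\<close> differ at
  most by a factor polynomial in \<open>n |\<theta> - \<tau>|\<close>, so a sufficiently high power of the Fejer kernel absorbs
  the weight.

  If \<open>E\<^sub>n(f) = O(n\<^sup>-\<^sup>\<alpha>)\<close>, near-best polynomials are telescoped over dyadic degrees. The \<open>r\<close>-th difference of
  a piece \<open>Q\<close> of degree \<open>m \<le> n\<close> is a mean value of its \<open>r\<close>-th derivative, which a weighted
  Bernstein inequality bounds. Replacing \<open>w\<^sub>n\<close> by \<open>w\<^sub>m\<close> costs a factor \<open>n/m\<close>; what remains is
  \<open>(m/n) powr (r p - 1)\<close>, and the sum over the pieces has the required size exactly because \<open>\<alpha> p < r p - 1\<close>.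

  Conversely, \<open>[-1,1]\<close> is covered by the overlapping cells between \<open>cos ((j-1) \<pi> / N)\<close> and
  \<open>cos ((j+1) \<pi> / N)\<close> with \<open>N = 8n\<close>. Whitney's inequality gives a polynomial of degree less than \<open>r\<close> on each cell, and these
  are blended by polynomials of degree \<open>O(n)\<close> in \<open>cos \<theta>\<close> which approximate step functions
  up to errors decaying like a high power of \<open>1 / (n |\<theta> - t\<^sub>j|)\<close>. In this way the error of approximation
  is bounded by the average of the weighted differences over the steps \<open>h \<le> 1/n\<close>.\<close>

section \<open>Powers with exponent at most one\<close>

text \<open>Only p-th powers are integrated and only polynomials are differentiated. Constants and
  nodes are taken at points where a p-th power does not exceed its mean.

  The Jacobian sin \<theta> vanishes at both ends, so it is not slowly varying at scale 1/n. The
  polynomial estimates therefore bound integrals over [0, \<pi>] by integrals over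
  [c/n, \<pi> - c/n], where sin \<theta> and sin \<theta> + 1/n are comparable. After that the
  Jacobian can be restored.

  The weight itself changes with n. Monotone in n is not w_n but \<rho>_n w_n, the mass of the
  averaging interval. For m <= n <= K m this gives w_n <= K^2 w_m, which lets a polynomial of degree
  O(n) built for w_n serve a larger index whose degree bound it meets.

  Finally f is only Lebesgue measurable. It is replaced by a Borel function equal to it almost
  everywhere. The differences survive this, because the maps x + c \<phi>(x) have derivative at
  least 1/2 where they are used, and so pull null sets back to null sets.\<close>

definition pp :: "real \<Rightarrow> real \<Rightarrow> ennreal" where
  "pp p x = ennreal (\<bar>x\<bar> powr p)"

lemma measurable_pp [measurable]: "pp p \<in> borel_measurable borel"
  unfolding pp_def[abs_def] by measurable

lemma pp_minus [simp]: "pp p (- x) = pp p x"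
  by (simp add: pp_def)

lemma pp_minus_commute: "pp p (x - y) = pp p (y - x)"
  by (simp add: pp_def abs_minus_commute)

lemma pp_0 [simp]: "pp p 0 = 0"
  by (simp add: pp_def)

lemma pp_lt_top [simp]: "pp p x < \<infinity>" "pp p x \<noteq> \<infinity>" "pp p x < top" "pp p x \<noteq> top"
  by (simp_all add: pp_def)

lemma pp_mult: "pp p (x * y) = pp p x * pp p y"
  by (simp add: pp_def abs_mult powr_mult ennreal_mult)

lemma pp_mono: "0 \<le> p \<Longrightarrow> \<bar>x\<bar> \<le> \<bar>y\<bar> \<Longrightarrow> pp p x \<le> pp p y"
  by (simp add: pp_def powr_mono2 ennreal_leI)

text \<open>By homogeneity one may normalise to a + b = 1, and t <= t^p on [0,1] because p <=
  1.\<close>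

lemma powr_add_le:
  fixes a b p :: real
  assumes "0 < p" "p \<le> 1" "0 \<le> a" "0 \<le> b"
  shows "(a + b) powr p \<le> a powr p + b powr p"
proof (cases "a + b = 0")
  case True
  then show ?thesis using assms by auto
next
  case False
  then have s: "a + b > 0" using assms by auto
  have le: "x \<le> x powr p" if "0 \<le> x" "x \<le> 1" for x :: real
  proof (cases "x = 0")
    case False
    then have "x powr 1 \<le> x powr p" using that assms by (intro powr_mono') auto
    then show ?thesis using that by simp
  qed simp
  have "1 = a / (a + b) + b / (a + b)" using s by (simp add: add_divide_distrib[symmetric])
  also have "\<dots> \<le> (a / (a + b)) powr p + (b / (a + b)) powr p"
    using s assms by (intro add_mono le) auto
  also have "\<dots> = (a powr p + b powr p) / (a + b) powr p"
    using s assms by (simp add: powr_divide add_divide_distrib)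
  finally show ?thesis using s powr_gt_zero[of "a + b" p] by (simp add: pos_le_divide_eq)
qed

lemma pp_add:
  assumes "0 < p" "p \<le> 1"
  shows "pp p (x + y) \<le> pp p x + pp p y"
proof -
  have "\<bar>x + y\<bar> powr p \<le> (\<bar>x\<bar> + \<bar>y\<bar>) powr p" using assms by (intro powr_mono2) auto
  also have "\<dots> \<le> \<bar>x\<bar> powr p + \<bar>y\<bar> powr p" using assms by (intro powr_add_le) auto
  finally show ?thesis by (simp add: pp_def ennreal_leI flip: ennreal_plus)
qed

lemma pp_diff:
  assumes "0 < p" "p \<le> 1"
  shows "pp p (x - y) \<le> pp p x + pp p y"
  using pp_add[OF assms, of x "- y"] by simp

lemma pp_sum:
  assumes "0 < p" "p \<le> 1"
  shows "pp p (\<Sum>i\<in>A. f i) \<le> (\<Sum>i\<in>A. pp p (f i))"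
proof (induction A rule: infinite_finite_induct)
  case (insert i A)
  then show ?case using pp_add[OF assms, of "f i" "sum f A"]
    by (simp) (meson add_left_mono order_trans)
qed auto

lemma pp_le_iff:
  assumes "0 < p" "0 \<le> e"
  shows "pp p x \<le> ennreal e \<longleftrightarrow> \<bar>x\<bar> \<le> e powr (1 / p)"
proof -
  have "pp p x \<le> ennreal e \<longleftrightarrow> \<bar>x\<bar> powr p \<le> e" using assms by (simp add: pp_def)
  also have "\<dots> \<longleftrightarrow> (\<bar>x\<bar> powr p) powr (1/p) \<le> e powr (1/p)"
    using assms powr_less_mono2[of "1/p" e "\<bar>x\<bar> powr p"] powr_mono2[of "1/p" "\<bar>x\<bar> powr p" e]
    by (auto simp: not_le[symmetric])
  also have "(\<bar>x\<bar> powr p) powr (1/p) = \<bar>x\<bar>" using assms by (simp add: powr_powr)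
  finally show ?thesis .
qed

section \<open>Integrals over intervals: shifting, scaling, Fubini, points below the mean\<close>

lemma nn_integral_shift:
  fixes f :: "real \<Rightarrow> ennreal"
  assumes [measurable]: "f \<in> borel_measurable borel"
  shows "(\<integral>\<^sup>+x\<in>{a..b}. f (x + h) \<partial>lborel) = (\<integral>\<^sup>+x\<in>{a+h..b+h}. f x \<partial>lborel)"
proof -
  have "(\<integral>\<^sup>+x\<in>{a+h..b+h}. f x \<partial>lborel) = ennreal \<bar>1::real\<bar> * (\<integral>\<^sup>+x. f (h + 1 * x) * indicator {a+h..b+h} (h + 1 * x) \<partial>lborel)"
    by (intro nn_integral_real_affine) auto
  also have "\<dots> = (\<integral>\<^sup>+x\<in>{a..b}. f (x + h) \<partial>lborel)"
    by (auto intro!: nn_integral_cong simp: add.commute split: split_indicator)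
  finally show ?thesis by simp
qed

lemma nn_integral_scale:
  fixes f :: "real \<Rightarrow> ennreal"
  assumes [measurable]: "f \<in> borel_measurable borel" and "c > 0"
  shows "(\<integral>\<^sup>+x\<in>{a..b}. f (t + c * x) \<partial>lborel) = ennreal (1/c) * (\<integral>\<^sup>+x\<in>{t+c*a..t+c*b}. f x \<partial>lborel)"
proof -
  have "(\<integral>\<^sup>+x\<in>{t+c*a..t+c*b}. f x \<partial>lborel) = ennreal \<bar>c\<bar> * (\<integral>\<^sup>+x. f (t + c * x) * indicator {t+c*a..t+c*b} (t + c * x) \<partial>lborel)"
    using assms by (intro nn_integral_real_affine) auto
  also have "(\<integral>\<^sup>+x. f (t + c * x) * indicator {t+c*a..t+c*b} (t + c * x) \<partial>lborel) = (\<integral>\<^sup>+x\<in>{a..b}. f (t + c * x) \<partial>lborel)"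
    using \<open>c > 0\<close> by (auto intro!: nn_integral_cong split: split_indicator)
  finally show ?thesis using \<open>c > 0\<close> 
    by (simp add: mult.assoc[symmetric] ennreal_mult[symmetric])
qed

lemma set_nn_integral_mono:
  assumes "\<And>x. x \<in> A \<Longrightarrow> f x \<le> g x"
  shows "(\<integral>\<^sup>+x\<in>A. f x \<partial>M) \<le> (\<integral>\<^sup>+x\<in>A. g x \<partial>M)"
  using assms by (intro nn_integral_mono) (auto split: split_indicator)

lemma set_nn_integral_mono_set:
  assumes "A \<subseteq> B"
  shows "(\<integral>\<^sup>+x\<in>A. f x \<partial>M) \<le> (\<integral>\<^sup>+x\<in>B. f x \<partial>M)"
  using assms by (intro nn_integral_mono) (auto split: split_indicator)

lemma set_nn_integral_add:
  fixes f g :: "real \<Rightarrow> ennreal"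
  assumes [measurable]: "f \<in> borel_measurable borel" "g \<in> borel_measurable borel" "A \<in> sets borel"
  shows "(\<integral>\<^sup>+x\<in>A. f x + g x \<partial>lborel) = (\<integral>\<^sup>+x\<in>A. f x \<partial>lborel) + (\<integral>\<^sup>+x\<in>A. g x \<partial>lborel)"
  by (simp add: distrib_right nn_integral_add)

lemma set_nn_integral_const:
  assumes "a \<le> b"
  shows "(\<integral>\<^sup>+x\<in>{a..b}. c \<partial>lborel) = c * ennreal (b - a)"
  using assms by (simp add: nn_integral_cmult_indicator)

lemma lborel_Fubini:
  fixes f :: "real \<Rightarrow> real \<Rightarrow> ennreal"
  assumes "case_prod f \<in> borel_measurable (borel \<Otimes>\<^sub>M borel)"
  shows "(\<integral>\<^sup>+y. (\<integral>\<^sup>+x. f x y \<partial>lborel) \<partial>lborel) = (\<integral>\<^sup>+x. (\<integral>\<^sup>+y. f x y \<partial>lborel) \<partial>lborel)"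
  by (rule lborel_pair.Fubini') (use assms in simp)

text \<open>Substitute for pointwise control of a function that is only p-integrable.
  \<open>near_constant\<close> finds its constant this way and \<open>poly_Lp_growth\<close> its
  interpolation nodes.\<close>

lemma ex_le_set_nn_integral:
  fixes f :: "real \<Rightarrow> ennreal"
  assumes [measurable]: "f \<in> borel_measurable borel" and "a < b" 
    and "(\<integral>\<^sup>+x\<in>{a..b}. f x \<partial>lborel) \<le> ennreal c" "0 \<le> c"
  shows "\<exists>x\<in>{a..b}. f x \<le> ennreal (c / (b - a))"
proof (rule ccontr)
  assume "\<not> ?thesis"
  then have gt: "\<And>x. x \<in> {a..b} \<Longrightarrow> ennreal (c / (b - a)) < f x" by force
  have "(\<integral>\<^sup>+x. ennreal (c / (b - a)) * indicator {a..b} x \<partial>lborel) < (\<integral>\<^sup>+x\<in>{a..b}. f x \<partial>lborel)"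
  proof (rule nn_integral_less)
    show "\<not> (AE x in lborel. f x * indicator {a..b} x \<le> ennreal (c / (b - a)) * indicator {a..b} x)"
    proof
      assume "AE x in lborel. f x * indicator {a..b} x \<le> ennreal (c / (b - a)) * indicator {a..b} x"
      then have "AE x in lborel. x \<notin> {a..b}"
        by eventually_elim (use gt in \<open>force simp: not_le[symmetric] split: split_indicator_asm\<close>)
      then have "emeasure lborel {a..b} = 0"
        by (subst (asm) AE_iff_measurable[where N="{a..b}"]) auto
      then show False using \<open>a < b\<close> by simp
    qed
  qed (use gt assms in \<open>auto simp: nn_integral_cmult_indicator less_imp_le ennreal_mult_eq_top_iff split: split_indicator\<close>)
  moreover have "(\<integral>\<^sup>+x. ennreal (c / (b - a)) * indicator {a..b} x \<partial>lborel) = ennreal c"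
    using \<open>a < b\<close> \<open>0 \<le> c\<close> by (simp add: nn_integral_cmult_indicator flip: ennreal_mult)
  ultimately show False using assms(3) by simp
qed

section \<open>Mixed differences and Whitney's inequality\<close>

definition fdiff :: "nat \<Rightarrow> real \<Rightarrow> (real \<Rightarrow> real) \<Rightarrow> real \<Rightarrow> real" where
  "fdiff r u f x = (\<Sum>j\<le>r. (-1) ^ (r - j) * real (r choose j) * f (x + real j * u))"

definition dif :: "real \<Rightarrow> (real \<Rightarrow> real) \<Rightarrow> real \<Rightarrow> real" where
  "dif h f x = f (x + h) - f x"

primrec mdif :: "real list \<Rightarrow> (real \<Rightarrow> real) \<Rightarrow> real \<Rightarrow> real" where
  "mdif [] f = f"
| "mdif (h # hs) f = dif h (mdif hs f)"

lemma dif_commute: "dif h (dif k f) = dif k (dif h f)"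
  by (simp add: dif_def fun_eq_iff algebra_simps)

lemma mdif_dif: "mdif hs (dif h f) = dif h (mdif hs f)"
  by (induction hs) (simp_all add: dif_commute)

lemma mdif_append: "mdif (xs @ ys) f = mdif xs (mdif ys f)"
  by (induction xs) simp_all

lemma mdif_middle: "mdif (xs @ h # ys) f = dif h (mdif (xs @ ys) f)"
  by (simp add: mdif_append mdif_dif)

lemma dif_measurable [measurable]:
  assumes [measurable]: "f \<in> borel_measurable borel"
  shows "dif h f \<in> borel_measurable borel"
  unfolding dif_def[abs_def] by measurable

lemma mdif_measurable [measurable]: "f \<in> borel_measurable borel \<Longrightarrow> mdif hs f \<in> borel_measurable borel"
  by (induction hs) simp_all

lemma mdif_zero_step: "0 \<in> set hs \<Longrightarrow> mdif hs f = (\<lambda>x. 0)"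
  by (induction hs) (auto simp: dif_def)

lemma mdif_diff: "mdif hs (\<lambda>x. f x - g x) = (\<lambda>x. mdif hs f x - mdif hs g x)"
  by (induction hs) (simp_all add: dif_def fun_eq_iff algebra_simps)

text \<open>Induction along Horner's form. If D is the difference of q, then the difference of x
  q(x) + a is x D + h D + h q; the leading coefficient collects one h from the last term and the
  rest from x D.\<close>

lemma pcompose_shift_coeff:
  fixes q :: "real poly"
  assumes "degree q \<le> Suc k"
  shows "degree (pcompose q [:h, 1:] - q) \<le> k \<and>
    coeff (pcompose q [:h, 1:] - q) k = real (Suc k) * h * coeff q (Suc k)"
  using assms
proof (induction q arbitrary: k)
  case 0
  then show ?case by simp
next
  case (pCons a q)
  let ?D = "pcompose q [:h, 1:] - q"
  have eq: "pcompose (pCons a q) [:h, 1:] - pCons a q = smult h ?D + pCons 0 ?D + smult h q"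
    by (simp add: pcompose_pCons algebra_simps smult_diff_right)
  have dq: "degree q \<le> k" using pCons.prems by (cases "q = 0") auto
  show ?case
  proof (cases k)
    case 0
    then obtain c where "q = [:c:]" using dq by (metis degree_eq_zeroE le_zero_eq)
    then show ?thesis using 0 unfolding eq by (simp add: pcompose_pCons)
  next
    case (Suc l)
    from pCons.IH[of l] dq Suc have IH: "degree ?D \<le> l" "coeff ?D l = real (Suc l) * h * coeff q (Suc l)" by auto
    have "degree (smult h ?D + pCons 0 ?D + smult h q) \<le> k"
      using IH dq Suc by (intro degree_add_le order.trans[OF degree_smult_le] order.trans[OF degree_pCons_le]) auto
    moreover have "coeff ?D k = 0" using IH Suc by (intro coeff_eq_0) auto
    ultimately show ?thesis using IH Suc unfolding eq by (simp add: algebra_simps)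
  qed
qed

text \<open>Used in two ways: below degree \<open>length hs\<close> the coefficient is 0 and the
  polynomial is annihilated; in that degree the result is a multiple of the product of the steps,
  the form into which the stability of additive functions brings the constants of Whitney's
  inequality.\<close>

lemma mdif_poly:
  assumes "degree q \<le> length hs"
  shows "mdif hs (poly q) x = coeff q (length hs) * fact (length hs) * prod_list hs"
  using assms
proof (induction hs arbitrary: q)
  case Nil
  then obtain c where "q = [:c:]" by (metis degree_eq_zeroE le_zero_eq list.size(3))
  then show ?case by simp
next
  case (Cons h hs)
  let ?D = "pcompose q [:h, 1:] - q"
  have D: "dif h (poly q) = poly ?D" by (simp add: dif_def fun_eq_iff poly_pcompose add.commute)
  have "degree ?D \<le> length hs" "coeff ?D (length hs) = real (Suc (length hs)) * h * coeff q (Suc (length hs))"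
    using pcompose_shift_coeff[of q "length hs" h] Cons.prems by auto
  then show ?case using Cons.IH[of ?D]
    by (simp add: mdif_dif[symmetric] D del: poly_diff)
qed

lemma fdiff_eq_mdif: "fdiff r u f x = mdif (replicate r u) f x"
proof (induction r arbitrary: x)
  case 0
  then show ?case by (simp add: fdiff_def)
next
  case (Suc r)
  let ?g = "\<lambda>j. f (x + real j * u)"
  have "mdif (replicate (Suc r) u) f x = fdiff r u f (x + u) - fdiff r u f x"
    by (simp add: dif_def Suc)
  also have "\<dots> = (\<Sum>j\<le>r. (-1) ^ (r - j) * real (r choose j) * ?g (Suc j))
      - (\<Sum>j\<le>r. (-1) ^ (r - j) * real (r choose j) * ?g j)"
    by (simp add: fdiff_def algebra_simps)
  also have "(\<Sum>j\<le>r. (-1) ^ (r - j) * real (r choose j) * ?g j) =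
      (-1) ^ r * ?g 0 + (\<Sum>j\<le>r. (-1) ^ (r - Suc j) * real (r choose Suc j) * ?g (Suc j))"
    using sum.atMost_Suc_shift[of "\<lambda>j. (-1) ^ (r - j) * real (r choose j) * ?g j" r] by (simp add: binomial_eq_0)
  also have "(\<Sum>j\<le>r. (-1) ^ (r - Suc j) * real (r choose Suc j) * ?g (Suc j)) =
      - (\<Sum>j\<le>r. (-1) ^ (r - j) * real (r choose Suc j) * ?g (Suc j))"
    unfolding sum_negf[symmetric]
  proof (intro sum.cong refl)
    fix j assume "j \<in> {..r}"
    \<comment> \<open>For j = r the truncated subtraction spoils the sign, but there
      \<open>r choose Suc r\<close> is 0.\<close>
    then show "(-1) ^ (r - Suc j) * real (r choose Suc j) * ?g (Suc j) = - ((-1) ^ (r - j) * real (r choose Suc j) * ?g (Suc j))"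
      by (cases "j = r") (simp_all add: Suc_diff_Suc[symmetric])
  qed
  also have "(\<Sum>j\<le>r. (-1) ^ (r - j) * real (r choose j) * ?g (Suc j)) -
      ((-1) ^ r * ?g 0 + - (\<Sum>j\<le>r. (-1) ^ (r - j) * real (r choose Suc j) * ?g (Suc j))) =
      - ((-1) ^ r * ?g 0) + (\<Sum>j\<le>r. (-1) ^ (r - j) * real (Suc r choose Suc j) * ?g (Suc j))"
    by (simp add: sum.distrib[symmetric] algebra_simps)
  also have "\<dots> = fdiff (Suc r) u f x"
    unfolding fdiff_def by (subst sum.atMost_Suc_shift) simp
  finally show ?case ..
qed

lemma fdiff_poly_eq_0:
  assumes "q \<in> Poly_space r"
  shows "fdiff r u (poly q) x = 0"
proof (cases "q = 0")
  case True
  then show ?thesis by (simp add: fdiff_def)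
next
  case False
  then have "degree q < r" using assms by (simp add: Poly_space_def)
  then show ?thesis by (simp add: fdiff_eq_mdif mdif_poly coeff_eq_0)
qed

lemma fdiff_diff: "fdiff r u (\<lambda>x. f x - g x) x = fdiff r u f x - fdiff r u g x"
  by (simp add: fdiff_eq_mdif mdif_diff)

lemma fdiff_measurable [measurable]:
  assumes [measurable]: "f \<in> borel_measurable borel" "a \<in> borel_measurable M" "b \<in> borel_measurable M"
  shows "(\<lambda>x. fdiff r (a x) f (b x)) \<in> borel_measurable M"
  unfolding fdiff_def by measurable

section \<open>Mixed differences bounded by differences with equal steps\<close>

definition msum :: "(real \<times> real) list \<Rightarrow> nat \<Rightarrow> (real \<Rightarrow> real) \<Rightarrow> real \<Rightarrow> real \<Rightarrow> real" where
  "msum L r f B A =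
     (\<Sum>j\<le>r. (-1) ^ j * real (r choose j) * mdif (map (\<lambda>(a, b). a - real j * b) L) f (B + real j * A))"

lemma msum_Nil: "msum [] r f B A = (-1) ^ r * fdiff r A f B"
  unfolding msum_def fdiff_def sum_distrib_left
proof (intro sum.cong refl)
  fix j assume "j \<in> {..r}"
  then have "(-1::real) ^ r * (-1) ^ (r - j) = (-1) ^ j"
    by (auto simp: minus_one_power_iff)
  then show "(- 1) ^ j * real (r choose j) * mdif (map (\<lambda>(a, b). a - real j * b) []) f (B + real j * A) =
         (- 1) ^ r * ((- 1) ^ (r - j) * real (r choose j) * f (B + real j * A))"
    by (simp add: mult.assoc[symmetric])
qed

text \<open>Adding the step a - j b to the base point B + j A amounts to moving (B, A) to (B + a, A
  - b), for all j at once. The list is thus removed pair by pair until \<open>msum_Nil\<close>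
  leaves equal-step differences, 2^(length L) of them. This is the mechanism of Djokovic's
  representation of mixed differences.\<close>

lemma msum_Cons: "msum ((a, b) # L) r f B A = msum L r f (B + a) (A - b) - msum L r f B A"
  unfolding msum_def by (simp add: dif_def sum_subtractf[symmetric] algebra_simps)

lemma msum_measurable [measurable]:
  assumes [measurable]: "f \<in> borel_measurable borel" "\<beta> \<in> borel_measurable M" "\<alpha> \<in> borel_measurable M"
  shows "(\<lambda>x. msum L r f (\<beta> x) (\<alpha> x)) \<in> borel_measurable M"
  unfolding msum_def
  by (intro borel_measurable_sum borel_measurable_times measurable_compose[OF _ mdif_measurable]) measurable

text \<open>With the second components \<open>h\<^sub>i / i\<close>, every summand of \<open>msum\<close> with \<open>j \<ge> 1\<close> has a vanishing step,
  so the sum does not depend on \<open>A\<close> and may be averaged over it.\<close>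

lemma msum_eq_mdif:
  assumes "length hs = r"
  shows "msum (map (\<lambda>i. (hs ! i, hs ! i / real (Suc i))) [0..<r]) r f B A = mdif hs f B"
proof -
  let ?L = "map (\<lambda>i. (hs ! i, hs ! i / real (Suc i))) [0..<r]"
  have "mdif (map (\<lambda>(a, b). a - real j * b) ?L) f (B + real j * A) = 0" if "j \<in> {..r} - {0}" for j
  proof -
    have "0 \<in> set (map (\<lambda>(a, b). a - real j * b) ?L)"
      using that by (auto simp: image_iff intro!: bexI[of _ "j - 1"])
    from mdif_zero_step[OF this] show ?thesis by simp
  qed
  then have "msum ?L r f B A = (\<Sum>j\<in>{0}. (-1) ^ j * real (r choose j) * mdif (map (\<lambda>(a, b). a - real j * b) ?L) f (B + real j * A))"
    unfolding msum_def by (intro sum.mono_neutral_right) auto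
  also have "\<dots> = mdif (map (\<lambda>i. hs ! i) [0..<r]) f B" by (simp add: o_def)
  also have "map (\<lambda>i. hs ! i) [0..<r] = hs" using assms map_nth by blast
  finally show ?thesis .
qed

text \<open>Hyers' stability argument on (0,1]. Let d(s) = c(s) - s c(1) and let D be the supremum
  of |d|. Doubling gives |d(s)| <= (D + e)/2 for s <= 1/2, and larger s are reflected to 1 - s using
  d(1) = 0. Hence D <= D/2 + 3e/2. The crude bound K makes D finite, so that it can be
  absorbed.\<close>

lemma hyers_bounded:
  fixes c :: "real \<Rightarrow> real"
  assumes bd: "\<And>s. 0 < s \<Longrightarrow> s \<le> 1 \<Longrightarrow> \<bar>c s\<bar> \<le> K"
    and add: "\<And>s t. 0 < s \<Longrightarrow> 0 < t \<Longrightarrow> s + t \<le> 1 \<Longrightarrow> \<bar>c (s + t) - c s - c t\<bar> \<le> e"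
    and s: "0 < s" "s \<le> 1"
  shows "\<bar>c s - s * c 1\<bar> \<le> 3 * e"
proof -
  define d where "d s = c s - s * c 1" for s
  define D where "D = (SUP s\<in>{0<..1}. \<bar>d s\<bar>)"
  have "bdd_above ((\<lambda>s. \<bar>d s\<bar>) ` {0<..1})"
  proof (rule bdd_aboveI2)
    fix s :: real assume s: "s \<in> {0<..1}"
    have "\<bar>s * c 1\<bar> \<le> 1 * K" unfolding abs_mult using s bd[of 1] by (intro mult_mono) auto
    then show "\<bar>d s\<bar> \<le> K + K" using bd[of s] s unfolding d_def by (auto intro: order.trans[OF abs_triangle_ineq4])
  qed
  then have le: "\<bar>d s\<bar> \<le> D" if "0 < s" "s \<le> 1" for s
    unfolding D_def using that by (intro cSUP_upper) auto
  have dadd: "\<bar>d (s + t) - d s - d t\<bar> \<le> e" if "0 < s" "0 < t" "s + t \<le> 1" for s t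
    using add[OF that] by (simp add: d_def algebra_simps)
  have d1: "d 1 = 0" by (simp add: d_def)
  have e: "0 \<le> e" using dadd[of "1/2" "1/2"] by auto
  have D0: "0 \<le> D" using le[of 1] by auto
  have small: "\<bar>d s\<bar> \<le> (D + e) / 2" if "0 < s" "s \<le> 1/2" for s
    using dadd[of s s] le[of "s + s"] that by auto
  have "\<bar>d s\<bar> \<le> D / 2 + 3 * e / 2" if "0 < s" "s \<le> 1" for s
  proof (cases "s \<le> 1/2")
    case True
    then show ?thesis using small[of s] that e by auto
  next
    case False
    then show ?thesis using small[of "1 - s"] dadd[of s "1 - s"] that e d1 D0 by (cases "s = 1") auto
  qed
  then have "D \<le> D / 2 + 3 * e / 2" unfolding D_def by (intro cSUP_least) auto
  then show ?thesis using le[OF s] by (simp add: d_def)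
qed

text \<open>The steps are replaced by 1 one after the other, each replacement costing 3e by
  \<open>hyers_bounded\<close>. The factors already split off are products of numbers in (0,1], so
  they do not magnify later errors.\<close>

lemma hyers_multi:
  fixes c :: "real list \<Rightarrow> real"
  assumes bd: "\<And>hs. length hs = k \<Longrightarrow> set hs \<subseteq> {0<..1} \<Longrightarrow> \<bar>c hs\<bar> \<le> K"
    and add: "\<And>xs ys s t. length (xs @ ys) + 1 = k \<Longrightarrow> set (xs @ ys) \<subseteq> {0<..1} \<Longrightarrow> 0 < s \<Longrightarrow> 0 < t \<Longrightarrow> s + t \<le> 1
       \<Longrightarrow> \<bar>c (xs @ (s + t) # ys) - c (xs @ s # ys) - c (xs @ t # ys)\<bar> \<le> e"
    and "length hs = k" "set hs \<subseteq> {0<..1}"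
  shows "\<bar>c hs - prod_list hs * c (replicate k 1)\<bar> \<le> 3 * real k * e"
proof -
  \<comment> \<open>Generalised to a state in which the first i steps have already become 1.\<close>
  have "\<bar>c (replicate i 1 @ zs) - prod_list zs * c (replicate k 1)\<bar> \<le> 3 * real (length zs) * e \<and> 0 \<le> prod_list zs \<and> prod_list zs \<le> 1"
    if "i + length zs = k" "set zs \<subseteq> {0<..1}" for i zs
    using that
  proof (induction zs arbitrary: i)
    case (Cons z zs)
    have IH: "\<bar>c (replicate (Suc i) 1 @ zs) - prod_list zs * c (replicate k 1)\<bar> \<le> 3 * real (length zs) * e" 
       "0 \<le> prod_list zs" "prod_list zs \<le> 1"
      using Cons.IH[of "Suc i"] Cons.prems by auto
    have z: "0 < z" "z \<le> 1" and zs: "\<And>x. x \<in> set zs \<Longrightarrow> 0 < x \<and> x \<le> 1" using Cons.prems by auto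
    have "\<bar>c (replicate i 1 @ z # zs) - z * c (replicate i 1 @ 1 # zs)\<bar> \<le> 3 * e"
      by (rule hyers_bounded[where K=K and c="\<lambda>z. c (replicate i 1 @ z # zs)"])
         (use Cons.prems zs in \<open>auto intro!: bd add split: if_splits\<close>)
    also have "replicate i 1 @ 1 # zs = replicate (Suc i) 1 @ zs" by (simp add: replicate_app_Cons_same)
    finally have 1: "\<bar>c (replicate i 1 @ z # zs) - z * c (replicate (Suc i) 1 @ zs)\<bar> \<le> 3 * e" .
    have "\<bar>z * (c (replicate (Suc i) 1 @ zs) - prod_list zs * c (replicate k 1))\<bar> \<le> 1 * (3 * real (length zs) * e)"
      unfolding abs_mult using z IH by (intro mult_mono) auto
    with 1 have "\<bar>c (replicate i 1 @ z # zs) - z * prod_list zs * c (replicate k 1)\<bar> \<le> 3 * e + 3 * real (length zs) * e"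
      by (simp add: algebra_simps)
    moreover have "z * prod_list zs \<le> 1 * 1" using z IH by (intro mult_mono) auto
    ultimately show ?case using z IH by (simp add: algebra_simps)
  qed simp
  from this[of 0 hs] assms(3,4) show ?thesis by simp
qed

lemma set_nn_integral_sum:
  fixes f :: "'i \<Rightarrow> real \<Rightarrow> ennreal"
  assumes "\<And>i. i \<in> I \<Longrightarrow> f i \<in> borel_measurable borel" "A \<in> sets borel"
  shows "(\<integral>\<^sup>+x\<in>A. (\<Sum>i\<in>I. f i x) \<partial>lborel) = (\<Sum>i\<in>I. \<integral>\<^sup>+x\<in>A. f i x \<partial>lborel)"
  using assms by (simp add: sum_distrib_right nn_integral_sum)

lemma nn_integral_inner_measurable [measurable]:
  fixes f :: "real \<Rightarrow> real \<Rightarrow> ennreal"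
  assumes [measurable]: "case_prod f \<in> borel_measurable (borel \<Otimes>\<^sub>M borel)"
  shows "(\<lambda>x. \<integral>\<^sup>+y. f x y \<partial>lborel) \<in> borel_measurable borel"
  using lborel.borel_measurable_nn_integral[of f borel] assms by simp

text \<open>The side conditions travel along the induction: they keep x + B and s - A in [0, r + 1]
  until the list is empty and the equal-step difference appears. The variable s starts at r because
  the second components may subtract up to r from it.\<close>

lemma msum_average:
  assumes p: "0 < p" "p \<le> 1" and [measurable]: "f \<in> borel_measurable borel"
    and "\<And>a b. (a, b) \<in> set L \<Longrightarrow> 0 \<le> a \<and> 0 \<le> b"
    and "0 \<le> B" "B + (\<Sum>z\<leftarrow>L. fst z) \<le> real r" "0 \<le> A" "A + (\<Sum>z\<leftarrow>L. snd z) \<le> real r"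
  shows "(\<integral>\<^sup>+s\<in>{real r..real r + 1}. (\<integral>\<^sup>+x\<in>{0..1}. pp p (msum L r f (x + B) (s - A)) \<partial>lborel) \<partial>lborel)
    \<le> 2 ^ length L * (\<integral>\<^sup>+u\<in>{0..real r + 1}. (\<integral>\<^sup>+y\<in>{0..real r + 1}. pp p (fdiff r u f y) \<partial>lborel) \<partial>lborel)"
  using assms(4-)
proof (induction L arbitrary: A B)
  case Nil
  have "(\<integral>\<^sup>+s\<in>{real r..real r + 1}. (\<integral>\<^sup>+x\<in>{0..1}. pp p (msum [] r f (x + B) (s - A)) \<partial>lborel) \<partial>lborel)
     = (\<integral>\<^sup>+s\<in>{real r..real r + 1}. (\<integral>\<^sup>+x\<in>{0..1}. pp p (fdiff r (s - A) f (x + B)) \<partial>lborel) \<partial>lborel)"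
    by (simp add: msum_Nil pp_mult) (simp add: pp_def)
  also have "\<dots> = (\<integral>\<^sup>+s\<in>{real r..real r + 1}. (\<integral>\<^sup>+x\<in>{0+B..1+B}. pp p (fdiff r (s + (- A)) f x) \<partial>lborel) \<partial>lborel)"
    by (subst nn_integral_shift) auto
  also have "\<dots> = (\<integral>\<^sup>+u\<in>{real r+(-A)..real r + 1+(-A)}. (\<integral>\<^sup>+x\<in>{0+B..1+B}. pp p (fdiff r u f x) \<partial>lborel) \<partial>lborel)"
    by (rule nn_integral_shift) measurable
  also have "\<dots> \<le> (\<integral>\<^sup>+u\<in>{0..real r + 1}. (\<integral>\<^sup>+x\<in>{0+B..1+B}. pp p (fdiff r u f x) \<partial>lborel) \<partial>lborel)"
    using Nil by (intro set_nn_integral_mono_set) auto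
  also have "\<dots> \<le> (\<integral>\<^sup>+u\<in>{0..real r + 1}. (\<integral>\<^sup>+y\<in>{0..real r + 1}. pp p (fdiff r u f y) \<partial>lborel) \<partial>lborel)"
    using Nil by (intro set_nn_integral_mono set_nn_integral_mono_set) auto
  finally show ?case by simp
next
  case (Cons z L)
  obtain a b where z: "z = (a, b)" by force
  have ab: "0 \<le> a" "0 \<le> b" using Cons.prems(1)[of a b] z by auto
  have nn: "0 \<le> (\<Sum>z\<leftarrow>L. fst z)" "0 \<le> (\<Sum>z\<leftarrow>L. snd z)" 
    and Lp: "\<And>a b. (a, b) \<in> set L \<Longrightarrow> 0 \<le> a \<and> 0 \<le> b"
    using Cons.prems(1) by (fastforce intro!: sum_list_nonneg)+
  let ?I = "\<lambda>B A. (\<integral>\<^sup>+s\<in>{real r..real r + 1}. (\<integral>\<^sup>+x\<in>{0..1}. pp p (msum L r f (x + B) (s - A)) \<partial>lborel) \<partial>lborel)"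
  let ?\<Omega> = "\<integral>\<^sup>+u\<in>{0..real r + 1}. (\<integral>\<^sup>+y\<in>{0..real r + 1}. pp p (fdiff r u f y) \<partial>lborel) \<partial>lborel"
  have "(\<integral>\<^sup>+s\<in>{real r..real r + 1}. (\<integral>\<^sup>+x\<in>{0..1}. pp p (msum (z # L) r f (x + B) (s - A)) \<partial>lborel) \<partial>lborel)
    \<le> (\<integral>\<^sup>+s\<in>{real r..real r + 1}. (\<integral>\<^sup>+x\<in>{0..1}. pp p (msum L r f (x + (B + a)) (s - (A + b))) + pp p (msum L r f (x + B) (s - A)) \<partial>lborel) \<partial>lborel)"
    unfolding z msum_Cons
    by (intro set_nn_integral_mono order.trans[OF pp_diff[OF p]]) (simp add: algebra_simps)
  also have "\<dots> = ?I (B + a) (A + b) + ?I B A"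
    by (simp add: set_nn_integral_add)
  also have "?I (B + a) (A + b) \<le> 2 ^ length L * ?\<Omega>"
    by (rule Cons.IH) (use Cons.prems(2-) Lp ab z in \<open>auto simp: algebra_simps\<close>)
  also have "?I B A \<le> 2 ^ length L * ?\<Omega>"
    by (rule Cons.IH) (use Cons.prems(2-) Lp ab nn z in \<open>auto simp: algebra_simps\<close>)
  also have "2 ^ length L * ?\<Omega> + 2 ^ length L * ?\<Omega> = 2 ^ length (z # L) * ?\<Omega>"
    by (simp add: mult_2 distrib_right)
  finally show ?case by (simp add: add_mono)
qed

lemma mdif_average:
  assumes p: "0 < p" "p \<le> 1" and [measurable]: "f \<in> borel_measurable borel"
    and hs: "length hs = r" "set hs \<subseteq> {0<..1}"
  shows "(\<integral>\<^sup>+x\<in>{0..1}. pp p (mdif hs f x) \<partial>lborel)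
    \<le> 2 ^ r * (\<integral>\<^sup>+u\<in>{0..real r + 1}. (\<integral>\<^sup>+y\<in>{0..real r + 1}. pp p (fdiff r u f y) \<partial>lborel) \<partial>lborel)"
proof -
  let ?L = "map (\<lambda>i. (hs ! i, hs ! i / real (Suc i))) [0..<r]"
  have h: "0 < hs ! i \<and> hs ! i \<le> 1" if "i < r" for i using hs(1) subsetD[OF hs(2) nth_mem[of i hs]] that by simp
  have h': "0 \<le> hs ! i / real (Suc i) \<and> hs ! i / real (Suc i) \<le> 1" if "i < r" for i using h[OF that]
    by (auto simp: field_simps intro: order.trans)
  have le1: "sum_list (map g [0..<r]) \<le> real r" if "\<And>i. i < r \<Longrightarrow> g i \<le> 1" for g :: "nat \<Rightarrow> real"
    unfolding interv_sum_list_conv_sum_set_nat using sum_bounded_above[of "{0..<r}" g 1] that by simp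
  \<comment> \<open>Since \<open>msum\<close> does not depend on its last argument here, averaging
    it over an interval of length 1 changes nothing.\<close>
  have "(\<integral>\<^sup>+x\<in>{0..1}. pp p (mdif hs f x) \<partial>lborel) = 
     (\<integral>\<^sup>+s\<in>{real r..real r + 1}. (\<integral>\<^sup>+x\<in>{0..1}. pp p (msum ?L r f (x + 0) (s - 0)) \<partial>lborel) \<partial>lborel)"
    by (subst msum_eq_mdif[OF hs(1)], subst set_nn_integral_const) auto
  also have "\<dots> \<le> 2 ^ length ?L * (\<integral>\<^sup>+u\<in>{0..real r + 1}. (\<integral>\<^sup>+y\<in>{0..real r + 1}. pp p (fdiff r u f y) \<partial>lborel) \<partial>lborel)"
    by (rule msum_average[OF p]) (use h h' le1[of "\<lambda>i. hs ! i"] le1[of "\<lambda>i. hs ! i / real (Suc i)"] in \<open>auto simp: o_def less_imp_le\<close>)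
  finally show ?thesis by simp
qed

text \<open>The integral of |F(y) - F(x)|^p over the unit square splits along the diagonal into two
  equal parts, and on y = x + s with s >= 0 it is an average of the differences of F. Some x then
  has a small integral over y, and F(x) is the constant.\<close>

lemma near_constant:
  assumes p: "0 < p" "p \<le> 1" and [measurable]: "F \<in> borel_measurable borel" and "0 \<le> \<epsilon>"
    and h: "\<And>s. 0 < s \<Longrightarrow> s \<le> 1 \<Longrightarrow> (\<integral>\<^sup>+x\<in>{0..1}. pp p (dif s F x) \<partial>lborel) \<le> ennreal \<epsilon>"
  shows "\<exists>c. (\<integral>\<^sup>+x\<in>{0..1}. pp p (F x - c) \<partial>lborel) \<le> ennreal (2 * \<epsilon>)"
proof -
  have h: "(\<integral>\<^sup>+x\<in>{0..1}. pp p (dif s F x) \<partial>lborel) \<le> ennreal \<epsilon>" if "0 \<le> s" "s \<le> 1" for s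
    using h[of s] that by (cases "s = 0") (auto simp: dif_def)
  let ?J = "\<integral>\<^sup>+x. (\<integral>\<^sup>+y. (if 0 \<le> x \<and> x \<le> y \<and> y \<le> 1 then pp p (F y - F x) else 0) \<partial>lborel) \<partial>lborel"
  have "?J = (\<integral>\<^sup>+x. (\<integral>\<^sup>+s. (if 0 \<le> x \<and> x \<le> x + s \<and> x + s \<le> 1 then pp p (F (x + s) - F x) else 0) \<partial>lborel) \<partial>lborel)"
  proof (rule nn_integral_cong)
    fix x :: real
    show "(\<integral>\<^sup>+y. (if 0 \<le> x \<and> x \<le> y \<and> y \<le> 1 then pp p (F y - F x) else 0) \<partial>lborel) =
      (\<integral>\<^sup>+s. (if 0 \<le> x \<and> x \<le> x + s \<and> x + s \<le> 1 then pp p (F (x + s) - F x) else 0) \<partial>lborel)"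
      using nn_integral_real_affine[of "\<lambda>y. if 0 \<le> x \<and> x \<le> y \<and> y \<le> 1 then pp p (F y - F x) else 0" 1 x]
      by (simp cong: if_cong)
  qed
  also have "\<dots> \<le> (\<integral>\<^sup>+x. (\<integral>\<^sup>+s. pp p (F (x + s) - F x) * indicator {0..1} x * indicator {0..1} s \<partial>lborel) \<partial>lborel)"
    by (intro nn_integral_mono) (auto split: split_indicator)
  also have "\<dots> = (\<integral>\<^sup>+s. (\<integral>\<^sup>+x. pp p (F (x + s) - F x) * indicator {0..1} x * indicator {0..1} s \<partial>lborel) \<partial>lborel)"
    by (rule lborel_Fubini) measurable
  also have "\<dots> = (\<integral>\<^sup>+s\<in>{0..1}. (\<integral>\<^sup>+x\<in>{0..1}. pp p (dif s F x) \<partial>lborel) \<partial>lborel)"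
    by (simp add: nn_integral_multc dif_def)
  also have "\<dots> \<le> (\<integral>\<^sup>+s\<in>{0..1::real}. ennreal \<epsilon> \<partial>lborel)" by (intro set_nn_integral_mono h) auto
  also have "\<dots> = ennreal \<epsilon>" by (subst set_nn_integral_const) auto
  finally have J: "?J \<le> ennreal \<epsilon>" .
  let ?J' = "\<integral>\<^sup>+x. (\<integral>\<^sup>+y. (if 0 \<le> y \<and> y \<le> x \<and> x \<le> 1 then pp p (F y - F x) else 0) \<partial>lborel) \<partial>lborel"
  have "?J' = (\<integral>\<^sup>+y. (\<integral>\<^sup>+x. (if 0 \<le> y \<and> y \<le> x \<and> x \<le> 1 then pp p (F y - F x) else 0) \<partial>lborel) \<partial>lborel)"
    by (rule lborel_Fubini[symmetric]) measurable
  also have "\<dots> = ?J"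
    by (intro nn_integral_cong) (auto simp: pp_minus_commute split: split_indicator)
  finally have J': "?J' \<le> ennreal \<epsilon>" using J by simp
  have "(\<integral>\<^sup>+x\<in>{0..1}. (\<integral>\<^sup>+y\<in>{0..1}. pp p (F y - F x) \<partial>lborel) \<partial>lborel) =
    (\<integral>\<^sup>+x. (\<integral>\<^sup>+y. pp p (F y - F x) * indicator {0..1} y * indicator {0..1} x \<partial>lborel) \<partial>lborel)"
    by (simp add: nn_integral_multc)
  also have "\<dots> \<le> (\<integral>\<^sup>+x. (\<integral>\<^sup>+y. (if 0 \<le> x \<and> x \<le> y \<and> y \<le> 1 then pp p (F y - F x) else 0) 
      + (if 0 \<le> y \<and> y \<le> x \<and> x \<le> 1 then pp p (F y - F x) else 0) \<partial>lborel) \<partial>lborel)"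
    by (intro nn_integral_mono) (auto split: split_indicator)
  also have "\<dots> = ?J + ?J'"
    by (subst nn_integral_add[symmetric]) (auto simp: nn_integral_add)
  also have "\<dots> \<le> ennreal \<epsilon> + ennreal \<epsilon>" by (intro add_mono J J')
  also have "\<dots> = ennreal (2 * \<epsilon>)" using \<open>0 \<le> \<epsilon>\<close> by (simp flip: ennreal_plus)
  finally have "\<exists>x\<in>{0..1}. (\<integral>\<^sup>+y\<in>{0..1}. pp p (F y - F x) \<partial>lborel) \<le> ennreal (2 * \<epsilon> / (1 - 0))"
    using \<open>0 \<le> \<epsilon>\<close> by (intro ex_le_set_nn_integral) auto
  then show ?thesis by auto
qed

text \<open>Of interest for finiteness: it yields the a priori bound on the constants c that the
  stability argument has to start from.\<close>

lemma mdif_integral_bound: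
  assumes p: "0 < p" "p \<le> 1" and [measurable]: "f \<in> borel_measurable borel"
    and "set hs \<subseteq> {0<..1}"
  shows "(\<integral>\<^sup>+x\<in>{0..b}. pp p (mdif hs f x) \<partial>lborel) \<le> 2 ^ length hs * (\<integral>\<^sup>+x\<in>{0..b + length hs}. pp p (f x) \<partial>lborel)"
  using assms(4)
proof (induction hs arbitrary: b)
  case (Cons h hs)
  let ?g = "mdif hs f"
  have h: "0 < h" "h \<le> 1" using Cons.prems by auto
  have "(\<integral>\<^sup>+x\<in>{0..b}. pp p (mdif (h # hs) f x) \<partial>lborel) \<le> (\<integral>\<^sup>+x\<in>{0..b}. pp p (?g (x + h)) + pp p (?g x) \<partial>lborel)"
    by (intro set_nn_integral_mono) (simp add: dif_def pp_diff[OF p])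
  also have "\<dots> = (\<integral>\<^sup>+x\<in>{0..b}. pp p (?g (x + h)) \<partial>lborel) + (\<integral>\<^sup>+x\<in>{0..b}. pp p (?g x) \<partial>lborel)"
    by (rule set_nn_integral_add) measurable
  also have "(\<integral>\<^sup>+x\<in>{0..b}. pp p (?g (x + h)) \<partial>lborel) = (\<integral>\<^sup>+x\<in>{0+h..b+h}. pp p (?g x) \<partial>lborel)"
    by (rule nn_integral_shift) measurable
  also have "\<dots> \<le> (\<integral>\<^sup>+x\<in>{0..b+1}. pp p (?g x) \<partial>lborel)" using h by (intro set_nn_integral_mono_set) auto
  also have "(\<integral>\<^sup>+x\<in>{0..b}. pp p (?g x) \<partial>lborel) \<le> (\<integral>\<^sup>+x\<in>{0..b+1}. pp p (?g x) \<partial>lborel)" by (intro set_nn_integral_mono_set) auto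
  also have "(\<integral>\<^sup>+x\<in>{0..b+1}. pp p (?g x) \<partial>lborel) \<le> 2 ^ length hs * (\<integral>\<^sup>+x\<in>{0..b + 1 + length hs}. pp p (f x) \<partial>lborel)"
    using Cons by simp
  finally show ?case by (simp add: add_mono mult_2 distrib_right add_ac)
qed simp


lemma pp_le_ennreal:
  assumes "0 < p" "0 \<le> e" "\<bar>x\<bar> \<le> K * e powr (1 / p)" "0 \<le> K"
  shows "pp p x \<le> ennreal (K powr p * e)"
proof -
  have "pp p x \<le> pp p (K * e powr (1 / p))" using assms by (intro pp_mono) auto
  also have "\<dots> = ennreal (K powr p * e)" using assms by (simp add: pp_def powr_mult powr_powr)
  finally show ?thesis .
qed

lemma poly_measurable [measurable]: "(\<lambda>x. poly q (x :: real)) \<in> borel_measurable borel"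
  by (intro borel_measurable_continuous_onI continuous_intros)

lemma pp_const_le:
  fixes G :: "real \<Rightarrow> real"
  assumes p: "0 < p" "p \<le> 1" and [measurable]: "G \<in> borel_measurable borel"
  shows "pp p c \<le> (\<integral>\<^sup>+x\<in>{0..1}. pp p (G x - c) \<partial>lborel) + (\<integral>\<^sup>+x\<in>{0..1}. pp p (G x) \<partial>lborel)"
proof -
  have "pp p c = (\<integral>\<^sup>+x\<in>{0..1::real}. pp p c \<partial>lborel)" by (subst set_nn_integral_const) auto
  also have "\<dots> \<le> (\<integral>\<^sup>+x\<in>{0..1}. pp p (G x - c) + pp p (G x) \<partial>lborel)"
  proof (rule set_nn_integral_mono)
    fix x :: real
    show "pp p c \<le> pp p (G x - c) + pp p (G x)" using pp_diff[OF p, of "G x" "G x - c"] by (simp add: add.commute)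
  qed
  also have "\<dots> = (\<integral>\<^sup>+x\<in>{0..1}. pp p (G x - c) \<partial>lborel) + (\<integral>\<^sup>+x\<in>{0..1}. pp p (G x) \<partial>lborel)"
    by (rule set_nn_integral_add) measurable
  finally show ?thesis .
qed

lemma set_nn_integral_poly_finite:
  assumes "0 < p"
  shows "(\<integral>\<^sup>+x\<in>{a..b}. pp p (poly q x) \<partial>lborel) < \<infinity>"
proof -
  have "compact (poly q ` {a..b})" by (intro compact_continuous_image continuous_intros) auto
  then obtain K where K: "\<And>x. x \<in> {a..b} \<Longrightarrow> \<bar>poly q x\<bar> \<le> K" 
    by (force dest!: compact_imp_bounded simp: bounded_iff)
  have "(\<integral>\<^sup>+x\<in>{a..b}. pp p (poly q x) \<partial>lborel) \<le> (\<integral>\<^sup>+x\<in>{a..b}. pp p K \<partial>lborel)"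
    using K assms by (intro set_nn_integral_mono pp_mono order.trans[OF K]) auto
  also have "\<dots> = pp p K * emeasure lborel {a..b}" by (simp add: nn_integral_cmult_indicator)
  also have "\<dots> < \<infinity>" by (simp add: ennreal_mult_less_top emeasure_lborel_Icc_eq)
  finally show ?thesis .
qed

text \<open>\<open>mdif hs f\<close> is near a constant \<open>c hs\<close>. This \<open>c\<close> is almost additive in each step, hence, by the stability
  of additive functions, near a multiple of the product of the steps, and a monomial removes it.\<close>

lemma whitney_mixed_step:
  assumes p: "0 < p" "p \<le> 1" and f[measurable]: "f \<in> borel_measurable borel" and \<epsilon>: "0 \<le> \<epsilon>"
    and fin: "(\<integral>\<^sup>+x\<in>{0..real k + 1}. pp p (f x) \<partial>lborel) < \<infinity>"
    and small: "\<And>hs. length hs = Suc k \<Longrightarrow> set hs \<subseteq> {0<..1} \<Longrightarrow> (\<integral>\<^sup>+x\<in>{0..1}. pp p (mdif hs f x) \<partial>lborel) \<le> ennreal \<epsilon>"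
  shows "\<exists>l. \<forall>hs. length hs = k \<longrightarrow> set hs \<subseteq> {0<..1} \<longrightarrow>
    (\<integral>\<^sup>+x\<in>{0..1}. pp p (mdif hs (\<lambda>x. f x - poly (monom l k) x) x) \<partial>lborel) \<le> ennreal ((2 + (3 * real k) powr p * 7) * \<epsilon>)"
proof -
  have "\<exists>c. (\<integral>\<^sup>+x\<in>{0..1}. pp p (mdif hs f x - c) \<partial>lborel) \<le> ennreal (2 * \<epsilon>)" if "length hs = k" "set hs \<subseteq> {0<..1}" for hs
  proof (rule near_constant[OF p _ \<epsilon>])
    fix s :: real assume "0 < s" "s \<le> 1"
    then show "(\<integral>\<^sup>+x\<in>{0..1}. pp p (dif s (mdif hs f) x) \<partial>lborel) \<le> ennreal \<epsilon>"
      using small[of "s # hs"] that by simp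
  qed measurable
  then obtain c where c: "\<And>hs. length hs = k \<Longrightarrow> set hs \<subseteq> {0<..1} \<Longrightarrow> 
      (\<integral>\<^sup>+x\<in>{0..1}. pp p (mdif hs f x - c hs) \<partial>lborel) \<le> ennreal (2 * \<epsilon>)"
    by metis
  \<comment> \<open>The size of this bound does not enter the final constant;
    \<open>hyers_multi\<close> asks only for some bound.\<close>
  let ?M = "2 * \<epsilon> + 2 ^ k * enn2real (\<integral>\<^sup>+x\<in>{0..real k + 1}. pp p (f x) \<partial>lborel)"
  have bd: "\<bar>c hs\<bar> \<le> ?M powr (1 / p)" if hs: "length hs = k" "set hs \<subseteq> {0<..1}" for hs
  proof -
    have "pp p (c hs) \<le> (\<integral>\<^sup>+x\<in>{0..1}. pp p (mdif hs f x - c hs) \<partial>lborel) + (\<integral>\<^sup>+x\<in>{0..1}. pp p (mdif hs f x) \<partial>lborel)"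
      by (rule pp_const_le[OF p]) measurable
    also have "\<dots> \<le> ennreal (2 * \<epsilon>) + 2 ^ k * (\<integral>\<^sup>+x\<in>{0..1 + real k}. pp p (f x) \<partial>lborel)"
      using mdif_integral_bound[OF p f hs(2), of 1] hs by (intro add_mono c) auto
    also have "\<dots> = ennreal ?M" using fin \<epsilon>
      by (simp add: ennreal_plus ennreal_mult ennreal_enn2real less_top add.commute flip: ennreal_power)
    finally show ?thesis using \<epsilon> p by (subst (asm) pp_le_iff) auto
  qed
  have add: "\<bar>c (xs @ (s + t) # ys) - c (xs @ s # ys) - c (xs @ t # ys)\<bar> \<le> (7 * \<epsilon>) powr (1 / p)"
    if xy: "length (xs @ ys) + 1 = k" "set (xs @ ys) \<subseteq> {0<..1}" and st: "0 < s" "0 < t" "s + t \<le> 1" for xs ys s t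
  proof -
    let ?G = "\<lambda>s. mdif (xs @ s # ys) f" and ?c = "\<lambda>s. c (xs @ s # ys)"
    let ?H = "mdif (t # xs @ s # ys) f"
    have Gc: "(\<integral>\<^sup>+x\<in>{0..1}. pp p (?G u x - ?c u) \<partial>lborel) \<le> ennreal (2 * \<epsilon>)" if "0 < u" "u \<le> 1" for u
      using c[of "xs @ u # ys"] xy that by auto
    \<comment> \<open>From \<open>dif (s + t) = dif s + dif t + dif t (dif s)\<close>. The last term
      has \<open>Suc k\<close> steps and costs \<epsilon>; each of the three constants costs 2
      \<epsilon>. Together this is the 7 below.\<close>
    have eq: "?c (s + t) - ?c s - ?c t = (?G s x - ?c s) + (?G t x - ?c t) + ?H x - (?G (s + t) x - ?c (s + t))" for x
      by (simp add: mdif_middle dif_def algebra_simps)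
    have pp4: "pp p (a + b + d - e) \<le> pp p a + pp p b + pp p d + pp p e" for a b d e
      by (intro order.trans[OF pp_diff[OF p]] add_mono order.trans[OF pp_add[OF p]] order.refl)
    have "pp p (?c (s + t) - ?c s - ?c t) = (\<integral>\<^sup>+x\<in>{0..1::real}. pp p (?c (s + t) - ?c s - ?c t) \<partial>lborel)" 
      by (subst set_nn_integral_const) auto
    also have "\<dots> \<le> (\<integral>\<^sup>+x\<in>{0..1::real}. pp p (?G s x - ?c s) + pp p (?G t x - ?c t) + pp p (?H x) + pp p (?G (s + t) x - ?c (s + t)) \<partial>lborel)"
      by (intro set_nn_integral_mono, subst eq, rule pp4)
    also have "\<dots> = (\<integral>\<^sup>+x\<in>{0..1::real}. pp p (?G s x - ?c s) \<partial>lborel) + (\<integral>\<^sup>+x\<in>{0..1::real}. pp p (?G t x - ?c t) \<partial>lborel)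
       + (\<integral>\<^sup>+x\<in>{0..1::real}. pp p (?H x) \<partial>lborel) + (\<integral>\<^sup>+x\<in>{0..1::real}. pp p (?G (s + t) x - ?c (s + t)) \<partial>lborel)"
      by (simp add: set_nn_integral_add del: mdif.simps)
    also have "\<dots> \<le> ennreal (2 * \<epsilon>) + ennreal (2 * \<epsilon>) + ennreal \<epsilon> + ennreal (2 * \<epsilon>)"
      by (intro add_mono Gc small) (use xy st in auto)
    also have "\<dots> = ennreal (7 * \<epsilon>)" using \<epsilon> by (simp flip: ennreal_plus)
    finally show ?thesis using \<epsilon> p by (subst (asm) pp_le_iff) auto
  qed
  \<comment> \<open>By \<open>mdif_poly\<close> the k-fold difference of x^k is k! times the product
    of the steps.\<close>
  define l where "l = c (replicate k 1) / fact k"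
  show ?thesis
  proof (intro exI[of _ l] allI impI)
    fix hs :: "real list" assume hs: "length hs = k" "set hs \<subseteq> {0<..1}"
    have "mdif hs (poly (monom l k)) x = prod_list hs * c (replicate k 1)" for x
      using mdif_poly[of "monom l k" hs x] hs by (simp add: degree_monom_le l_def mult.commute)
    then have eq: "mdif hs (\<lambda>x. f x - poly (monom l k) x) x = (mdif hs f x - c hs) + (c hs - prod_list hs * c (replicate k 1))" for x
      by (simp add: mdif_diff)
    have "(\<integral>\<^sup>+x\<in>{0..1}. pp p (mdif hs (\<lambda>x. f x - poly (monom l k) x) x) \<partial>lborel)
       \<le> (\<integral>\<^sup>+x\<in>{0..1}. pp p (mdif hs f x - c hs) + pp p (c hs - prod_list hs * c (replicate k 1)) \<partial>lborel)"
      unfolding eq by (intro set_nn_integral_mono pp_add p)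
    also have "\<dots> = (\<integral>\<^sup>+x\<in>{0..1}. pp p (mdif hs f x - c hs) \<partial>lborel) + (\<integral>\<^sup>+x\<in>{0..1::real}. pp p (c hs - prod_list hs * c (replicate k 1)) \<partial>lborel)"
      by (rule set_nn_integral_add) measurable
    also have "\<dots> = (\<integral>\<^sup>+x\<in>{0..1}. pp p (mdif hs f x - c hs) \<partial>lborel) + pp p (c hs - prod_list hs * c (replicate k 1))"
      by (subst set_nn_integral_const) auto
    also have "\<dots> \<le> ennreal (2 * \<epsilon>) + ennreal ((3 * real k) powr p * (7 * \<epsilon>))"
      using p \<epsilon> hyers_multi[of k c, OF bd add hs] by (intro add_mono c hs pp_le_ennreal) auto
    also have "\<dots> = ennreal ((2 + (3 * real k) powr p * 7) * \<epsilon>)" using \<epsilon> 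
      by (simp add: algebra_simps flip: ennreal_plus)
    finally show "(\<integral>\<^sup>+x\<in>{0..1}. pp p (mdif hs (\<lambda>x. f x - poly (monom l k) x) x) \<partial>lborel) \<le> ennreal ((2 + (3 * real k) powr p * 7) * \<epsilon>)" .
  qed
qed

text \<open>Monomials are removed from the top degree downwards: once the right multiple of x^k is
  subtracted, all k-fold differences are small. With no steps left the hypothesis bounds f
  itself.\<close>

lemma whitney_mixed:
  assumes p: "0 < p" "p \<le> 1"
  shows "\<exists>C\<ge>0. \<forall>f \<epsilon>. f \<in> borel_measurable borel \<longrightarrow> 0 \<le> \<epsilon> \<longrightarrow>
     (\<integral>\<^sup>+x\<in>{0..real r + 1}. pp p (f x) \<partial>lborel) < \<infinity> \<longrightarrow>
     (\<forall>hs. length hs = r \<longrightarrow> set hs \<subseteq> {0<..1} \<longrightarrow> (\<integral>\<^sup>+x\<in>{0..1}. pp p (mdif hs f x) \<partial>lborel) \<le> ennreal \<epsilon>) \<longrightarrow>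
     (\<exists>q\<in>Poly_space r. (\<integral>\<^sup>+x\<in>{0..1}. pp p (f x - poly q x) \<partial>lborel) \<le> ennreal (C * \<epsilon>))"
proof (induction r)
  case 0
  show ?case by (intro exI[of _ 1]) (auto simp: Poly_space_def)
next
  case (Suc k)
  then obtain C where "0 \<le> C" and C: "\<And>f \<epsilon>. f \<in> borel_measurable borel \<Longrightarrow> 0 \<le> \<epsilon> \<Longrightarrow>
     (\<integral>\<^sup>+x\<in>{0..real k + 1}. pp p (f x) \<partial>lborel) < \<infinity> \<Longrightarrow>
     (\<And>hs. length hs = k \<Longrightarrow> set hs \<subseteq> {0<..1} \<Longrightarrow> (\<integral>\<^sup>+x\<in>{0..1}. pp p (mdif hs f x) \<partial>lborel) \<le> ennreal \<epsilon>) \<Longrightarrow>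
     (\<exists>q\<in>Poly_space k. (\<integral>\<^sup>+x\<in>{0..1}. pp p (f x - poly q x) \<partial>lborel) \<le> ennreal (C * \<epsilon>))"
    by blast
  let ?K = "2 + (3 * real k) powr p * 7"
  show ?case
  proof (intro exI[of _ "C * ?K"] conjI allI impI)
    fix f :: "real \<Rightarrow> real" and \<epsilon> :: real
    assume f[measurable]: "f \<in> borel_measurable borel" and \<epsilon>: "0 \<le> \<epsilon>" and fin: "(\<integral>\<^sup>+x\<in>{0..real (Suc k) + 1}. pp p (f x) \<partial>lborel) < \<infinity>"
      and small: "\<forall>hs. length hs = Suc k \<longrightarrow> set hs \<subseteq> {0<..1} \<longrightarrow> (\<integral>\<^sup>+x\<in>{0..1}. pp p (mdif hs f x) \<partial>lborel) \<le> ennreal \<epsilon>"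
    have "(\<integral>\<^sup>+x\<in>{0..real k + 1}. pp p (f x) \<partial>lborel) \<le> (\<integral>\<^sup>+x\<in>{0..real (Suc k) + 1}. pp p (f x) \<partial>lborel)"
      by (intro set_nn_integral_mono_set) auto
    with fin have fin': "(\<integral>\<^sup>+x\<in>{0..real k + 1}. pp p (f x) \<partial>lborel) < \<infinity>" by auto
    obtain l where l: "\<And>hs. length hs = k \<Longrightarrow> set hs \<subseteq> {0<..1} \<Longrightarrow>
      (\<integral>\<^sup>+x\<in>{0..1}. pp p (mdif hs (\<lambda>x. f x - poly (monom l k) x) x) \<partial>lborel) \<le> ennreal (?K * \<epsilon>)"
      using whitney_mixed_step[OF p f \<epsilon> fin'] small by blast
    have "(\<integral>\<^sup>+x\<in>{0..real k + 1}. pp p (f x - poly (monom l k) x) \<partial>lborel) \<le>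
       (\<integral>\<^sup>+x\<in>{0..real k + 1}. pp p (f x) + pp p (poly (monom l k) x) \<partial>lborel)"
      by (intro set_nn_integral_mono pp_diff p)
    also have "\<dots> = (\<integral>\<^sup>+x\<in>{0..real k + 1}. pp p (f x) \<partial>lborel) + (\<integral>\<^sup>+x\<in>{0..real k + 1}. pp p (poly (monom l k) x) \<partial>lborel)"
      by (rule set_nn_integral_add) measurable
    also have "\<dots> < \<infinity>" using fin' set_nn_integral_poly_finite[OF p(1)] by simp
    finally have "\<exists>q\<in>Poly_space k. (\<integral>\<^sup>+x\<in>{0..1}. pp p (f x - poly (monom l k) x - poly q x) \<partial>lborel) \<le> ennreal (C * (?K * \<epsilon>))"
      using \<epsilon> by (intro C l) auto
    then obtain q where q: "q \<in> Poly_space k" "(\<integral>\<^sup>+x\<in>{0..1}. pp p (f x - poly (monom l k) x - poly q x) \<partial>lborel) \<le> ennreal (C * (?K * \<epsilon>))"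
      by blast
    show "\<exists>q\<in>Poly_space (Suc k). (\<integral>\<^sup>+x\<in>{0..1}. pp p (f x - poly q x) \<partial>lborel) \<le> ennreal (C * ?K * \<epsilon>)"
    proof (rule bexI[of _ "monom l k + q"])
      have "degree q \<le> k" using q(1) by (auto simp: Poly_space_def)
      then have "degree (monom l k + q) \<le> k" by (intro degree_add_le degree_monom_le)
      then show "monom l k + q \<in> Poly_space (Suc k)" by (auto simp: Poly_space_def)
    qed (use q(2) in \<open>simp add: algebra_simps\<close>)
  qed (use \<open>0 \<le> C\<close> in auto)
qed

text \<open>For \<open>h\<close> in \<open>[h0, 2 h0]\<close> all nodes but the last of a difference ending in \<open>[a, a + h0]\<close> lie left of \<open>a\<close>.\<close>

lemma whitney_extend_step:
  fixes g :: "real \<Rightarrow> real"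
  assumes p: "0 < p" "p \<le> 1" and [measurable]: "g \<in> borel_measurable borel"
    and r: "1 \<le> r" and a: "1 \<le> a" "a \<le> T"
  defines "h0 \<equiv> 1 / (2 * real r)"
  shows "(\<integral>\<^sup>+x\<in>{0..min (a + h0) T}. pp p (g x) \<partial>lborel)
    \<le> (1 + 2 ^ r) * (\<integral>\<^sup>+x\<in>{0..a}. pp p (g x) \<partial>lborel) +
      ennreal (2 * real r) * (\<integral>\<^sup>+u\<in>{0..T / real r}. (\<integral>\<^sup>+y\<in>{0..T - real r * u}. pp p (fdiff r u g y) \<partial>lborel) \<partial>lborel)"
proof -
  define b where "b = min (a + h0) T"
  let ?G = "\<integral>\<^sup>+x\<in>{0..a}. pp p (g x) \<partial>lborel"
  let ?F = "\<lambda>u. \<integral>\<^sup>+y\<in>{0..T - real r * u}. pp p (fdiff r u g y) \<partial>lborel"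
  let ?X = "\<integral>\<^sup>+x\<in>{a..b}. pp p (g x) \<partial>lborel"
  have h0: "0 < h0" "real r * (2 * h0) = 1" using r by (auto simp: h0_def)
  have F[measurable]: "?F \<in> borel_measurable borel"
  proof -
    have eq: "?F = (\<lambda>u. \<integral>\<^sup>+y. (if 0 \<le> y \<and> y \<le> T - real r * u then pp p (fdiff r u g y) else 0) \<partial>lborel)"
      by (intro ext nn_integral_cong) (auto split: split_indicator)
    show ?thesis unfolding eq by measurable
  qed
  have X: "?X \<le> ?F h + 2 ^ r * ?G" if h: "h \<in> {h0..2 * h0}" for h
  proof -
    have rh: "real r * h \<le> 1" using mult_left_mono[of h "2 * h0" "real r"] h h0 by auto
    let ?t = "\<lambda>i x. (-1) ^ (r - i) * real (r choose i) * g (x - real r * h + real i * h)"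
    \<comment> \<open>The difference is solved for the value at its last node.\<close>
    have gx: "g x = fdiff r h g (x - real r * h) - (\<Sum>i<r. ?t i x)" for x
    proof -
      have "{..r} = insert r {..<r}" by auto
      then show ?thesis by (simp add: fdiff_def algebra_simps)
    qed
    have ti: "(\<integral>\<^sup>+x\<in>{a..b}. pp p (?t i x) \<partial>lborel) \<le> of_nat (r choose i) * ?G" if "i < r" for i
    proof -
      have "(\<integral>\<^sup>+x\<in>{a..b}. pp p (?t i x) \<partial>lborel) = (\<integral>\<^sup>+x\<in>{a..b}. pp p (real (r choose i)) * pp p (g (x + (real i * h - real r * h))) \<partial>lborel)"
        by (intro nn_integral_cong) (simp add: pp_mult, simp add: pp_def algebra_simps)
      also have "\<dots> = pp p (real (r choose i)) * (\<integral>\<^sup>+x\<in>{a..b}. pp p (g (x + (real i * h - real r * h))) \<partial>lborel)"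
        by (simp add: mult.assoc nn_integral_cmult)
      also have "(\<integral>\<^sup>+x\<in>{a..b}. pp p (g (x + (real i * h - real r * h))) \<partial>lborel) = 
         (\<integral>\<^sup>+x\<in>{a + (real i * h - real r * h)..b + (real i * h - real r * h)}. pp p (g x) \<partial>lborel)"
        by (rule nn_integral_shift) measurable
      also have "\<dots> \<le> ?G"
      proof (intro set_nn_integral_mono_set)
        have 1: "0 \<le> a + (real i * h - real r * h)" using a rh h h0 by (smt (verit) mult_nonneg_nonneg of_nat_0_le_iff atLeastAtMost_iff)
        have "real (Suc i) * h \<le> real r * h" using \<open>i < r\<close> h h0 by (intro mult_right_mono) auto
        then have 2: "b + (real i * h - real r * h) \<le> a" using h h0 by (auto simp: b_def algebra_simps)
        show "{a + (real i * h - real r * h)..b + (real i * h - real r * h)} \<subseteq> {0..a}" using 1 2 by auto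
      qed
      also have "pp p (real (r choose i)) \<le> of_nat (r choose i)"
      proof -
        have "real (r choose i) powr p \<le> real (r choose i) powr 1" using p that 
          by (intro powr_mono) (auto simp: Suc_le_eq)
        then show ?thesis by (simp add: pp_def ennreal_of_nat_eq_real_of_nat ennreal_leI)
      qed
      finally show ?thesis by (simp add: mult_mono)
    qed
    have "?X \<le> (\<integral>\<^sup>+x\<in>{a..b}. pp p (fdiff r h g (x - real r * h)) + (\<Sum>i<r. pp p (?t i x)) \<partial>lborel)"
      by (intro set_nn_integral_mono, subst gx) (intro order.trans[OF pp_diff[OF p]] add_mono pp_sum p order.refl)
    also have "\<dots> = (\<integral>\<^sup>+x\<in>{a..b}. pp p (fdiff r h g (x + (- real r * h))) \<partial>lborel) + (\<Sum>i<r. \<integral>\<^sup>+x\<in>{a..b}. pp p (?t i x) \<partial>lborel)"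
      by (simp add: set_nn_integral_add set_nn_integral_sum)
    also have "(\<integral>\<^sup>+x\<in>{a..b}. pp p (fdiff r h g (x + (- real r * h))) \<partial>lborel) = (\<integral>\<^sup>+x\<in>{a + (- real r * h)..b + (- real r * h)}. pp p (fdiff r h g x) \<partial>lborel)"
      by (rule nn_integral_shift) measurable
    also have "\<dots> \<le> ?F h" using rh a by (intro set_nn_integral_mono_set) (auto simp: b_def)
    also have "(\<Sum>i<r. \<integral>\<^sup>+x\<in>{a..b}. pp p (?t i x) \<partial>lborel) \<le> (\<Sum>i<r. of_nat (r choose i) * ?G)"
      by (intro sum_mono ti) auto
    also have "(\<Sum>i<r. of_nat (r choose i) * ?G) = of_nat (\<Sum>i<r. r choose i) * ?G" by (simp add: sum_distrib_right)
    also have "\<dots> \<le> of_nat (2 ^ r) * ?G"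
    proof -
      have "(\<Sum>i<r. r choose i) \<le> (\<Sum>i\<le>r. r choose i)" by (intro sum_mono2) auto
      also have "\<dots> = 2 ^ r" by (rule choose_row_sum)
      finally show ?thesis by (intro mult_right_mono of_nat_mono) auto
    qed
    finally show ?thesis by (simp add: add_mono)
  qed
  \<comment> \<open>The bound \<open>X\<close> holds for every single h. Averaging over an interval
    of length \<open>h0\<close> turns the one-step difference into the double integral, at the price
    1/h0 = 2r.\<close>
  have "ennreal h0 * ?X = (\<integral>\<^sup>+h\<in>{h0..2*h0}. ?X \<partial>lborel)" using h0 by (subst set_nn_integral_const) (auto simp: mult.commute)
  also have "\<dots> \<le> (\<integral>\<^sup>+h\<in>{h0..2*h0}. ?F h + 2 ^ r * ?G \<partial>lborel)" by (intro set_nn_integral_mono X)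
  also have "\<dots> = (\<integral>\<^sup>+h\<in>{h0..2*h0}. ?F h \<partial>lborel) + (\<integral>\<^sup>+h\<in>{h0..2*h0}. 2 ^ r * ?G \<partial>lborel)"
    by (rule set_nn_integral_add) measurable
  also have "(\<integral>\<^sup>+h\<in>{h0..2*h0}. 2 ^ r * ?G \<partial>lborel) = 2 ^ r * ?G * ennreal h0" using h0 by (subst set_nn_integral_const) auto
  also have "(\<integral>\<^sup>+h\<in>{h0..2*h0}. ?F h \<partial>lborel) \<le> (\<integral>\<^sup>+h\<in>{0..T / real r}. ?F h \<partial>lborel)"
    using h0 a r by (intro set_nn_integral_mono_set) (auto simp: field_simps h0_def)
  finally have "ennreal (2 * real r) * (ennreal h0 * ?X) \<le> ennreal (2 * real r) * ((\<integral>\<^sup>+h\<in>{0..T / real r}. ?F h \<partial>lborel) + 2 ^ r * ?G * ennreal h0)"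
    by (intro mult_left_mono) (auto simp: add_mono)
  moreover have "ennreal (2 * real r) * (ennreal h0 * ?X) = ?X"
    using r by (simp add: mult.assoc[symmetric] ennreal_mult[symmetric] h0_def)
  moreover have "ennreal (2 * real r) * (2 ^ r * ?G * ennreal h0) = 2 ^ r * ?G * (ennreal (2 * real r) * ennreal h0)"
    by (simp only: mult_ac)
  moreover have "ennreal (2 * real r) * ennreal h0 = 1" using r by (simp add: ennreal_mult[symmetric] h0_def)
  ultimately have X': "?X \<le> ennreal (2 * real r) * (\<integral>\<^sup>+h\<in>{0..T / real r}. ?F h \<partial>lborel) + 2 ^ r * ?G"
    by (simp add: distrib_left)
  have "(\<integral>\<^sup>+x\<in>{0..b}. pp p (g x) \<partial>lborel) \<le> (\<integral>\<^sup>+x. pp p (g x) * indicator {0..a} x + pp p (g x) * indicator {a..b} x \<partial>lborel)"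
    by (intro nn_integral_mono) (auto split: split_indicator)
  also have "\<dots> = ?G + ?X" by (rule nn_integral_add) measurable
  also have "\<dots> \<le> ?G + (ennreal (2 * real r) * (\<integral>\<^sup>+h\<in>{0..T / real r}. ?F h \<partial>lborel) + 2 ^ r * ?G)"
    by (intro add_mono X' order.refl)
  finally show ?thesis unfolding b_def by (simp add: distrib_right add_ac)
qed

text \<open>Each application of the extension step gains 1/(2r) on the right, and \<open>min\<close>
  stops at T. The constant compounds geometrically, which is harmless because T and hence the number
  of steps will depend on r only.\<close>

lemma whitney_extend:
  fixes g :: "real \<Rightarrow> real"
  assumes p: "0 < p" "p \<le> 1" and g: "g \<in> borel_measurable borel"
    and r: "1 \<le> r" and T: "1 \<le> T"
  shows "(\<integral>\<^sup>+x\<in>{0..min (1 + real k * (1 / (2 * real r))) T}. pp p (g x) \<partial>lborel)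
    \<le> (1 + 2 ^ r) ^ k * ((\<integral>\<^sup>+x\<in>{0..1}. pp p (g x) \<partial>lborel) +
      of_nat k * (ennreal (2 * real r) * (\<integral>\<^sup>+u\<in>{0..T / real r}. (\<integral>\<^sup>+y\<in>{0..T - real r * u}. pp p (fdiff r u g y) \<partial>lborel) \<partial>lborel)))"
    (is "?G k \<le> ?c ^ k * (?H + of_nat k * ?O)")
proof (induction k)
  case 0
  then show ?case using T by simp
next
  case (Suc k)
  let ?h0 = "1 / (2 * real r)"
  let ?a = "min (1 + real k * ?h0) T"
  have "min (1 + real (Suc k) * ?h0) T = min (?a + ?h0) T"
  proof -
    have "min (1 + real (Suc k) * h) T = min (min (1 + real k * h) T + h) T" if "0 \<le> h" for h :: real
      using that by (auto simp: min_def algebra_simps)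
    from this[of ?h0] show ?thesis by simp
  qed
  then have "?G (Suc k) \<le> ?c * ?G k + ?O"
    using whitney_extend_step[OF p g r, of ?a T] r T by (simp add: min_def)
  also have "\<dots> \<le> ?c * (?c ^ k * (?H + of_nat k * ?O)) + ?c ^ Suc k * ?O"
  proof (intro add_mono mult_left_mono Suc)
    have "1 * ?O \<le> ?c ^ Suc k * ?O"
      by (intro mult_right_mono one_le_power) (auto simp: le_add_same_cancel1)
    then show "?O \<le> ?c ^ Suc k * ?O" by simp
  qed auto
  also have "\<dots> = ?c ^ Suc k * (?H + of_nat (Suc k) * ?O)" by (simp add: algebra_simps)
  finally show ?case .
qed

text \<open>The value of T is what the averaging of mixed differences requires: a difference with
  base point and step up to r + 1 reaches r (r + 1) + (r + 1) = (r + 1)^2. This controls f on [0,1],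
  and \<open>whitney_extend\<close> carries the same polynomial to [0,T], its own r-th differences
  being zero.\<close>

lemma whitney_unit:
  assumes p: "0 < p" "p \<le> 1" and r: "1 \<le> r"
  defines "T \<equiv> (real r + 1)\<^sup>2"
  shows "\<exists>C>0. \<forall>f. f \<in> borel_measurable borel \<longrightarrow>
     (\<integral>\<^sup>+x\<in>{0..T}. pp p (f x) \<partial>lborel) < \<infinity> \<longrightarrow>
     (\<exists>q\<in>Poly_space r. (\<integral>\<^sup>+x\<in>{0..T}. pp p (f x - poly q x) \<partial>lborel) \<le>
       ennreal C * (\<integral>\<^sup>+u\<in>{0..T / real r}. (\<integral>\<^sup>+y\<in>{0..T - real r * u}. pp p (fdiff r u f y) \<partial>lborel) \<partial>lborel))"
proof -
  from whitney_mixed[OF p, of r] obtain C where C0: "0 \<le> C" and C: "\<And>f \<epsilon>. f \<in> borel_measurable borel \<Longrightarrow> 0 \<le> \<epsilon> \<Longrightarrow>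
     (\<integral>\<^sup>+x\<in>{0..real r + 1}. pp p (f x) \<partial>lborel) < \<infinity> \<Longrightarrow>
     (\<And>hs. length hs = r \<Longrightarrow> set hs \<subseteq> {0<..1} \<Longrightarrow> (\<integral>\<^sup>+x\<in>{0..1}. pp p (mdif hs f x) \<partial>lborel) \<le> ennreal \<epsilon>) \<Longrightarrow>
     (\<exists>q\<in>Poly_space r. (\<integral>\<^sup>+x\<in>{0..1}. pp p (f x - poly q x) \<partial>lborel) \<le> ennreal (C * \<epsilon>))"
    by blast
  have Tr: "real r + 1 \<le> T / real r" "real r * (real r + 1) + (real r + 1) \<le> T" "real r + 1 \<le> T" "1 \<le> T"
    using r by (auto simp: T_def power2_eq_square field_simps)
  \<comment> \<open>Number of extension steps needed to reach T from 1.\<close>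
  obtain k :: nat where k: "T \<le> real k * (1 / (2 * real r))"
    using real_arch_simple[of "T * (2 * real r)"] r by (auto simp: field_simps)
  define K where "K = (1 + 2 ^ r) ^ k * (C * 2 ^ r + real k * (2 * real r)) + 1"
  have K: "0 < K" using C0 by (auto simp: K_def intro!: add_nonneg_pos)
  show ?thesis
  proof (intro exI[of _ K] conjI allI impI K)
    fix f assume f[measurable]: "f \<in> borel_measurable borel" and fin: "(\<integral>\<^sup>+x\<in>{0..T}. pp p (f x) \<partial>lborel) < \<infinity>"
    let ?\<Omega> = "\<integral>\<^sup>+u\<in>{0..T / real r}. (\<integral>\<^sup>+y\<in>{0..T - real r * u}. pp p (fdiff r u f y) \<partial>lborel) \<partial>lborel"
    show "\<exists>q\<in>Poly_space r. (\<integral>\<^sup>+x\<in>{0..T}. pp p (f x - poly q x) \<partial>lborel) \<le> ennreal K * ?\<Omega>"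
    proof (cases "?\<Omega> = \<infinity>")
      case True
      then show ?thesis using K by (intro bexI[of _ 0]) (auto simp: Poly_space_def ennreal_mult_top)
    next
      case False
      then obtain w where w: "0 \<le> w" "?\<Omega> = ennreal w" by (cases ?\<Omega>) auto
      have "(\<integral>\<^sup>+u\<in>{0..real r + 1}. (\<integral>\<^sup>+y\<in>{0..real r + 1}. pp p (fdiff r u f y) \<partial>lborel) \<partial>lborel) \<le> 
        (\<integral>\<^sup>+u\<in>{0..real r + 1}. (\<integral>\<^sup>+y\<in>{0..T - real r * u}. pp p (fdiff r u f y) \<partial>lborel) \<partial>lborel)"
      proof (intro set_nn_integral_mono set_nn_integral_mono_set)
        fix u assume u: "u \<in> {0..real r + 1}"
        then have "real r * u \<le> real r * (real r + 1)" by (intro mult_left_mono) auto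
        then show "{0..real r + 1} \<subseteq> {0..T - real r * u}" using Tr by auto
      qed
      also have "\<dots> \<le> ?\<Omega>" using Tr by (intro set_nn_integral_mono_set) auto
      finally have \<Omega>: "(\<integral>\<^sup>+u\<in>{0..real r + 1}. (\<integral>\<^sup>+y\<in>{0..real r + 1}. pp p (fdiff r u f y) \<partial>lborel) \<partial>lborel) \<le> ?\<Omega>" .
      have "\<exists>q\<in>Poly_space r. (\<integral>\<^sup>+x\<in>{0..1}. pp p (f x - poly q x) \<partial>lborel) \<le> ennreal (C * (2 ^ r * w))"
      proof (rule C)
        show "(\<integral>\<^sup>+x\<in>{0..real r + 1}. pp p (f x) \<partial>lborel) < \<infinity>"
          using Tr by (intro order.strict_trans1[OF set_nn_integral_mono_set fin]) auto
        fix hs :: "real list" assume hs: "length hs = r" "set hs \<subseteq> {0<..1}"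
        note mdif_average[OF p f hs]
        also have "2 ^ r * (\<integral>\<^sup>+u\<in>{0..real r + 1}. (\<integral>\<^sup>+y\<in>{0..real r + 1}. pp p (fdiff r u f y) \<partial>lborel) \<partial>lborel) \<le> 2 ^ r * ?\<Omega>"
          by (intro mult_left_mono \<Omega>) auto
        also have "\<dots> = ennreal (2 ^ r * w)" using w by (simp add: ennreal_mult flip: ennreal_power)
        finally show "(\<integral>\<^sup>+x\<in>{0..1}. pp p (mdif hs f x) \<partial>lborel) \<le> ennreal (2 ^ r * w)" .
      qed (use w in auto)
      then obtain q where q: "q \<in> Poly_space r" and qle: "(\<integral>\<^sup>+x\<in>{0..1}. pp p (f x - poly q x) \<partial>lborel) \<le> ennreal (C * (2 ^ r * w))"
        by blast
      have "(\<integral>\<^sup>+x\<in>{0..T}. pp p (f x - poly q x) \<partial>lborel) \<le> (\<integral>\<^sup>+x\<in>{0..min (1 + real k * (1 / (2 * real r))) T}. pp p (f x - poly q x) \<partial>lborel)"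
        using k by (intro set_nn_integral_mono_set) auto
      also have "\<dots> \<le> (1 + 2 ^ r) ^ k * ((\<integral>\<^sup>+x\<in>{0..1}. pp p (f x - poly q x) \<partial>lborel) +
        of_nat k * (ennreal (2 * real r) * (\<integral>\<^sup>+u\<in>{0..T / real r}. (\<integral>\<^sup>+y\<in>{0..T - real r * u}. pp p (fdiff r u (\<lambda>x. f x - poly q x) y) \<partial>lborel) \<partial>lborel)))"
        by (rule whitney_extend[OF p _ r Tr(4)]) measurable
      also have "(\<integral>\<^sup>+u\<in>{0..T / real r}. (\<integral>\<^sup>+y\<in>{0..T - real r * u}. pp p (fdiff r u (\<lambda>x. f x - poly q x) y) \<partial>lborel) \<partial>lborel) = ?\<Omega>"
        by (simp add: fdiff_diff fdiff_poly_eq_0[OF q])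
      also have "(1 + 2 ^ r) ^ k * ((\<integral>\<^sup>+x\<in>{0..1}. pp p (f x - poly q x) \<partial>lborel) + of_nat k * (ennreal (2 * real r) * ?\<Omega>))
        \<le> (1 + 2 ^ r) ^ k * (ennreal (C * (2 ^ r * w)) + of_nat k * (ennreal (2 * real r) * ?\<Omega>))"
        by (intro mult_left_mono add_mono qle) auto
      also have "\<dots> = ennreal ((1 + 2 ^ r) ^ k * (C * 2 ^ r + real k * (2 * real r)) * w)"
      proof -
        have 1: "(1 + 2 ^ r :: ennreal) = ennreal (1 + 2 ^ r)" by (simp add: ennreal_plus flip: ennreal_power)
        show ?thesis unfolding 1 w(2) ennreal_of_nat_eq_real_of_nat using w(1) C0
          by (simp add: ennreal_mult[symmetric] ennreal_plus[symmetric] ennreal_power algebra_simps del: ennreal_plus)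
      qed
      also have "\<dots> \<le> ennreal (K * w)" using w by (intro ennreal_leI mult_right_mono) (auto simp: K_def)
      also have "\<dots> = ennreal K * ?\<Omega>" using w K by (simp add: ennreal_mult)
      finally show ?thesis using q by blast
    qed
  qed
qed

lemma fdiff_affine: "fdiff r u (\<lambda>t. f (a + k * t)) y = fdiff r (k * u) f (a + k * y)"
  by (simp add: fdiff_def algebra_simps)

text \<open>Affine rescaling of [0,T]. The double integral has two rescaled variables and the left
  side one, which leaves the factor 1/(b - a).\<close>

theorem whitney:
  assumes p: "0 < p" "p \<le> 1" and r: "1 \<le> r"
  shows "\<exists>C>0. \<forall>f a b. f \<in> borel_measurable borel \<longrightarrow> a < b \<longrightarrow>
     (\<integral>\<^sup>+x\<in>{a..b}. pp p (f x) \<partial>lborel) < \<infinity> \<longrightarrow>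
     (\<exists>q\<in>Poly_space r. (\<integral>\<^sup>+x\<in>{a..b}. pp p (f x - poly q x) \<partial>lborel) \<le>
       ennreal (C / (b - a)) * (\<integral>\<^sup>+u\<in>{0..(b - a) / real r}. (\<integral>\<^sup>+y\<in>{a..b - real r * u}. pp p (fdiff r u f y) \<partial>lborel) \<partial>lborel))"
proof -
  define T where "T = (real r + 1)\<^sup>2"
  have T: "0 < T" by (auto simp: T_def)
  from whitney_unit[OF p r] obtain C where C0: "0 < C" and C: "\<And>f. f \<in> borel_measurable borel \<Longrightarrow> 
     (\<integral>\<^sup>+x\<in>{0..T}. pp p (f x) \<partial>lborel) < \<infinity> \<Longrightarrow>
     (\<exists>q\<in>Poly_space r. (\<integral>\<^sup>+x\<in>{0..T}. pp p (f x - poly q x) \<partial>lborel) \<le>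
       ennreal C * (\<integral>\<^sup>+u\<in>{0..T / real r}. (\<integral>\<^sup>+y\<in>{0..T - real r * u}. pp p (fdiff r u f y) \<partial>lborel) \<partial>lborel))"
    unfolding T_def[symmetric] by blast
  show ?thesis
  proof (intro exI[of _ "C * T"] conjI allI impI)
    fix f and a b :: real
    assume f[measurable]: "f \<in> borel_measurable borel" and ab: "a < b" and fin: "(\<integral>\<^sup>+x\<in>{a..b}. pp p (f x) \<partial>lborel) < \<infinity>"
    define k where "k = (b - a) / T"
    have k: "0 < k" "a + k * T = b" using ab T by (auto simp: k_def)
    have scale: "(\<integral>\<^sup>+x\<in>{c..d}. F (a + k * x) \<partial>lborel) = ennreal (1 / k) * (\<integral>\<^sup>+x\<in>{a + k * c..a + k * d}. F x \<partial>lborel)"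
      if "F \<in> borel_measurable borel" for F :: "real \<Rightarrow> ennreal" and c d
      using nn_integral_scale[OF that k(1)] .
    have "\<exists>q\<in>Poly_space r. (\<integral>\<^sup>+x\<in>{0..T}. pp p (f (a + k * x) - poly q x) \<partial>lborel) \<le>
       ennreal C * (\<integral>\<^sup>+u\<in>{0..T / real r}. (\<integral>\<^sup>+y\<in>{0..T - real r * u}. pp p (fdiff r u (\<lambda>t. f (a + k * t)) y) \<partial>lborel) \<partial>lborel)"
    proof (rule C)
      have "(\<integral>\<^sup>+x\<in>{0..T}. pp p (f (a + k * x)) \<partial>lborel) = ennreal (1 / k) * (\<integral>\<^sup>+x\<in>{a..b}. pp p (f x) \<partial>lborel)"
        using scale[of "\<lambda>x. pp p (f x)" 0 T] k by simp
      then show "(\<integral>\<^sup>+x\<in>{0..T}. pp p (f (a + k * x)) \<partial>lborel) < \<infinity>" using fin by (simp add: ennreal_mult_less_top)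
    qed measurable
    then obtain q where q: "q \<in> Poly_space r" and qle: "(\<integral>\<^sup>+x\<in>{0..T}. pp p (f (a + k * x) - poly q x) \<partial>lborel) \<le>
       ennreal C * (\<integral>\<^sup>+u\<in>{0..T / real r}. (\<integral>\<^sup>+y\<in>{0..T - real r * u}. pp p (fdiff r u (\<lambda>t. f (a + k * t)) y) \<partial>lborel) \<partial>lborel)"
      by blast
    define q' where "q' = pcompose q [:- a / k, 1 / k:]"
    have q': "poly q' (a + k * x) = poly q x" for x using k by (simp add: q'_def poly_pcompose field_simps)
    have q'P: "q' \<in> Poly_space r"
      using q by (auto simp: Poly_space_def q'_def degree_pcompose)
    let ?\<Omega> = "\<integral>\<^sup>+u\<in>{0..(b - a) / real r}. (\<integral>\<^sup>+y\<in>{a..b - real r * u}. pp p (fdiff r u f y) \<partial>lborel) \<partial>lborel"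
    have inner: "(\<integral>\<^sup>+y\<in>{0..T - real r * u}. pp p (fdiff r u (\<lambda>t. f (a + k * t)) y) \<partial>lborel) =
        ennreal (1 / k) * (\<integral>\<^sup>+y\<in>{a..b - real r * (k * u)}. pp p (fdiff r (k * u) f y) \<partial>lborel)" for u
      using scale[of "\<lambda>y. pp p (fdiff r (k * u) f y)" 0 "T - real r * u"] k
      unfolding fdiff_affine by (simp add: algebra_simps)
    let ?F = "\<lambda>u. \<integral>\<^sup>+y\<in>{a..b - real r * u}. pp p (fdiff r u f y) \<partial>lborel"
    have F[measurable]: "?F \<in> borel_measurable borel"
    proof -
      have eq: "?F = (\<lambda>u. \<integral>\<^sup>+y. (if a \<le> y \<and> y \<le> b - real r * u then pp p (fdiff r u f y) else 0) \<partial>lborel)"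
        by (intro ext nn_integral_cong) (auto split: split_indicator)
      show ?thesis unfolding eq by measurable
    qed
    have "ennreal (1 / k) * (\<integral>\<^sup>+x\<in>{a..b}. pp p (f x - poly q' x) \<partial>lborel) = (\<integral>\<^sup>+x\<in>{0..T}. pp p (f (a + k * x) - poly q x) \<partial>lborel)"
      using scale[of "\<lambda>x. pp p (f x - poly q' x)" 0 T] k q' by simp
    also note qle
    also have "(\<integral>\<^sup>+u\<in>{0..T / real r}. (\<integral>\<^sup>+y\<in>{0..T - real r * u}. pp p (fdiff r u (\<lambda>t. f (a + k * t)) y) \<partial>lborel) \<partial>lborel)
       = ennreal (1 / k) * (\<integral>\<^sup>+u\<in>{0..T / real r}. ?F (0 + k * u) \<partial>lborel)"
      unfolding inner by (simp add: mult.assoc nn_integral_cmult)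
    also have "(\<integral>\<^sup>+u\<in>{0..T / real r}. ?F (0 + k * u) \<partial>lborel) = ennreal (1 / k) * ?\<Omega>"
    proof -
      have kT: "0 + k * (T / real r) = (b - a) / real r" "0 + k * 0 = 0" using T by (simp_all add: k_def)
      show ?thesis using nn_integral_scale[OF F k(1), of 0 0 "T / real r"] unfolding kT .
    qed
    finally have "ennreal (1 / k) * (\<integral>\<^sup>+x\<in>{a..b}. pp p (f x - poly q' x) \<partial>lborel) \<le> ennreal C * (ennreal (1 / k) * (ennreal (1 / k) * ?\<Omega>))" .
    then have "ennreal k * (ennreal (1 / k) * (\<integral>\<^sup>+x\<in>{a..b}. pp p (f x - poly q' x) \<partial>lborel)) \<le> ennreal k * (ennreal C * (ennreal (1 / k) * (ennreal (1 / k) * ?\<Omega>)))"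
      by (intro mult_left_mono) auto
    also have "\<dots> = ennreal (C * T / (b - a)) * ?\<Omega>"
      using k C0 T ab by (simp add: mult.assoc[symmetric] ennreal_mult[symmetric]) (simp add: k_def field_simps)
    finally have "(\<integral>\<^sup>+x\<in>{a..b}. pp p (f x - poly q' x) \<partial>lborel) \<le> ennreal (C * T / (b - a)) * ?\<Omega>"
      using k by (simp add: mult.assoc[symmetric] ennreal_mult[symmetric])
    then show "\<exists>q\<in>Poly_space r. (\<integral>\<^sup>+x\<in>{a..b}. pp p (f x - poly q x) \<partial>lborel) \<le> ennreal (C * T / (b - a)) * ?\<Omega>"
      using q'P by blast
  qed (use C0 T in auto)
qed

section \<open>Growth of a polynomial away from an interval where its p-th power integral is
  known\<close>

lemma lagrange_interpolation:
  fixes q :: "real poly"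
  assumes q: "q \<in> Poly_space r" and Y: "finite Y" "card Y = r"
  shows "poly q x = (\<Sum>y\<in>Y. poly q y * (\<Prod>z\<in>Y - {y}. (x - z) / (y - z)))"
proof -
  define P where "P = (\<Sum>y\<in>Y. smult (poly q y) (\<Prod>z\<in>Y - {y}. [:- z / (y - z), 1 / (y - z):]))"
  have poly_P: "poly P x = (\<Sum>y\<in>Y. poly q y * (\<Prod>z\<in>Y - {y}. (x - z) / (y - z)))" for x
  proof -
    have "poly [:- z / (y - z), 1 / (y - z):] x = (x - z) / (y - z)" for y z by (simp add: diff_divide_distrib)
    then show ?thesis unfolding P_def poly_sum poly_smult poly_prod by (simp only:)
  qed
  show ?thesis
  proof (cases "r = 0")
    case True
    then show ?thesis using q Y by (simp add: Poly_space_def)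
  next
    case False
    have "degree P < r"
      unfolding P_def
    proof (rule degree_sum_less)
      fix y assume y: "y \<in> Y"
      have "degree (\<Prod>z\<in>Y - {y}. [:- z / (y - z), 1 / (y - z):]) \<le> (\<Sum>z\<in>Y - {y}. 1)"
        using Y by (intro order.trans[OF degree_prod_sum_le] sum_mono) auto
      also have "\<dots> < r" using y Y False by simp
      finally show "degree (smult (poly q y) (\<Prod>z\<in>Y - {y}. [:- z / (y - z), 1 / (y - z):])) < r"
        by (rule le_less_trans[OF degree_smult_le])
    qed (use False in auto)
    moreover have "degree q < r" using q False by (auto simp: Poly_space_def)
    moreover have "poly q y = poly P y" if y: "y \<in> Y" for y
    proof -
      have "poly P y = (\<Sum>v\<in>{y}. poly q v * (\<Prod>z\<in>Y - {v}. (y - z) / (v - z)))"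
        unfolding poly_P using Y y by (intro sum.mono_neutral_right) auto
      also have "\<dots> = poly q y"
      proof -
        have "(\<Prod>z\<in>Y - {y}. (y - z) / (y - z)) = 1" by (intro prod.neutral) auto
        then show ?thesis by simp
      qed
      finally show ?thesis ..
    qed
    ultimately have "q = P" using Y(2) by (intro poly_eqI_degree[of Y]) simp_all
    then have "poly q x = poly P x" by simp
    then show ?thesis unfolding poly_P .
  qed
qed

text \<open>In r cells of [a,b], with gaps between them, there are points where |q|^p is at most its
  mean over the cell. These nodes are well separated, so Lagrange interpolation at them has basis
  polynomials bounded by a power of the relative distance of x from a.\<close>

lemma poly_Lp_growth:
  assumes p: "0 < p" "p \<le> 1"
  shows "\<exists>C>0. \<forall>q\<in>Poly_space r. \<forall>a b x. a < b \<longrightarrow>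
    pp p (poly q x) \<le> ennreal (C * (1 + \<bar>x - a\<bar> / (b - a)) ^ r / (b - a)) * (\<integral>\<^sup>+y\<in>{a..b}. pp p (poly q y) \<partial>lborel)"
proof (cases "r = 0")
  case True
  then have P: "Poly_space r = {0}" by (simp add: Poly_space_def)
  show ?thesis unfolding P by (rule exI[of _ 1]) (simp only: ball_simps poly_0 pp_0 zero_le zero_less_one simp_thms)
next
  case False
  then have r: "0 < r" by simp
  define C where "C = real r * (2 * real r) ^ r * (2 * real r)"
  show ?thesis
  proof (intro exI[of _ C] conjI ballI allI impI)
    fix q :: "real poly" and a b x :: real
    assume q: "q \<in> Poly_space r" and ab: "a < b"
    let ?I = "\<integral>\<^sup>+y\<in>{a..b}. pp p (poly q y) \<partial>lborel"
    obtain w where w: "0 \<le> w" "?I = ennreal w"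
      using set_nn_integral_poly_finite[OF p(1), where a=a and b=b and q=q] by (cases ?I) auto
    \<comment> \<open>With 2r equal cells, every other one receives a node; the skipped cells keep
      the nodes at least \<delta> apart.\<close>
    define \<delta> where "\<delta> = (b - a) / (2 * real r)"
    have \<delta>: "0 < \<delta>" "2 * real r * \<delta> = b - a" using ab r by (auto simp: \<delta>_def)
    have "\<exists>y\<in>{a + 2 * real k * \<delta>..a + (2 * real k + 1) * \<delta>}. pp p (poly q y) \<le> ennreal (w / \<delta>)" if k: "k < r" for k
    proof -
      have "(2 * real k + 1) * \<delta> \<le> 2 * real r * \<delta>" using k \<delta> by (intro mult_right_mono) auto
      then have "(\<integral>\<^sup>+y\<in>{a + 2 * real k * \<delta>..a + (2 * real k + 1) * \<delta>}. pp p (poly q y) \<partial>lborel) \<le> ?I"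
        using \<delta> by (intro set_nn_integral_mono_set) auto
      moreover have "a + (2 * real k + 1) * \<delta> - (a + 2 * real k * \<delta>) = \<delta>" by (simp add: algebra_simps)
      ultimately show ?thesis
        using ex_le_set_nn_integral[of "\<lambda>y. pp p (poly q y)" "a + 2 * real k * \<delta>" "a + (2 * real k + 1) * \<delta>" w] w \<delta>
        by (auto simp: algebra_simps)
    qed
    then have "\<exists>y. \<forall>k\<in>{..<r}. y k \<in> {a + 2 * real k * \<delta>..a + (2 * real k + 1) * \<delta>} \<and> pp p (poly q (y k)) \<le> ennreal (w / \<delta>)"
      by (intro bchoice) (auto simp: Bex_def)
    then obtain y where y: "\<And>k. k < r \<Longrightarrow> y k \<in> {a + 2 * real k * \<delta>..a + (2 * real k + 1) * \<delta>}"
      and qy: "\<And>k. k < r \<Longrightarrow> pp p (poly q (y k)) \<le> ennreal (w / \<delta>)" by auto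
    have sep: "\<delta> \<le> y j - y i" if "i < j" "j < r" for i j
    proof -
      have "(2 * real i + 2) * \<delta> \<le> 2 * real j * \<delta>" using that \<delta> by (intro mult_right_mono) auto
      then show ?thesis using y[of i] y[of j] that by (auto simp: algebra_simps)
    qed
    have gap: "\<delta> \<le> \<bar>y i - y j\<bar>" if "i \<noteq> j" "i < r" "j < r" for i j
      using sep[of i j] sep[of j i] that by (cases "i < j") auto
    have inj: "inj_on y {..<r}"
    proof (rule inj_onI)
      fix i j assume "i \<in> {..<r}" "j \<in> {..<r}" "y i = y j"
      then show "i = j" using gap[of i j] \<delta> by (cases "i = j") auto
    qed
    define l where "l = 1 + \<bar>x - a\<bar> / (b - a)"
    have l: "1 \<le> l" using ab by (auto simp: l_def)
    have yab: "a \<le> y k \<and> y k \<le> b" if k: "k < r" for k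
    proof -
      have "(2 * real k + 1) * \<delta> \<le> 2 * real r * \<delta>" using k \<delta> by (intro mult_right_mono) auto
      moreover have "0 \<le> 2 * real k * \<delta>" using \<delta>(1) by simp
      moreover have "a + 2 * real k * \<delta> \<le> y k" "y k \<le> a + (2 * real k + 1) * \<delta>" using y[OF k] by auto
      ultimately show ?thesis using \<delta>(2) by linarith
    qed
    have ratio: "\<bar>(x - z) / (v - z)\<bar> \<le> 2 * real r * l" if "v \<in> y ` {..<r}" "z \<in> y ` {..<r} - {v}" for v z
    proof -
      obtain i j where ij: "i < r" "j < r" "v = y i" "z = y j" "i \<noteq> j" using \<open>v \<in> _\<close> \<open>z \<in> _\<close> by auto
      have g: "\<delta> \<le> \<bar>v - z\<bar>" unfolding ij(3,4) by (rule gap[OF ij(5,1,2)])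
      have "\<bar>x - z\<bar> \<le> \<bar>x - a\<bar> + (b - a)" using yab[OF ij(2)] ij(4) by auto
      also have "\<dots> = (b - a) * l" using ab by (simp add: l_def distrib_left)
      also have "\<dots> = 2 * real r * l * \<delta>" unfolding \<delta>(2)[symmetric] by (simp add: mult_ac)
      also have "\<dots> \<le> 2 * real r * l * \<bar>v - z\<bar>" using l by (intro mult_left_mono g) auto
      finally show ?thesis using g \<delta>(1) by (simp add: abs_divide divide_le_eq)
    qed
    have prod: "pp p (\<Prod>z\<in>y ` {..<r} - {v}. (x - z) / (v - z)) \<le> ennreal ((2 * real r) ^ r * l ^ r)" if "v \<in> y ` {..<r}" for v
    proof -
      have "1 * 1 \<le> (2 * real r) * l" using r l by (intro mult_mono) auto
      then have 1: "1 \<le> 2 * real r * l" by simp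
      have "\<bar>\<Prod>z\<in>y ` {..<r} - {v}. (x - z) / (v - z)\<bar> \<le> (\<Prod>z\<in>y ` {..<r} - {v}. 2 * real r * l)"
        unfolding abs_prod by (intro prod_mono conjI abs_ge_zero ratio[OF that])
      also have "\<dots> = (2 * real r * l) ^ card (y ` {..<r} - {v})" by simp
      also have "\<dots> \<le> (2 * real r * l) ^ r"
      proof (rule power_increasing[OF _ 1])
        show "card (y ` {..<r} - {v}) \<le> r" 
          using card_mono[of "y ` {..<r}" "y ` {..<r} - {v}"] card_image_le[of "{..<r}" y] by auto
      qed
      finally have "\<bar>\<Prod>z\<in>y ` {..<r} - {v}. (x - z) / (v - z)\<bar> powr p \<le> ((2 * real r * l) ^ r) powr p"
        using p by (intro powr_mono2) auto
      also have "\<dots> \<le> ((2 * real r * l) ^ r) powr 1" using 1 p by (intro powr_mono one_le_power) auto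
      also have "\<dots> = (2 * real r) ^ r * l ^ r" using l by (simp add: power_mult_distrib)
      finally show ?thesis by (simp add: pp_def ennreal_leI)
    qed
    have lag: "poly q x = (\<Sum>v\<in>y ` {..<r}. poly q v * (\<Prod>z\<in>y ` {..<r} - {v}. (x - z) / (v - z)))"
      by (rule lagrange_interpolation[OF q]) (simp_all add: card_image inj)
    have "pp p (poly q x) \<le> (\<Sum>v\<in>y ` {..<r}. pp p (poly q v * (\<Prod>z\<in>y ` {..<r} - {v}. (x - z) / (v - z))))"
      unfolding lag by (rule pp_sum[OF p])
    also have "\<dots> \<le> (\<Sum>v\<in>y ` {..<r}. ennreal (w / \<delta>) * ennreal ((2 * real r) ^ r * l ^ r))"
    proof (intro sum_mono)
      fix v assume v: "v \<in> y ` {..<r}"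
      then have "pp p (poly q v) \<le> ennreal (w / \<delta>)" using qy by auto
      then show "pp p (poly q v * (\<Prod>z\<in>y ` {..<r} - {v}. (x - z) / (v - z))) \<le> ennreal (w / \<delta>) * ennreal ((2 * real r) ^ r * l ^ r)"
        unfolding pp_mult by (intro mult_mono prod[OF v]) auto
    qed
    also have "\<dots> = ennreal (real r) * (ennreal (w / \<delta>) * ennreal ((2 * real r) ^ r * l ^ r))"
      by (simp only: sum_constant card_image[OF inj] card_lessThan ennreal_of_nat_eq_real_of_nat)
    also have "\<dots> = ennreal (C * l ^ r / (b - a)) * ennreal w"
    proof -
      have "real r * (w / \<delta> * ((2 * real r) ^ r * l ^ r)) = C * l ^ r / (b - a) * w"
      proof -
        have "w / \<delta> = w * (2 * real r) / (b - a)" by (simp add: \<delta>_def)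
        then show ?thesis unfolding C_def by (simp only: times_divide_eq_left times_divide_eq_right mult_ac)
      qed
      moreover have "0 \<le> w / \<delta>" "0 \<le> (2 * real r) ^ r * l ^ r" "0 \<le> C * l ^ r / (b - a)"
        using w(1) \<delta>(1) l ab r by (auto simp: C_def intro!: divide_nonneg_nonneg mult_nonneg_nonneg)
      ultimately show ?thesis using w(1) by (simp only: ennreal_mult[symmetric] mult_nonneg_nonneg of_nat_0_le_iff)
    qed
    finally show "pp p (poly q x) \<le> ennreal (C * (1 + \<bar>x - a\<bar> / (b - a)) ^ r / (b - a)) * ?I"
      unfolding l_def w(2) .
  next
    show "0 < C" unfolding C_def using r by (intro mult_pos_pos zero_less_power) auto
  qed
qed

section \<open>Fejer kernels and cosine polynomials\<close>

definition dirichlet :: "nat \<Rightarrow> real \<Rightarrow> real" where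
  "dirichlet k t = 1 + 2 * (\<Sum>j=1..k. cos (real j * t))"

text \<open>Away from multiples of 2\<pi> this is (sin (M t/2) / (M sin (t/2)))^2, normalised to
  value 1 at 0 rather than to unit mass. The form as a sum exhibits it as a cosine polynomial and
  avoids the quotient at its peaks.\<close>

definition fejer :: "nat \<Rightarrow> real \<Rightarrow> real" where
  "fejer M t = (\<Sum>k<M. dirichlet k t) / (real M)\<^sup>2"

text \<open>A closed form without division by 1 - cos t. Its right side telescopes over k, which
  gives \<open>fejer_mult\<close>.\<close>

lemma dirichlet_mult: "(1 - cos t) * dirichlet k t = cos (real k * t) - cos (real (Suc k) * t)"
proof (induction k)
  case 0
  then show ?case by (simp add: dirichlet_def)
next
  case (Suc k)
  have "dirichlet (Suc k) t = dirichlet k t + 2 * cos (real (Suc k) * t)"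
    by (simp add: dirichlet_def)
  moreover have "cos (real k * t) + cos (real (Suc (Suc k)) * t) = 2 * cos t * cos (real (Suc k) * t)"
  proof -
    have "real k * t = real (Suc k) * t - t" "real (Suc (Suc k)) * t = real (Suc k) * t + t" 
      by (simp_all add: algebra_simps)
    then show ?thesis by (simp only: cos_add cos_diff) simp
  qed
  ultimately show ?case using Suc by (simp only: distrib_left) (simp add: algebra_simps)
qed

lemma fejer_mult: "(1 - cos t) * fejer M t = (1 - cos (real M * t)) / (real M)\<^sup>2"
proof -
  have "(1 - cos t) * (\<Sum>k<M. dirichlet k t) = 1 - cos (real M * t)"
    unfolding sum_distrib_left dirichlet_mult
    by (induction M) simp_all
  then show ?thesis by (simp add: fejer_def)
qed

lemma abs_dirichlet_le: "\<bar>dirichlet k t\<bar> \<le> 2 * real k + 1"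
proof -
  have "\<bar>\<Sum>j=1..k. cos (real j * t)\<bar> \<le> (\<Sum>j=1..k. 1)"
    by (intro order.trans[OF sum_abs] sum_mono) auto
  then show ?thesis by (simp add: dirichlet_def)
qed

lemma fejer_le_1: "\<bar>fejer M t\<bar> \<le> 1"
proof -
  have "\<bar>\<Sum>k<M. dirichlet k t\<bar> \<le> (\<Sum>k<M. 2 * real k + 1)"
    by (intro order.trans[OF sum_abs] sum_mono abs_dirichlet_le)
  also have "\<dots> = (real M)\<^sup>2" by (induction M) (simp_all add: power2_eq_square algebra_simps)
  finally show ?thesis by (simp add: fejer_def divide_le_eq)
qed

lemma cos_eq_1_fejer:
  assumes "cos t = 1" "1 \<le> M"
  shows "fejer M t = 1"
proof -
  have cosj: "cos (real j * t) = 1" for j :: nat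
  proof -
    obtain n :: int where "t = of_int n * 2 * pi" using assms(1) cos_one_2pi_int by auto
    then have "real j * t = of_int (int j * n) * 2 * pi" by simp
    then show ?thesis using cos_one_2pi_int by blast
  qed
  have "(\<Sum>k<M. dirichlet k t) = (\<Sum>k<M. 2 * real k + 1)" by (intro sum.cong) (auto simp: dirichlet_def cosj)
  also have "\<dots> = (real M)\<^sup>2" by (induction M) (simp_all add: power2_eq_square algebra_simps)
  finally show ?thesis using assms by (simp add: fejer_def)
qed

lemma fejer_0: "1 \<le> M \<Longrightarrow> fejer M 0 = 1"
  by (rule cos_eq_1_fejer) auto

lemma fejer_nonneg:
  assumes "1 \<le> M"
  shows "0 \<le> fejer M t"
proof (cases "cos t = 1")
  case True
  then show ?thesis using cos_eq_1_fejer assms by simp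
next
  case False
  then have "0 < 1 - cos t" by (metis cos_le_one diff_gt_0_iff_gt less_eq_real_def)
  moreover have "0 \<le> (1 - cos t) * fejer M t" unfolding fejer_mult by simp
  ultimately show ?thesis by (simp add: zero_le_mult_iff)
qed

lemma fejer_periodic: "fejer M (2 * pi - t) = fejer M t"
proof -
  have "cos (real j * (2 * pi - t)) = cos (real j * t)" for j
  proof -
    have "real j * (2 * pi - t) = 2 * pi * of_int (int j) - real j * t" by (simp add: algebra_simps)
    then show ?thesis by (simp add: cos_diff cos_int_2pin sin_int_2pin del: of_int_of_nat_eq)
  qed
  then show ?thesis by (simp add: fejer_def dirichlet_def)
qed

section \<open>Decay and peak of the Fejer kernel, and its derivative\<close>

lemma jordan_sin:
  assumes "0 \<le> x" "x \<le> pi / 2"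
  shows "2 * x / pi \<le> sin x"
proof -
  have "concave_on {0..pi} sin"
    by (rule f''_le0_imp_concave[where f'=cos and f''="\<lambda>x. - sin x"]) (auto intro!: derivative_eq_intros sin_ge_zero)
  then have "(1 - 2 * x / pi) * sin 0 + (2 * x / pi) * sin (pi / 2) \<le> sin ((1 - 2 * x / pi) *\<^sub>R 0 + (2 * x / pi) *\<^sub>R (pi / 2))"
    using assms by (intro concave_onD) (auto simp: field_simps)
  then show ?thesis by simp
qed

lemma one_minus_cos: "1 - cos t = 2 * (sin (t / 2))\<^sup>2" for t :: real
  using cos_double_sin[of "t / 2"] by simp

text \<open>For |t| <= \<pi> the kernel F = \<open>fejer M\<close> satisfies F(t) <= 1 and (M t)^2
  F(t) <= \<pi>^2; adding these gives (1 + (M t)^2) F(t) <= 1 + \<pi>^2.\<close>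

definition fc :: real where "fc = 1 + pi\<^sup>2"

lemma fc_ge_1: "1 \<le> fc" by (simp add: fc_def)

lemma fejer_decay:
  assumes "1 \<le> M" "\<bar>t\<bar> \<le> pi"
  shows "fejer M t \<le> fc / (1 + (real M * t)\<^sup>2)"
proof -
  have "(t / pi)\<^sup>2 \<le> (sin (t / 2))\<^sup>2"
  proof -
    have "\<bar>t\<bar> / pi \<le> sin (\<bar>t\<bar> / 2)" using jordan_sin[of "\<bar>t\<bar> / 2"] assms by simp
    then have "(\<bar>t\<bar> / pi)\<^sup>2 \<le> (sin (\<bar>t\<bar> / 2))\<^sup>2" by (intro power_mono) auto
    also have "sin (\<bar>t\<bar> / 2) = \<bar>sin (t / 2)\<bar> \<or> sin (\<bar>t\<bar> / 2) = - \<bar>sin (t / 2)\<bar>" by (cases "0 \<le> t") (auto simp: abs_if)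
    then have "(sin (\<bar>t\<bar> / 2))\<^sup>2 = (sin (t / 2))\<^sup>2" by auto
    finally show ?thesis by (simp add: power_divide)
  qed
  then have "2 * (t / pi)\<^sup>2 * fejer M t \<le> (1 - cos t) * fejer M t"
    unfolding one_minus_cos using fejer_nonneg assms by (intro mult_right_mono) auto
  also have "\<dots> \<le> 2 / (real M)\<^sup>2" unfolding fejer_mult using cos_ge_minus_one[of "real M * t"] by (intro divide_right_mono) auto
  finally have "(t / pi)\<^sup>2 * fejer M t \<le> 1 / (real M)\<^sup>2" by simp
  then have "(real M * t)\<^sup>2 * fejer M t \<le> pi\<^sup>2"
    using assms by (simp add: power_divide power_mult_distrib field_simps)
  moreover have "fejer M t \<le> 1" using fejer_le_1[of M t] by auto
  ultimately have "(1 + (real M * t)\<^sup>2) * fejer M t \<le> fc" by (simp add: fc_def distrib_right)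
  moreover have "0 < 1 + (real M * t)\<^sup>2" by (simp add: add_pos_nonneg)
  ultimately show ?thesis by (simp add: pos_le_divide_eq mult.commute)
qed

text \<open>Keeps the mass of a power of the kernel from being too small;
  \<open>step_approximation\<close> divides by that mass.\<close>

lemma fejer_lower:
  assumes "1 \<le> M" "\<bar>t\<bar> \<le> 1 / real M"
  shows "4 / pi\<^sup>2 \<le> fejer M t"
proof (cases "t = 0")
  case True
  have "4 / pi\<^sup>2 \<le> 1" using pi_gt3 power_mono[of 2 pi 2] by simp
  then show ?thesis using True fejer_0 assms by simp
next
  case False
  have sq: "(sin (\<bar>x\<bar> / 2))\<^sup>2 = (sin (x / 2))\<^sup>2" for x :: real by (cases "0 \<le> x") auto
  have Mt: "\<bar>real M * t\<bar> \<le> 1" using assms by (simp add: abs_mult field_simps)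
  have "(real M * t / pi)\<^sup>2 \<le> (sin (real M * t / 2))\<^sup>2"
  proof -
    have "\<bar>real M * t\<bar> / pi \<le> sin (\<bar>real M * t\<bar> / 2)" using jordan_sin[of "\<bar>real M * t\<bar> / 2"] Mt pi_gt3 by simp
    then have "(\<bar>real M * t\<bar> / pi)\<^sup>2 \<le> (sin (\<bar>real M * t\<bar> / 2))\<^sup>2" by (intro power_mono) auto
    then show ?thesis using sq[of "real M * t"] by (simp add: power_divide)
  qed
  then have "2 * (t / pi)\<^sup>2 \<le> (1 - cos (real M * t)) / (real M)\<^sup>2"
    unfolding one_minus_cos using assms by (simp add: power_divide power_mult_distrib field_simps)
  also have "\<dots> = (1 - cos t) * fejer M t" by (rule fejer_mult[symmetric])
  also have "1 - cos t \<le> t\<^sup>2 / 2"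
  proof -
    have "(sin (t / 2))\<^sup>2 \<le> (t / 2)\<^sup>2" using abs_sin_x_le_abs_x[of "t / 2"] by (metis abs_le_square_iff)
    then show ?thesis unfolding one_minus_cos by (simp add: power_divide)
  qed
  then have "(1 - cos t) * fejer M t \<le> t\<^sup>2 / 2 * fejer M t" using fejer_nonneg assms by (intro mult_right_mono) auto
  finally have "t\<^sup>2 * (4 / pi\<^sup>2) \<le> t\<^sup>2 * fejer M t" by (simp add: power_divide mult.commute)
  moreover have "0 < t\<^sup>2" using False by simp
  ultimately show ?thesis by (rule mult_left_le_imp_le)
qed

definition fejer' :: "nat \<Rightarrow> real \<Rightarrow> real" where
  "fejer' M t = (\<Sum>k<M. 2 * (\<Sum>j=1..k. - sin (real j * t) * real j)) / (real M)\<^sup>2"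

lemma fejer_deriv: "(fejer M has_real_derivative fejer' M t) (at t)"
proof -
  have "(dirichlet k has_real_derivative 2 * (\<Sum>j=1..k. - sin (real j * t) * real j)) (at t)" for k
    unfolding dirichlet_def[abs_def] by (auto intro!: derivative_eq_intros)
  then have "((\<lambda>t. \<Sum>k<M. dirichlet k t) has_real_derivative (\<Sum>k<M. 2 * (\<Sum>j=1..k. - sin (real j * t) * real j))) (at t)"
    by (intro DERIV_sum)
  from DERIV_cdivide[OF this, of "(real M)\<^sup>2"] show ?thesis
    unfolding fejer_def[abs_def] fejer'_def .
qed

lemma fejer'_0: "fejer' M 0 = 0"
  by (simp add: fejer'_def)

lemma fejer'_bound: "1 \<le> M \<Longrightarrow> \<bar>fejer' M t\<bar> \<le> 2 * real M"
proof -
  assume M: "1 \<le> M"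
  have "\<bar>\<Sum>k<M. 2 * (\<Sum>j=1..k. - sin (real j * t) * real j)\<bar> \<le> (\<Sum>k<M. 2 * (real M)\<^sup>2)"
  proof (intro order.trans[OF sum_abs] sum_mono)
    fix k assume k: "k \<in> {..<M}"
    have "\<bar>\<Sum>j=1..k. - sin (real j * t) * real j\<bar> \<le> (\<Sum>j=1..k. 1 * real M)"
    proof (intro order.trans[OF sum_abs] sum_mono)
      fix j assume "j \<in> {1..k}"
      then have "\<bar>sin (real j * t)\<bar> * real j \<le> 1 * real M" using k by (intro mult_mono) auto
      then show "\<bar>- sin (real j * t) * real j\<bar> \<le> 1 * real M" by (simp add: abs_mult)
    qed
    also have "\<dots> \<le> (real M)\<^sup>2" using k by (simp add: power2_eq_square)
    finally show "\<bar>2 * (\<Sum>j=1..k. - sin (real j * t) * real j)\<bar> \<le> 2 * (real M)\<^sup>2" by (simp add: abs_mult)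
  qed
  also have "\<dots> = 2 * real M * (real M)\<^sup>2" by simp
  finally show ?thesis using M unfolding fejer'_def by (simp add: abs_divide divide_le_eq)
qed

section \<open>Cosine polynomials as algebraic polynomials in cos t\<close>

definition cos_poly :: "nat \<Rightarrow> (real \<Rightarrow> real) \<Rightarrow> bool" where
  "cos_poly N g \<longleftrightarrow> (\<exists>a. \<forall>t. g t = (\<Sum>k\<le>N. a k * cos (real k * t)))"

lemma cos_poly_add: "cos_poly N f \<Longrightarrow> cos_poly N g \<Longrightarrow> cos_poly N (\<lambda>t. f t + g t)"
  unfolding cos_poly_def
proof (elim exE)
  fix a b assume "\<forall>t. f t = (\<Sum>k\<le>N. a k * cos (real k * t))" "\<forall>t. g t = (\<Sum>k\<le>N. b k * cos (real k * t))"
  then show "\<exists>a. \<forall>t. f t + g t = (\<Sum>k\<le>N. a k * cos (real k * t))"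
    by (intro exI[of _ "\<lambda>k. a k + b k"]) (simp add: sum.distrib distrib_right)
qed

lemma cos_poly_cmult: "cos_poly N f \<Longrightarrow> cos_poly N (\<lambda>t. c * f t)"
  unfolding cos_poly_def
proof (elim exE)
  fix a assume "\<forall>t. f t = (\<Sum>k\<le>N. a k * cos (real k * t))"
  then show "\<exists>a. \<forall>t. c * f t = (\<Sum>k\<le>N. a k * cos (real k * t))"
    by (intro exI[of _ "\<lambda>k. c * a k"]) (simp add: sum_distrib_left mult.assoc)
qed

lemma cos_poly_cos: "k \<le> N \<Longrightarrow> cos_poly N (\<lambda>t. cos (real k * t))"
  unfolding cos_poly_def
  by (intro exI[of _ "\<lambda>j. if j = k then 1 else 0"]) (simp add: if_distrib[of "\<lambda>x. x * _"] cong: if_cong)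

lemma cos_poly_0: "cos_poly N (\<lambda>t. 0)"
  unfolding cos_poly_def by (intro exI[of _ "\<lambda>_. 0"]) simp

lemma cos_poly_sum: "(\<And>i. i \<in> I \<Longrightarrow> cos_poly N (f i)) \<Longrightarrow> cos_poly N (\<lambda>t. \<Sum>i\<in>I. f i t)"
  by (induction I rule: infinite_finite_induct) (auto intro: cos_poly_0 cos_poly_add)

lemma cos_poly_mult_cos: "cos_poly N f \<Longrightarrow> cos_poly (Suc N) (\<lambda>t. cos t * f t)"
proof -
  assume "cos_poly N f"
  then obtain a where a: "f = (\<lambda>t. \<Sum>k\<le>N. a k * cos (real k * t))" unfolding cos_poly_def by blast
  have 1: "cos_poly (Suc N) (\<lambda>t. cos t * cos (real k * t))" if "k \<le> N" for k
  proof (cases k)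
    case 0
    then show ?thesis using cos_poly_cos[of 1 "Suc N"] by simp
  next
    case (Suc l)
    have "cos t * cos (real k * t) = 1/2 * cos (real (Suc k) * t) + 1/2 * cos (real l * t)" for t
    proof -
      have "real (Suc k) * t = real k * t + t" "real l * t = real k * t - t" by (simp_all add: Suc algebra_simps)
      then show ?thesis by (simp only: cos_add cos_diff) (simp add: field_simps)
    qed
    then show ?thesis using that Suc
      by (simp only:) (intro cos_poly_add cos_poly_cmult cos_poly_cos, auto)
  qed
  show ?thesis unfolding a sum_distrib_left using 1 
    by (intro cos_poly_sum) (simp add: mult.left_commute[of "cos _"] cos_poly_cmult)
qed

lemma cos_poly_of_poly: "degree P \<le> N \<Longrightarrow> cos_poly N (\<lambda>t. poly P (cos t))"
proof (induction P arbitrary: N)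
  case 0
  then show ?case by (simp add: cos_poly_0)
next
  case (pCons c P)
  show ?case
  proof (cases "P = 0")
    case True
    then show ?thesis using cos_poly_cmult[OF cos_poly_cos[of 0 N], of c] by simp
  next
    case False
    then obtain N' where N: "N = Suc N'" "degree P \<le> N'" using pCons.prems by (cases N) auto
    have "cos_poly N (\<lambda>t. c * cos (real 0 * t))" by (intro cos_poly_cmult cos_poly_cos) simp
    moreover have "cos_poly N (\<lambda>t. cos t * poly P (cos t))" unfolding N(1) by (intro cos_poly_mult_cos pCons.IH N)
    ultimately have "cos_poly N (\<lambda>t. c * cos (real 0 * t) + cos t * poly P (cos t))" by (rule cos_poly_add)
    then show ?thesis by simp
  qed
qed

lemma chebyshev_poly: "\<exists>P. degree P \<le> k \<and> (\<forall>t. cos (real k * t) = poly P (cos t))"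
proof (induction k rule: less_induct)
  case (less k)
  show ?case
  proof (cases "k < 2")
    case True
    then consider "k = 0" | "k = 1" by linarith
    then show ?thesis
    proof cases
      case 1 then show ?thesis by (intro exI[of _ 1]) simp
    next
      case 2 then show ?thesis by (intro exI[of _ "[:0, 1:]"]) simp
    qed
  next
    case False
    then obtain l where l: "k = Suc (Suc l)" by (metis add_2_eq_Suc le_Suc_ex not_less)
    obtain P Q where P: "degree P \<le> Suc l" "\<And>t. cos (real (Suc l) * t) = poly P (cos t)"
      and Q: "degree Q \<le> l" "\<And>t. cos (real l * t) = poly Q (cos t)"
      using less.IH[of "Suc l"] less.IH[of l] l by auto
    have eq: "cos (real k * t) = 2 * cos t * cos (real (Suc l) * t) - cos (real l * t)" for t
    proof -
      have "real k * t = real (Suc l) * t + t" "real l * t = real (Suc l) * t - t" by (simp_all add: l algebra_simps)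
      then show ?thesis by (simp only: cos_add cos_diff) simp
    qed
    have "degree (smult 2 (pCons 0 P) - Q) \<le> k"
      using P(1) Q(1) l by (intro degree_diff_le order.trans[OF degree_smult_le] order.trans[OF degree_pCons_le]) auto
    moreover have "cos (real k * t) = poly (smult 2 (pCons 0 P) - Q) (cos t)" for t
      unfolding eq P(2) Q(2) by simp
    ultimately show ?thesis by blast
  qed
qed

lemma poly_of_cos_poly:
  assumes "cos_poly N g"
  shows "\<exists>P. degree P \<le> N \<and> (\<forall>t. g t = poly P (cos t))"
proof -
  obtain a where a: "\<And>t. g t = (\<Sum>k\<le>N. a k * cos (real k * t))" using assms unfolding cos_poly_def by blast
  obtain T where T: "\<And>k. degree (T k) \<le> k" "\<And>k t. cos (real k * t) = poly (T k) (cos t)"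
    using chebyshev_poly by metis
  have "degree (\<Sum>k\<le>N. smult (a k) (T k)) \<le> N"
    using T(1) by (intro degree_sum_le) (auto intro: order.trans[OF degree_smult_le] order.trans)
  moreover have "g t = poly (\<Sum>k\<le>N. smult (a k) (T k)) (cos t)" for t
    by (simp add: a T(2) poly_sum)
  ultimately show ?thesis by blast
qed

lemma cos_poly_iff: "cos_poly N g \<longleftrightarrow> (\<exists>P. degree P \<le> N \<and> (\<forall>t. g t = poly P (cos t)))"
proof
  assume "\<exists>P. degree P \<le> N \<and> (\<forall>t. g t = poly P (cos t))"
  then obtain P where "degree P \<le> N" "g = (\<lambda>t. poly P (cos t))" by auto
  then show "cos_poly N g" by (simp add: cos_poly_of_poly)
qed (rule poly_of_cos_poly)

lemma cos_poly_mult: "cos_poly N f \<Longrightarrow> cos_poly N' g \<Longrightarrow> cos_poly (N + N') (\<lambda>t. f t * g t)"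
  unfolding cos_poly_iff
proof (elim exE conjE)
  fix P Q assume "degree P \<le> N" "\<forall>t. f t = poly P (cos t)" "degree Q \<le> N'" "\<forall>t. g t = poly Q (cos t)"
  then show "\<exists>R. degree R \<le> N + N' \<and> (\<forall>t. f t * g t = poly R (cos t))"
    by (intro exI[of _ "P * Q"]) (auto intro: order.trans[OF degree_mult_le])
qed

lemma cos_poly_power: "cos_poly N f \<Longrightarrow> cos_poly (l * N) (\<lambda>t. f t ^ l)"
proof (induction l)
  case 0
  then show ?case using cos_poly_cos[of 0 0] by simp
next
  case (Suc l)
  then show ?case using cos_poly_mult[of N f "l * N" "\<lambda>t. f t ^ l"] by simp
qed

lemma cos_poly_fejer: "cos_poly M (fejer M)"
proof -
  have d: "cos_poly M (\<lambda>t. 1 + (\<Sum>j=1..k. 2 * cos (real j * t)))" if "k < M" for k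
    using that cos_poly_cos[of 0 M] by (intro cos_poly_add cos_poly_sum cos_poly_cmult cos_poly_cos) auto
  have "cos_poly M (\<lambda>t. 1 / (real M)\<^sup>2 * (\<Sum>k<M. 1 + (\<Sum>j=1..k. 2 * cos (real j * t))))"
    using d by (intro cos_poly_cmult cos_poly_sum) auto
  moreover have "(\<lambda>t. 1 / (real M)\<^sup>2 * (\<Sum>k<M. 1 + (\<Sum>j=1..k. 2 * cos (real j * t)))) = fejer M"
    by (simp add: fejer_def[abs_def] dirichlet_def sum_distrib_left[symmetric])
  ultimately show ?thesis by simp
qed

text \<open>A single translate of an even function is not even; the opposite translate cancels the
  sine terms.\<close>

lemma cos_poly_translates: "cos_poly N g \<Longrightarrow> cos_poly N (\<lambda>t. g (t - \<theta>) + g (t + \<theta>))"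
proof -
  assume "cos_poly N g"
  then obtain a where a: "\<And>t. g t = (\<Sum>k\<le>N. a k * cos (real k * t))" unfolding cos_poly_def by blast
  have "g (t - \<theta>) + g (t + \<theta>) = (\<Sum>k\<le>N. (2 * a k * cos (real k * \<theta>)) * cos (real k * t))" for t
  proof -
    have "a k * cos (real k * (t - \<theta>)) + a k * cos (real k * (t + \<theta>)) = (2 * a k * cos (real k * \<theta>)) * cos (real k * t)" for k
      by (simp add: algebra_simps cos_add cos_diff)
    then show ?thesis by (simp add: a sum.distrib[symmetric])
  qed
  then show ?thesis unfolding cos_poly_def by (intro exI[of _ "\<lambda>k. 2 * a k * cos (real k * \<theta>)"]) simp
qed

section \<open>Cosine coefficients and Nikolskii type inequalities\<close>

lemma has_integral_cos_int: "((\<lambda>t. cos (of_int m * t)) has_integral (if m = 0 then pi else 0)) {0..pi}"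
proof (cases "m = 0")
  case True
  then show ?thesis using has_integral_const_real[of "1::real" 0 pi] by simp
next
  case False
  have "((\<lambda>t. cos (of_int m * t)) has_integral sin (of_int m * pi) / of_int m - sin (of_int m * 0) / of_int m) {0..pi}"
    by (rule fundamental_theorem_of_calculus)
       (use False in \<open>auto intro!: derivative_eq_intros simp flip: has_real_derivative_iff_has_vector_derivative\<close>)
  moreover have "sin (of_int m * pi) = 0" by (simp add: sin_zero_iff_int2)
  ultimately show ?thesis using False by simp
qed

lemma has_integral_cos_cos:
  "((\<lambda>t. cos (real j * t) * cos (real k * t)) has_integral (if j = k then if k = 0 then pi else pi / 2 else 0)) {0..pi}"
proof -
  have "((\<lambda>t. 1/2 * cos (of_int (int j - int k) * t) + 1/2 * cos (of_int (int j + int k) * t)) has_integral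
     (1/2 * (if int j - int k = 0 then pi else 0) + 1/2 * (if int j + int k = 0 then pi else 0))) {0..pi}"
    by (intro has_integral_add has_integral_mult_right has_integral_cos_int)
  moreover have "1/2 * cos (of_int (int j - int k) * t) + 1/2 * cos (of_int (int j + int k) * t) = cos (real j * t) * cos (real k * t)" for t :: real
    by (simp add: left_diff_distrib distrib_right cos_add cos_diff add_divide_distrib diff_divide_distrib)
  moreover have "1/2 * (if int j - int k = 0 then pi else 0) + 1/2 * (if int j + int k = 0 then pi else 0) =
      (if j = k then if k = 0 then pi else pi / 2 else 0)"
    by auto
  ultimately show ?thesis by (simp only:)
qed

lemma cos_coeff_bound:
  assumes g: "\<And>t. g t = (\<Sum>k\<le>N. a k * cos (real k * t))" and k: "k \<le> N"
  shows "\<bar>a k\<bar> \<le> 2 / pi * integral {0..pi} (\<lambda>t. \<bar>g t\<bar>)"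
proof -
  have cont: "continuous_on A g" for A unfolding g by (intro continuous_intros)
  have "((\<lambda>t. \<Sum>j\<le>N. a j * (cos (real j * t) * cos (real k * t))) has_integral 
     (\<Sum>j\<le>N. a j * (if j = k then if k = 0 then pi else pi / 2 else 0))) {0..pi}"
    by (intro has_integral_sum has_integral_mult_right has_integral_cos_cos) auto
  also have "(\<lambda>t. \<Sum>j\<le>N. a j * (cos (real j * t) * cos (real k * t))) = (\<lambda>t. g t * cos (real k * t))"
    by (simp add: g sum_distrib_right mult.assoc)
  also have "(\<Sum>j\<le>N. a j * (if j = k then if k = 0 then pi else pi / 2 else 0)) = a k * (if k = 0 then pi else pi / 2)"
    using k by (simp add: if_distrib[of "\<lambda>x. _ * x"] cong: if_cong)
  finally have I: "integral {0..pi} (\<lambda>t. g t * cos (real k * t)) = a k * (if k = 0 then pi else pi / 2)"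
    by (rule integral_unique)
  have "norm (integral {0..pi} (\<lambda>t. g t * cos (real k * t))) \<le> integral {0..pi} (\<lambda>t. \<bar>g t\<bar>)"
  proof (rule integral_norm_bound_integral)
    fix t assume "t \<in> {0..pi}"
    have "\<bar>g t\<bar> * \<bar>cos (real k * t)\<bar> \<le> \<bar>g t\<bar> * 1" by (intro mult_left_mono) auto
    then show "norm (g t * cos (real k * t)) \<le> \<bar>g t\<bar>" by (simp add: abs_mult)
  qed (auto intro!: integrable_continuous_real continuous_intros cont)
  moreover have "\<bar>a k\<bar> * (pi / 2) \<le> \<bar>a k * (if k = 0 then pi else pi / 2)\<bar>" by (auto simp: abs_mult)
  ultimately show ?thesis unfolding I by (simp add: field_simps)
qed

text \<open>All N + 1 coefficients are bounded by the L_1 norm on [0, \<pi>], and each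
  differentiated term gains a factor at most N. The second bound concerns the derivative in t, hence
  the factor sin t.\<close>

lemma cos_poly_sup_bounds:
  assumes G: "degree G \<le> N"
  defines "I \<equiv> integral {0..pi} (\<lambda>t. \<bar>poly G (cos t)\<bar>)"
  shows "\<bar>poly G (cos t)\<bar> \<le> (real N + 1) * (2 / pi) * I"
    and "\<bar>sin t * poly (pderiv G) (cos t)\<bar> \<le> real N * ((real N + 1) * (2 / pi) * I)"
proof -
  obtain a where a: "\<And>t. poly G (cos t) = (\<Sum>k\<le>N. a k * cos (real k * t))"
    using cos_poly_of_poly[OF G] unfolding cos_poly_def by blast
  have ak: "\<bar>a k\<bar> \<le> 2 / pi * I" if "k \<le> N" for k
    unfolding I_def by (rule cos_coeff_bound[OF a that])
  have "\<bar>poly G (cos t)\<bar> \<le> (\<Sum>k\<le>N. 2 / pi * I)"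
    unfolding a
  proof (intro order.trans[OF sum_abs] sum_mono)
    fix k assume "k \<in> {..N}"
    then have "\<bar>a k\<bar> * \<bar>cos (real k * t)\<bar> \<le> 2 / pi * I * 1" by (intro mult_mono ak) (use ak[of k] in auto)
    then show "\<bar>a k * cos (real k * t)\<bar> \<le> 2 / pi * I" by (simp add: abs_mult)
  qed
  then show "\<bar>poly G (cos t)\<bar> \<le> (real N + 1) * (2 / pi) * I" by (simp add: algebra_simps)
  have "((\<lambda>t. poly G (cos t)) has_real_derivative (\<Sum>k\<le>N. a k * (- sin (real k * t) * real k))) (at t)"
    unfolding a by (auto intro!: derivative_eq_intros sum.cong)
  moreover have "((\<lambda>t. poly G (cos t)) has_real_derivative poly (pderiv G) (cos t) * (- sin t)) (at t)"
    by (rule DERIV_chain2[OF poly_DERIV DERIV_cos])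
  ultimately have "poly (pderiv G) (cos t) * (- sin t) = (\<Sum>k\<le>N. a k * (- sin (real k * t) * real k))" by (rule DERIV_unique[symmetric])
  then have "\<bar>sin t * poly (pderiv G) (cos t)\<bar> = \<bar>\<Sum>k\<le>N. a k * (- sin (real k * t) * real k)\<bar>"
    by (metis abs_minus_cancel mult.commute mult_minus_right)
  also have "\<dots> \<le> (\<Sum>k\<le>N. 2 / pi * I * real N)"
  proof (intro order.trans[OF sum_abs] sum_mono)
    fix k assume k: "k \<in> {..N}"
    then have I: "0 \<le> 2 / pi * I" using ak[of k] by auto
    have "\<bar>sin (real k * t)\<bar> * real k \<le> 1 * real N" using k by (intro mult_mono) auto
    then have "\<bar>a k\<bar> * (\<bar>sin (real k * t)\<bar> * real k) \<le> 2 / pi * I * (1 * real N)" using k I by (intro mult_mono ak) auto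
    then show "\<bar>a k * (- sin (real k * t) * real k)\<bar> \<le> 2 / pi * I * real N" by (simp add: abs_mult)
  qed
  finally show "\<bar>sin t * poly (pderiv G) (cos t)\<bar> \<le> real N * ((real N + 1) * (2 / pi) * I)" by (simp add: algebra_simps)
qed

text \<open>Two absorptions. The omitted ends carry at most 2 \<eta> S, where S is the maximum;
  since S is at most (2/\<pi>)(N + 1) I, the choice of \<eta> makes this at most I/\<pi>, less than
  half of I. Then |g| <= S^(1-p) |g|^p passes from L_1 to p-th powers, and S^(1-p) is cancelled
  against S.\<close>

lemma nikolskii:
  assumes G: "degree G \<le> N" and p: "0 < p" "p \<le> 1"
  defines "\<eta> \<equiv> 1 / (4 * (real N + 1))"
  defines "J \<equiv> integral {\<eta>..pi - \<eta>} (\<lambda>t. \<bar>poly G (cos t)\<bar> powr p)"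
  shows "\<bar>poly G (cos t)\<bar> powr p \<le> 2 * (real N + 1) * J"
    and "\<bar>sin t * poly (pderiv G) (cos t)\<bar> powr p \<le> real N powr p * (2 * (real N + 1) * J)"
proof -
  let ?g = "\<lambda>t. poly G (cos t)" and ?N = "real N + 1"
  define I where "I = integral {0..pi} (\<lambda>t. \<bar>?g t\<bar>)"
  define I' where "I' = integral {\<eta>..pi - \<eta>} (\<lambda>t. \<bar>?g t\<bar>)"
  have N: "1 \<le> ?N" by simp
  have \<eta>: "0 < \<eta>" "\<eta> \<le> 1 / 4" "4 * ?N * \<eta> = 1" by (auto simp: \<eta>_def field_simps)
  note pi3 = pi_gt3
  have cont: "continuous_on A (\<lambda>t. \<bar>?g t\<bar>)" for A by (intro continuous_intros)
  have int: "(\<lambda>t. \<bar>?g t\<bar>) integrable_on {a..b}" for a b by (intro integrable_continuous_real cont)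
  have contp: "continuous_on A (\<lambda>t. \<bar>?g t\<bar> powr p)" for A
    using p by (intro continuous_on_powr' cont continuous_intros) auto
  have intp: "(\<lambda>t. \<bar>?g t\<bar> powr p) integrable_on {a..b}" for a b by (intro integrable_continuous_real contp)
  \<comment> \<open>The maximum is attained, so S is a real number and S^(1-p) may be cancelled
    unless S = 0.\<close>
  have "\<exists>x\<in>{0..pi}. \<forall>y\<in>{0..pi}. \<bar>?g y\<bar> \<le> \<bar>?g x\<bar>"
    by (intro continuous_attains_sup cont) auto
  then obtain t0 where t0: "\<And>t. t \<in> {0..pi} \<Longrightarrow> \<bar>?g t\<bar> \<le> \<bar>?g t0\<bar>" by blast
  define S where "S = \<bar>?g t0\<bar>"
  have S0: "0 \<le> S" by (simp add: S_def)
  have S: "\<bar>?g t\<bar> \<le> S" for t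
    using t0[of "arccos (cos t)"] by (simp add: S_def arccos_lbound arccos_ubound)
  have S_I: "S \<le> ?N * (2 / pi) * I" unfolding S_def I_def by (rule cos_poly_sup_bounds[OF G])
  have I_split: "I = integral {0..\<eta>} (\<lambda>t. \<bar>?g t\<bar>) + I' + integral {pi - \<eta>..pi} (\<lambda>t. \<bar>?g t\<bar>)"
    unfolding I_def I'_def using \<eta> pi3
    by (simp add: Henstock_Kurzweil_Integration.integral_combine[OF _ _ int])
  have small: "integral {a..b} (\<lambda>t. \<bar>?g t\<bar>) \<le> S * (b - a)" if "a \<le> b" for a b
  proof -
    have "integral {a..b} (\<lambda>t. \<bar>?g t\<bar>) \<le> integral {a..b} (\<lambda>t. S)" using S by (intro integral_le int) auto
    then show ?thesis using that by (simp add: mult.commute)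
  qed
  have "I \<le> I' + 2 * \<eta> * S" using small[of 0 \<eta>] small[of "pi - \<eta>" pi] \<eta> unfolding I_split by (simp add: algebra_simps)
  also have "2 * \<eta> * S \<le> 2 * \<eta> * (?N * (2 / pi) * I)" using \<eta> S_I by (intro mult_left_mono) auto
  also have "\<dots> = (4 * ?N * \<eta>) * I / pi" by simp
  also have "\<dots> = I / pi" unfolding \<eta>(3) by simp
  finally have "I \<le> I' + I / pi" by simp
  moreover have I0: "0 \<le> I" unfolding I_def by (intro integral_nonneg int) auto
  then have "I / pi \<le> I / 2" using pi3 by (intro divide_left_mono) auto
  ultimately have II': "I \<le> 2 * I'" by linarith
  have I'J: "I' \<le> S powr (1 - p) * J"
  proof -
    have "I' \<le> integral {\<eta>..pi - \<eta>} (\<lambda>t. S powr (1 - p) * \<bar>?g t\<bar> powr p)"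
      unfolding I'_def
    proof (intro integral_le int integrable_on_mult_right intp)
      fix t
      have "\<bar>?g t\<bar> = \<bar>?g t\<bar> powr (1 - p) * \<bar>?g t\<bar> powr p" by (cases "?g t = 0") (simp_all flip: powr_add)
      also have "\<dots> \<le> S powr (1 - p) * \<bar>?g t\<bar> powr p" using S p by (intro mult_right_mono powr_mono2) auto
      finally show "\<bar>?g t\<bar> \<le> S powr (1 - p) * \<bar>?g t\<bar> powr p" .
    qed
    then show ?thesis by (simp add: J_def)
  qed
  have J0: "0 \<le> J" unfolding J_def by (intro integral_nonneg intp) auto
  define X where "X = 2 * ?N * J"
  have X0: "0 \<le> X" using J0 by (simp add: X_def)
  have c: "?N * (2 / pi) * I \<le> X * S powr (1 - p)"
  proof -
    have "?N * (2 / pi) * I \<le> ?N * (2 / pi) * (2 * (S powr (1 - p) * J))" using II' I'J by (intro mult_left_mono) auto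
    also have "\<dots> = X * S powr (1 - p) * (2 / pi)" by (simp add: X_def)
    also have "\<dots> \<le> X * S powr (1 - p) * 1" using X0 pi3 by (intro mult_left_mono) auto
    finally show ?thesis by simp
  qed
  have Sp: "S powr p \<le> X"
  proof (cases "S = 0")
    case False
    then have "S powr p * S powr (1 - p) = S" using S0 by (simp flip: powr_add)
    also have "S \<le> X * S powr (1 - p)" using S_I c by simp
    finally show ?thesis using False S0 by simp
  qed (use X0 p in simp)
  show "\<bar>poly G (cos t)\<bar> powr p \<le> 2 * (real N + 1) * J"
    using powr_mono2[of p "\<bar>?g t\<bar>" S] S[of t] Sp p unfolding X_def by auto
  have "\<bar>sin t * poly (pderiv G) (cos t)\<bar> \<le> real N * (?N * (2 / pi) * I)"
    unfolding I_def by (rule cos_poly_sup_bounds[OF G])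
  also have "\<dots> \<le> real N * (X * S powr (1 - p))" by (intro mult_left_mono c) auto
  also have "S powr (1 - p) \<le> X powr ((1 - p) / p)"
  proof -
    have "S powr (1 - p) = (S powr p) powr ((1 - p) / p)" using p by (simp add: powr_powr)
    also have "\<dots> \<le> X powr ((1 - p) / p)" using p Sp by (intro powr_mono2) auto
    finally show ?thesis .
  qed
  then have "real N * (X * S powr (1 - p)) \<le> real N * (X * X powr ((1 - p) / p))" using X0 by (intro mult_left_mono) auto
  also have "X * X powr ((1 - p) / p) = X powr (1 / p)"
  proof (cases "X = 0")
    case False
    then have "X * X powr ((1 - p) / p) = X powr (1 + (1 - p) / p)" using X0 by (simp add: powr_add)
    also have "1 + (1 - p) / p = 1 / p" using p by (simp add: field_simps)
    finally show ?thesis .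
  qed simp
  finally have "\<bar>sin t * poly (pderiv G) (cos t)\<bar> powr p \<le> (real N * X powr (1 / p)) powr p" using p by (intro powr_mono2) auto
  also have "\<dots> = real N powr p * X" using p X0 by (simp add: powr_mult powr_powr)
  finally show "\<bar>sin t * poly (pderiv G) (cos t)\<bar> powr p \<le> real N powr p * (2 * (real N + 1) * J)" by (simp add: X_def)
qed

lemma nikolskii_pp:
  assumes G: "degree G \<le> N" and p: "0 < p" "p \<le> 1" and N: "1 \<le> N"
    and \<eta>: "\<eta> \<le> 1 / (4 * (real N + 1))"
  defines "J \<equiv> \<integral>\<^sup>+\<tau>\<in>{\<eta>..pi - \<eta>}. pp p (poly G (cos \<tau>)) \<partial>lborel"
  shows "pp p (poly G (cos t)) \<le> ennreal (2 * (real N + 1)) * J"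
    and "pp p (sin t * poly (pderiv G) (cos t) / real N) \<le> ennreal (2 * (real N + 1)) * J"
proof -
  define \<eta>' where "\<eta>' = 1 / (4 * (real N + 1))"
  define J' where "J' = integral {\<eta>'..pi - \<eta>'} (\<lambda>t. \<bar>poly G (cos t)\<bar> powr p)"
  have contp: "continuous_on A (\<lambda>t. \<bar>poly G (cos t)\<bar> powr p)" for A
    using p by (intro continuous_on_powr' continuous_intros) auto
  then have intp: "(\<lambda>t. \<bar>poly G (cos t)\<bar> powr p) integrable_on {a..b}" for a b by (intro integrable_continuous_real)
  have "ennreal J' = (\<integral>\<^sup>+\<tau>\<in>{\<eta>'..pi - \<eta>'}. pp p (poly G (cos \<tau>)) \<partial>lborel)"
    unfolding J'_def pp_def
    by (rule nn_integral_has_integral_lebesgue'[symmetric]) (auto intro: integrable_integral intp)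
  also have "\<dots> \<le> J" unfolding J_def using \<eta> by (intro set_nn_integral_mono_set) (auto simp: \<eta>'_def)
  finally have J': "ennreal J' \<le> J" .
  have J'0: "0 \<le> J'" unfolding J'_def by (intro integral_nonneg intp) auto
  note nik = nikolskii[OF G p, folded \<eta>'_def, folded J'_def]
  have "pp p (poly G (cos t)) \<le> ennreal (2 * (real N + 1) * J')" unfolding pp_def by (intro ennreal_leI nik)
  also have "\<dots> = ennreal (2 * (real N + 1)) * ennreal J'" using J'0 by (simp add: ennreal_mult)
  also have "\<dots> \<le> ennreal (2 * (real N + 1)) * J" by (intro mult_left_mono J') auto
  finally show "pp p (poly G (cos t)) \<le> ennreal (2 * (real N + 1)) * J" .
  have "\<bar>sin t * poly (pderiv G) (cos t) / real N\<bar> powr p = \<bar>sin t * poly (pderiv G) (cos t)\<bar> powr p / real N powr p"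
    using N by (simp add: abs_divide powr_divide)
  also have "\<dots> \<le> 2 * (real N + 1) * J'"
    using nik(2)[of t] N by (simp add: pos_divide_le_eq mult_ac)
  finally have "pp p (sin t * poly (pderiv G) (cos t) / real N) \<le> ennreal (2 * (real N + 1) * J')"
    unfolding pp_def by (rule ennreal_leI)
  also have "\<dots> = ennreal (2 * (real N + 1)) * ennreal J'" using J'0 by (simp add: ennreal_mult)
  also have "\<dots> \<le> ennreal (2 * (real N + 1)) * J" by (intro mult_left_mono J') auto
  finally show "pp p (sin t * poly (pderiv G) (cos t) / real N) \<le> ennreal (2 * (real N + 1)) * J" .
qed

text \<open>The opposite translate peaks at -\<theta>, outside the range of \<tau>: modulo 2\<pi>
  the distance of \<tau> + \<theta> from 0 is at least |\<tau> - \<theta>|, so it decays at least as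
  fast.\<close>

lemma fejer_power_translates:
  assumes M: "1 \<le> M" and \<theta>: "\<theta> \<in> {0..pi}" and \<tau>: "\<tau> \<in> {0..pi}"
  shows "fejer M (\<tau> - \<theta>) ^ l + fejer M (\<tau> + \<theta>) ^ l \<le> 2 * fc ^ l / (1 + (real M * (\<tau> - \<theta>))\<^sup>2) ^ l"
    and "0 \<le> fejer M (\<tau> - \<theta>) ^ l + fejer M (\<tau> + \<theta>) ^ l"
proof -
  let ?D = "1 + (real M * (\<tau> - \<theta>))\<^sup>2"
  have D: "0 < ?D" by (simp add: add_pos_nonneg)
  have 1: "fejer M (\<tau> - \<theta>) \<le> fc / ?D" using \<theta> \<tau> by (intro fejer_decay M) auto
  have 2: "fejer M (\<tau> + \<theta>) \<le> fc / ?D"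
  proof -
    define t where "t = (if \<tau> + \<theta> \<le> pi then \<tau> + \<theta> else 2 * pi - (\<tau> + \<theta>))"
    have eq: "fejer M (\<tau> + \<theta>) = fejer M t" by (simp add: t_def fejer_periodic)
    have t: "0 \<le> t" "t \<le> pi" "\<bar>\<tau> - \<theta>\<bar> \<le> t" using \<theta> \<tau> by (auto simp: t_def)
    have "fejer M t \<le> fc / (1 + (real M * t)\<^sup>2)" using t by (intro fejer_decay M) auto
    also have "\<dots> \<le> fc / ?D"
    proof (intro divide_left_mono)
      have "(real M * \<bar>\<tau> - \<theta>\<bar>)\<^sup>2 \<le> (real M * t)\<^sup>2" using t by (intro power_mono mult_left_mono) auto
      then show "?D \<le> 1 + (real M * t)\<^sup>2" by (simp add: power_mult_distrib)
    qed (use D fc_ge_1 in \<open>auto intro!: mult_pos_pos add_pos_nonneg\<close>)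
    finally show ?thesis unfolding eq .
  qed
  have "fejer M (\<tau> - \<theta>) ^ l + fejer M (\<tau> + \<theta>) ^ l \<le> (fc / ?D) ^ l + (fc / ?D) ^ l"
    by (intro add_mono power_mono 1 2 fejer_nonneg M)
  then show "fejer M (\<tau> - \<theta>) ^ l + fejer M (\<tau> + \<theta>) ^ l \<le> 2 * fc ^ l / ?D ^ l" by (simp add: power_divide)
  show "0 \<le> fejer M (\<tau> - \<theta>) ^ l + fejer M (\<tau> + \<theta>) ^ l" by (intro add_nonneg_nonneg zero_le_power fejer_nonneg M)
qed

text \<open>To localise at \<theta>, multiply Q by the even kernel k made of powers of
  \<open>fejer\<close> moved to \<theta> and -\<theta>. The product is a polynomial G in the cosine
  of degree O(m), so the Nikolskii bounds apply to G and the decay of k appears under the integral.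
  At \<theta> one has k >= 1, and the derivative of Q is recovered from those of G and k by the
  product rule.\<close>

lemma local_bounds:
  assumes p: "0 < p" "p \<le> 1"
  shows "\<exists>C>0. \<exists>c>0. c \<le> 1 \<and> (\<forall>m Q. \<forall>\<theta>\<in>{0..pi}. 1 \<le> m \<longrightarrow> degree Q \<le> m \<longrightarrow>
    (let J = \<integral>\<^sup>+\<tau>\<in>{c / real m..pi - c / real m}. pp p (poly Q (cos \<tau>)) * ennreal (1 / (1 + (real m * (\<tau> - \<theta>))\<^sup>2) ^ d) \<partial>lborel
     in pp p (poly Q (cos \<theta>)) \<le> ennreal (C * real m) * J \<and>
        pp p (sin \<theta> * poly (pderiv Q) (cos \<theta>) / real m) \<le> ennreal (C * real m) * J))"
proof -
  obtain l :: nat where l0: "real d / p \<le> real l" using real_arch_simple by blast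
  \<comment> \<open>The p-th power of the kernel decays with exponent L p, which has to be at least
    d. \<open>Suc\<close> keeps L positive also when d = 0.\<close>
  define L where "L = Suc l"
  have L: "1 \<le> L" "real d \<le> real L * p"
  proof -
    have "real d \<le> real l * p" using l0 p by (simp add: pos_divide_le_eq)
    also have "\<dots> \<le> real L * p" using p by (simp add: L_def)
    finally show "real d \<le> real L * p" .
  qed (simp add: L_def)
  define K where "K = real (Suc L)"
  have K: "2 \<le> K" using L by (simp add: K_def)
  define C where "C = (4 * K * (2 * fc ^ L)) * (K + 2 * real L)"
  \<comment> \<open>G has degree N = K m, and 4 (N + 1) <= 8 K m, so the interval kept here contains
    the one kept by \<open>nikolskii\<close>.\<close>
  define c where "c = 1 / (8 * K)"
  have fcL: "1 \<le> fc ^ L" using fc_ge_1 by (rule one_le_power)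
  have C0: "0 < C" unfolding C_def using K fcL L by (intro mult_pos_pos add_pos_nonneg) auto
  have c0: "0 < c" "c \<le> 1" using K by (auto simp: c_def divide_le_eq)
  have main: "let J = \<integral>\<^sup>+\<tau>\<in>{c / real m..pi - c / real m}. pp p (poly Q (cos \<tau>)) * ennreal (1 / (1 + (real m * (\<tau> - \<theta>))\<^sup>2) ^ d) \<partial>lborel
     in pp p (poly Q (cos \<theta>)) \<le> ennreal (C * real m) * J \<and>
        pp p (sin \<theta> * poly (pderiv Q) (cos \<theta>) / real m) \<le> ennreal (C * real m) * J"
    if \<theta>: "\<theta> \<in> {0..pi}" and m: "1 \<le> m" and Q: "degree Q \<le> m" for m :: nat and Q :: "real poly" and \<theta>
  proof -
    define J where "J = (\<integral>\<^sup>+\<tau>\<in>{c / real m..pi - c / real m}. pp p (poly Q (cos \<tau>)) * ennreal (1 / (1 + (real m * (\<tau> - \<theta>))\<^sup>2) ^ d) \<partial>lborel)"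
    define k where "k \<tau> = fejer m (\<tau> - \<theta>) ^ L + fejer m (\<tau> + \<theta>) ^ L" for \<tau>
    define N where "N = m + L * m"
    have N: "real N = K * real m" by (simp add: N_def K_def algebra_simps)
    have "cos_poly N (\<lambda>\<tau>. poly Q (cos \<tau>) * k \<tau>)"
      unfolding N_def k_def by (intro cos_poly_mult cos_poly_of_poly Q cos_poly_translates[of _ "\<lambda>t. fejer m t ^ L"] cos_poly_power cos_poly_fejer)
    then obtain G where G: "degree G \<le> N" and polyG: "\<And>\<tau>. poly Q (cos \<tau>) * k \<tau> = poly G (cos \<tau>)"
      unfolding cos_poly_iff by blast
    have "1 * 1 \<le> K * real m" using K m by (intro mult_mono) auto
    then have km: "1 \<le> K * real m" by simp
    have ksum: "(\<integral>\<^sup>+\<tau>\<in>{c / real m..pi - c / real m}. pp p (poly G (cos \<tau>)) \<partial>lborel) \<le> ennreal (2 * fc ^ L) * J"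
    proof -
      have "(\<integral>\<^sup>+\<tau>\<in>{c / real m..pi - c / real m}. pp p (poly G (cos \<tau>)) \<partial>lborel) \<le>
        (\<integral>\<^sup>+\<tau>\<in>{c / real m..pi - c / real m}. ennreal (2 * fc ^ L) * (pp p (poly Q (cos \<tau>)) * ennreal (1 / (1 + (real m * (\<tau> - \<theta>))\<^sup>2) ^ d)) \<partial>lborel)"
      proof (intro set_nn_integral_mono)
        fix \<tau> assume "\<tau> \<in> {c / real m..pi - c / real m}"
        moreover have "0 \<le> c / real m" using c0(1) by simp
        ultimately have \<tau>: "\<tau> \<in> {0..pi}" by auto
        let ?D = "1 + (real m * (\<tau> - \<theta>))\<^sup>2"
        have D: "1 \<le> ?D" by simp
        have D0: "0 < ?D" by (rule less_le_trans[OF zero_less_one D])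
        have "\<bar>k \<tau>\<bar> powr p \<le> (2 * fc ^ L / ?D ^ L) powr p"
          using fejer_power_translates[OF m \<theta> \<tau>, of L] p by (intro powr_mono2) (auto simp: k_def)
        also have "\<dots> = (2 * fc ^ L) powr p / (?D ^ L) powr p" using fcL D by (simp add: powr_divide)
        also have "\<dots> \<le> (2 * fc ^ L) powr 1 / ?D ^ d"
        proof (intro frac_le powr_mono)
          have "?D ^ d = ?D powr real d" by (rule powr_realpow[OF D0, symmetric])
          also have "\<dots> \<le> ?D powr (real L * p)" using L D by (intro powr_mono) auto
          also have "\<dots> = (?D powr real L) powr p" by (simp add: powr_powr)
          also have "?D powr real L = ?D ^ L" by (rule powr_realpow[OF D0])
          finally show "?D ^ d \<le> (?D ^ L) powr p" .
        qed (use p fcL zero_less_power[OF D0, of d] in auto)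
        finally have "pp p (k \<tau>) \<le> ennreal (2 * fc ^ L * (1 / ?D ^ d))" using fcL by (simp add: pp_def ennreal_leI)
        also have "\<dots> = ennreal (2 * fc ^ L) * ennreal (1 / ?D ^ d)" using fcL D by (intro ennreal_mult) auto
        finally have "pp p (poly Q (cos \<tau>)) * pp p (k \<tau>) \<le> pp p (poly Q (cos \<tau>)) * (ennreal (2 * fc ^ L) * ennreal (1 / ?D ^ d))"
          by (intro mult_left_mono) auto
        then show "pp p (poly G (cos \<tau>)) \<le> ennreal (2 * fc ^ L) * (pp p (poly Q (cos \<tau>)) * ennreal (1 / ?D ^ d))"
          unfolding polyG[symmetric] pp_mult by (simp add: mult_ac)
      qed
      also have "\<dots> = ennreal (2 * fc ^ L) * J" unfolding J_def by (simp add: mult.assoc nn_integral_cmult)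
      finally show ?thesis .
    qed
    have \<eta>: "c / real m \<le> 1 / (4 * (real N + 1))"
    proof -
      have "4 * (real N + 1) \<le> 8 * K * real m" using km N by simp
      then have "1 / (8 * K * real m) \<le> 1 / (4 * (real N + 1))" by (intro divide_left_mono mult_pos_pos) (use km K m in auto)
      then show ?thesis by (simp add: c_def)
    qed
    define X where "X = ennreal (4 * K * (2 * fc ^ L) * real m) * J"
    have "ennreal (2 * (real N + 1)) * (\<integral>\<^sup>+\<tau>\<in>{c / real m..pi - c / real m}. pp p (poly G (cos \<tau>)) \<partial>lborel)
       \<le> ennreal (4 * (K * real m)) * (ennreal (2 * fc ^ L) * J)"
    proof (rule mult_mono[OF _ ksum])
      show "ennreal (2 * (real N + 1)) \<le> ennreal (4 * (K * real m))" 
      proof (rule ennreal_leI)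
        have "2 * (x + 1) \<le> 4 * x" if "1 \<le> x" for x :: real using that by simp
        from this[OF km] show "2 * (real N + 1) \<le> 4 * (K * real m)" unfolding N .
      qed
    qed auto
    also have "\<dots> = X" using K fcL unfolding X_def by (simp add: mult.assoc[symmetric] ennreal_mult[symmetric]) (simp add: mult_ac)
    finally have X: "ennreal (2 * (real N + 1)) * (\<integral>\<^sup>+\<tau>\<in>{c / real m..pi - c / real m}. pp p (poly G (cos \<tau>)) \<partial>lborel) \<le> X" .
    have N1: "1 \<le> N" using m by (simp add: N_def)
    note nik = nikolskii_pp[OF G p N1 \<eta>]
    \<comment> \<open>The translate centred at \<theta> equals 1 there and the other is
      nonnegative.\<close>
    have k\<theta>: "1 \<le> k \<theta>" using fejer_nonneg[OF m] by (simp add: k_def fejer_0[OF m])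
    have ge: "\<bar>z\<bar> \<le> \<bar>z * k \<theta>\<bar>" for z
      using k\<theta> mult_left_mono[OF k\<theta>, of "\<bar>z\<bar>"] by (simp add: abs_mult)
    have pQ: "pp p (poly Q (cos \<theta>)) \<le> X"
    proof -
      have "pp p (poly Q (cos \<theta>)) \<le> pp p (poly G (cos \<theta>))" unfolding polyG[symmetric] using p
        by (intro pp_mono ge) auto
      also have "\<dots> \<le> X" by (rule order.trans[OF nik(1) X])
      finally show ?thesis .
    qed
    have pG': "pp p (sin \<theta> * poly (pderiv G) (cos \<theta>) / real m) \<le> ennreal K * X"
    proof -
      have "sin \<theta> * poly (pderiv G) (cos \<theta>) / real m = K * (sin \<theta> * poly (pderiv G) (cos \<theta>) / real N)"
        using N K by simp
      then have "pp p (sin \<theta> * poly (pderiv G) (cos \<theta>) / real m) = pp p K * pp p (sin \<theta> * poly (pderiv G) (cos \<theta>) / real N)"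
        by (simp only: pp_mult)
      also have "\<dots> \<le> ennreal K * X"
      proof (intro mult_mono order.trans[OF nik(2) X])
        have "K powr p \<le> K powr 1" using K p by (intro powr_mono) auto
        then show "pp p K \<le> ennreal K" using K by (simp add: pp_def ennreal_leI)
      qed auto
      finally show ?thesis .
    qed
    \<comment> \<open>The translate centred at \<theta> has derivative 0 at its peak, so only the
      opposite one contributes, at the argument 2 \<theta>.\<close>
    define k' where "k' = real L * fejer m (2 * \<theta>) ^ (L - 1) * fejer' m (2 * \<theta>)"
    have k'_le: "\<bar>k'\<bar> \<le> 2 * real L * real m"
    proof -
      have "\<bar>fejer m (2 * \<theta>) ^ (L - 1)\<bar> \<le> 1" unfolding power_abs using fejer_le_1 by (intro power_le_one) auto
      then have "real L * (\<bar>fejer m (2 * \<theta>) ^ (L - 1)\<bar> * \<bar>fejer' m (2 * \<theta>)\<bar>) \<le> real L * (1 * (2 * real m))"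
        by (intro mult_left_mono mult_mono fejer'_bound m) auto
      then show ?thesis by (simp add: k'_def abs_mult mult_ac)
    qed
    have kder: "(k has_real_derivative k') (at \<theta>)"
    proof -
      have d: "((\<lambda>t. fejer m t ^ L) has_real_derivative real L * (fejer' m t * fejer m t ^ (L - Suc 0))) (at t)" for t
        by (rule DERIV_power[OF fejer_deriv])
      have "((\<lambda>\<tau>. fejer m (\<tau> + (- \<theta>)) ^ L + fejer m (\<tau> + \<theta>) ^ L) has_real_derivative
        (real L * (fejer' m (\<theta> + (- \<theta>)) * fejer m (\<theta> + (- \<theta>)) ^ (L - Suc 0)) + real L * (fejer' m (\<theta> + \<theta>) * fejer m (\<theta> + \<theta>) ^ (L - Suc 0)))) (at \<theta>)"
        by (intro DERIV_add iffD1[OF DERIV_shift] d)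
      then show ?thesis by (simp add: k_def[abs_def] k'_def fejer'_0 mult_ac)
    qed
    have "((\<lambda>t. poly Q (cos t) * k t) has_real_derivative (poly (pderiv Q) (cos \<theta>) * (- sin \<theta>)) * k \<theta> + k' * poly Q (cos \<theta>)) (at \<theta>)"
      by (rule DERIV_mult[OF DERIV_chain2[OF poly_DERIV DERIV_cos] kder])
    moreover have "((\<lambda>t. poly Q (cos t) * k t) has_real_derivative poly (pderiv G) (cos \<theta>) * (- sin \<theta>)) (at \<theta>)"
      unfolding polyG by (rule DERIV_chain2[OF poly_DERIV DERIV_cos])
    ultimately have "(poly (pderiv Q) (cos \<theta>) * (- sin \<theta>)) * k \<theta> + k' * poly Q (cos \<theta>) = poly (pderiv G) (cos \<theta>) * (- sin \<theta>)"
      by (rule DERIV_unique)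
    then have eq: "(sin \<theta> * poly (pderiv Q) (cos \<theta>) / real m) * k \<theta> = sin \<theta> * poly (pderiv G) (cos \<theta>) / real m + (k' / real m) * poly Q (cos \<theta>)"
      by (simp add: algebra_simps add_divide_distrib[symmetric])
    have "pp p (sin \<theta> * poly (pderiv Q) (cos \<theta>) / real m) \<le> pp p ((sin \<theta> * poly (pderiv Q) (cos \<theta>) / real m) * k \<theta>)"
      using p by (intro pp_mono ge) auto
    also have "\<dots> \<le> pp p (sin \<theta> * poly (pderiv G) (cos \<theta>) / real m) + pp p (k' / real m) * pp p (poly Q (cos \<theta>))"
      unfolding eq pp_mult[symmetric] by (rule pp_add[OF p])
    also have "\<dots> \<le> ennreal K * X + ennreal (2 * real L) * X"
    proof (intro add_mono mult_mono pG' pQ)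
      have "\<bar>k' / real m\<bar> powr p \<le> (2 * real L) powr p" using k'_le m p by (intro powr_mono2) (auto simp: abs_divide divide_le_eq)
      also have "\<dots> \<le> (2 * real L) powr 1" using L p by (intro powr_mono) auto
      finally show "pp p (k' / real m) \<le> ennreal (2 * real L)" by (simp add: pp_def ennreal_leI)
    qed auto
    also have "\<dots> = ennreal (C * real m) * J"
    proof -
      have "ennreal K * X + ennreal (2 * real L) * X = ennreal (K + 2 * real L) * X" using K by (simp add: ennreal_plus distrib_right)
      also have "\<dots> = ennreal ((K + 2 * real L) * (4 * K * (2 * fc ^ L) * real m)) * J"
        using K fcL unfolding X_def by (subst ennreal_mult) (auto simp: mult.assoc)
      also have "(K + 2 * real L) * (4 * K * (2 * fc ^ L) * real m) = C * real m" by (simp only: C_def mult_ac)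
      finally show ?thesis .
    qed
    finally have pQ': "pp p (sin \<theta> * poly (pderiv Q) (cos \<theta>) / real m) \<le> ennreal (C * real m) * J" .
    have "X \<le> ennreal (C * real m) * J"
    proof -
      have "(4 * K * (2 * fc ^ L)) * 1 \<le> (4 * K * (2 * fc ^ L)) * (K + 2 * real L)"
        using K fcL by (intro mult_left_mono) auto
      then have "4 * K * (2 * fc ^ L) * real m \<le> C * real m" unfolding C_def
        by (intro mult_right_mono) simp_all
      from mult_right_mono[OF ennreal_leI[OF this], of J] show ?thesis unfolding X_def by simp
    qed
    with pQ pQ' show ?thesis
      unfolding J_def[symmetric] Let_def by (intro conjI order.trans[OF pQ])
  qed
  show ?thesis
    by (rule exI[of _ C], rule conjI[OF C0], rule exI[of _ c], intro conjI c0 allI ballI impI main)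
qed

section \<open>Slowly varying weights and the Bernstein inequality\<close>

text \<open>B and s are separate arguments so that they can be kept independent of the degree m. The
  growth is measured in powers of 1 + (m t)^2 because the Fejer kernel decays in the same
  quantity.\<close>

definition slow :: "real \<Rightarrow> nat \<Rightarrow> nat \<Rightarrow> (real \<Rightarrow> real) \<Rightarrow> bool" where
  "slow B s m V \<longleftrightarrow> V \<in> borel_measurable borel \<and> (\<forall>\<theta>\<in>{0..pi}. 0 \<le> V \<theta>) \<and>
     (\<forall>\<theta>\<in>{0..pi}. \<forall>\<tau>\<in>{0..pi}. V \<theta> \<le> B * (1 + (real m * (\<theta> - \<tau>))\<^sup>2) ^ s * V \<tau>)"

text \<open>This is \<open>rho m\<close> in the variable \<theta>; see
  \<open>rho_cos\<close>.\<close>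

definition sg :: "nat \<Rightarrow> real \<Rightarrow> real" where
  "sg m \<theta> = sin \<theta> / real m + 1 / (real m)\<^sup>2"

lemma sg_measurable [measurable]: "sg m \<in> borel_measurable borel"
  unfolding sg_def[abs_def] divide_inverse by (intro borel_measurable_continuous_onI continuous_intros)

lemma sg_pos: "\<theta> \<in> {0..pi} \<Longrightarrow> 1 \<le> m \<Longrightarrow> 0 < sg m \<theta>"
  unfolding sg_def by (intro add_nonneg_pos divide_nonneg_nonneg sin_ge_zero) auto

lemma sin_le_add: "sin a \<le> sin b + \<bar>a - b\<bar>" for a b :: real
proof -
  have "sin a - sin b = 2 * sin ((a - b) / 2) * cos ((a + b) / 2)" by (rule sin_diff_sin)
  also have "\<dots> \<le> \<bar>2 * sin ((a - b) / 2) * cos ((a + b) / 2)\<bar>" by simp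
  also have "\<dots> = 2 * (\<bar>sin ((a - b) / 2)\<bar> * \<bar>cos ((a + b) / 2)\<bar>)" by (simp add: abs_mult)
  also have "\<dots> \<le> 2 * (\<bar>(a - b) / 2\<bar> * 1)" by (intro mult_left_mono mult_mono abs_sin_x_le_abs_x) auto
  finally show ?thesis by simp
qed

text \<open>After multiplication by m^2 the function is m sin \<theta> + 1, and the sine is
  1-Lipschitz. The estimate 1 + x <= 2 (1 + x^2) brings the ratio into the required form.\<close>

lemma slow_sg:
  assumes m: "1 \<le> m"
  shows "slow 2 1 m (sg m)"
  unfolding slow_def
proof (intro conjI ballI)
  fix \<theta> \<tau> :: real assume \<theta>: "\<theta> \<in> {0..pi}" and \<tau>: "\<tau> \<in> {0..pi}"
  define x where "x = real m * \<bar>\<theta> - \<tau>\<bar>"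
  have x: "0 \<le> x" by (simp add: x_def)
  have s: "0 \<le> sin \<tau>" using \<tau> by (intro sin_ge_zero) auto
  have "(1 + x) \<le> 2 * (1 + x\<^sup>2)" using zero_le_power2[of "x - 1"] by (simp add: power2_diff) (smt (verit) zero_le_power2)
  moreover have "real m * sin \<theta> + 1 \<le> (real m * sin \<tau> + 1) * (1 + x)"
  proof -
    have "real m * sin \<theta> \<le> real m * (sin \<tau> + \<bar>\<theta> - \<tau>\<bar>)" by (intro mult_left_mono sin_le_add) auto
    then have "real m * sin \<theta> \<le> real m * sin \<tau> + x" by (simp add: x_def distrib_left)
    moreover have "0 \<le> real m * sin \<tau> * x" using s x by simp
    ultimately show ?thesis by (simp add: algebra_simps)
  qed
  ultimately have "real m * sin \<theta> + 1 \<le> (real m * sin \<tau> + 1) * (2 * (1 + x\<^sup>2))"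
    using s by (elim order.trans) (intro mult_left_mono add_nonneg_nonneg, auto)
  then have "(real m * sin \<theta> + 1) / (real m)\<^sup>2 \<le> (real m * sin \<tau> + 1) * (2 * (1 + x\<^sup>2)) / (real m)\<^sup>2"
    by (intro divide_right_mono) auto
  also have "(real m * sin \<tau> + 1) * (2 * (1 + x\<^sup>2)) / (real m)\<^sup>2 = (real m * sin \<tau> + 1) / (real m)\<^sup>2 * (2 * (1 + x\<^sup>2))"
    by (simp only: times_divide_eq_left)
  also have sgt: "(real m * sin t + 1) / (real m)\<^sup>2 = sg m t" for t using m by (simp add: sg_def field_simps power2_eq_square)
  also have "x\<^sup>2 = (real m * (\<theta> - \<tau>))\<^sup>2" by (simp add: x_def power_mult_distrib)
  finally show "sg m \<theta> \<le> 2 * (1 + (real m * (\<theta> - \<tau>))\<^sup>2) ^ 1 * sg m \<tau>"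
    by (simp only: power_one_right mult_ac sgt)
next
  fix \<theta> :: real assume "\<theta> \<in> {0..pi}"
  then show "0 \<le> sg m \<theta>" using sg_pos m less_imp_le by blast
qed measurable

lemma slow_mult:
  assumes "slow B s m V" "slow B' s' m V'" "0 \<le> B" "0 \<le> B'"
  shows "slow (B * B') (s + s') m (\<lambda>\<theta>. V \<theta> * V' \<theta>)"
  unfolding slow_def
proof (intro conjI ballI)
  show "(\<lambda>\<theta>. V \<theta> * V' \<theta>) \<in> borel_measurable borel" using assms by (auto simp: slow_def)
  fix \<theta> \<tau> :: real assume t: "\<theta> \<in> {0..pi}" "\<tau> \<in> {0..pi}"
  let ?D = "1 + (real m * (\<theta> - \<tau>))\<^sup>2"
  have "V \<theta> * V' \<theta> \<le> (B * ?D ^ s * V \<tau>) * (B' * ?D ^ s' * V' \<tau>)"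
    using assms t by (intro mult_mono) (auto simp: slow_def intro!: mult_nonneg_nonneg add_nonneg_nonneg)
  then show "V \<theta> * V' \<theta> \<le> B * B' * ?D ^ (s + s') * (V \<tau> * V' \<tau>)" by (simp add: power_add mult_ac)
next
  fix \<theta> :: real assume "\<theta> \<in> {0..pi}"
  then show "0 \<le> V \<theta> * V' \<theta>" using assms by (auto simp: slow_def)
qed

lemma slow_const: "0 \<le> a \<Longrightarrow> slow 1 0 m (\<lambda>\<theta>. a)"
  by (simp add: slow_def)

text \<open>The constants are preserved because the whole comparison factor is at least 1 when B >=
  1, and a power q <= 1 does not increase it.\<close>

lemma slow_powr:
  assumes V: "slow B s m V" and B: "1 \<le> B" and q: "0 \<le> q" "q \<le> 1"
  shows "slow B s m (\<lambda>\<theta>. V \<theta> powr q)"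
  unfolding slow_def
proof (intro conjI ballI)
  show "(\<lambda>\<theta>. V \<theta> powr q) \<in> borel_measurable borel" using V by (auto simp: slow_def)
  fix \<theta> \<tau> :: real assume t: "\<theta> \<in> {0..pi}" "\<tau> \<in> {0..pi}"
  let ?D = "B * (1 + (real m * (\<theta> - \<tau>))\<^sup>2) ^ s"
  have "1 * 1 \<le> ?D" using B by (intro mult_mono one_le_power) auto
  then have D: "1 \<le> ?D" by simp
  have "V \<theta> powr q \<le> (?D * V \<tau>) powr q"
    using V t q by (intro powr_mono2) (auto simp: slow_def)
  also have "\<dots> = ?D powr q * V \<tau> powr q" by (simp add: powr_mult)
  also have "\<dots> \<le> ?D powr 1 * V \<tau> powr q" using D q by (intro mult_right_mono powr_mono) auto
  finally show "V \<theta> powr q \<le> ?D * V \<tau> powr q" using D by simp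
qed simp

lemma slow_power:
  assumes V: "slow B s m V" and B: "0 \<le> B"
  shows "slow (B ^ k) (k * s) m (\<lambda>\<theta>. V \<theta> ^ k)"
proof (induction k)
  case 0
  then show ?case using slow_const[of 1 m] by simp
next
  case (Suc k)
  show ?case using slow_mult[OF V Suc] B by simp
qed

lemma slow_sg_powr:
  assumes m: "1 \<le> m" and p: "0 \<le> p" "p \<le> 1"
  shows "slow (2 ^ k) k m (\<lambda>\<theta>. (sg m \<theta> powr p) ^ k)"
  using slow_power[OF slow_powr[OF slow_sg[OF m] _ p], of k] by simp

section \<open>Integrating localised bounds against a slowly varying weight\<close>

lemma cauchy_kernel_integral:
  assumes m: "1 \<le> m"
  shows "(\<integral>\<^sup>+\<theta>\<in>{0..pi}. ennreal (real m / (1 + (real m * (\<tau> - \<theta>))\<^sup>2)) \<partial>lborel) \<le> ennreal pi"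
proof -
  have "(\<integral>\<^sup>+\<theta>\<in>{0..pi}. ennreal (real m / (1 + (real m * (\<tau> - \<theta>))\<^sup>2)) \<partial>lborel) = 
    ennreal (arctan (real m * (pi - \<tau>)) - arctan (real m * (0 - \<tau>)))"
  proof (rule nn_integral_FTC_Icc[where F="\<lambda>x. arctan (real m * (x - \<tau>))"])
    fix x
    have "((\<lambda>x. arctan (real m * (x - \<tau>))) has_real_derivative real m / (1 + (real m * (x - \<tau>))\<^sup>2)) (at x)"
      by (auto intro!: derivative_eq_intros simp: field_simps)
    also have "(real m * (x - \<tau>))\<^sup>2 = (real m * (\<tau> - x))\<^sup>2" by (simp add: power_mult_distrib power2_commute)
    finally show "((\<lambda>x. arctan (real m * (x - \<tau>))) has_real_derivative real m / (1 + (real m * (\<tau> - x))\<^sup>2)) (at x)" .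
  qed (auto simp: add_nonneg_nonneg)
  also have "\<dots> \<le> ennreal pi"
    using arctan_bounded[of "real m * (pi - \<tau>)"] arctan_bounded[of "real m * (0 - \<tau>)"] by (intro ennreal_leI) auto
  finally show ?thesis .
qed

text \<open>Moving the weight from \<theta> to \<tau> costs s powers of the kernel; the one that is
  left is the Cauchy kernel, whose integral in \<theta> is at most \<pi>. Hence the exponent
  \<open>Suc s\<close>. Only a pointwise majorant of \<Phi> is used, which suits points selected one
  by one.\<close>

lemma weighted_kernel:
  fixes f \<Phi> :: "real \<Rightarrow> ennreal"
  assumes m: "1 \<le> m" and V: "slow B s m V" and B: "0 \<le> B" and C: "0 \<le> C"
    and [measurable]: "f \<in> borel_measurable borel" and ab: "0 \<le> a" "b \<le> pi"
    and \<Phi>: "\<And>\<theta>. \<theta> \<in> {0..pi} \<Longrightarrow> \<Phi> \<theta> \<le> ennreal (C * real m) * (\<integral>\<^sup>+\<tau>\<in>{a..b}. f \<tau> * ennreal (1 / (1 + (real m * (\<tau> - \<theta>))\<^sup>2) ^ Suc s) \<partial>lborel)"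
  shows "(\<integral>\<^sup>+\<theta>\<in>{0..pi}. \<Phi> \<theta> * ennreal (V \<theta>) \<partial>lborel) \<le> ennreal (C * B * pi) * (\<integral>\<^sup>+\<tau>\<in>{a..b}. f \<tau> * ennreal (V \<tau>) \<partial>lborel)"
proof -
  have [measurable]: "V \<in> borel_measurable borel" using V by (simp add: slow_def)
  let ?D = "\<lambda>\<tau> \<theta>. 1 + (real m * (\<tau> - \<theta>))\<^sup>2"
  have D: "1 \<le> ?D \<tau> \<theta>" for \<tau> \<theta> by simp
  have "(\<integral>\<^sup>+\<theta>\<in>{0..pi}. \<Phi> \<theta> * ennreal (V \<theta>) \<partial>lborel) \<le> 
    (\<integral>\<^sup>+\<theta>\<in>{0..pi}. (\<integral>\<^sup>+\<tau>\<in>{a..b}. ennreal (C * B) * (f \<tau> * ennreal (V \<tau>)) * ennreal (real m / ?D \<tau> \<theta>) \<partial>lborel) \<partial>lborel)"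
  proof (rule set_nn_integral_mono)
    fix \<theta> assume \<theta>: "\<theta> \<in> {0..pi}"
    have "\<Phi> \<theta> * ennreal (V \<theta>) \<le> ennreal (C * real m) * (\<integral>\<^sup>+\<tau>\<in>{a..b}. f \<tau> * ennreal (1 / ?D \<tau> \<theta> ^ Suc s) \<partial>lborel) * ennreal (V \<theta>)"
      by (intro mult_right_mono \<Phi> \<theta>) auto
    also have "\<dots> = (\<integral>\<^sup>+\<tau>\<in>{a..b}. ennreal (C * real m) * (f \<tau> * ennreal (1 / ?D \<tau> \<theta> ^ Suc s)) * ennreal (V \<theta>) \<partial>lborel)"
      by (simp add: nn_integral_cmult[symmetric] nn_integral_multc[symmetric] mult_ac)
    also have "\<dots> \<le> (\<integral>\<^sup>+\<tau>\<in>{a..b}. ennreal (C * B) * (f \<tau> * ennreal (V \<tau>)) * ennreal (real m / ?D \<tau> \<theta>) \<partial>lborel)"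
    proof (rule set_nn_integral_mono)
      fix \<tau> assume "\<tau> \<in> {a..b}"
      then have \<tau>: "\<tau> \<in> {0..pi}" using ab by auto
      have V0: "0 \<le> V \<theta>" "0 \<le> V \<tau>" using V \<theta> \<tau> by (auto simp: slow_def)
      have Vle: "V \<theta> \<le> B * ?D \<tau> \<theta> ^ s * V \<tau>" 
      proof -
        have "(real m * (\<theta> - \<tau>))\<^sup>2 = (real m * (\<tau> - \<theta>))\<^sup>2" by (simp add: power_mult_distrib power2_commute)
        then show ?thesis using V \<theta> \<tau> unfolding slow_def by metis
      qed
      have "1 / ?D \<tau> \<theta> ^ Suc s * V \<theta> \<le> 1 / ?D \<tau> \<theta> ^ Suc s * (B * ?D \<tau> \<theta> ^ s * V \<tau>)" using D
        by (intro mult_left_mono Vle) auto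
      also have "\<dots> = B * V \<tau> / ?D \<tau> \<theta>"
      proof -
        have "1 / E ^ Suc s * (B * E ^ s * v) = B * v / E" if "E \<noteq> 0" for E v :: real
          using that by (simp add: field_simps)
        moreover have "?D \<tau> \<theta> \<noteq> 0" using D[of \<tau> \<theta>] by linarith
        ultimately show ?thesis by blast
      qed
      finally have "C * real m * (1 / ?D \<tau> \<theta> ^ Suc s * V \<theta>) \<le> C * real m * (B * V \<tau> / ?D \<tau> \<theta>)" using C by (intro mult_left_mono) auto
      then have "ennreal (C * real m * (1 / ?D \<tau> \<theta> ^ Suc s * V \<theta>)) \<le> ennreal (C * B * (V \<tau> * (real m / ?D \<tau> \<theta>)))"
        by (intro ennreal_leI) (simp add: mult_ac)
      then have "ennreal (C * real m) * (ennreal (1 / ?D \<tau> \<theta> ^ Suc s) * ennreal (V \<theta>)) \<le> ennreal (C * B) * (ennreal (V \<tau>) * ennreal (real m / ?D \<tau> \<theta>))"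
        using C B V0 D by (simp add: ennreal_mult[symmetric] add_nonneg_nonneg)
      then have "f \<tau> * (ennreal (C * real m) * (ennreal (1 / ?D \<tau> \<theta> ^ Suc s) * ennreal (V \<theta>))) \<le> f \<tau> * (ennreal (C * B) * (ennreal (V \<tau>) * ennreal (real m / ?D \<tau> \<theta>)))"
        by (intro mult_left_mono) auto
      then show "ennreal (C * real m) * (f \<tau> * ennreal (1 / ?D \<tau> \<theta> ^ Suc s)) * ennreal (V \<theta>) \<le> ennreal (C * B) * (f \<tau> * ennreal (V \<tau>)) * ennreal (real m / ?D \<tau> \<theta>)"
        by (simp only: mult_ac)
    qed
    finally show "\<Phi> \<theta> * ennreal (V \<theta>) \<le> (\<integral>\<^sup>+\<tau>\<in>{a..b}. ennreal (C * B) * (f \<tau> * ennreal (V \<tau>)) * ennreal (real m / ?D \<tau> \<theta>) \<partial>lborel)" .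
  qed
  also have "\<dots> = (\<integral>\<^sup>+\<theta>. (\<integral>\<^sup>+\<tau>. ennreal (C * B) * (f \<tau> * ennreal (V \<tau>)) * ennreal (real m / ?D \<tau> \<theta>) * indicator {a..b} \<tau> * indicator {0..pi} \<theta> \<partial>lborel) \<partial>lborel)"
    by (simp add: nn_integral_multc)
  also have "\<dots> = (\<integral>\<^sup>+\<tau>. (\<integral>\<^sup>+\<theta>. ennreal (C * B) * (f \<tau> * ennreal (V \<tau>)) * ennreal (real m / ?D \<tau> \<theta>) * indicator {a..b} \<tau> * indicator {0..pi} \<theta> \<partial>lborel) \<partial>lborel)"
    by (rule lborel_Fubini) measurable
  also have "\<dots> = (\<integral>\<^sup>+\<tau>. ennreal (C * B) * (f \<tau> * ennreal (V \<tau>)) * indicator {a..b} \<tau> * (\<integral>\<^sup>+\<theta>. ennreal (real m / ?D \<tau> \<theta>) * indicator {0..pi} \<theta> \<partial>lborel) \<partial>lborel)"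
  proof (rule nn_integral_cong)
    fix \<tau> :: real
    show "(\<integral>\<^sup>+\<theta>. ennreal (C * B) * (f \<tau> * ennreal (V \<tau>)) * ennreal (real m / ?D \<tau> \<theta>) * indicator {a..b} \<tau> * indicator {0..pi} \<theta> \<partial>lborel)
      = ennreal (C * B) * (f \<tau> * ennreal (V \<tau>)) * indicator {a..b} \<tau> * (\<integral>\<^sup>+\<theta>. ennreal (real m / ?D \<tau> \<theta>) * indicator {0..pi} \<theta> \<partial>lborel)"
      by (subst nn_integral_cmult[symmetric]) (auto simp: mult_ac)
  qed
  also have "\<dots> \<le> (\<integral>\<^sup>+\<tau>. ennreal (C * B) * (f \<tau> * ennreal (V \<tau>)) * indicator {a..b} \<tau> * ennreal pi \<partial>lborel)"
    by (intro nn_integral_mono mult_left_mono cauchy_kernel_integral m) auto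
  also have "\<dots> = ennreal (C * B) * ennreal pi * (\<integral>\<^sup>+\<tau>. f \<tau> * ennreal (V \<tau>) * indicator {a..b} \<tau> \<partial>lborel)"
    by (subst nn_integral_cmult[symmetric]) (auto simp: mult_ac)
  also have "ennreal (C * B) * ennreal pi = ennreal (C * B * pi)" using C B by (simp add: ennreal_mult)
  finally show ?thesis .
qed

lemma poly_cos_measurable [measurable]: "(\<lambda>\<theta>::real. poly Q (cos \<theta>)) \<in> borel_measurable borel"
  by (rule measurable_compose[OF _ poly_measurable]) measurable

text \<open>A displacement of the centre by O(1/m) is invisible to the kernel up to a constant; the
  factor 2 is from (x + y)^2 <= 2 x^2 + 2 y^2.\<close>

lemma kernel_shift:
  assumes m: "1 \<le> m" and \<xi>: "\<bar>\<xi> - \<theta>\<bar> \<le> \<kappa> / real m" 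
  shows "1 / (1 + (real m * (\<tau> - \<xi>))\<^sup>2) ^ d \<le> (2 * (1 + \<kappa>\<^sup>2)) ^ d * (1 / (1 + (real m * (\<tau> - \<theta>))\<^sup>2) ^ d)"
proof -
  define x y where "x = real m * (\<tau> - \<xi>)" and "y = real m * (\<xi> - \<theta>)"
  have xy: "real m * (\<tau> - \<theta>) = x + y" by (simp add: x_def y_def algebra_simps)
  have "\<bar>y\<bar> \<le> \<kappa>" using \<xi> m by (simp add: y_def abs_mult pos_le_divide_eq mult.commute)
  then have y: "y\<^sup>2 \<le> \<kappa>\<^sup>2" by (metis abs_le_square_iff abs_of_nonneg abs_ge_zero order.trans)
  have "(x + y)\<^sup>2 + (x - y)\<^sup>2 = 2 * x\<^sup>2 + 2 * y\<^sup>2" by (simp add: power2_eq_square algebra_simps)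
  then have "(x + y)\<^sup>2 \<le> 2 * x\<^sup>2 + 2 * y\<^sup>2" using zero_le_power2[of "x - y"] by linarith
  moreover have "0 \<le> x\<^sup>2 * \<kappa>\<^sup>2" by simp
  moreover have "2 * (1 + \<kappa>\<^sup>2) * (1 + x\<^sup>2) = 2 + 2 * \<kappa>\<^sup>2 + 2 * x\<^sup>2 + 2 * (x\<^sup>2 * \<kappa>\<^sup>2)" by (simp add: algebra_simps)
  ultimately have "1 + (x + y)\<^sup>2 \<le> 2 * (1 + \<kappa>\<^sup>2) * (1 + x\<^sup>2)" using y by linarith
  then have "(1 + (x + y)\<^sup>2) ^ d \<le> (2 * (1 + \<kappa>\<^sup>2) * (1 + x\<^sup>2)) ^ d" by (intro power_mono) auto
  also have "\<dots> = (2 * (1 + \<kappa>\<^sup>2)) ^ d * (1 + x\<^sup>2) ^ d" by (rule power_mult_distrib)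
  finally have le: "(1 + (x + y)\<^sup>2) ^ d \<le> (2 * (1 + \<kappa>\<^sup>2)) ^ d * (1 + x\<^sup>2) ^ d" .
  have pos: "0 < (1 + (x + y)\<^sup>2) ^ d" "0 < (1 + x\<^sup>2) ^ d" by (intro zero_less_power add_pos_nonneg; simp)+
  show ?thesis unfolding xy x_def[symmetric] using le pos by (simp add: divide_simps mult_ac)
qed

text \<open>\<open>local_bounds\<close> with d = \<open>Suc s\<close>, integrated by
  \<open>weighted_kernel\<close>. The cut-off c is fixed before the displacement bound \<kappa>,
  which affects only the constant C. The right sides omit the ends; the first estimate is useful for
  that reason even without displacement.\<close>

lemma bernstein_basic:
  assumes p: "0 < p" "p \<le> 1"
  shows "\<exists>c>0. c \<le> 1 \<and> (\<forall>\<kappa>. \<exists>C>0. \<forall>m Q B V \<xi>. 1 \<le> m \<longrightarrow> degree Q \<le> m \<longrightarrow> 0 \<le> B \<longrightarrow> slow B s m V \<longrightarrow>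
     (\<forall>\<theta>\<in>{0..pi}. \<xi> \<theta> \<in> {0..pi} \<and> \<bar>\<xi> \<theta> - \<theta>\<bar> \<le> \<kappa> / real m) \<longrightarrow>
     (\<integral>\<^sup>+\<theta>\<in>{0..pi}. pp p (poly Q (cos (\<xi> \<theta>))) * ennreal (V \<theta>) \<partial>lborel) \<le>
        ennreal (C * B) * (\<integral>\<^sup>+\<tau>\<in>{c / real m..pi - c / real m}. pp p (poly Q (cos \<tau>)) * ennreal (V \<tau>) \<partial>lborel) \<and>
     (\<integral>\<^sup>+\<theta>\<in>{0..pi}. pp p (sin \<theta> * poly (pderiv Q) (cos \<theta>) / real m) * ennreal (V \<theta>) \<partial>lborel) \<le>
        ennreal (C * B) * (\<integral>\<^sup>+\<tau>\<in>{c / real m..pi - c / real m}. pp p (poly Q (cos \<tau>)) * ennreal (V \<tau>) \<partial>lborel))"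
proof -
  obtain C c where C: "0 < C" and c: "0 < c" "c \<le> 1" and main: "\<And>m Q \<theta>. \<theta> \<in> {0..pi} \<Longrightarrow> 1 \<le> m \<Longrightarrow> degree Q \<le> m \<Longrightarrow>
    (let J = \<integral>\<^sup>+\<tau>\<in>{c / real m..pi - c / real m}. pp p (poly Q (cos \<tau>)) * ennreal (1 / (1 + (real m * (\<tau> - \<theta>))\<^sup>2) ^ Suc s) \<partial>lborel
     in pp p (poly Q (cos \<theta>)) \<le> ennreal (C * real m) * J \<and>
        pp p (sin \<theta> * poly (pderiv Q) (cos \<theta>) / real m) \<le> ennreal (C * real m) * J)"
    using local_bounds[OF p, of "Suc s"] by blast
  show ?thesis
  proof (rule exI[of _ c], intro conjI c allI)
    fix \<kappa> :: real
    define K where "K = (2 * (1 + \<kappa>\<^sup>2)) ^ Suc s"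
    have K: "1 \<le> K" unfolding K_def by (intro one_le_power) (simp add: algebra_simps add_increasing2)
    have CK: "C \<le> C * K" using C K by simp
    show "\<exists>C>0. \<forall>m Q B V \<xi>. 1 \<le> m \<longrightarrow> degree Q \<le> m \<longrightarrow> 0 \<le> B \<longrightarrow> slow B s m V \<longrightarrow>
     (\<forall>\<theta>\<in>{0..pi}. \<xi> \<theta> \<in> {0..pi} \<and> \<bar>\<xi> \<theta> - \<theta>\<bar> \<le> \<kappa> / real m) \<longrightarrow>
     (\<integral>\<^sup>+\<theta>\<in>{0..pi}. pp p (poly Q (cos (\<xi> \<theta>))) * ennreal (V \<theta>) \<partial>lborel) \<le>
        ennreal (C * B) * (\<integral>\<^sup>+\<tau>\<in>{c / real m..pi - c / real m}. pp p (poly Q (cos \<tau>)) * ennreal (V \<tau>) \<partial>lborel) \<and>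
     (\<integral>\<^sup>+\<theta>\<in>{0..pi}. pp p (sin \<theta> * poly (pderiv Q) (cos \<theta>) / real m) * ennreal (V \<theta>) \<partial>lborel) \<le>
        ennreal (C * B) * (\<integral>\<^sup>+\<tau>\<in>{c / real m..pi - c / real m}. pp p (poly Q (cos \<tau>)) * ennreal (V \<tau>) \<partial>lborel)"
    proof (rule exI[of _ "C * K * pi"], intro conjI allI impI)
      show "0 < C * K * pi" using C K by simp
      fix m :: nat and Q :: "real poly" and B V \<xi>
      assume m: "1 \<le> m" and Q: "degree Q \<le> m" and B: "0 \<le> B" and V: "slow B s m V"
        and \<xi>: "\<forall>\<theta>\<in>{0..pi}. \<xi> \<theta> \<in> {0..pi} \<and> \<bar>\<xi> \<theta> - \<theta>\<bar> \<le> \<kappa> / real m"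
      have cm: "0 \<le> c / real m" "pi - c / real m \<le> pi" using c by auto
      let ?J = "\<lambda>\<theta>. \<integral>\<^sup>+\<tau>\<in>{c / real m..pi - c / real m}. pp p (poly Q (cos \<tau>)) * ennreal (1 / (1 + (real m * (\<tau> - \<theta>))\<^sup>2) ^ Suc s) \<partial>lborel"
      have CKB: "C * K * pi * B = C * K * B * pi" by simp
      have CK0: "0 \<le> C * K" using C K by simp
      show "(\<integral>\<^sup>+\<theta>\<in>{0..pi}. pp p (poly Q (cos (\<xi> \<theta>))) * ennreal (V \<theta>) \<partial>lborel) \<le>
        ennreal (C * K * pi * B) * (\<integral>\<^sup>+\<tau>\<in>{c / real m..pi - c / real m}. pp p (poly Q (cos \<tau>)) * ennreal (V \<tau>) \<partial>lborel)"
        unfolding CKB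
      proof (rule weighted_kernel[OF m V B CK0 _ cm])
        fix \<theta> assume \<theta>: "\<theta> \<in> {0..pi}"
        have "pp p (poly Q (cos (\<xi> \<theta>))) \<le> ennreal (C * real m) * ?J (\<xi> \<theta>)"
          using main[of "\<xi> \<theta>" m Q] \<xi> \<theta> m Q by (simp add: Let_def)
        also have "?J (\<xi> \<theta>) \<le> (\<integral>\<^sup>+\<tau>\<in>{c / real m..pi - c / real m}. ennreal K * (pp p (poly Q (cos \<tau>)) * ennreal (1 / (1 + (real m * (\<tau> - \<theta>))\<^sup>2) ^ Suc s)) \<partial>lborel)"
        proof (rule set_nn_integral_mono)
          fix \<tau> :: real
          have "ennreal (1 / (1 + (real m * (\<tau> - \<xi> \<theta>))\<^sup>2) ^ Suc s) \<le> ennreal (K * (1 / (1 + (real m * (\<tau> - \<theta>))\<^sup>2) ^ Suc s))"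
            unfolding K_def using \<xi> \<theta> by (intro ennreal_leI kernel_shift m) auto
          also have "\<dots> = ennreal K * ennreal (1 / (1 + (real m * (\<tau> - \<theta>))\<^sup>2) ^ Suc s)"
            using K by (intro ennreal_mult) auto
          finally have "pp p (poly Q (cos \<tau>)) * ennreal (1 / (1 + (real m * (\<tau> - \<xi> \<theta>))\<^sup>2) ^ Suc s) \<le>
            pp p (poly Q (cos \<tau>)) * (ennreal K * ennreal (1 / (1 + (real m * (\<tau> - \<theta>))\<^sup>2) ^ Suc s))"
            by (intro mult_left_mono) auto
          then show "pp p (poly Q (cos \<tau>)) * ennreal (1 / (1 + (real m * (\<tau> - \<xi> \<theta>))\<^sup>2) ^ Suc s) \<le>
            ennreal K * (pp p (poly Q (cos \<tau>)) * ennreal (1 / (1 + (real m * (\<tau> - \<theta>))\<^sup>2) ^ Suc s))"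
            by (simp only: mult_ac)
        qed
        also have "\<dots> = ennreal K * ?J \<theta>" by (simp add: mult.assoc nn_integral_cmult)
        finally have "pp p (poly Q (cos (\<xi> \<theta>))) \<le> ennreal (C * real m) * (ennreal K * ?J \<theta>)" by (simp add: mult_left_mono)
        also have "\<dots> = (ennreal (C * real m) * ennreal K) * ?J \<theta>" by (simp only: mult.assoc)
        also have "ennreal (C * real m) * ennreal K = ennreal (C * K * real m)" using C K by (simp add: ennreal_mult[symmetric] mult_ac)
        finally show "pp p (poly Q (cos (\<xi> \<theta>))) \<le> ennreal (C * K * real m) * ?J \<theta>" .
      qed measurable
      show "(\<integral>\<^sup>+\<theta>\<in>{0..pi}. pp p (sin \<theta> * poly (pderiv Q) (cos \<theta>) / real m) * ennreal (V \<theta>) \<partial>lborel) \<le>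
        ennreal (C * K * pi * B) * (\<integral>\<^sup>+\<tau>\<in>{c / real m..pi - c / real m}. pp p (poly Q (cos \<tau>)) * ennreal (V \<tau>) \<partial>lborel)"
        unfolding CKB
      proof (rule weighted_kernel[OF m V B CK0 _ cm])
        fix \<theta> assume \<theta>: "\<theta> \<in> {0..pi}"
        have "pp p (sin \<theta> * poly (pderiv Q) (cos \<theta>) / real m) \<le> ennreal (C * real m) * ?J \<theta>"
          using main[OF \<theta> m Q] by (simp add: Let_def)
        also have "\<dots> \<le> ennreal (C * K * real m) * ?J \<theta>"
          using CK by (intro mult_right_mono ennreal_leI) auto
        finally show "pp p (sin \<theta> * poly (pderiv Q) (cos \<theta>) / real m) \<le> ennreal (C * K * real m) * ?J \<theta>" .
      qed measurable
    qed
  qed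
qed

text \<open>At distance c/m from both ends sin \<tau> is at least a constant over m, so it dominates
  the second summand of \<open>sg\<close> as well. This comparison is the purpose of the truncated
  intervals.\<close>

lemma sg_le_sin:
  assumes m: "1 \<le> m" and c: "0 < c" "c \<le> 1" and \<tau>: "\<tau> \<in> {c / real m..pi - c / real m}"
  shows "sg m \<tau> \<le> (1 + pi / (2 * c)) * (sin \<tau> / real m)" "0 \<le> sin \<tau>"
proof -
  define t where "t = (if \<tau> \<le> pi / 2 then \<tau> else pi - \<tau>)"
  have cm: "0 < c / real m" using c m by simp
  have t: "c / real m \<le> t" "t \<le> pi / 2" "sin t = sin \<tau>" using \<tau> by (auto simp: t_def)
  have "2 * (c / real m) / pi \<le> 2 * t / pi" using t by (intro divide_right_mono mult_left_mono) auto
  also have "\<dots> \<le> sin t" using t cm by (intro jordan_sin) auto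
  finally have le: "2 * (c / real m) / pi \<le> sin \<tau>" using t by simp
  then show "0 \<le> sin \<tau>" using cm by (smt (verit) divide_nonneg_nonneg pi_ge_zero)
  have "1 / real m = pi / (2 * c) * (2 * (c / real m) / pi)" using c by simp
  also have "\<dots> \<le> pi / (2 * c) * sin \<tau>" using c by (intro mult_left_mono le) auto
  finally have "1 / real m / real m \<le> pi / (2 * c) * sin \<tau> / real m" by (intro divide_right_mono) auto
  then show "sg m \<tau> \<le> (1 + pi / (2 * c)) * (sin \<tau> / real m)" by (simp add: sg_def power2_eq_square algebra_simps)
qed

text \<open>One derivative at a time. First the ends are discarded for the derivative with its full
  weight. On the remaining interval one factor \<open>sg m\<close> is at most a multiple of sin/m,
  which completes the derivative in x to a derivative in \<theta>. To that the second estimate of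
  \<open>bernstein_basic\<close> applies, and then the induction hypothesis.\<close>

lemma bernstein_iterated:
  assumes p: "0 < p" "p \<le> 1" and B: "1 \<le> B"
  shows "\<exists>c>0. c \<le> 1 \<and> (\<exists>C>0. \<forall>m Q V. 1 \<le> m \<longrightarrow> degree Q \<le> m \<longrightarrow> slow B s m V \<longrightarrow>
     (\<integral>\<^sup>+\<theta>\<in>{0..pi}. pp p (poly ((pderiv ^^ k) Q) (cos \<theta>)) * ennreal ((sg m \<theta> powr p) ^ k * V \<theta>) \<partial>lborel) \<le>
        ennreal C * (\<integral>\<^sup>+\<tau>\<in>{c / real m..pi - c / real m}. pp p (poly Q (cos \<tau>)) * ennreal (V \<tau>) \<partial>lborel))"
proof (induction k)
  case 0
  \<comment> \<open>With \<kappa> = 0 the displaced point is \<theta> itself, so this estimate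
    merely discards the ends.\<close>
  obtain c where c: "0 < c" "c \<le> 1" and "\<exists>C>0. \<forall>m Q B V \<xi>. 1 \<le> m \<longrightarrow> degree Q \<le> m \<longrightarrow> 0 \<le> B \<longrightarrow> slow B s m V \<longrightarrow>
     (\<forall>\<theta>\<in>{0..pi}. \<xi> \<theta> \<in> {0..pi} \<and> \<bar>\<xi> \<theta> - \<theta>\<bar> \<le> 0 / real m) \<longrightarrow>
     (\<integral>\<^sup>+\<theta>\<in>{0..pi}. pp p (poly Q (cos (\<xi> \<theta>))) * ennreal (V \<theta>) \<partial>lborel) \<le>
        ennreal (C * B) * (\<integral>\<^sup>+\<tau>\<in>{c / real m..pi - c / real m}. pp p (poly Q (cos \<tau>)) * ennreal (V \<tau>) \<partial>lborel)"
    using bernstein_basic[OF p, of s] by blast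
  then obtain C where C: "0 < C" "\<And>m Q B V \<xi>. 1 \<le> m \<Longrightarrow> degree Q \<le> m \<Longrightarrow> 0 \<le> B \<Longrightarrow> slow B s m V \<Longrightarrow>
     (\<forall>\<theta>\<in>{0..pi}. \<xi> \<theta> \<in> {0..pi} \<and> \<bar>\<xi> \<theta> - \<theta>\<bar> \<le> 0 / real m) \<Longrightarrow>
     (\<integral>\<^sup>+\<theta>\<in>{0..pi}. pp p (poly Q (cos (\<xi> \<theta>))) * ennreal (V \<theta>) \<partial>lborel) \<le>
        ennreal (C * B) * (\<integral>\<^sup>+\<tau>\<in>{c / real m..pi - c / real m}. pp p (poly Q (cos \<tau>)) * ennreal (V \<tau>) \<partial>lborel)"
    by blast
  show ?case
  proof (rule exI[of _ c], intro conjI c, rule exI[of _ "C * B"], intro conjI allI impI)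
    fix m :: nat and Q :: "real poly" and V assume "1 \<le> m" "degree Q \<le> m" "slow B s m V"
    then show "(\<integral>\<^sup>+\<theta>\<in>{0..pi}. pp p (poly ((pderiv ^^ 0) Q) (cos \<theta>)) * ennreal ((sg m \<theta> powr p) ^ 0 * V \<theta>) \<partial>lborel) \<le>
        ennreal (C * B) * (\<integral>\<^sup>+\<tau>\<in>{c / real m..pi - c / real m}. pp p (poly Q (cos \<tau>)) * ennreal (V \<tau>) \<partial>lborel)"
      using C(2)[of m Q B V "\<lambda>\<theta>. \<theta>"] B by simp
  qed (use C B in simp)
next
  case (Suc k)
  then obtain c C where c: "0 < c" "c \<le> 1" and C: "0 < C" and IH: "\<And>m Q V. 1 \<le> m \<Longrightarrow> degree Q \<le> m \<Longrightarrow> slow B s m V \<Longrightarrow>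
     (\<integral>\<^sup>+\<theta>\<in>{0..pi}. pp p (poly ((pderiv ^^ k) Q) (cos \<theta>)) * ennreal ((sg m \<theta> powr p) ^ k * V \<theta>) \<partial>lborel) \<le>
        ennreal C * (\<integral>\<^sup>+\<tau>\<in>{c / real m..pi - c / real m}. pp p (poly Q (cos \<tau>)) * ennreal (V \<tau>) \<partial>lborel)"
    by blast
  from bernstein_basic[OF p, of "Suc k + s"] obtain c1 C1 where c1: "0 < c1" "c1 \<le> 1" and C1: "0 < C1" "\<And>m Q B V \<xi>. 1 \<le> m \<Longrightarrow> degree Q \<le> m \<Longrightarrow> 0 \<le> B \<Longrightarrow> slow B (Suc k + s) m V \<Longrightarrow>
     (\<forall>\<theta>\<in>{0..pi}. \<xi> \<theta> \<in> {0..pi} \<and> \<bar>\<xi> \<theta> - \<theta>\<bar> \<le> 0 / real m) \<Longrightarrow>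
     (\<integral>\<^sup>+\<theta>\<in>{0..pi}. pp p (poly Q (cos (\<xi> \<theta>))) * ennreal (V \<theta>) \<partial>lborel) \<le>
        ennreal (C1 * B) * (\<integral>\<^sup>+\<tau>\<in>{c1 / real m..pi - c1 / real m}. pp p (poly Q (cos \<tau>)) * ennreal (V \<tau>) \<partial>lborel)"
    by blast
  from bernstein_basic[OF p, of "k + s"] obtain c2 C2 where c2: "0 < c2" "c2 \<le> 1" and C2: "0 < C2" "\<And>m Q B V \<xi>. 1 \<le> m \<Longrightarrow> degree Q \<le> m \<Longrightarrow> 0 \<le> B \<Longrightarrow> slow B (k + s) m V \<Longrightarrow>
     (\<forall>\<theta>\<in>{0..pi}. \<xi> \<theta> \<in> {0..pi} \<and> \<bar>\<xi> \<theta> - \<theta>\<bar> \<le> 0 / real m) \<Longrightarrow>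
     (\<integral>\<^sup>+\<theta>\<in>{0..pi}. pp p (sin \<theta> * poly (pderiv Q) (cos \<theta>) / real m) * ennreal (V \<theta>) \<partial>lborel) \<le>
        ennreal (C2 * B) * (\<integral>\<^sup>+\<tau>\<in>{c2 / real m..pi - c2 / real m}. pp p (poly Q (cos \<tau>)) * ennreal (V \<tau>) \<partial>lborel)"
    by blast
  define D where "D = 1 + pi / (2 * c1)"
  have D: "1 \<le> D" using c1 by (simp add: D_def)
  define A where "A = C1 * (2 ^ Suc k * B) * (D * (C2 * (2 ^ k * B) * C))"
  show ?case
  proof (rule exI[of _ c], intro conjI c, rule exI[of _ A], intro conjI allI impI)
    show "0 < A" unfolding A_def using C C1(1) C2(1) B D by (intro mult_pos_pos) auto
    fix m :: nat and Q :: "real poly" and V assume m: "1 \<le> m" and Q: "degree Q \<le> m" and V: "slow B s m V"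
    let ?R = "(pderiv ^^ k) Q"
    have dR: "degree ((pderiv ^^ j) Q) \<le> m" for j
      by (induction j) (use Q in \<open>auto simp: degree_pderiv\<close>)
    have dR': "degree (pderiv ?R) \<le> m" using dR[of "Suc k"] by simp
    have V0: "\<And>\<theta>. \<theta> \<in> {0..pi} \<Longrightarrow> 0 \<le> V \<theta>" using V by (auto simp: slow_def)
    have [measurable]: "V \<in> borel_measurable borel" using V by (auto simp: slow_def)
    have W: "slow (2 ^ j * B) (j + s) m (\<lambda>\<theta>. (sg m \<theta> powr p) ^ j * V \<theta>)" for j
      using slow_mult[OF slow_sg_powr[OF m, of p j] V] p B by simp
    let ?I = "\<lambda>R j. \<integral>\<^sup>+\<theta>\<in>{0..pi}. pp p (poly R (cos \<theta>)) * ennreal ((sg m \<theta> powr p) ^ j * V \<theta>) \<partial>lborel"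
    have "?I (pderiv ?R) (Suc k) \<le> ennreal (C1 * (2 ^ Suc k * B)) * 
      (\<integral>\<^sup>+\<tau>\<in>{c1 / real m..pi - c1 / real m}. pp p (poly (pderiv ?R) (cos \<tau>)) * ennreal ((sg m \<tau> powr p) ^ Suc k * V \<tau>) \<partial>lborel)"
      using C1(2)[OF m dR' _ W[of "Suc k"], of "\<lambda>\<theta>. \<theta>"] B by simp
    also have "\<dots> \<le> ennreal (C1 * (2 ^ Suc k * B)) * (ennreal D * 
      (\<integral>\<^sup>+\<theta>\<in>{0..pi}. pp p (sin \<theta> * poly (pderiv ?R) (cos \<theta>) / real m) * ennreal ((sg m \<theta> powr p) ^ k * V \<theta>) \<partial>lborel))"
    proof (rule mult_left_mono)
      have "(\<integral>\<^sup>+\<tau>\<in>{c1 / real m..pi - c1 / real m}. pp p (poly (pderiv ?R) (cos \<tau>)) * ennreal ((sg m \<tau> powr p) ^ Suc k * V \<tau>) \<partial>lborel)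
        \<le> (\<integral>\<^sup>+\<tau>\<in>{c1 / real m..pi - c1 / real m}. ennreal D * (pp p (sin \<tau> * poly (pderiv ?R) (cos \<tau>) / real m) * ennreal ((sg m \<tau> powr p) ^ k * V \<tau>)) \<partial>lborel)"
      proof (rule set_nn_integral_mono)
        fix \<tau> assume \<tau>: "\<tau> \<in> {c1 / real m..pi - c1 / real m}"
        have "0 \<le> c1 / real m" using c1 by simp
        with \<tau> have \<tau>': "\<tau> \<in> {0..pi}" by auto
        note sl = sg_le_sin[OF m c1 \<tau>, folded D_def]
        have "sg m \<tau> powr p \<le> (D * (sin \<tau> / real m)) powr p" using sl sg_pos[OF \<tau>' m] p by (intro powr_mono2) auto
        also have "\<dots> = D powr p * (sin \<tau> / real m) powr p" by (rule powr_mult)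
        also have "\<dots> \<le> D powr 1 * (sin \<tau> / real m) powr p" using D p by (intro mult_right_mono powr_mono) auto
        finally have 1: "ennreal (sg m \<tau> powr p) \<le> ennreal D * pp p (sin \<tau> / real m)" 
          using D sl by (simp add: pp_def ennreal_mult[symmetric] ennreal_leI)
        have "ennreal ((sg m \<tau> powr p) ^ Suc k * V \<tau>) = ennreal (sg m \<tau> powr p) * ennreal ((sg m \<tau> powr p) ^ k * V \<tau>)"
          using V0[OF \<tau>'] by (simp add: ennreal_mult[symmetric] mult.assoc)
        also have "\<dots> \<le> (ennreal D * pp p (sin \<tau> / real m)) * ennreal ((sg m \<tau> powr p) ^ k * V \<tau>)"
          by (intro mult_right_mono 1) auto
        finally have "pp p (poly (pderiv ?R) (cos \<tau>)) * ennreal ((sg m \<tau> powr p) ^ Suc k * V \<tau>) \<le>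
          pp p (poly (pderiv ?R) (cos \<tau>)) * ((ennreal D * pp p (sin \<tau> / real m)) * ennreal ((sg m \<tau> powr p) ^ k * V \<tau>))"
          by (intro mult_left_mono) auto
        also have "\<dots> = ennreal D * ((pp p (sin \<tau> / real m) * pp p (poly (pderiv ?R) (cos \<tau>))) * ennreal ((sg m \<tau> powr p) ^ k * V \<tau>))"
          by (simp only: mult_ac)
        also have "pp p (sin \<tau> / real m) * pp p (poly (pderiv ?R) (cos \<tau>)) = pp p (sin \<tau> * poly (pderiv ?R) (cos \<tau>) / real m)"
          by (simp flip: pp_mult)
        finally show "pp p (poly (pderiv ?R) (cos \<tau>)) * ennreal ((sg m \<tau> powr p) ^ Suc k * V \<tau>) \<le>
          ennreal D * (pp p (sin \<tau> * poly (pderiv ?R) (cos \<tau>) / real m) * ennreal ((sg m \<tau> powr p) ^ k * V \<tau>))" .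
      qed
      also have "\<dots> = ennreal D * (\<integral>\<^sup>+\<tau>\<in>{c1 / real m..pi - c1 / real m}. pp p (sin \<tau> * poly (pderiv ?R) (cos \<tau>) / real m) * ennreal ((sg m \<tau> powr p) ^ k * V \<tau>) \<partial>lborel)"
        by (simp add: mult.assoc nn_integral_cmult)
      also have "\<dots> \<le> ennreal D * (\<integral>\<^sup>+\<tau>\<in>{0..pi}. pp p (sin \<tau> * poly (pderiv ?R) (cos \<tau>) / real m) * ennreal ((sg m \<tau> powr p) ^ k * V \<tau>) \<partial>lborel)"
        using c1 by (intro mult_left_mono set_nn_integral_mono_set) (auto intro: order.trans[rotated])
      finally show "(\<integral>\<^sup>+\<tau>\<in>{c1 / real m..pi - c1 / real m}. pp p (poly (pderiv ?R) (cos \<tau>)) * ennreal ((sg m \<tau> powr p) ^ Suc k * V \<tau>) \<partial>lborel) \<le> \<dots>" .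
    qed auto
    also have "\<dots> \<le> ennreal (C1 * (2 ^ Suc k * B)) * (ennreal D * (ennreal (C2 * (2 ^ k * B)) * (ennreal C * 
       (\<integral>\<^sup>+\<tau>\<in>{c / real m..pi - c / real m}. pp p (poly Q (cos \<tau>)) * ennreal (V \<tau>) \<partial>lborel))))"
    proof (intro mult_left_mono)
      have "(\<integral>\<^sup>+\<theta>\<in>{0..pi}. pp p (sin \<theta> * poly (pderiv ?R) (cos \<theta>) / real m) * ennreal ((sg m \<theta> powr p) ^ k * V \<theta>) \<partial>lborel) \<le>
        ennreal (C2 * (2 ^ k * B)) * (\<integral>\<^sup>+\<tau>\<in>{c2 / real m..pi - c2 / real m}. pp p (poly ?R (cos \<tau>)) * ennreal ((sg m \<tau> powr p) ^ k * V \<tau>) \<partial>lborel)"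
        using C2(2)[OF m dR[of k] _ W[of k], of "\<lambda>\<theta>. \<theta>"] B by simp
      also have "\<dots> \<le> ennreal (C2 * (2 ^ k * B)) * ?I ?R k"
        using c2 by (intro mult_left_mono set_nn_integral_mono_set) (auto intro: order.trans[rotated])
      also have "\<dots> \<le> ennreal (C2 * (2 ^ k * B)) * (ennreal C * (\<integral>\<^sup>+\<tau>\<in>{c / real m..pi - c / real m}. pp p (poly Q (cos \<tau>)) * ennreal (V \<tau>) \<partial>lborel))"
        by (intro mult_left_mono IH m Q V) auto
      finally show "(\<integral>\<^sup>+\<theta>\<in>{0..pi}. pp p (sin \<theta> * poly (pderiv ?R) (cos \<theta>) / real m) * ennreal ((sg m \<theta> powr p) ^ k * V \<theta>) \<partial>lborel) \<le> \<dots>" .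
    qed auto
    also have "\<dots> = ennreal A * (\<integral>\<^sup>+\<tau>\<in>{c / real m..pi - c / real m}. pp p (poly Q (cos \<tau>)) * ennreal (V \<tau>) \<partial>lborel)"
      unfolding A_def using C C1(1) C2(1) B D by (simp add: ennreal_mult mult.assoc)
    finally show "(\<integral>\<^sup>+\<theta>\<in>{0..pi}. pp p (poly ((pderiv ^^ Suc k) Q) (cos \<theta>)) * ennreal ((sg m \<theta> powr p) ^ Suc k * V \<theta>) \<partial>lborel) \<le>
        ennreal A * (\<integral>\<^sup>+\<tau>\<in>{c / real m..pi - c / real m}. pp p (poly Q (cos \<tau>)) * ennreal (V \<tau>) \<partial>lborel)"
      by simp
  qed
qed

text \<open>The perturbation \<open>\<xi>\<close> lets the left side dominate values of the derivative at nearby points.\<close>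

theorem bernstein:
  assumes p: "0 < p" "p \<le> 1" and B: "1 \<le> B"
  shows "\<exists>C>0. \<forall>m Q V \<xi>. 1 \<le> m \<longrightarrow> degree Q \<le> m \<longrightarrow> slow B s m V \<longrightarrow>
     (\<forall>\<theta>\<in>{0..pi}. \<xi> \<theta> \<in> {0..pi} \<and> \<bar>\<xi> \<theta> - \<theta>\<bar> \<le> \<kappa> / real m) \<longrightarrow>
     (\<integral>\<^sup>+\<theta>\<in>{0..pi}. pp p (poly ((pderiv ^^ k) Q) (cos (\<xi> \<theta>))) * ennreal ((sg m \<theta> powr p) ^ k * V \<theta> * sin \<theta>) \<partial>lborel) \<le>
        ennreal C * (\<integral>\<^sup>+\<theta>\<in>{0..pi}. pp p (poly Q (cos \<theta>)) * ennreal (V \<theta> * sin \<theta>) \<partial>lborel)"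
proof -
  have B2: "1 \<le> 2 * B" using B by simp
  from bernstein_iterated[OF p B2, of "Suc s" k] obtain c C where c: "0 < c" "c \<le> 1" and C: "0 < C" "\<And>m Q V. 1 \<le> m \<Longrightarrow> degree Q \<le> m \<Longrightarrow> slow (2 * B) (Suc s) m V \<Longrightarrow>
     (\<integral>\<^sup>+\<theta>\<in>{0..pi}. pp p (poly ((pderiv ^^ k) Q) (cos \<theta>)) * ennreal ((sg m \<theta> powr p) ^ k * V \<theta>) \<partial>lborel) \<le>
        ennreal C * (\<integral>\<^sup>+\<tau>\<in>{c / real m..pi - c / real m}. pp p (poly Q (cos \<tau>)) * ennreal (V \<tau>) \<partial>lborel)"
    by blast
  from bernstein_basic[OF p, of "k + Suc s"] obtain c1 where c1: "0 < c1" "c1 \<le> 1" and "\<exists>C>0. \<forall>m Q B V \<xi>. 1 \<le> m \<longrightarrow> degree Q \<le> m \<longrightarrow> 0 \<le> B \<longrightarrow> slow B (k + Suc s) m V \<longrightarrow>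
     (\<forall>\<theta>\<in>{0..pi}. \<xi> \<theta> \<in> {0..pi} \<and> \<bar>\<xi> \<theta> - \<theta>\<bar> \<le> \<kappa> / real m) \<longrightarrow>
     (\<integral>\<^sup>+\<theta>\<in>{0..pi}. pp p (poly Q (cos (\<xi> \<theta>))) * ennreal (V \<theta>) \<partial>lborel) \<le>
        ennreal (C * B) * (\<integral>\<^sup>+\<tau>\<in>{c1 / real m..pi - c1 / real m}. pp p (poly Q (cos \<tau>)) * ennreal (V \<tau>) \<partial>lborel)"
    by blast
  then obtain C1 where C1: "0 < C1" "\<And>m Q B V \<xi>. 1 \<le> m \<Longrightarrow> degree Q \<le> m \<Longrightarrow> 0 \<le> B \<Longrightarrow> slow B (k + Suc s) m V \<Longrightarrow>
     (\<forall>\<theta>\<in>{0..pi}. \<xi> \<theta> \<in> {0..pi} \<and> \<bar>\<xi> \<theta> - \<theta>\<bar> \<le> \<kappa> / real m) \<Longrightarrow>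
     (\<integral>\<^sup>+\<theta>\<in>{0..pi}. pp p (poly Q (cos (\<xi> \<theta>))) * ennreal (V \<theta>) \<partial>lborel) \<le>
        ennreal (C1 * B) * (\<integral>\<^sup>+\<tau>\<in>{c1 / real m..pi - c1 / real m}. pp p (poly Q (cos \<tau>)) * ennreal (V \<tau>) \<partial>lborel)"
    by blast
  define D where "D = 1 + pi / (2 * c)"
  have D: "1 \<le> D" using c by (simp add: D_def)
  show ?thesis
  proof (rule exI[of _ "C1 * (2 ^ k * (2 * B)) * (C * D)"], intro conjI allI impI)
    show "0 < C1 * (2 ^ k * (2 * B)) * (C * D)" using C(1) C1(1) B D by (intro mult_pos_pos) auto
    fix m :: nat and Q :: "real poly" and V \<xi> assume m: "1 \<le> m" and Q: "degree Q \<le> m" and V: "slow B s m V"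
      and \<xi>: "\<forall>\<theta>\<in>{0..pi}. \<xi> \<theta> \<in> {0..pi} \<and> \<bar>\<xi> \<theta> - \<theta>\<bar> \<le> \<kappa> / real m"
    let ?R = "(pderiv ^^ k) Q"
    have dR: "degree ?R \<le> m" by (induction k) (use Q in \<open>auto simp: degree_pderiv\<close>)
    have V0: "\<And>\<theta>. \<theta> \<in> {0..pi} \<Longrightarrow> 0 \<le> V \<theta>" using V by (auto simp: slow_def)
    have [measurable]: "V \<in> borel_measurable borel" using V by (auto simp: slow_def)
    \<comment> \<open>The Jacobian sin \<theta> vanishes at the ends and is not slow, but m *
      \<open>sg m \<theta>\<close> = sin \<theta> + 1/m is, and dominates it. On the truncated
      interval W is bounded by a multiple of V sin \<theta> again.\<close>
    define W where "W \<theta> = V \<theta> * (real m * sg m \<theta>)" for \<theta>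
    have "slow (B * (1 * 2)) (s + (0 + 1)) m W" unfolding W_def
      by (intro slow_mult V slow_const slow_sg m) (use B in auto)
    then have W: "slow (2 * B) (Suc s) m W" by (simp add: mult.commute)
    have [measurable]: "W \<in> borel_measurable borel" using W by (auto simp: slow_def)
    have W': "slow (2 ^ k * (2 * B)) (k + Suc s) m (\<lambda>\<theta>. (sg m \<theta> powr p) ^ k * W \<theta>)"
      using slow_mult[OF slow_sg_powr[OF m, of p k] W] p B by simp
    have msg: "real m * sg m \<theta> = sin \<theta> + 1 / real m" for \<theta> using m by (simp add: sg_def field_simps power2_eq_square)
    have "(\<integral>\<^sup>+\<theta>\<in>{0..pi}. pp p (poly ?R (cos (\<xi> \<theta>))) * ennreal ((sg m \<theta> powr p) ^ k * V \<theta> * sin \<theta>) \<partial>lborel) \<le>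
      (\<integral>\<^sup>+\<theta>\<in>{0..pi}. pp p (poly ?R (cos (\<xi> \<theta>))) * ennreal ((sg m \<theta> powr p) ^ k * W \<theta>) \<partial>lborel)"
    proof (intro set_nn_integral_mono mult_left_mono ennreal_leI)
      fix \<theta> assume "\<theta> \<in> {0..pi}"
      then have "(sg m \<theta> powr p) ^ k * V \<theta> * sin \<theta> \<le> (sg m \<theta> powr p) ^ k * V \<theta> * (real m * sg m \<theta>)"
        using V0 by (intro mult_left_mono) (auto simp: msg)
      then show "(sg m \<theta> powr p) ^ k * V \<theta> * sin \<theta> \<le> (sg m \<theta> powr p) ^ k * W \<theta>" by (simp add: W_def mult.assoc)
    qed auto
    also have "\<dots> \<le> ennreal (C1 * (2 ^ k * (2 * B))) * (\<integral>\<^sup>+\<tau>\<in>{c1 / real m..pi - c1 / real m}. pp p (poly ?R (cos \<tau>)) * ennreal ((sg m \<tau> powr p) ^ k * W \<tau>) \<partial>lborel)"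
      using B by (intro C1(2) m dR W' \<xi>) auto
    also have "\<dots> \<le> ennreal (C1 * (2 ^ k * (2 * B))) * (\<integral>\<^sup>+\<tau>\<in>{0..pi}. pp p (poly ?R (cos \<tau>)) * ennreal ((sg m \<tau> powr p) ^ k * W \<tau>) \<partial>lborel)"
      using c1 by (intro mult_left_mono set_nn_integral_mono_set) (auto intro: order.trans[rotated])
    also have "\<dots> \<le> ennreal (C1 * (2 ^ k * (2 * B))) * (ennreal C * (\<integral>\<^sup>+\<tau>\<in>{c / real m..pi - c / real m}. pp p (poly Q (cos \<tau>)) * ennreal (W \<tau>) \<partial>lborel))"
      by (intro mult_left_mono C(2) m Q W) auto
    also have "(\<integral>\<^sup>+\<tau>\<in>{c / real m..pi - c / real m}. pp p (poly Q (cos \<tau>)) * ennreal (W \<tau>) \<partial>lborel) \<le> 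
       (\<integral>\<^sup>+\<tau>\<in>{c / real m..pi - c / real m}. ennreal D * (pp p (poly Q (cos \<tau>)) * ennreal (V \<tau> * sin \<tau>)) \<partial>lborel)"
    proof (rule set_nn_integral_mono)
      fix \<tau> assume \<tau>: "\<tau> \<in> {c / real m..pi - c / real m}"
      have "0 \<le> c / real m" using c by simp
      with \<tau> have \<tau>': "\<tau> \<in> {0..pi}" by auto
      note sl = sg_le_sin[OF m c \<tau>, folded D_def]
      have "real m * sg m \<tau> \<le> real m * (D * (sin \<tau> / real m))" using sl by (intro mult_left_mono) auto
      also have "\<dots> = D * sin \<tau>" using m by simp
      finally have "W \<tau> \<le> V \<tau> * (D * sin \<tau>)" unfolding W_def using V0[OF \<tau>'] by (intro mult_left_mono)
      then have "ennreal (W \<tau>) \<le> ennreal (D * (V \<tau> * sin \<tau>))" by (intro ennreal_leI) (simp add: mult_ac)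
      also have "\<dots> = ennreal D * ennreal (V \<tau> * sin \<tau>)" using D V0[OF \<tau>'] sl by (intro ennreal_mult) auto
      finally have "pp p (poly Q (cos \<tau>)) * ennreal (W \<tau>) \<le> pp p (poly Q (cos \<tau>)) * (ennreal D * ennreal (V \<tau> * sin \<tau>))"
        by (intro mult_left_mono) auto
      then show "pp p (poly Q (cos \<tau>)) * ennreal (W \<tau>) \<le> ennreal D * (pp p (poly Q (cos \<tau>)) * ennreal (V \<tau> * sin \<tau>))"
        by (simp only: mult_ac)
    qed
    also have "\<dots> = ennreal D * (\<integral>\<^sup>+\<tau>\<in>{c / real m..pi - c / real m}. pp p (poly Q (cos \<tau>)) * ennreal (V \<tau> * sin \<tau>) \<partial>lborel)"
      by (simp add: mult.assoc nn_integral_cmult)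
    also have "\<dots> \<le> ennreal D * (\<integral>\<^sup>+\<tau>\<in>{0..pi}. pp p (poly Q (cos \<tau>)) * ennreal (V \<tau> * sin \<tau>) \<partial>lborel)"
      using c by (intro mult_left_mono set_nn_integral_mono_set) (auto intro: order.trans[rotated])
    finally have "(\<integral>\<^sup>+\<theta>\<in>{0..pi}. pp p (poly ?R (cos (\<xi> \<theta>))) * ennreal ((sg m \<theta> powr p) ^ k * V \<theta> * sin \<theta>) \<partial>lborel) \<le>
       ennreal (C1 * (2 ^ k * (2 * B))) * (ennreal C * (ennreal D * (\<integral>\<^sup>+\<tau>\<in>{0..pi}. pp p (poly Q (cos \<tau>)) * ennreal (V \<tau> * sin \<tau>) \<partial>lborel)))"
      by (simp add: mult_left_mono)
    also have "\<dots> = ennreal (C1 * (2 ^ k * (2 * B)) * (C * D)) * (\<integral>\<^sup>+\<tau>\<in>{0..pi}. pp p (poly Q (cos \<tau>)) * ennreal (V \<tau> * sin \<tau>) \<partial>lborel)"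
      using C(1) C1(1) B D by (simp add: ennreal_mult mult.assoc)
    finally show "(\<integral>\<^sup>+\<theta>\<in>{0..pi}. pp p (poly ?R (cos (\<xi> \<theta>))) * ennreal ((sg m \<theta> powr p) ^ k * V \<theta> * sin \<theta>) \<partial>lborel) \<le>
        ennreal (C1 * (2 ^ k * (2 * B)) * (C * D)) * (\<integral>\<^sup>+\<theta>\<in>{0..pi}. pp p (poly Q (cos \<theta>)) * ennreal (V \<theta> * sin \<theta>) \<partial>lborel)" .
  qed
qed

section \<open>Averages of doubling weights\<close>

definition mass :: "(real \<Rightarrow> real) \<Rightarrow> real \<Rightarrow> real \<Rightarrow> real" where
  "mass w a b = (LINT u:{a..b}|lebesgue. w u)"

lemma doubling_weight_integrable:
  assumes "doubling_weight w"
  shows "integrable lebesgue w" and "\<And>x. 0 \<le> w x" and "\<And>x. x \<notin> {-1..1} \<Longrightarrow> w x = 0"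
proof -
  have eq: "(\<lambda>x. indicat_real {-1..1} x *\<^sub>R w x) = w"
    using assms by (auto simp: doubling_weight_def fun_eq_iff indicator_def)
  show "integrable lebesgue w" using assms unfolding doubling_weight_def set_integrable_def eq by blast
  show 0: "\<And>x. x \<notin> {-1..1} \<Longrightarrow> w x = 0" using assms by (simp add: doubling_weight_def)
  show "\<And>x. 0 \<le> w x" using assms 0 unfolding doubling_weight_def by (metis order_refl)
qed

lemma rho_pos: "1 \<le> n \<Longrightarrow> x \<in> {-1..1} \<Longrightarrow> 0 < rho n x"
  unfolding rho_def by (intro add_nonneg_pos divide_nonneg_nonneg real_sqrt_ge_zero) (auto simp: abs_square_le_1 power2_le_iff_abs_le abs_le_iff)

lemma rho_cos: "\<theta> \<in> {0..pi} \<Longrightarrow> rho n (cos \<theta>) = sg n \<theta>"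
  by (simp add: rho_def sg_def sin_ge_zero flip: sin_squared_eq)

lemma rho_antimono: "1 \<le> m \<Longrightarrow> m \<le> n \<Longrightarrow> x \<in> {-1..1} \<Longrightarrow> rho n x \<le> rho m x"
  unfolding rho_def by (intro add_mono divide_left_mono power_mono mult_pos_pos zero_less_power real_sqrt_ge_zero)
    (auto simp: abs_square_le_1 abs_le_iff)

context
  fixes w :: "real \<Rightarrow> real"
  assumes w: "doubling_weight w"
begin

lemma set_integrable_weight: "A \<in> sets lebesgue \<Longrightarrow> set_integrable lebesgue A w"
  unfolding set_integrable_def by (intro integrable_mult_indicator doubling_weight_integrable[OF w])

lemma set_integral_weight_mono:
  assumes "A \<in> sets lebesgue" "B \<in> sets lebesgue" "A \<inter> {-1..1} \<subseteq> B"
  shows "(LINT u:A|lebesgue. w u) \<le> (LINT u:B|lebesgue. w u)"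
  unfolding set_lebesgue_integral_def
proof (intro integral_mono)
  fix x :: real
  show "indicat_real A x *\<^sub>R w x \<le> indicat_real B x *\<^sub>R w x"
    using assms(3) doubling_weight_integrable[OF w] by (cases "x \<in> {-1..1}") (auto simp: indicator_def)
qed (use assms set_integrable_weight in \<open>auto simp: set_integrable_def\<close>)

lemma mass_mono: "{a..b} \<inter> {-1..1} \<subseteq> {c..d} \<Longrightarrow> mass w a b \<le> mass w c d"
  unfolding mass_def by (intro set_integral_weight_mono) auto

lemma mass_nonneg: "0 \<le> mass w a b"
  unfolding mass_def set_lebesgue_integral_def
  by (intro integral_nonneg_AE AE_I2) (simp add: doubling_weight_integrable[OF w])

text \<open>Doubling is given only for intervals inside [-1,1], so the interval about y is clipped
  first. For R < 2 the clipped interval still has length at least R/2; doubling it adds at least R/4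
  on each side, which is where 5/4 comes from. For R >= 2 it already covers [-1,1].\<close>

lemma mass_doubling_step:
  obtains L where "1 \<le> L" "\<And>y R. y \<in> {-1..1} \<Longrightarrow> 0 < R \<Longrightarrow> mass w (y - 5/4 * R) (y + 5/4 * R) \<le> L * mass w (y - R) (y + R)"
proof -
  obtain L0 where L0: "doubling_constant w L0" using w by (auto simp: doubling_weight_def)
  define L where "L = max L0 1"
  have L: "mass w (a - (b - a) / 2) (b + (b - a) / 2) \<le> L * mass w a b" if "-1 \<le> a" "a < b" "b \<le> 1" for a b
  proof -
    have "mass w (a - (b - a) / 2) (b + (b - a) / 2) \<le> L0 * mass w a b"
      using L0 that by (auto simp: doubling_constant_def mass_def)
    also have "\<dots> \<le> L * mass w a b" by (intro mult_right_mono mass_nonneg) (simp add: L_def)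
    finally show ?thesis .
  qed
  have "mass w (y - 5/4 * R) (y + 5/4 * R) \<le> L * mass w (y - R) (y + R)" if y: "y \<in> {-1..1}" and R: "0 < R" for y R
  proof (cases "2 \<le> R")
    case True
    have "mass w (y - 5/4 * R) (y + 5/4 * R) \<le> 1 * mass w (y - R) (y + R)" using True y by (simp add: mass_mono)
    also have "\<dots> \<le> L * mass w (y - R) (y + R)" by (intro mult_right_mono mass_nonneg) (simp add: L_def)
    finally show ?thesis .
  next
    case False
    define a b where "a = max (-1) (y - R)" and "b = min 1 (y + R)"
    have ab: "-1 \<le> a" "b \<le> 1" "R / 2 \<le> b - a" using y R False by (auto simp: a_def b_def max_def min_def)
    have "mass w (y - 5/4 * R) (y + 5/4 * R) \<le> mass w (a - (b - a) / 2) (b + (b - a) / 2)"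
    proof (rule mass_mono, rule subsetI)
      fix x assume x: "x \<in> {y - 5/4 * R..y + 5/4 * R} \<inter> {-1..1}"
      have "a = -1 \<or> a = y - R" "b = 1 \<or> b = y + R" by (auto simp: a_def b_def)
      moreover define e where "e = (b - a) / 2"
      moreover have "R / 4 \<le> e" using ab by (simp add: e_def)
      ultimately have "a - e \<le> x \<and> x \<le> b + e" using x R unfolding Int_iff atLeastAtMost_iff by linarith
      then show "x \<in> {a - (b - a) / 2..b + (b - a) / 2}" by (simp add: e_def)
    qed
    also have "\<dots> \<le> L * mass w a b" using ab R by (intro L) auto
    also have "\<dots> \<le> L * mass w (y - R) (y + R)" by (intro mult_left_mono mass_mono) (auto simp: a_def b_def L_def)
    finally show ?thesis .
  qed
  then show ?thesis using that[of L] by (simp add: L_def)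
qed

text \<open>Iteration of the factor 5/4: the least k with l <= (5/4)^k satisfies (5/4)^k <= 5/4 l,
  and choosing s with L <= (5/4)^s turns L^k into a power of l.\<close>

lemma mass_growth:
  obtains K s where "1 \<le> K" "\<And>y R l. y \<in> {-1..1} \<Longrightarrow> 0 < R \<Longrightarrow> 1 \<le> l \<Longrightarrow> mass w (y - l * R) (y + l * R) \<le> K * l ^ s * mass w (y - R) (y + R)"
proof -
  obtain L where L1: "1 \<le> L" and L: "\<And>y R. y \<in> {-1..1} \<Longrightarrow> 0 < R \<Longrightarrow> mass w (y - 5/4 * R) (y + 5/4 * R) \<le> L * mass w (y - R) (y + R)"
    by (rule mass_doubling_step[OF that])
  have iter: "mass w (y - (5/4) ^ k * R) (y + (5/4) ^ k * R) \<le> L ^ k * mass w (y - R) (y + R)" if "y \<in> {-1..1}" "0 < R" for y R k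
  proof (induction k)
    case (Suc k)
    have "mass w (y - (5/4) ^ Suc k * R) (y + (5/4) ^ Suc k * R) \<le> L * mass w (y - (5/4) ^ k * R) (y + (5/4) ^ k * R)"
      using L[of y "(5/4) ^ k * R"] that by (simp add: mult.assoc)
    also have "\<dots> \<le> L * (L ^ k * mass w (y - R) (y + R))" using Suc L1 by (intro mult_left_mono) auto
    finally show ?case by (simp add: mult.assoc)
  qed simp
  obtain s where s: "L \<le> (5/4) ^ s" using real_arch_pow[of "5/4" L] by (auto intro: less_imp_le)
  show ?thesis
  proof (rule that[of "(5/4) ^ s" s])
    show "1 \<le> (5/4 :: real) ^ s" by (rule one_le_power) simp
    fix y R l :: real assume y: "y \<in> {-1..1}" and R: "0 < R" and l: "1 \<le> l"
    define k where "k = (LEAST k. l \<le> (5/4) ^ k)"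
    have ex: "\<exists>k. l \<le> (5/4) ^ k" using real_arch_pow[of "5/4" l] by (auto intro: less_imp_le)
    have k1: "l \<le> (5/4) ^ k" unfolding k_def by (rule LeastI_ex[OF ex])
    have k2: "(5/4) ^ k \<le> 5/4 * l"
    proof (cases k)
      case 0
      then show ?thesis using l by simp
    next
      case (Suc j)
      then have "\<not> l \<le> (5/4) ^ j" unfolding k_def using not_less_Least[of j "\<lambda>k. l \<le> (5/4) ^ k"] by simp
      then show ?thesis using Suc by simp
    qed
    have "l * R \<le> (5/4) ^ k * R" using k1 R by (intro mult_right_mono) auto
    then have "mass w (y - l * R) (y + l * R) \<le> mass w (y - (5/4) ^ k * R) (y + (5/4) ^ k * R)"
      by (intro mass_mono) auto
    also have "\<dots> \<le> L ^ k * mass w (y - R) (y + R)" by (rule iter[OF y R])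
    also have "\<dots> \<le> ((5/4) ^ s * l ^ s) * mass w (y - R) (y + R)"
    proof (intro mult_right_mono mass_nonneg)
      have "L ^ k \<le> ((5/4) ^ s) ^ k" using s L1 by (intro power_mono) auto
      also have "\<dots> = ((5/4) ^ k) ^ s" by (simp add: mult.commute flip: power_mult)
      also have "\<dots> \<le> (5/4 * l) ^ s" using k2 by (intro power_mono) auto
      also have "\<dots> = (5/4) ^ s * l ^ s" by (rule power_mult_distrib)
      finally show "L ^ k \<le> (5/4) ^ s * l ^ s" .
    qed
    finally show "mass w (y - l * R) (y + l * R) \<le> (5/4) ^ s * l ^ s * mass w (y - R) (y + R)" .
  qed
qed

section \<open>Regularity of the averaged weight in the point and in the index\<close>

lemma avg_weight_eq: "avg_weight w n x = mass w (x - rho n x) (x + rho n x) / rho n x"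
  by (simp add: avg_weight_def mass_def)

lemma avg_weight_nonneg: "1 \<le> n \<Longrightarrow> x \<in> {-1..1} \<Longrightarrow> 0 \<le> avg_weight w n x"
  unfolding avg_weight_eq using rho_pos by (intro divide_nonneg_nonneg mass_nonneg) (auto intro: less_imp_le)

text \<open>w itself is only Lebesgue measurable. The mass of an interval is a difference of two
  monotone functions of its endpoints, and monotone functions are Borel.\<close>

lemma avg_weight_measurable [measurable]: "avg_weight w n \<in> borel_measurable borel"
proof -
  have rho[measurable]: "rho n \<in> borel_measurable borel"
    unfolding rho_def[abs_def] by measurable
  let ?F = "\<lambda>b. LINT u:{..b}|lebesgue. w u" and ?G = "\<lambda>b. LINT u:{..<b}|lebesgue. w u"
  have "mono ?F" "mono ?G" by (auto intro!: monoI set_integral_weight_mono)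
  then have [measurable]: "?F \<in> borel_measurable borel" "?G \<in> borel_measurable borel" by (auto intro: borel_measurable_mono)
  have "mass w a b = (if a \<le> b then ?F b - ?G a else 0)" for a b
  proof (cases "a \<le> b")
    case True
    then have "?F b = ?G a + mass w a b" unfolding mass_def
      by (subst set_integral_Un[symmetric]) (auto intro!: set_integrable_weight arg_cong[where f="\<lambda>A. LINT u:A|lebesgue. w u"])
    then show ?thesis using True by simp
  qed (simp add: mass_def set_lebesgue_integral_def)
  then have "avg_weight w n = (\<lambda>x. (if x - rho n x \<le> x + rho n x then ?F (x + rho n x) - ?G (x - rho n x) else 0) / rho n x)"
    by (simp add: avg_weight_eq fun_eq_iff)
  also have "\<dots> \<in> borel_measurable borel" by measurable
  finally show ?thesis .
qed

text \<open>With t = n |\<theta> - \<tau>| the points cos \<theta> and cos \<tau> differ by at most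
  (t + t^2) \<open>sg n \<tau>\<close>. So the averaging interval at cos \<theta> lies in the one at
  cos \<tau> dilated by 4 (1 + t^2), and \<open>mass_growth\<close> applies. The ratio of the two
  lengths costs one further power.\<close>

lemma avg_weight_slow:
  obtains B s where "1 \<le> B" "\<And>n. 1 \<le> n \<Longrightarrow> slow B s n (\<lambda>\<theta>. avg_weight w n (cos \<theta>))"
proof -
  obtain K s where K: "1 \<le> K" and grow: "\<And>y R l. y \<in> {-1..1} \<Longrightarrow> 0 < R \<Longrightarrow> 1 \<le> l \<Longrightarrow> mass w (y - l * R) (y + l * R) \<le> K * l ^ s * mass w (y - R) (y + R)"
    by (rule mass_growth[OF that])
  show ?thesis
  proof (rule that[of "2 * K * 4 ^ s" "Suc s"])
    have "1 * 1 \<le> (2 * K) * 4 ^ s" using K by (intro mult_mono one_le_power) auto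
    then show "1 \<le> 2 * K * 4 ^ s" by simp
    fix n :: nat assume n: "1 \<le> n"
    show "slow (2 * K * 4 ^ s) (Suc s) n (\<lambda>\<theta>. avg_weight w n (cos \<theta>))"
      unfolding slow_def
    proof (intro conjI ballI)
      fix \<theta> \<tau> :: real assume \<theta>: "\<theta> \<in> {0..pi}" and \<tau>: "\<tau> \<in> {0..pi}"
      define d where "d = \<bar>\<theta> - \<tau>\<bar>"
      define t where "t = real n * d"
      define E where "E = 1 + (real n * (\<theta> - \<tau>))\<^sup>2"
      have E: "E = 1 + t\<^sup>2" by (simp add: E_def t_def d_def power_mult_distrib)
      have E1: "1 \<le> E" by (simp add: E)
      have d0: "0 \<le> d" by (simp add: d_def)
      define R where "R = \<bar>cos \<theta> - cos \<tau>\<bar> + sg n \<theta>"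
      have sgp: "0 < sg n \<theta>" "0 < sg n \<tau>" using sg_pos n \<theta> \<tau> by auto
      have sg1: "sg n \<theta> \<le> 2 * E * sg n \<tau>" using slow_sg[OF n] \<theta> \<tau> by (auto simp: slow_def E_def)
      have sg2: "sg n \<tau> \<le> 2 * E * sg n \<theta>" using slow_sg[OF n] \<theta> \<tau> unfolding slow_def E_def
        by (metis (no_types, opaque_lifting) power2_commute power_mult_distrib power_one_right)
      have sin\<tau>: "0 \<le> sin \<tau>" using \<tau> by (intro sin_ge_zero) auto
      have "\<bar>cos \<theta> - cos \<tau>\<bar> \<le> (t + t\<^sup>2) * sg n \<tau>"
      proof -
        have "\<bar>cos \<theta> - cos \<tau>\<bar> = 2 * (\<bar>sin ((\<theta> + \<tau>) / 2)\<bar> * \<bar>sin ((\<tau> - \<theta>) / 2)\<bar>)"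
          by (simp add: cos_diff_cos abs_mult)
        also have "\<bar>sin ((\<theta> + \<tau>) / 2)\<bar> * \<bar>sin ((\<tau> - \<theta>) / 2)\<bar> \<le> (sin \<tau> + d) * (d / 2)"
        proof (rule mult_mono)
          show "\<bar>sin ((\<tau> - \<theta>) / 2)\<bar> \<le> d / 2" using abs_sin_x_le_abs_x[of "(\<tau> - \<theta>) / 2"] by (simp add: d_def abs_minus_commute)
          show "\<bar>sin ((\<theta> + \<tau>) / 2)\<bar> \<le> sin \<tau> + d"
        proof -
          have "0 \<le> sin ((\<theta> + \<tau>) / 2)" using \<theta> \<tau> by (intro sin_ge_zero) auto
          moreover have "sin ((\<theta> + \<tau>) / 2) \<le> sin \<tau> + \<bar>(\<theta> + \<tau>) / 2 - \<tau>\<bar>" by (rule sin_le_add)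
          moreover have "\<bar>(\<theta> + \<tau>) / 2 - \<tau>\<bar> \<le> d" 
          proof -
            have "(\<theta> + \<tau>) / 2 - \<tau> = (\<theta> - \<tau>) / 2" by (simp add: field_simps)
            then show ?thesis by (simp add: d_def)
          qed
          ultimately show ?thesis by linarith
        qed
        qed (use sin\<tau> d0 in auto)
        finally have "\<bar>cos \<theta> - cos \<tau>\<bar> \<le> d * sin \<tau> + d * d" by (simp add: algebra_simps)
        also have "\<dots> = t * (sin \<tau> / real n) + t\<^sup>2 * (1 / (real n)\<^sup>2)" using n by (simp add: t_def power2_eq_square)
        also have "\<dots> \<le> t * sg n \<tau> + t\<^sup>2 * sg n \<tau>" using d0 sin\<tau> by (intro add_mono mult_left_mono) (auto simp: sg_def t_def)
        finally show ?thesis by (simp add: distrib_right)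
      qed
      moreover have "t + t\<^sup>2 + 2 * E \<le> 4 * E"
      proof -
        have "2 * t \<le> t\<^sup>2 + 1" using zero_le_power2[of "t - 1"] by (simp add: power2_diff)
        moreover have "0 \<le> t\<^sup>2" by simp
        ultimately have "t \<le> 2 + t\<^sup>2" by linarith
        then show ?thesis by (simp add: E)
      qed
      ultimately have R: "R \<le> (4 * E) * sg n \<tau>"
        unfolding R_def using sg1 sgp mult_right_mono[of "t + t\<^sup>2 + 2 * E" "4 * E" "sg n \<tau>"] by (simp add: distrib_right)
      have "mass w (cos \<theta> - sg n \<theta>) (cos \<theta> + sg n \<theta>) \<le> mass w (cos \<tau> - (4 * E) * sg n \<tau>) (cos \<tau> + (4 * E) * sg n \<tau>)"
        using R by (intro mass_mono) (auto simp: R_def)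
      also have "\<dots> \<le> K * (4 * E) ^ s * mass w (cos \<tau> - sg n \<tau>) (cos \<tau> + sg n \<tau>)"
        using E1 sgp by (intro grow) auto
      also have "\<dots> = K * (4 * E) ^ s * (sg n \<tau> * avg_weight w n (cos \<tau>))"
        using sgp by (simp add: avg_weight_eq rho_cos[OF \<tau>])
      also have "\<dots> \<le> K * (4 * E) ^ s * (2 * E * sg n \<theta> * avg_weight w n (cos \<tau>))"
        using K E1 n by (intro mult_left_mono mult_right_mono sg2 avg_weight_nonneg) auto
      also have "\<dots> = (2 * K * 4 ^ s * E ^ Suc s * avg_weight w n (cos \<tau>)) * sg n \<theta>" by (simp add: power_mult_distrib mult_ac)
      finally show "avg_weight w n (cos \<theta>) \<le> 2 * K * 4 ^ s * (1 + (real n * (\<theta> - \<tau>))\<^sup>2) ^ Suc s * avg_weight w n (cos \<tau>)"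
        unfolding avg_weight_eq[of n "cos \<theta>"] E_def[symmetric] rho_cos[OF \<theta>] using sgp by (simp add: pos_divide_le_eq)
    next
      fix \<theta> :: real assume "\<theta> \<in> {0..pi}"
      then show "0 \<le> avg_weight w n (cos \<theta>)" using n by (intro avg_weight_nonneg) auto
    next
      show "(\<lambda>\<theta>. avg_weight w n (cos \<theta>)) \<in> borel_measurable borel"
        by (rule measurable_compose[OF _ avg_weight_measurable]) measurable
    qed
  qed
qed

text \<open>The averaging intervals are nested, so their masses are comparable although the averages
  need not be; multiplying by \<rho> gives back the masses.\<close>

lemma avg_weight_compare:
  assumes "1 \<le> m" "m \<le> n" "x \<in> {-1..1}"
  shows "rho n x * avg_weight w n x \<le> rho m x * avg_weight w m x"
  using rho_antimono[OF assms] rho_pos[of m x] rho_pos[of n x] assms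
  by (auto simp: avg_weight_eq intro!: mass_mono)

text \<open>The square is due to the summand 1/n^2 of \<rho>.\<close>

lemma avg_weight_compare_const:
  assumes m: "1 \<le> m" "m \<le> n" "n \<le> K * m" and x: "x \<in> {-1..1}"
  shows "avg_weight w n x \<le> (real K)\<^sup>2 * avg_weight w m x"
proof -
  have K: "1 \<le> real K" using m by (cases K) auto
  have s: "0 \<le> sqrt (1 - x\<^sup>2)" using x by (auto simp: abs_square_le_1 abs_le_iff)
  have nK: "real n \<le> real K * real m" using m(3) by (simp flip: of_nat_mult)
  have "rho m x \<le> (real K)\<^sup>2 * rho n x"
  proof -
    have "1 / real m \<le> real K / real n" using nK m by (simp add: field_simps)
    also have "\<dots> \<le> (real K)\<^sup>2 / real n" using K by (intro divide_right_mono) (auto simp: power2_eq_square)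
    finally have "sqrt (1 - x\<^sup>2) * (1 / real m) \<le> sqrt (1 - x\<^sup>2) * ((real K)\<^sup>2 / real n)" using s by (intro mult_left_mono)
    moreover have "1 / (real m)\<^sup>2 \<le> (real K)\<^sup>2 / (real n)\<^sup>2"
      using power_mono[OF nK, of 2] m by (simp add: power_mult_distrib field_simps)
    ultimately show ?thesis by (simp add: rho_def distrib_left mult.commute)
  qed
  then have "rho n x * avg_weight w n x \<le> ((real K)\<^sup>2 * rho n x) * avg_weight w m x"
    using avg_weight_compare[OF m(1,2) x] avg_weight_nonneg[OF m(1) x] by (meson mult_right_mono order.trans)
  then have "rho n x * avg_weight w n x \<le> rho n x * ((real K)\<^sup>2 * avg_weight w m x)" by (simp add: mult_ac)
  then show ?thesis using rho_pos[of n x] m x by (simp add: mult_le_cancel_left_pos)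
qed

lemma avg_weight_bounded:
  assumes n: "1 \<le> n" and x: "x \<in> {-1..1}"
  shows "avg_weight w n x \<le> (real n)\<^sup>2 * mass w (-1) 1"
proof -
  have s: "0 \<le> sqrt (1 - x\<^sup>2)" using x by (auto simp: abs_square_le_1 abs_le_iff)
  then have r: "1 / (real n)\<^sup>2 \<le> rho n x" by (simp add: rho_def)
  have "avg_weight w n x \<le> mass w (-1) 1 / rho n x" unfolding avg_weight_eq 
    using rho_pos[OF n x] by (intro divide_right_mono mass_mono) auto
  also have "\<dots> \<le> mass w (-1) 1 / (1 / (real n)\<^sup>2)" using r n rho_pos[OF n x] by (intro divide_left_mono mass_nonneg mult_pos_pos) auto
  finally show ?thesis by (simp add: mult.commute)
qed

end

section \<open>Weighted symmetric differences\<close>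

lemma nn_integral_cos_subst:
  fixes F :: "real \<Rightarrow> ennreal"
  assumes [measurable]: "F \<in> borel_measurable borel"
  shows "(\<integral>\<^sup>+x\<in>{-1..1}. F x \<partial>lborel) = (\<integral>\<^sup>+\<theta>\<in>{0..pi}. F (cos \<theta>) * ennreal (sin \<theta>) \<partial>lborel)"
proof -
  \<comment> \<open>The substitution rule needs an increasing function, so x is reflected and -cos
    is substituted.\<close>
  have "(\<integral>\<^sup>+x\<in>{-1..1}. F x \<partial>lborel) = ennreal \<bar>-1::real\<bar> * (\<integral>\<^sup>+x. F (0 + (-1) * x) * indicator {-1..1} (0 + (-1) * x) \<partial>lborel)"
    by (rule nn_integral_real_affine) auto
  also have "\<dots> = (\<integral>\<^sup>+x. F (- x) * indicator {- cos 0..- cos pi} x \<partial>lborel)"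
    by (auto intro!: nn_integral_cong split: split_indicator)
  also have "\<dots> = (\<integral>\<^sup>+\<theta>. F (- (- cos \<theta>)) * ennreal (sin \<theta>) * indicator {0..pi} \<theta> \<partial>lborel)"
    by (rule nn_integral_substitution_aux[where f="\<lambda>x. F (- x)" and g="\<lambda>\<theta>. - cos \<theta>" and g'=sin])
       (auto intro!: derivative_eq_intros continuous_intros sin_ge_zero)
  finally show ?thesis by simp
qed

section \<open>Position and angle of the nodes of a symmetric difference\<close>

lemma phi_cos: "\<theta> \<in> {0..pi} \<Longrightarrow> phi (cos \<theta>) = sin \<theta>"
  by (simp add: phi_def sin_ge_zero flip: sin_squared_eq)

lemma phi_nonneg: "x \<in> {-1..1} \<Longrightarrow> 0 \<le> phi x"
  by (auto simp: phi_def abs_square_le_1 abs_le_iff)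

lemma phi_measurable [measurable]: "phi \<in> borel_measurable borel"
  unfolding phi_def[abs_def] by measurable

text \<open>Points \<open>x\<close> for which all arguments of a symmetric difference with total width \<open>2 k \<phi>(x)\<close> lie in \<open>[-1,1]\<close>.\<close>

definition admissible :: "real \<Rightarrow> real \<Rightarrow> bool" where
  "admissible k x \<longleftrightarrow> x \<in> {-1..1} \<and> \<bar>x\<bar> + k * phi x \<le> 1"

lemma admissible_measurable [measurable]: "Measurable.pred borel (admissible k)"
  unfolding admissible_def by measurable

text \<open>Square k \<phi>(x) <= 1 - |x|, use \<phi>(x)^2 = (1 - |x|)(1 + |x|) and cancel 1 - |x|.
  The endpoints are exceptional because they are always admissible, \<phi> being 0 there.\<close>

lemma admissible_bound:
  assumes "admissible k x" "0 < k" "\<bar>x\<bar> \<noteq> 1"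
  shows "\<bar>x\<bar> \<le> (1 - k\<^sup>2) / (1 + k\<^sup>2)"
proof -
  have x: "\<bar>x\<bar> < 1" "k * phi x \<le> 1 - \<bar>x\<bar>" using assms by (auto simp: admissible_def)
  have ph: "(phi x)\<^sup>2 = (1 - \<bar>x\<bar>) * (1 + \<bar>x\<bar>)"
  proof -
    have "x\<^sup>2 \<le> 1" using x by (simp add: abs_square_le_1)
    then have "(phi x)\<^sup>2 = 1 - \<bar>x\<bar>\<^sup>2" by (simp add: phi_def)
    then show ?thesis by (simp add: power2_eq_square algebra_simps)
  qed
  have "0 \<le> k * phi x" using assms by (intro mult_nonneg_nonneg phi_nonneg) (auto simp: admissible_def)
  then have "(k * phi x)\<^sup>2 \<le> (1 - \<bar>x\<bar>)\<^sup>2" using x by (intro power_mono) auto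
  moreover have "(k * phi x)\<^sup>2 = (1 - \<bar>x\<bar>) * (k\<^sup>2 * (1 + \<bar>x\<bar>))" unfolding power_mult_distrib ph by simp
  ultimately have "(1 - \<bar>x\<bar>) * (k\<^sup>2 * (1 + \<bar>x\<bar>)) \<le> (1 - \<bar>x\<bar>) * (1 - \<bar>x\<bar>)" by (simp only: power2_eq_square[of "1 - \<bar>x\<bar>"])
  then have "k\<^sup>2 * (1 + \<bar>x\<bar>) \<le> 1 - \<bar>x\<bar>" using x by (simp add: mult_le_cancel_left_pos)
  moreover have "0 < 1 + k\<^sup>2" by (simp add: add_pos_nonneg)
  ultimately show ?thesis by (simp add: pos_le_divide_eq algebra_simps)
qed

text \<open>The last claim bounds the derivative of k \<phi> by 1/2. It follows from k \<phi>(x) <=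
  1 - |x| through 2 |x| (1 - |x|) <= (1 + |x|)(1 - |x|) = \<phi>(x)^2.\<close>

lemma bound_admissible:
  assumes "\<bar>x\<bar> \<le> (1 - k\<^sup>2) / (1 + k\<^sup>2)" "0 < k"
  shows "0 < phi x" "k * phi x \<le> 1 - \<bar>x\<bar>" "\<bar>x\<bar> < 1" "k * \<bar>x\<bar> / phi x \<le> 1 / 2"
proof -
  have k0: "0 < 1 + k\<^sup>2" by (simp add: add_pos_nonneg)
  have "\<bar>x\<bar> * (1 + k\<^sup>2) \<le> 1 - k\<^sup>2" using assms k0 by (simp add: pos_le_divide_eq)
  then have le: "k\<^sup>2 * (1 + \<bar>x\<bar>) \<le> 1 - \<bar>x\<bar>" by (simp add: algebra_simps)
  have "0 < k\<^sup>2 * (1 + \<bar>x\<bar>)" using assms by (intro mult_pos_pos) auto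
  with le show x1: "\<bar>x\<bar> < 1" by simp
  have ph2: "(phi x)\<^sup>2 = (1 - \<bar>x\<bar>) * (1 + \<bar>x\<bar>)"
  proof -
    have "x\<^sup>2 \<le> 1" using x1 by (simp add: abs_square_le_1)
    then have "(phi x)\<^sup>2 = 1 - \<bar>x\<bar>\<^sup>2" by (simp add: phi_def)
    then show ?thesis by (simp add: power2_eq_square algebra_simps)
  qed
  have "x\<^sup>2 < 1" using x1 by (simp add: abs_square_less_1)
  then show ph: "0 < phi x" by (simp add: phi_def)
  have "(k * phi x)\<^sup>2 = (1 - \<bar>x\<bar>) * (k\<^sup>2 * (1 + \<bar>x\<bar>))" unfolding power_mult_distrib ph2 by simp
  also have "\<dots> \<le> (1 - \<bar>x\<bar>) * (1 - \<bar>x\<bar>)" using le x1 by (intro mult_left_mono) auto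
  also have "\<dots> = (1 - \<bar>x\<bar>)\<^sup>2" by (rule power2_eq_square[symmetric])
  finally have "(k * phi x)\<^sup>2 \<le> (1 - \<bar>x\<bar>)\<^sup>2" .
  moreover have "0 \<le> 1 - \<bar>x\<bar>" using x1 by simp
  ultimately show kp: "k * phi x \<le> 1 - \<bar>x\<bar>" by (rule power2_le_imp_le)
  have "2 * (k * \<bar>x\<bar>) * phi x \<le> 2 * \<bar>x\<bar> * (1 - \<bar>x\<bar>)" using mult_left_mono[OF kp, of "2 * \<bar>x\<bar>"] by (simp add: mult_ac)
  also have "\<dots> \<le> (1 + \<bar>x\<bar>) * (1 - \<bar>x\<bar>)" using x1 by (intro mult_right_mono) auto
  also have "\<dots> = phi x * phi x" using ph2 by (simp add: power2_eq_square mult_ac)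
  finally have "2 * (k * \<bar>x\<bar>) \<le> phi x" using ph by simp
  then show "k * \<bar>x\<bar> / phi x \<le> 1 / 2" using ph by (simp add: divide_le_eq)
qed

lemma phi_deriv:
  assumes "\<bar>x\<bar> < 1"
  shows "(phi has_real_derivative - x / phi x) (at x)"
proof -
  have "0 < 1 - x\<^sup>2" using assms by (simp add: abs_square_less_1)
  then show ?thesis unfolding phi_def[abs_def]
    by (auto intro!: derivative_eq_intros simp: divide_simps)
qed

text \<open>On the admissible set the map \<open>x \<mapsto> x + c \<phi>(x)\<close> has derivative at least \<open>1/2\<close>.\<close>

lemma shift_subst:
  fixes G :: "real \<Rightarrow> ennreal"
  assumes [measurable]: "G \<in> borel_measurable borel" and k: "0 < k" and c: "\<bar>c\<bar> \<le> k"
  shows "(\<integral>\<^sup>+x. (if admissible k x then G (x + c * phi x) else 0) \<partial>lborel) \<le> 2 * (\<integral>\<^sup>+x\<in>{-1..1}. G x \<partial>lborel)"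
proof -
  \<comment> \<open>Apart from the endpoints of [-1,1], the admissible set is the interval [-a,a],
    by \<open>admissible_bound\<close> and \<open>bound_admissible\<close>.\<close>
  define a where "a = (1 - k\<^sup>2) / (1 + k\<^sup>2)"
  let ?y = "\<lambda>x. x + c * phi x" and ?y' = "\<lambda>x. 1 + c * (- x / phi x)"
  have "(\<integral>\<^sup>+x. (if admissible k x then G (?y x) else 0) \<partial>lborel) \<le> (\<integral>\<^sup>+x\<in>{-a..a}. G (?y x) \<partial>lborel)"
  proof (rule nn_integral_mono_AE)
    \<comment> \<open>The two endpoints are admissible but may lie outside [-a,a]; they form a null
      set.\<close>
    have "AE x in lborel. x \<notin> {-1, 1 :: real}" by (rule AE_not_in) (simp add: finite_imp_null_set_lborel)
    then show "AE x in lborel. (if admissible k x then G (?y x) else 0) \<le> G (?y x) * indicator {-a..a} x"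
    proof eventually_elim
      case (elim x)
      then have "\<bar>x\<bar> \<noteq> 1" by auto
      then show ?case using admissible_bound[of k x] k by (auto simp: a_def abs_le_iff split: split_indicator)
    qed
  qed
  also have "\<dots> \<le> 2 * (\<integral>\<^sup>+x\<in>{-1..1}. G x \<partial>lborel)"
  proof (cases "0 < a")
    case False
    then have "{-a..a} \<subseteq> {0}" by auto
    then have "(\<integral>\<^sup>+x\<in>{-a..a}. G (?y x) \<partial>lborel) \<le> (\<integral>\<^sup>+x\<in>{0}. G (?y x) \<partial>lborel)" by (rule set_nn_integral_mono_set)
    also have "\<dots> = 0" by (subst nn_integral_indicator_singleton) auto
    finally show ?thesis by simp
  next
    case True
    have bd: "0 < phi x" "k * phi x \<le> 1 - \<bar>x\<bar>" "\<bar>x\<bar> < 1" "k * \<bar>x\<bar> / phi x \<le> 1 / 2" if "x \<in> {-a..a}" for x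
      using bound_admissible[of x k] that k by (auto simp: a_def abs_le_iff)
    have y': "1 / 2 \<le> ?y' x" if "x \<in> {-a..a}" for x
    proof -
      have "\<bar>c * (- x / phi x)\<bar> = \<bar>c\<bar> * \<bar>x\<bar> / phi x" using bd(1)[OF that] by (simp add: abs_mult abs_divide)
      also have "\<dots> \<le> k * \<bar>x\<bar> / phi x" using c bd(1)[OF that] by (intro divide_right_mono mult_right_mono) auto
      also have "\<dots> \<le> 1 / 2" by (rule bd(4)[OF that])
      finally show ?thesis by linarith
    qed
    have contphi: "continuous_on {-a..a} phi" unfolding phi_def[abs_def] by (intro continuous_intros)
    have ypm: "?y x \<in> {-1..1}" if "x \<in> {-a..a}" for x
    proof -
      have "\<bar>c * phi x\<bar> \<le> k * phi x" using c bd(1)[OF that] by (simp add: abs_mult)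
      then show ?thesis using bd(2)[OF that] by (auto simp: abs_le_iff)
    qed
    have "(\<integral>\<^sup>+x\<in>{-a..a}. G (?y x) \<partial>lborel) \<le> (\<integral>\<^sup>+x. 2 * (G (?y x) * ennreal (?y' x) * indicator {-a..a} x) \<partial>lborel)"
    proof (rule nn_integral_mono)
      fix x :: real
      show "G (?y x) * indicator {-a..a} x \<le> 2 * (G (?y x) * ennreal (?y' x) * indicator {-a..a} x)"
      proof (cases "x \<in> {-a..a}")
        case True
        have "ennreal 1 \<le> ennreal (2 * ?y' x)" 
        proof (rule ennreal_leI)
          have "1 \<le> 2 * z" if "1 / 2 \<le> z" for z :: real using that by simp
          then show "1 \<le> 2 * ?y' x" using y'[OF True] .
        qed
        moreover have "ennreal (2 * z) = 2 * ennreal z" for z by (simp add: ennreal_mult')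
        ultimately have "1 \<le> 2 * ennreal (?y' x)" by (simp only: ennreal_1)
        from mult_left_mono[OF this, of "G (?y x)"] show ?thesis using True by (simp add: mult_ac)
      qed simp
    qed
    also have "\<dots> = 2 * (\<integral>\<^sup>+x. G (?y x) * ennreal (?y' x) * indicator {-a..a} x \<partial>lborel)"
      by (rule nn_integral_cmult) measurable
    also have "(\<integral>\<^sup>+x. G (?y x) * ennreal (?y' x) * indicator {-a..a} x \<partial>lborel) = (\<integral>\<^sup>+x. G x * indicator {?y (-a)..?y a} x \<partial>lborel)"
    proof (rule nn_integral_substitution_aux[symmetric, where g="?y"])
      fix x assume x: "x \<in> {-a..a}"
      show "(?y has_real_derivative ?y' x) (at x)"
        by (intro DERIV_add DERIV_ident DERIV_cmult phi_deriv bd(3)[OF x])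
      show "0 \<le> ?y' x" by (rule order.trans[OF _ y'[OF x]]) simp
    next
      show "continuous_on {-a..a} ?y'" using bd(1) by (intro continuous_intros contphi) force
    qed (use True in auto)
    also have "\<dots> \<le> (\<integral>\<^sup>+x\<in>{-1..1}. G x \<partial>lborel)"
      using ypm[of a] ypm[of "-a"] True by (intro set_nn_integral_mono_set) auto
    finally show ?thesis by (simp add: mult_left_mono)
  qed
  finally show ?thesis .
qed

text \<open>By the product formula for cos \<theta> - cos \<tau>: the sine of the middle angle is at
  least half of sin \<theta>, and Jordan's inequality bounds the other sine from below.\<close>

lemma angle_close:
  assumes \<theta>: "\<theta> \<in> {0..pi}" and \<tau>: "\<tau> \<in> {0..pi}" and le: "\<bar>cos \<theta> - cos \<tau>\<bar> \<le> d * sin \<theta>" and s: "0 < sin \<theta>"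
  shows "\<bar>\<theta> - \<tau>\<bar> \<le> pi * d"
proof -
  have "sin \<theta> / 2 \<le> sin ((\<theta> + \<tau>) / 2)"
  proof -
    have "sin \<theta> + sin \<tau> = 2 * sin ((\<theta> + \<tau>) / 2) * cos ((\<theta> - \<tau>) / 2)" by (rule sin_plus_sin)
    also have "\<dots> \<le> 2 * sin ((\<theta> + \<tau>) / 2) * 1" using \<theta> \<tau> by (intro mult_left_mono mult_nonneg_nonneg sin_ge_zero) auto
    finally show ?thesis using sin_ge_zero[of \<tau>] \<tau> by auto
  qed
  moreover have "\<bar>\<theta> - \<tau>\<bar> / pi \<le> \<bar>sin ((\<tau> - \<theta>) / 2)\<bar>"
  proof -
    have "\<bar>\<theta> - \<tau>\<bar> / pi = 2 * (\<bar>\<tau> - \<theta>\<bar> / 2) / pi" by (simp add: abs_minus_commute)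
    also have "\<dots> \<le> sin (\<bar>\<tau> - \<theta>\<bar> / 2)" using \<theta> \<tau> by (intro jordan_sin) auto
    also have "\<dots> \<le> \<bar>sin ((\<tau> - \<theta>) / 2)\<bar>" 
    proof (cases "\<theta> \<le> \<tau>")
      case False
      then have "\<bar>\<tau> - \<theta>\<bar> = - (\<tau> - \<theta>)" by simp
      then have "\<bar>\<tau> - \<theta>\<bar> / 2 = - ((\<tau> - \<theta>) / 2)" by (simp only: minus_divide_left)
      then have "sin (\<bar>\<tau> - \<theta>\<bar> / 2) = - sin ((\<tau> - \<theta>) / 2)" by (simp only: sin_minus)
      then show ?thesis by simp
    qed simp
    finally show ?thesis .
  qed
  ultimately have "sin \<theta> / 2 * (\<bar>\<theta> - \<tau>\<bar> / pi) \<le> sin ((\<theta> + \<tau>) / 2) * \<bar>sin ((\<tau> - \<theta>) / 2)\<bar>"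
    using s by (intro mult_mono) auto
  also have "\<dots> = \<bar>cos \<theta> - cos \<tau>\<bar> / 2"
    using \<theta> \<tau> sin_ge_zero[of "(\<theta> + \<tau>) / 2"] by (simp add: cos_diff_cos abs_mult)
  also have "\<dots> \<le> d * sin \<theta> / 2" using le by simp
  finally have "sin \<theta> * \<bar>\<theta> - \<tau>\<bar> \<le> sin \<theta> * (pi * d)" by (simp add: field_simps)
  then show ?thesis using s by simp
qed

lemma admissible_point:
  assumes "admissible k x" "\<bar>c\<bar> \<le> k"
  shows "x + c * phi x \<in> {-1..1}"
proof -
  have "0 \<le> phi x" using assms phi_nonneg by (auto simp: admissible_def)
  then have "\<bar>c * phi x\<bar> \<le> k * phi x" using assms by (simp add: abs_mult mult_right_mono)
  then show ?thesis using assms by (auto simp: admissible_def abs_le_iff)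
qed

text \<open>In the variable \<theta> all nodes of a difference with h <= 1/n lie within O(1/n) of
  the centre, the scale on which a slow weight is almost constant.\<close>

lemma admissible_angle:
  assumes "admissible k x" "\<bar>c\<bar> \<le> k"
  shows "\<bar>arccos x - arccos (x + c * phi x)\<bar> \<le> pi * k"
proof (cases "phi x = 0")
  case True
  have "0 \<le> k" using assms by linarith
  then show ?thesis using True by simp
next
  case False
  have x: "x \<in> {-1..1}" using assms by (simp add: admissible_def)
  have y: "x + c * phi x \<in> {-1..1}" by (rule admissible_point[OF assms])
  have ph: "phi x = sin (arccos x)" using phi_cos[of "arccos x"] x by (simp add: arccos_lbound arccos_ubound)
  have p0: "0 < phi x" using False phi_nonneg[OF x] by linarith
  show ?thesis
  proof (rule angle_close)
    have "\<bar>c * phi x\<bar> \<le> k * phi x" using assms p0 by (simp add: abs_mult)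
    then show "\<bar>cos (arccos x) - cos (arccos (x + c * phi x))\<bar> \<le> k * sin (arccos x)"
      using x y by (simp add: ph[symmetric])
    show "0 < sin (arccos x)" using p0 ph by simp
  qed (use x y in \<open>auto simp: arccos_lbound arccos_ubound\<close>)
qed

lemma admissible_cd:
  assumes "x \<in> {-1..1}" "0 \<le> h"
  shows "(x - real r * (h * phi x) / 2 \<in> {-1..1} \<and> x + real r * (h * phi x) / 2 \<in> {-1..1}) \<longleftrightarrow> admissible (real r * h / 2) x"
proof -
  have "0 \<le> real r * h / 2 * phi x" using phi_nonneg[OF assms(1)] assms by simp
  then show ?thesis using assms by (auto simp: admissible_def abs_le_iff)
qed

lemma central_difference_eq:
  assumes "x \<in> {-1..1}" "0 \<le> h"
  shows "central_difference r (h * phi x) f x =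
    (if admissible (real r * h / 2) x then fdiff r (h * phi x) f (x - real r * h / 2 * phi x) else 0)"
  unfolding central_difference_def admissible_cd[OF assms] fdiff_def
  by (auto simp: atLeast0AtMost mult_ac intro!: sum.cong)

lemma central_difference_measurable [measurable]:
  assumes [measurable]: "f \<in> borel_measurable borel"
  shows "(\<lambda>x. central_difference r (h * phi x) f x) \<in> borel_measurable borel"
  unfolding central_difference_def by measurable

text \<open>The p-th power of the weighted norm, for Borel functions and over \<open>lborel\<close>;
  \<open>Lp_norm_le_iff\<close> is the link to the norm.\<close>

definition wint :: "real \<Rightarrow> (real \<Rightarrow> real) \<Rightarrow> nat \<Rightarrow> (real \<Rightarrow> real) \<Rightarrow> ennreal" where
  "wint p w n g = (\<integral>\<^sup>+x\<in>{-1..1}. pp p (g x) * ennreal (avg_weight w n x) \<partial>lborel)"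

lemma wint_add:
  assumes p: "0 < p" "p \<le> 1" and w: "doubling_weight w" 
    and [measurable]: "f \<in> borel_measurable borel" "g \<in> borel_measurable borel"
  shows "wint p w n (\<lambda>x. f x + g x) \<le> wint p w n f + wint p w n g"
proof -
  note [measurable] = avg_weight_measurable[OF w]
  have "wint p w n (\<lambda>x. f x + g x) \<le> (\<integral>\<^sup>+x\<in>{-1..1}. pp p (f x) * ennreal (avg_weight w n x) + pp p (g x) * ennreal (avg_weight w n x) \<partial>lborel)"
    unfolding wint_def distrib_right[symmetric] by (intro set_nn_integral_mono mult_right_mono pp_add p) auto
  also have "\<dots> = wint p w n f + wint p w n g" unfolding wint_def by (rule set_nn_integral_add) measurable
  finally show ?thesis .
qed

lemma wint_diff:
  assumes p: "0 < p" "p \<le> 1" and w: "doubling_weight w" 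
    and f: "f \<in> borel_measurable borel" and g: "g \<in> borel_measurable borel"
  shows "wint p w n (\<lambda>x. f x - g x) \<le> wint p w n f + wint p w n g"
  using wint_add[OF p w f, of "\<lambda>x. - g x" n] g by (simp add: wint_def)

lemma wint_compare_const:
  assumes w: "doubling_weight w" and "1 \<le> m" "m \<le> n" "n \<le> K * m" 
    and [measurable]: "g \<in> borel_measurable borel"
  shows "wint p w n g \<le> ennreal ((real K)\<^sup>2) * wint p w m g"
proof -
  note [measurable] = avg_weight_measurable[OF w]
  have "wint p w n g \<le> (\<integral>\<^sup>+x\<in>{-1..1}. ennreal ((real K)\<^sup>2) * (pp p (g x) * ennreal (avg_weight w m x)) \<partial>lborel)"
    unfolding wint_def
  proof (rule set_nn_integral_mono)
    fix x :: real assume x: "x \<in> {-1..1}"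
    have "ennreal (avg_weight w n x) \<le> ennreal ((real K)\<^sup>2 * avg_weight w m x)"
      by (intro ennreal_leI avg_weight_compare_const w assms x)
    also have "\<dots> = ennreal ((real K)\<^sup>2) * ennreal (avg_weight w m x)"
      by (rule ennreal_mult) (use avg_weight_nonneg[OF w \<open>1 \<le> m\<close> x] in auto)
    finally have "pp p (g x) * ennreal (avg_weight w n x) \<le> pp p (g x) * (ennreal ((real K)\<^sup>2) * ennreal (avg_weight w m x))"
      by (intro mult_left_mono) auto
    then show "pp p (g x) * ennreal (avg_weight w n x) \<le> ennreal ((real K)\<^sup>2) * (pp p (g x) * ennreal (avg_weight w m x))"
      by (simp only: mult_ac)
  qed
  also have "\<dots> = ennreal ((real K)\<^sup>2) * wint p w m g" unfolding wint_def by (simp add: mult.assoc nn_integral_cmult)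
  finally show ?thesis .
qed

lemma wint_finite:
  assumes w: "doubling_weight w" and n: "1 \<le> n" and g: "(\<integral>\<^sup>+x\<in>{-1..1}. pp p (g x) \<partial>lborel) < \<infinity>"
    and [measurable]: "g \<in> borel_measurable borel"
  shows "wint p w n g < \<infinity>"
proof -
  have "wint p w n g \<le> (\<integral>\<^sup>+x\<in>{-1..1}. ennreal ((real n)\<^sup>2 * mass w (-1) 1) * pp p (g x) \<partial>lborel)"
    unfolding wint_def
    by (intro set_nn_integral_mono, subst mult.commute, intro mult_right_mono ennreal_leI avg_weight_bounded w n) auto
  also have "\<dots> = ennreal ((real n)\<^sup>2 * mass w (-1) 1) * (\<integral>\<^sup>+x\<in>{-1..1}. pp p (g x) \<partial>lborel)"
    by (simp add: mult.assoc nn_integral_cmult)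
  also have "\<dots> < \<infinity>" using g by (simp add: ennreal_mult_less_top)
  finally show ?thesis .
qed

lemma avg_weight_shift:
  assumes w: "doubling_weight w" and slow: "slow B s n (\<lambda>\<theta>. avg_weight w n (cos \<theta>))" and n: "1 \<le> n" and B: "0 \<le> B"
    and a: "admissible k x" "\<bar>c\<bar> \<le> k" "k \<le> K / real n"
  shows "avg_weight w n x \<le> B * (1 + (pi * K)\<^sup>2) ^ s * avg_weight w n (x + c * phi x)"
proof -
  have x: "x \<in> {-1..1}" using a by (simp add: admissible_def)
  have y: "x + c * phi x \<in> {-1..1}" by (rule admissible_point[OF a(1,2)])
  let ?\<theta> = "arccos x" and ?\<tau> = "arccos (x + c * phi x)"
  have "real n * \<bar>?\<theta> - ?\<tau>\<bar> \<le> real n * (pi * k)" by (intro mult_left_mono admissible_angle a) auto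
  also have "\<dots> \<le> real n * (pi * (K / real n))" using a by (intro mult_left_mono) auto
  also have "\<dots> = pi * K" using n by simp
  finally have "(real n * \<bar>?\<theta> - ?\<tau>\<bar>)\<^sup>2 \<le> (pi * K)\<^sup>2" by (intro power_mono) auto
  then have le: "1 + (real n * (?\<theta> - ?\<tau>))\<^sup>2 \<le> 1 + (pi * K)\<^sup>2" by (simp add: power_mult_distrib)
  have "avg_weight w n (cos ?\<theta>) \<le> B * (1 + (real n * (?\<theta> - ?\<tau>))\<^sup>2) ^ s * avg_weight w n (cos ?\<tau>)"
  proof -
    have "?\<theta> \<in> {0..pi}" "?\<tau> \<in> {0..pi}" using x y by (auto simp: arccos_lbound arccos_ubound)
    then show ?thesis using slow unfolding slow_def by blast
  qed
  also have "\<dots> \<le> B * (1 + (pi * K)\<^sup>2) ^ s * avg_weight w n (cos ?\<tau>)"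
    using y B by (intro mult_right_mono mult_left_mono power_mono le avg_weight_nonneg w n) auto
  finally show ?thesis using x y by simp
qed

text \<open>The difference is expanded into its nodes. At each node the weight may be replaced by
  its value there (\<open>avg_weight_shift\<close>) and the integral may be carried over to the node
  (\<open>shift_subst\<close>). This handles the remainder g - P, of which only the size is
  known.\<close>

lemma wint_difference_bound:
  assumes p: "0 < p" "p \<le> 1" and w: "doubling_weight w" and r: "1 \<le> r"
  obtains C where "0 < C" "\<And>g n h. g \<in> borel_measurable borel \<Longrightarrow> 1 \<le> n \<Longrightarrow> 0 < h \<Longrightarrow> h \<le> 1 / real n \<Longrightarrow>
     wint p w n (\<lambda>x. central_difference r (h * phi x) g x) \<le> ennreal C * wint p w n g"
proof -
  obtain B s where B: "1 \<le> B" and slow: "\<And>n. 1 \<le> n \<Longrightarrow> slow B s n (\<lambda>\<theta>. avg_weight w n (cos \<theta>))"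
    by (rule avg_weight_slow[OF w that])
  note [measurable] = avg_weight_measurable[OF w]
  define A where "A = B * (1 + (pi * (real r / 2))\<^sup>2) ^ s"
  have A: "0 < A" unfolding A_def using B by (intro mult_pos_pos zero_less_power add_pos_nonneg) auto
  define C where "C = 2 ^ r * (2 * A)"
  have "wint p w n (\<lambda>x. central_difference r (h * phi x) g x) \<le> ennreal C * wint p w n g"
    if [measurable]: "g \<in> borel_measurable borel" and n: "1 \<le> n" and h: "0 < h" "h \<le> 1 / real n" for g n h
  proof -
    define k where "k = real r * h / 2"
    have k: "0 < k" "k \<le> real r / 2 / real n" using r h n by (auto simp: k_def field_simps)
    define G where "G x = ennreal A * (pp p (g x) * ennreal (avg_weight w n x))" for x
    have [measurable]: "G \<in> borel_measurable borel" unfolding G_def by measurable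
    define c where "c j = (real j * h - k)" for j
    have c: "\<bar>c j\<bar> \<le> k" if "j \<le> r" for j
    proof -
      have "real j * h \<le> real r * h" using that h by (intro mult_right_mono) auto
      moreover have "0 \<le> real j * h" using h by simp
      ultimately show ?thesis unfolding c_def k_def abs_le_iff by linarith
    qed
    have Gint: "(\<integral>\<^sup>+x\<in>{-1..1}. G x \<partial>lborel) = ennreal A * wint p w n g"
      unfolding G_def wint_def by (simp add: mult.assoc nn_integral_cmult)
    have "wint p w n (\<lambda>x. central_difference r (h * phi x) g x) \<le> 
      (\<integral>\<^sup>+x. (\<Sum>j\<le>r. of_nat (r choose j) * (if admissible k x then G (x + c j * phi x) else 0)) \<partial>lborel)"
      unfolding wint_def
    proof (rule nn_integral_mono)
      fix x :: real
      show "pp p (central_difference r (h * phi x) g x) * ennreal (avg_weight w n x) * indicator {-1..1} x \<le>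
        (\<Sum>j\<le>r. of_nat (r choose j) * (if admissible k x then G (x + c j * phi x) else 0))"
      proof (cases "admissible k x")
        case False
        then show ?thesis using central_difference_eq[of x h r g] h by (auto simp: k_def split: split_indicator)
      next
        case True
        then have x: "x \<in> {-1..1}" by (simp add: admissible_def)
        have "central_difference r (h * phi x) g x = fdiff r (h * phi x) g (x - k * phi x)"
          using central_difference_eq[OF x, of h r g] h True by (simp add: k_def)
        also have "\<dots> = (\<Sum>j\<le>r. ((-1) ^ (r - j) * real (r choose j)) * g (x + c j * phi x))"
          unfolding fdiff_def by (intro sum.cong refl arg_cong[where f="\<lambda>z. _ * g z"]) (simp add: c_def algebra_simps)
        finally have "pp p (central_difference r (h * phi x) g x) \<le> (\<Sum>j\<le>r. pp p (((-1) ^ (r - j) * real (r choose j)) * g (x + c j * phi x)))"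
          by (simp only:) (rule pp_sum[OF p])
        also have "\<dots> \<le> (\<Sum>j\<le>r. of_nat (r choose j) * pp p (g (x + c j * phi x)))"
        proof (rule sum_mono)
          fix j assume j: "j \<in> {..r}"
          have "\<bar>(-1) ^ (r - j) * real (r choose j)\<bar> powr p = real (r choose j) powr p" by (simp add: abs_mult power_abs)
          also have "\<dots> \<le> real (r choose j) powr 1" using p j by (intro powr_mono) (auto simp: Suc_le_eq)
          finally have "pp p ((-1) ^ (r - j) * real (r choose j)) \<le> of_nat (r choose j)"
            by (simp add: pp_def ennreal_of_nat_eq_real_of_nat ennreal_leI)
          then show "pp p (((-1) ^ (r - j) * real (r choose j)) * g (x + c j * phi x)) \<le> of_nat (r choose j) * pp p (g (x + c j * phi x))"
            unfolding pp_mult[of p "(-1) ^ (r - j) * real (r choose j)"] by (intro mult_right_mono) auto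
        qed
        finally have "pp p (central_difference r (h * phi x) g x) * ennreal (avg_weight w n x) \<le>
           (\<Sum>j\<le>r. of_nat (r choose j) * pp p (g (x + c j * phi x))) * ennreal (avg_weight w n x)" by (intro mult_right_mono) auto
        also have "\<dots> = (\<Sum>j\<le>r. of_nat (r choose j) * (pp p (g (x + c j * phi x)) * ennreal (avg_weight w n x)))"
          by (simp add: sum_distrib_right mult.assoc)
        also have "\<dots> \<le> (\<Sum>j\<le>r. of_nat (r choose j) * G (x + c j * phi x))"
        proof (intro sum_mono mult_left_mono)
          fix j assume "j \<in> {..r}"
          then have j: "j \<le> r" by simp
          have "ennreal (avg_weight w n x) \<le> ennreal (A * avg_weight w n (x + c j * phi x))"
            unfolding A_def using B by (intro ennreal_leI avg_weight_shift[OF w slow[OF n] n _ True c[OF j] k(2)]) auto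
          also have "\<dots> = ennreal A * ennreal (avg_weight w n (x + c j * phi x))"
            using A avg_weight_nonneg[OF w n admissible_point[OF True c[OF j]]] by (intro ennreal_mult) auto
          finally have "pp p (g (x + c j * phi x)) * ennreal (avg_weight w n x) \<le> pp p (g (x + c j * phi x)) * (ennreal A * ennreal (avg_weight w n (x + c j * phi x)))"
            by (intro mult_left_mono) auto
          then show "pp p (g (x + c j * phi x)) * ennreal (avg_weight w n x) \<le> G (x + c j * phi x)"
            unfolding G_def by (simp only: mult_ac)
        qed auto
        finally show ?thesis using True x by simp
      qed
    qed
    also have "\<dots> = (\<Sum>j\<le>r. of_nat (r choose j) * (\<integral>\<^sup>+x. (if admissible k x then G (x + c j * phi x) else 0) \<partial>lborel))"
      by (simp add: nn_integral_sum nn_integral_cmult)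
    also have "\<dots> \<le> (\<Sum>j\<le>r. of_nat (r choose j) * (2 * (\<integral>\<^sup>+x\<in>{-1..1}. G x \<partial>lborel)))"
      by (intro sum_mono mult_left_mono shift_subst k c) auto
    also have "\<dots> = of_nat (\<Sum>j\<le>r. r choose j) * (2 * (ennreal A * wint p w n g))"
      unfolding Gint by (simp add: sum_distrib_right)
    also have "of_nat (\<Sum>j\<le>r. r choose j) = ennreal (2 ^ r)" unfolding choose_row_sum by (simp add: ennreal_power flip: ennreal_numeral)
    also have "ennreal (2 ^ r) * (2 * (ennreal A * wint p w n g)) = ennreal C * wint p w n g"
      using A unfolding C_def by (simp add: ennreal_mult mult.assoc)
    finally show ?thesis .
  qed
  then show ?thesis using that[of C] A by (auto simp: C_def)
qed

section \<open>Differences of polynomials\<close>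

lemma pderiv_iter_shift:
  "poly ((pderiv ^^ k) (pcompose Q [:s, 1:])) x = poly ((pderiv ^^ k) Q) (x + s)" for Q :: "real poly"
proof (induction k arbitrary: Q)
  case 0
  then show ?case by (simp add: poly_pcompose add.commute)
next
  case (Suc k)
  have "pderiv (pcompose Q [:s, 1:]) = pcompose (pderiv Q) [:s, 1:]" by (simp add: pderiv_pcompose pderiv_pCons)
  then show ?case using Suc[of "pderiv Q"] by (simp add: funpow_Suc_right del: funpow.simps)
qed

lemma pderiv_iter_diff: "(pderiv ^^ k) (P - Q) = (pderiv ^^ k) P - (pderiv ^^ k) Q" for P Q :: "real poly"
  by (induction k) (simp_all add: pderiv_diff)

text \<open>One of the differences is moved onto the polynomial, which becomes Q(x + s) - Q(x). The
  induction hypothesis for it leaves one first difference of the r-th derivative of Q, and the mean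
  value theorem removes that.\<close>

lemma fdiff_mean_value:
  assumes "0 \<le> s"
  shows "\<exists>\<xi>\<in>{y..y + real r * s}. \<bar>fdiff r s (poly Q) y\<bar> \<le> s ^ r * \<bar>poly ((pderiv ^^ r) Q) \<xi>\<bar>"
proof (induction r arbitrary: Q)
  case 0
  then show ?case by (simp add: fdiff_def)
next
  case (Suc r)
  let ?D = "pcompose Q [:s, 1:] - Q"
  have "fdiff (Suc r) s (poly Q) y = mdif (replicate r s) (dif s (poly Q)) y" 
    by (simp add: fdiff_eq_mdif mdif_dif)
  also have "dif s (poly Q) = poly ?D" by (simp add: dif_def fun_eq_iff poly_pcompose add.commute)
  finally have eq: "fdiff (Suc r) s (poly Q) y = fdiff r s (poly ?D) y" by (simp only: fdiff_eq_mdif)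
  obtain \<xi> where \<xi>: "\<xi> \<in> {y..y + real r * s}" "\<bar>fdiff r s (poly ?D) y\<bar> \<le> s ^ r * \<bar>poly ((pderiv ^^ r) ?D) \<xi>\<bar>"
    using Suc[of ?D] by blast
  let ?R = "(pderiv ^^ r) Q"
  have D: "poly ((pderiv ^^ r) ?D) \<xi> = poly ?R (\<xi> + s) - poly ?R \<xi>" by (simp add: pderiv_iter_diff pderiv_iter_shift)
  obtain \<zeta> where \<zeta>: "\<zeta> \<in> {\<xi>..\<xi> + s}" "poly ?R (\<xi> + s) - poly ?R \<xi> = s * poly (pderiv ?R) \<zeta>"
  proof (cases "s = 0")
    case True
    then show ?thesis using that[of \<xi>] by simp
  next
    case False
    then have "\<xi> < \<xi> + s" using assms by simp
    from poly_MVT[OF this, of ?R] obtain z where "\<xi> < z" "z < \<xi> + s"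
      "poly ?R (\<xi> + s) - poly ?R \<xi> = (\<xi> + s - \<xi>) * poly (pderiv ?R) z" by blast
    then show ?thesis by (intro that[of z]) auto
  qed
  have "\<bar>fdiff (Suc r) s (poly Q) y\<bar> \<le> s ^ r * (s * \<bar>poly (pderiv ?R) \<zeta>\<bar>)"
    using \<xi>(2) unfolding eq D \<zeta>(2) using assms by (simp add: abs_mult)
  moreover have "\<zeta> \<in> {y..y + real (Suc r) * s}" using \<xi>(1) \<zeta>(1) by (auto simp: algebra_simps)
  ultimately show ?case by (intro bexI[of _ \<zeta>]) (auto simp: mult_ac)
qed

text \<open>With \<open>u = h \<phi> / \<rho>\<^sub>m \<le> m/n\<close> one has \<open>u\<^sup>r\<^sup>p w\<^sub>n \<le> u\<^sup>r\<^sup>p (\<rho>\<^sub>m / \<rho>\<^sub>n) w\<^sub>m \<le> u\<^sup>r\<^sup>p\<^sup>-\<^sup>1 w\<^sub>m\<close>; this is the step that needs \<open>r > 1/p\<close>.\<close>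

lemma step_weight_bound:
  assumes w: "doubling_weight w" and p: "0 < p" and rp: "1 \<le> real r * p" and m: "1 \<le> m" "m \<le> n"
    and h: "0 < h" "h \<le> 1 / real n" and \<theta>: "\<theta> \<in> {0..pi}" and s: "0 < sin \<theta>"
  shows "(h * sin \<theta>) powr (real r * p) * avg_weight w n (cos \<theta>) \<le>
    (real m / real n) powr (real r * p - 1) * ((sg m \<theta> powr p) ^ r * avg_weight w m (cos \<theta>))"
proof -
  have n: "1 \<le> n" using m by simp
  define \<rho> where "\<rho> = sg m \<theta>"
  define t where "t = sin \<theta> / real n"
  define u where "u = t / \<rho>"
  define a where "a = avg_weight w m (cos \<theta>)"
  have a: "0 \<le> a" unfolding a_def by (intro avg_weight_nonneg w m) auto
  have \<rho>: "0 < \<rho>" unfolding \<rho>_def by (rule sg_pos[OF \<theta> m(1)])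
  have t: "0 < t" using s n by (simp add: t_def)
  have u: "0 < u" using \<rho> t by (simp add: u_def)
  have "u \<le> real m / real n"
  proof -
    have "sin \<theta> / real m \<le> \<rho>" by (simp add: \<rho>_def sg_def)
    then have "u \<le> t / (sin \<theta> / real m)" unfolding u_def using t s m \<rho> by (intro divide_left_mono) auto
    also have "\<dots> = real m / real n" using s by (simp add: t_def)
    finally show ?thesis .
  qed
  have wn: "avg_weight w n (cos \<theta>) \<le> a / u"
  proof -
    have "t \<le> sg n \<theta>" by (simp add: t_def sg_def)
    then have "t * avg_weight w n (cos \<theta>) \<le> sg n \<theta> * avg_weight w n (cos \<theta>)" by (intro mult_right_mono avg_weight_nonneg w n) auto
    also have "\<dots> \<le> \<rho> * a" using avg_weight_compare[OF w m(1,2), of "cos \<theta>"] by (simp add: rho_cos[OF \<theta>] \<rho>_def a_def)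
    finally show ?thesis using t \<rho> by (simp add: u_def field_simps)
  qed
  have "(h * sin \<theta>) powr (real r * p) \<le> t powr (real r * p)"
  proof -
    have "h * sin \<theta> \<le> 1 / real n * sin \<theta>" using h s by (intro mult_right_mono) auto
    then have "h * sin \<theta> \<le> t" by (simp add: t_def)
    then show ?thesis using h s rp by (intro powr_mono2) auto
  qed
  also have "t powr (real r * p) = u powr (real r * p) * \<rho> powr (real r * p)"
  proof -
    have "t = u * \<rho>" using \<rho> by (simp add: u_def)
    then show ?thesis by (simp add: powr_mult)
  qed
  also have "\<rho> powr (real r * p) = (\<rho> powr p) ^ r"
  proof -
    have "(\<rho> powr p) powr real r = (\<rho> powr p) ^ r" using \<rho> by (intro powr_realpow) simp
    then show ?thesis by (simp add: powr_powr mult.commute)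
  qed
  finally have "(h * sin \<theta>) powr (real r * p) * avg_weight w n (cos \<theta>) \<le> (u powr (real r * p) * (\<rho> powr p) ^ r) * (a / u)"
    using wn a u \<rho> by (intro mult_mono avg_weight_nonneg w n) auto
  also have "\<dots> = u powr (real r * p - 1) * ((\<rho> powr p) ^ r * a)"
    using u by (simp add: powr_diff)
  also have "\<dots> \<le> (real m / real n) powr (real r * p - 1) * ((\<rho> powr p) ^ r * a)"
    using \<open>u \<le> real m / real n\<close> u rp a by (intro mult_right_mono powr_mono2 mult_nonneg_nonneg) auto
  finally show ?thesis by (simp add: \<rho>_def a_def)
qed

text \<open>The mean value point depends on \<theta> without any regularity but stays within angle
  \<pi> r h / 2 of it, which is what the displacement in \<open>bernstein\<close> allows. The power
  of m/n is the gain computed in \<open>step_weight_bound\<close>.\<close>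

lemma wint_difference_poly:
  assumes p: "0 < p" "p \<le> 1" and w: "doubling_weight w" and rp: "1 \<le> real r * p"
  obtains C where "0 < C" "\<And>Q m n h. 1 \<le> m \<Longrightarrow> m \<le> n \<Longrightarrow> degree Q \<le> m \<Longrightarrow> 0 < h \<Longrightarrow> h \<le> 1 / real n \<Longrightarrow>
     wint p w n (\<lambda>x. central_difference r (h * phi x) (poly Q) x) \<le>
       ennreal (C * (real m / real n) powr (real r * p - 1)) * wint p w m (poly Q)"
proof -
  have r: "1 \<le> r" using rp p by (cases r) auto
  obtain B s where B: "1 \<le> B" and slow: "\<And>n. 1 \<le> n \<Longrightarrow> slow B s n (\<lambda>\<theta>. avg_weight w n (cos \<theta>))"
    by (rule avg_weight_slow[OF w that])
  note [measurable] = avg_weight_measurable[OF w]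
  obtain C where C: "0 < C" and bern: "\<And>m Q V \<xi>. 1 \<le> m \<Longrightarrow> degree Q \<le> m \<Longrightarrow> slow B s m V \<Longrightarrow>
     (\<forall>\<theta>\<in>{0..pi}. \<xi> \<theta> \<in> {0..pi} \<and> \<bar>\<xi> \<theta> - \<theta>\<bar> \<le> pi * (real r / 2) / real m) \<Longrightarrow>
     (\<integral>\<^sup>+\<theta>\<in>{0..pi}. pp p (poly ((pderiv ^^ r) Q) (cos (\<xi> \<theta>))) * ennreal ((sg m \<theta> powr p) ^ r * V \<theta> * sin \<theta>) \<partial>lborel) \<le>
        ennreal C * (\<integral>\<^sup>+\<theta>\<in>{0..pi}. pp p (poly Q (cos \<theta>)) * ennreal (V \<theta> * sin \<theta>) \<partial>lborel)"
    using bernstein[OF p B, of s "pi * (real r / 2)" r] by blast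
  have "wint p w n (\<lambda>x. central_difference r (h * phi x) (poly Q) x) \<le>
       ennreal (C * (real m / real n) powr (real r * p - 1)) * wint p w m (poly Q)"
    if m: "1 \<le> m" "m \<le> n" and Q: "degree Q \<le> m" and h: "0 < h" "h \<le> 1 / real n" for Q m n h
  proof -
    have n: "1 \<le> n" using m by simp
    define k where "k = real r * h / 2"
    have k0: "0 < k" using r h by (simp add: k_def)
    have km: "pi * k \<le> pi * (real r / 2) / real m"
    proof -
      have "1 / real n \<le> 1 / real m" using m by (simp add: field_simps)
      then have "h \<le> 1 / real m" by (rule order.trans[OF h(2)])
      then have "pi * (real r / 2) * h \<le> pi * (real r / 2) * (1 / real m)" by (intro mult_left_mono) auto
      then show ?thesis by (simp add: k_def)
    qed
    define cd where "cd x = central_difference r (h * phi x) (poly Q) x" for x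
    let ?R = "(pderiv ^^ r) Q"
    let ?\<beta> = "(real m / real n) powr (real r * p - 1)"
    \<comment> \<open>If the centre is not admissible, or is an endpoint so that the step is 0, the
      difference vanishes and \<theta> itself will do.\<close>
    have "\<exists>\<xi>\<in>{0..pi}. \<bar>\<xi> - \<theta>\<bar> \<le> pi * k \<and> \<bar>cd (cos \<theta>)\<bar> \<le> (h * sin \<theta>) ^ r * \<bar>poly ?R (cos \<xi>)\<bar>" if \<theta>: "\<theta> \<in> {0..pi}" for \<theta>
    proof (cases "admissible k (cos \<theta>) \<and> 0 < sin \<theta>")
      case False
      have "cd (cos \<theta>) = 0"
      proof (cases "admissible k (cos \<theta>)")
        case False
        then show ?thesis unfolding cd_def using central_difference_eq[of "cos \<theta>" h r "poly Q"] h by (simp add: k_def)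
      next
        case True
        then have "phi (cos \<theta>) = 0" using False phi_cos[OF \<theta>] sin_ge_zero[of \<theta>] \<theta> by auto
        moreover have "fdiff r 0 g y = 0" for g y using r unfolding fdiff_eq_mdif by (subst mdif_zero_step) auto
        ultimately show ?thesis unfolding cd_def using central_difference_eq[of "cos \<theta>" h r "poly Q"] h by simp
      qed
      then show ?thesis using \<theta> h k0 by (intro bexI[of _ \<theta>]) (auto intro!: mult_nonneg_nonneg zero_le_power sin_ge_zero)
    next
      case True
      then have ad: "admissible k (cos \<theta>)" and s: "0 < sin \<theta>" by auto
      have "cd (cos \<theta>) = fdiff r (h * sin \<theta>) (poly Q) (cos \<theta> - k * sin \<theta>)"
        unfolding cd_def using central_difference_eq[of "cos \<theta>" h r "poly Q"] h ad by (simp add: k_def phi_cos[OF \<theta>])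
      moreover have "0 \<le> h * sin \<theta>" using h s by simp
      ultimately obtain \<xi> where \<xi>: "\<xi> \<in> {cos \<theta> - k * sin \<theta>..cos \<theta> - k * sin \<theta> + real r * (h * sin \<theta>)}"
        "\<bar>cd (cos \<theta>)\<bar> \<le> (h * sin \<theta>) ^ r * \<bar>poly ?R \<xi>\<bar>"
        using fdiff_mean_value[of "h * sin \<theta>" "cos \<theta> - k * sin \<theta>" r Q] by auto
      define c where "c = (\<xi> - cos \<theta>) / sin \<theta>"
      have \<xi>c: "\<xi> = cos \<theta> + c * phi (cos \<theta>)" using s by (simp add: c_def phi_cos[OF \<theta>])
      have "real r * (h * sin \<theta>) = k * sin \<theta> + k * sin \<theta>" by (simp add: k_def)
      then have "\<bar>\<xi> - cos \<theta>\<bar> \<le> k * sin \<theta>" using \<xi>(1) unfolding atLeastAtMost_iff abs_le_iff by linarith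
      then have c: "\<bar>c\<bar> \<le> k" using s by (simp add: c_def abs_divide pos_divide_le_eq)
      have \<xi>1: "\<xi> \<in> {-1..1}" unfolding \<xi>c by (rule admissible_point[OF ad c])
      have "\<bar>arccos (cos \<theta>) - arccos \<xi>\<bar> \<le> pi * k" unfolding \<xi>c by (rule admissible_angle[OF ad c])
      then have "\<bar>arccos \<xi> - \<theta>\<bar> \<le> pi * k" using \<theta> by (simp add: arccos_cos abs_minus_commute)
      then show ?thesis using \<xi>1 \<xi>(2) by (intro bexI[of _ "arccos \<xi>"]) (auto simp: arccos_lbound arccos_ubound)
    qed
    then have "\<exists>\<xi>. \<forall>\<theta>\<in>{0..pi}. \<xi> \<theta> \<in> {0..pi} \<and> \<bar>\<xi> \<theta> - \<theta>\<bar> \<le> pi * k \<and> \<bar>cd (cos \<theta>)\<bar> \<le> (h * sin \<theta>) ^ r * \<bar>poly ?R (cos (\<xi> \<theta>))\<bar>"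
      by (intro bchoice) blast
    then obtain \<xi> where \<xi>: "\<And>\<theta>. \<theta> \<in> {0..pi} \<Longrightarrow> \<xi> \<theta> \<in> {0..pi}" "\<And>\<theta>. \<theta> \<in> {0..pi} \<Longrightarrow> \<bar>\<xi> \<theta> - \<theta>\<bar> \<le> pi * k"
      and cd: "\<And>\<theta>. \<theta> \<in> {0..pi} \<Longrightarrow> \<bar>cd (cos \<theta>)\<bar> \<le> (h * sin \<theta>) ^ r * \<bar>poly ?R (cos (\<xi> \<theta>))\<bar>"
      by blast
    have [measurable]: "cd \<in> borel_measurable borel" unfolding cd_def[abs_def] by measurable
    let ?V = "\<lambda>\<theta>. avg_weight w m (cos \<theta>)"
    have Vm[measurable]: "?V \<in> borel_measurable borel" using slow[OF m(1)] by (simp add: slow_def)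
    have "wint p w n cd = (\<integral>\<^sup>+\<theta>\<in>{0..pi}. pp p (cd (cos \<theta>)) * ennreal (avg_weight w n (cos \<theta>)) * ennreal (sin \<theta>) \<partial>lborel)"
      unfolding wint_def by (rule nn_integral_cos_subst) measurable
    also have "\<dots> \<le> (\<integral>\<^sup>+\<theta>\<in>{0..pi}. pp p (poly ?R (cos (\<xi> \<theta>))) * ennreal ((sg m \<theta> powr p) ^ r * (?\<beta> * ?V \<theta>) * sin \<theta>) \<partial>lborel)"
    proof (rule nn_integral_mono)
      fix \<theta> :: real
      show "pp p (cd (cos \<theta>)) * ennreal (avg_weight w n (cos \<theta>)) * ennreal (sin \<theta>) * indicator {0..pi} \<theta> \<le>
        pp p (poly ?R (cos (\<xi> \<theta>))) * ennreal ((sg m \<theta> powr p) ^ r * (?\<beta> * ?V \<theta>) * sin \<theta>) * indicator {0..pi} \<theta>"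
      proof (cases "\<theta> \<in> {0..pi} \<and> 0 < sin \<theta>")
        case False
        then show ?thesis by (auto simp: not_less ennreal_neg split: split_indicator)
      next
        case True
        then have \<theta>: "\<theta> \<in> {0..pi}" and s: "0 < sin \<theta>" by auto
        have V0: "0 \<le> ?V \<theta>" by (intro avg_weight_nonneg w m) auto
        have "\<bar>cd (cos \<theta>)\<bar> powr p \<le> ((h * sin \<theta>) ^ r * \<bar>poly ?R (cos (\<xi> \<theta>))\<bar>) powr p"
          using cd[OF \<theta>] p by (intro powr_mono2) auto
        also have "\<dots> = ((h * sin \<theta>) ^ r) powr p * \<bar>poly ?R (cos (\<xi> \<theta>))\<bar> powr p" by (rule powr_mult)
        also have "((h * sin \<theta>) ^ r) powr p = (h * sin \<theta>) powr (real r * p)"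
          using h s by (simp add: powr_realpow[symmetric] powr_powr)
        finally have "\<bar>cd (cos \<theta>)\<bar> powr p * avg_weight w n (cos \<theta>) * sin \<theta> \<le>
          (h * sin \<theta>) powr (real r * p) * \<bar>poly ?R (cos (\<xi> \<theta>))\<bar> powr p * avg_weight w n (cos \<theta>) * sin \<theta>"
          using s by (intro mult_right_mono avg_weight_nonneg w n) auto
        also have "\<dots> = \<bar>poly ?R (cos (\<xi> \<theta>))\<bar> powr p * sin \<theta> * ((h * sin \<theta>) powr (real r * p) * avg_weight w n (cos \<theta>))"
          by (simp only: mult_ac)
        also have "\<dots> \<le> \<bar>poly ?R (cos (\<xi> \<theta>))\<bar> powr p * sin \<theta> * (?\<beta> * ((sg m \<theta> powr p) ^ r * ?V \<theta>))"
          using s by (intro mult_left_mono step_weight_bound[OF w p(1) rp m h \<theta> s]) auto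
        also have "\<dots> = \<bar>poly ?R (cos (\<xi> \<theta>))\<bar> powr p * ((sg m \<theta> powr p) ^ r * (?\<beta> * ?V \<theta>) * sin \<theta>)"
          by (simp only: mult_ac)
        finally have le: "\<bar>cd (cos \<theta>)\<bar> powr p * avg_weight w n (cos \<theta>) * sin \<theta> \<le> \<bar>poly ?R (cos (\<xi> \<theta>))\<bar> powr p * ((sg m \<theta> powr p) ^ r * (?\<beta> * ?V \<theta>) * sin \<theta>)" .
        have w0: "0 \<le> avg_weight w n (cos \<theta>)" by (intro avg_weight_nonneg w n) auto
        have "pp p (cd (cos \<theta>)) * ennreal (avg_weight w n (cos \<theta>)) * ennreal (sin \<theta>) = ennreal (\<bar>cd (cos \<theta>)\<bar> powr p * avg_weight w n (cos \<theta>) * sin \<theta>)"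
          using w0 s by (simp add: pp_def ennreal_mult)
        also have "\<dots> \<le> ennreal (\<bar>poly ?R (cos (\<xi> \<theta>))\<bar> powr p * ((sg m \<theta> powr p) ^ r * (?\<beta> * ?V \<theta>) * sin \<theta>))" by (rule ennreal_leI[OF le])
        also have "\<dots> = pp p (poly ?R (cos (\<xi> \<theta>))) * ennreal ((sg m \<theta> powr p) ^ r * (?\<beta> * ?V \<theta>) * sin \<theta>)"
          unfolding pp_def using V0 s by (intro ennreal_mult) auto
        finally show ?thesis using \<theta> by simp
      qed
    qed
    also have "\<dots> \<le> ennreal C * (\<integral>\<^sup>+\<theta>\<in>{0..pi}. pp p (poly Q (cos \<theta>)) * ennreal ((?\<beta> * ?V \<theta>) * sin \<theta>) \<partial>lborel)"
    proof (rule bern[OF m(1) Q])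
      have "slow (1 * B) (0 + s) m (\<lambda>\<theta>. ?\<beta> * ?V \<theta>)" using B by (intro slow_mult slow_const slow m) auto
      then show "slow B s m (\<lambda>\<theta>. ?\<beta> * ?V \<theta>)" by simp
      show "\<forall>\<theta>\<in>{0..pi}. \<xi> \<theta> \<in> {0..pi} \<and> \<bar>\<xi> \<theta> - \<theta>\<bar> \<le> pi * (real r / 2) / real m"
        by (intro ballI conjI \<xi>(1) order.trans[OF \<xi>(2) km])
    qed
    also have "(\<integral>\<^sup>+\<theta>\<in>{0..pi}. pp p (poly Q (cos \<theta>)) * ennreal ((?\<beta> * ?V \<theta>) * sin \<theta>) \<partial>lborel) =
      (\<integral>\<^sup>+\<theta>. ennreal ?\<beta> * (pp p (poly Q (cos \<theta>)) * ennreal (?V \<theta> * sin \<theta>) * indicator {0..pi} \<theta>) \<partial>lborel)"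
      by (intro nn_integral_cong)
         (auto simp: ennreal_mult avg_weight_nonneg[OF w m(1)] sin_ge_zero mult_ac split: split_indicator)
    also have "\<dots> = ennreal ?\<beta> * (\<integral>\<^sup>+\<theta>\<in>{0..pi}. pp p (poly Q (cos \<theta>)) * ennreal (?V \<theta> * sin \<theta>) \<partial>lborel)"
      by (rule nn_integral_cmult) measurable
    also have "(\<integral>\<^sup>+\<theta>\<in>{0..pi}. pp p (poly Q (cos \<theta>)) * ennreal (?V \<theta> * sin \<theta>) \<partial>lborel) = wint p w m (poly Q)"
    proof -
      have "wint p w m (poly Q) = (\<integral>\<^sup>+\<theta>\<in>{0..pi}. pp p (poly Q (cos \<theta>)) * ennreal (?V \<theta>) * ennreal (sin \<theta>) \<partial>lborel)"
        unfolding wint_def by (rule nn_integral_cos_subst) measurable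
      also have "\<dots> = (\<integral>\<^sup>+\<theta>\<in>{0..pi}. pp p (poly Q (cos \<theta>)) * ennreal (?V \<theta> * sin \<theta>) \<partial>lborel)"
        by (intro nn_integral_cong) (auto simp: ennreal_mult avg_weight_nonneg[OF w m(1)] sin_ge_zero mult.assoc split: split_indicator)
      finally show ?thesis ..
    qed
    also have "ennreal C * (ennreal ?\<beta> * wint p w m (poly Q)) = ennreal (C * ?\<beta>) * wint p w m (poly Q)"
      using C by (simp add: ennreal_mult mult_ac)
    finally show ?thesis by (simp add: cd_def[abs_def])
  qed
  then show ?thesis using that C by blast
qed

lemma central_difference_add:
  "central_difference r h (\<lambda>x. f x + g x) x = central_difference r h f x + central_difference r h g x"
  by (simp add: central_difference_def sum.distrib distrib_left)

lemma wint_cd_add: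
  assumes p: "0 < p" "p \<le> 1" and w: "doubling_weight w" 
    and "f \<in> borel_measurable borel" "g \<in> borel_measurable borel"
  shows "wint p w n (\<lambda>x. central_difference r (h * phi x) (\<lambda>x. f x + g x) x) \<le>
    wint p w n (\<lambda>x. central_difference r (h * phi x) f x) + wint p w n (\<lambda>x. central_difference r (h * phi x) g x)"
  unfolding central_difference_add using assms by (intro wint_add) auto

section \<open>The inverse estimate\<close>

text \<open>Here \<gamma> = \<alpha> p is the rate for p-th powers. A dyadic index M j with M j <= n
  < 2 M j is chosen: the remainder of its polynomial has the right size already, and the polynomial
  is treated by telescoping. Pieces of degree m contribute m^(\<beta>-\<gamma>) n^(-\<beta>),
  dominated by the last piece because \<gamma> < \<beta>.\<close>

theorem inverse_estimate:
  assumes p: "0 < p" "p \<le> 1" and w: "doubling_weight w"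
    and \<gamma>: "0 < \<gamma>" "\<gamma> < real r * p - 1"
    and g[measurable]: "g \<in> borel_measurable borel" and N0: "1 \<le> N0" and C1: "0 \<le> C1"
    and P: "\<And>n. N0 \<le> n \<Longrightarrow> P n \<in> Poly_space n"
    and best: "\<And>n. N0 \<le> n \<Longrightarrow> wint p w n (\<lambda>x. g x - poly (P n) x) \<le> ennreal (C1 * real n powr (- \<gamma>))"
  shows "\<exists>K\<ge>0. \<forall>n\<ge>N0. \<forall>h. 0 < h \<longrightarrow> h \<le> 1 / real n \<longrightarrow>
     wint p w n (\<lambda>x. central_difference r (h * phi x) g x) \<le> ennreal (K * real n powr (- \<gamma>))"
proof -
  define \<beta> where "\<beta> = real r * p - 1"
  have \<beta>: "\<gamma> < \<beta>" "0 < \<beta>" using \<gamma> by (auto simp: \<beta>_def)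
  have rp: "1 \<le> real r * p" using \<beta> by (simp add: \<beta>_def)
  have r: "1 \<le> r" using rp p by (cases r) auto
  obtain C where C: "0 < C" and inv: "\<And>Q m n h. 1 \<le> m \<Longrightarrow> m \<le> n \<Longrightarrow> degree Q \<le> m \<Longrightarrow> 0 < h \<Longrightarrow> h \<le> 1 / real n \<Longrightarrow>
     wint p w n (\<lambda>x. central_difference r (h * phi x) (poly Q) x) \<le> ennreal (C * (real m / real n) powr \<beta>) * wint p w m (poly Q)"
    by (rule wint_difference_poly[OF p w rp, folded \<beta>_def, OF that])
  obtain D where D: "0 < D" and diff: "\<And>g n h. g \<in> borel_measurable borel \<Longrightarrow> 1 \<le> n \<Longrightarrow> 0 < h \<Longrightarrow> h \<le> 1 / real n \<Longrightarrow>
     wint p w n (\<lambda>x. central_difference r (h * phi x) g x) \<le> ennreal D * wint p w n g"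
    by (rule wint_difference_bound[OF p w r that])
  define M where "M j = N0 * 2 ^ j" for j :: nat
  have M: "1 \<le> M j" "N0 \<le> M j" "M (Suc j) = 2 * M j" for j using N0 by (auto simp: M_def)
  have M0: "0 < real (M j)" for j using M(1)[of j] by linarith
  have MS: "real (M (Suc j)) = 2 * real (M j)" for j by (simp add: M(3))
  have dP: "degree (P (M j)) \<le> M j" for j using P[OF M(2)[of j]] M(1)[of j] by (auto simp: Poly_space_def)
  have err: "wint p w (M j) (\<lambda>x. g x - poly (P (M j)) x) \<le> ennreal (C1 * real (M j) powr (- \<gamma>))" for j by (rule best[OF M(2)])
  have err2: "wint p w n (\<lambda>x. g x - poly (P (M j)) x) \<le> ennreal (4 * 2 powr \<gamma> * C1 * real n powr (- \<gamma>))"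
    if n: "M j \<le> n" "n \<le> 2 * M j" for n j
  proof -
    have "wint p w n (\<lambda>x. g x - poly (P (M j)) x) \<le> ennreal ((real 2)\<^sup>2) * wint p w (M j) (\<lambda>x. g x - poly (P (M j)) x)"
      using n by (intro wint_compare_const w M) auto
    also have "\<dots> \<le> ennreal ((real 2)\<^sup>2) * ennreal (C1 * real (M j) powr (- \<gamma>))" by (intro mult_left_mono err) auto
    also have "\<dots> = ennreal (4 * (C1 * real (M j) powr (- \<gamma>)))" using C1 by (simp add: ennreal_mult)
    also have "\<dots> \<le> ennreal (4 * 2 powr \<gamma> * C1 * real n powr (- \<gamma>))"
    proof (rule ennreal_leI)
      have "real n / 2 \<le> real (M j)" using n(2) by linarith
      then have "real (M j) powr (- \<gamma>) \<le> (real n / 2) powr (- \<gamma>)"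
        using n M(1)[of j] \<gamma> by (intro powr_mono2') auto
      also have "\<dots> = 2 powr \<gamma> * real n powr (- \<gamma>)" by (simp add: powr_divide powr_minus field_simps)
      finally have "C1 * real (M j) powr (- \<gamma>) \<le> C1 * (2 powr \<gamma> * real n powr (- \<gamma>))" using C1 by (intro mult_left_mono)
      then show "4 * (C1 * real (M j) powr (- \<gamma>)) \<le> 4 * 2 powr \<gamma> * C1 * real n powr (- \<gamma>)" by (simp add: mult_ac)
    qed
    finally show ?thesis .
  qed
  define A where "A = (4 * 2 powr \<gamma> + 1) * C1"
  have A0: "0 \<le> A" using C1 by (simp add: A_def add_nonneg_nonneg)
  have Q: "wint p w (M (Suc j)) (poly (P (M (Suc j)) - P (M j))) \<le> ennreal (A * real (M (Suc j)) powr (- \<gamma>))" for j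
  proof -
    let ?m = "M (Suc j)"
    have eq: "poly (P ?m - P (M j)) = (\<lambda>x. (g x - poly (P (M j)) x) - (g x - poly (P ?m) x))" by (simp add: fun_eq_iff)
    have "wint p w ?m (poly (P ?m - P (M j))) \<le> wint p w ?m (\<lambda>x. g x - poly (P (M j)) x) + wint p w ?m (\<lambda>x. g x - poly (P ?m) x)"
      unfolding eq by (rule wint_diff[OF p w]) measurable
    also have "\<dots> \<le> ennreal (4 * 2 powr \<gamma> * C1 * real ?m powr (- \<gamma>)) + ennreal (C1 * real ?m powr (- \<gamma>))"
      by (intro add_mono err err2) (auto simp: M(3))
    also have "\<dots> = ennreal (A * real ?m powr (- \<gamma>))" using C1 by (simp add: A_def ennreal_plus[symmetric] algebra_simps del: ennreal_plus)
    finally show ?thesis .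
  qed
  define q where "q = 2 powr (\<gamma> - \<beta>)"
  have q: "0 < q" "q < 1"
  proof -
    show "0 < q" by (simp add: q_def)
    have "2 powr (\<gamma> - \<beta>) < 2 powr (0::real)" using \<beta> by (intro powr_less_mono) auto
    then show "q < 1" by (simp add: q_def)
  qed
  have "wint p w N0 (poly (P N0)) < \<infinity>"
    by (intro wint_finite w N0 set_nn_integral_poly_finite p) measurable
  then obtain a0 where a0: "0 \<le> a0" "wint p w N0 (poly (P N0)) = ennreal a0" by (cases "wint p w N0 (poly (P N0))") auto
  \<comment> \<open>The first summand takes care of the starting polynomial; the second is the sum
    of the geometric series with ratio q, so that K q + C A <= K.\<close>
  define K where "K = C * a0 * real N0 powr \<gamma> + C * A / (1 - q)"
  have K0: "0 \<le> K" using C a0 A0 q by (simp add: K_def)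
  have Kq: "K * q + C * A \<le> K"
  proof -
    have "C * A / (1 - q) \<le> K" using C a0 by (simp add: K_def)
    then have "C * A \<le> K * (1 - q)" using q by (simp add: pos_divide_le_eq)
    then show ?thesis by (simp add: algebra_simps)
  qed
  \<comment> \<open>The telescoping sum is evaluated inside the induction: passing from j to j + 1
    shrinks the old bound by q relative to the new one, and the new piece adds C A.\<close>
  have claim: "wint p w n (\<lambda>x. central_difference r (h * phi x) (poly (P (M j))) x) \<le> ennreal (K * real (M j) powr (\<beta> - \<gamma>) * real n powr (- \<beta>))"
    if "M j \<le> n" "0 < h" "h \<le> 1 / real n" for j n h
    using that(1)
  proof (induction j)
    case 0
    have n: "0 < real n" using 0 M0[of 0] by linarith
    have "wint p w n (\<lambda>x. central_difference r (h * phi x) (poly (P (M 0))) x) \<le> ennreal (C * (real (M 0) / real n) powr \<beta>) * wint p w (M 0) (poly (P (M 0)))"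
      by (intro inv M 0 dP that)
    also have "\<dots> = ennreal (C * (real N0 / real n) powr \<beta> * a0)" using a0 C by (simp add: M_def ennreal_mult)
    also have "\<dots> \<le> ennreal (K * real (M 0) powr (\<beta> - \<gamma>) * real n powr (- \<beta>))"
    proof (rule ennreal_leI)
      have N0p: "0 < real N0" using N0 by simp
      have "C * (real N0 / real n) powr \<beta> * a0 = (C * a0 * real N0 powr \<gamma>) * (real N0 powr (\<beta> - \<gamma>) * real n powr (- \<beta>))"
        using N0p n by (simp add: powr_divide powr_minus powr_diff field_simps)
      also have "\<dots> \<le> K * (real N0 powr (\<beta> - \<gamma>) * real n powr (- \<beta>))"
        using C A0 q by (intro mult_right_mono) (auto simp: K_def)
      finally show "C * (real N0 / real n) powr \<beta> * a0 \<le> K * real (M 0) powr (\<beta> - \<gamma>) * real n powr (- \<beta>)" by (simp add: M_def mult.assoc)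
    qed
    finally show ?case .
  next
    case (Suc j)
    let ?m = "M (Suc j)"
    have n: "0 < real n" using Suc.prems M0[of "Suc j"] by linarith
    have "M j \<le> n" using Suc.prems M(3)[of j] by simp
    note IH = Suc.IH[OF this]
    have eq: "poly (P ?m) = (\<lambda>x. poly (P (M j)) x + poly (P ?m - P (M j)) x)" by (simp add: fun_eq_iff)
    have dQ: "degree (P ?m - P (M j)) \<le> ?m"
      using dP[of "Suc j"] dP[of j] M(3)[of j] by (intro degree_diff_le) auto
    have "wint p w n (\<lambda>x. central_difference r (h * phi x) (poly (P ?m)) x) \<le>
       wint p w n (\<lambda>x. central_difference r (h * phi x) (poly (P (M j))) x) + wint p w n (\<lambda>x. central_difference r (h * phi x) (poly (P ?m - P (M j))) x)"
      by (subst eq) (rule wint_cd_add[OF p w]; measurable)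
    also have "\<dots> \<le> ennreal (K * real (M j) powr (\<beta> - \<gamma>) * real n powr (- \<beta>)) + ennreal (C * (real ?m / real n) powr \<beta>) * ennreal (A * real ?m powr (- \<gamma>))"
      by (intro add_mono IH order.trans[OF inv[OF M(1) Suc.prems dQ that(2,3)]] mult_left_mono Q) auto
    also have "\<dots> = ennreal (K * real (M j) powr (\<beta> - \<gamma>) * real n powr (- \<beta>) + C * (real ?m / real n) powr \<beta> * (A * real ?m powr (- \<gamma>)))"
      using K0 C A0 by (simp add: ennreal_mult ennreal_plus)
    also have "K * real (M j) powr (\<beta> - \<gamma>) * real n powr (- \<beta>) + C * (real ?m / real n) powr \<beta> * (A * real ?m powr (- \<gamma>))
       = (K * q + C * A) * (real ?m powr (\<beta> - \<gamma>) * real n powr (- \<beta>))"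
    proof -
      have "real (M j) powr (\<beta> - \<gamma>) = q * real ?m powr (\<beta> - \<gamma>)"
        using M0[of j] by (simp add: MS q_def powr_mult powr_diff)
      moreover have "(real ?m / real n) powr \<beta> * real ?m powr (- \<gamma>) = real ?m powr (\<beta> - \<gamma>) * real n powr (- \<beta>)"
        using M0[of "Suc j"] n by (simp add: powr_divide powr_minus powr_diff field_simps)
      ultimately show ?thesis by (simp add: algebra_simps)
    qed
    also have "ennreal \<dots> \<le> ennreal (K * (real ?m powr (\<beta> - \<gamma>) * real n powr (- \<beta>)))"
      by (intro ennreal_leI mult_right_mono Kq) auto
    finally show ?case by (simp add: mult.assoc)
  qed
  define K' where "K' = D * (4 * 2 powr \<gamma> * C1) + K"
  show ?thesis
  proof (intro exI[of _ K'] conjI allI impI)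
    show "0 \<le> K'" using D C1 K0 by (simp add: K'_def)
    fix n h assume n: "N0 \<le> n" and h: "0 < h" "h \<le> 1 / real n"
    have n0: "0 < real n" using n N0 by linarith
    have "\<exists>j. n < M j"
    proof -
      have "n < 2 ^ n" by (rule less_exp)
      also have "\<dots> \<le> M n" using N0 by (simp add: M_def)
      finally show ?thesis by blast
    qed
    moreover have "\<not> n < M 0" using n by (simp add: M_def)
    ultimately obtain j where j: "M j \<le> n" "n < M (Suc j)"
      using ex_least_nat_less[of "\<lambda>j. n < M j"] by (metis le_refl linorder_not_le less_Suc_eq_le)
    have n2: "n \<le> 2 * M j" using j(2) M(3)[of j] by simp
    have eq: "g = (\<lambda>x. (g x - poly (P (M j)) x) + poly (P (M j)) x)" by simp
    have "wint p w n (\<lambda>x. central_difference r (h * phi x) g x) \<le>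
       wint p w n (\<lambda>x. central_difference r (h * phi x) (\<lambda>x. g x - poly (P (M j)) x) x) + wint p w n (\<lambda>x. central_difference r (h * phi x) (poly (P (M j))) x)"
      using wint_cd_add[OF p w, of "\<lambda>x. g x - poly (P (M j)) x" "poly (P (M j))" n r h] by simp
    also have "\<dots> \<le> ennreal D * ennreal (4 * 2 powr \<gamma> * C1 * real n powr (- \<gamma>)) + ennreal (K * real (M j) powr (\<beta> - \<gamma>) * real n powr (- \<beta>))"
    proof (intro add_mono claim j h)
      have "wint p w n (\<lambda>x. central_difference r (h * phi x) (\<lambda>x. g x - poly (P (M j)) x) x) \<le> ennreal D * wint p w n (\<lambda>x. g x - poly (P (M j)) x)"
        using n N0 by (intro diff h) auto
      also have "\<dots> \<le> ennreal D * ennreal (4 * 2 powr \<gamma> * C1 * real n powr (- \<gamma>))" by (intro mult_left_mono err2 j n2) auto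
      finally show "wint p w n (\<lambda>x. central_difference r (h * phi x) (\<lambda>x. g x - poly (P (M j)) x) x) \<le> \<dots>" .
    qed
    also have "\<dots> = ennreal (D * (4 * 2 powr \<gamma> * C1) * real n powr (- \<gamma>) + K * real (M j) powr (\<beta> - \<gamma>) * real n powr (- \<beta>))"
      using D C1 K0 by (simp add: ennreal_mult ennreal_plus mult.assoc)
    also have "\<dots> \<le> ennreal (K' * real n powr (- \<gamma>))"
    proof (rule ennreal_leI)
      have "real (M j) powr (\<beta> - \<gamma>) \<le> real n powr (\<beta> - \<gamma>)" using j \<beta> by (intro powr_mono2) auto
      then have "K * real (M j) powr (\<beta> - \<gamma>) * real n powr (- \<beta>) \<le> K * real n powr (\<beta> - \<gamma>) * real n powr (- \<beta>)"
        using K0 by (intro mult_right_mono mult_left_mono) auto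
      also have "\<dots> = K * real n powr (- \<gamma>)" using n0 by (simp add: mult.assoc powr_add[symmetric])
      finally show "D * (4 * 2 powr \<gamma> * C1) * real n powr (- \<gamma>) + K * real (M j) powr (\<beta> - \<gamma>) * real n powr (- \<beta>) \<le> K' * real n powr (- \<gamma>)"
        by (simp add: K'_def distrib_right)
    qed
    finally show "wint p w n (\<lambda>x. central_difference r (h * phi x) g x) \<le> ennreal (K' * real n powr (- \<gamma>))" .
  qed
qed

section \<open>Polynomial approximation of step functions\<close>

text \<open>Comparison of integrals in terms of antiderivatives, which the kernels below have
  explicitly.\<close>

lemma antideriv_diff_le:
  assumes "a \<le> b" "\<And>t. t \<in> {a..b} \<Longrightarrow> (\<Phi> has_real_derivative K t) (at t)" "\<And>t. t \<in> {a..b} \<Longrightarrow> (\<Psi> has_real_derivative F t) (at t)"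
    and "\<And>t. t \<in> {a..b} \<Longrightarrow> K t \<le> F t"
  shows "\<Phi> b - \<Phi> a \<le> \<Psi> b - \<Psi> (a :: real)"
proof -
  have "(\<lambda>t. \<Psi> t - \<Phi> t) a \<le> (\<lambda>t. \<Psi> t - \<Phi> t) b"
    using assms by (intro DERIV_nonneg_imp_nondecreasing[OF assms(1)]) (auto intro!: exI DERIV_diff)
  then show ?thesis by simp
qed

lemma sin_add_2pi_nat: "sin (real k * (t + 2 * pi)) = sin (real k * t)"
proof -
  have "real k * (t + 2 * pi) = real k * t + 2 * pi * of_int (int k)" by (simp add: algebra_simps)
  then show ?thesis by (simp add: sin_add cos_int_2pin sin_int_2pin del: of_int_of_nat_eq)
qed

definition fejer_int :: "nat \<Rightarrow> real \<Rightarrow> real" where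
  "fejer_int M t = (\<Sum>k<M. t + 2 * (\<Sum>j=1..k. sin (real j * t) / real j)) / (real M)\<^sup>2"

lemma fejer_int_deriv: "(fejer_int M has_real_derivative fejer M t) (at t)"
proof -
  have "((\<lambda>t. t + 2 * (\<Sum>j=1..k. sin (real j * t) / real j)) has_real_derivative dirichlet k t) (at t)" for k
    unfolding dirichlet_def
    by (auto intro!: derivative_eq_intros DERIV_sum sum.cong simp: field_simps)
  then have "((\<lambda>t. \<Sum>k<M. t + 2 * (\<Sum>j=1..k. sin (real j * t) / real j)) has_real_derivative (\<Sum>k<M. dirichlet k t)) (at t)"
    by (intro DERIV_sum)
  from DERIV_cdivide[OF this, of "(real M)\<^sup>2"] show ?thesis
    unfolding fejer_int_def[abs_def] fejer_def .
qed

lemma fejer_int_period: "1 \<le> M \<Longrightarrow> fejer_int M (t + 2 * pi) = fejer_int M t + 2 * pi / real M"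
  by (simp add: fejer_int_def sin_add_2pi_nat sum.distrib power2_eq_square add_divide_distrib)

lemma fejer_arc_decay:
  assumes M: "1 \<le> M" and t: "0 \<le> d" "d \<le> t" "t \<le> 2 * pi - d"
  shows "fejer M t \<le> fc / (1 + (real M * d)\<^sup>2)"
proof -
  define u where "u = (if t \<le> pi then t else 2 * pi - t)"
  have u: "d \<le> u" "u \<le> pi" "fejer M t = fejer M u" using t by (auto simp: u_def fejer_periodic)
  have "fejer M u \<le> fc / (1 + (real M * u)\<^sup>2)" using u t by (intro fejer_decay M) auto
  also have "\<dots> \<le> fc / (1 + (real M * d)\<^sup>2)"
  proof (intro divide_left_mono)
    have "(real M * d)\<^sup>2 \<le> (real M * u)\<^sup>2" using u t by (intro power_mono mult_left_mono) auto
    then show "1 + (real M * d)\<^sup>2 \<le> 1 + (real M * u)\<^sup>2" by simp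
  qed (use fc_ge_1 in \<open>auto intro!: mult_pos_pos add_pos_nonneg\<close>)
  finally show ?thesis using u by simp
qed

text \<open>The indicator of \<open>(a, \<pi>]\<close> is convolved with a power of the Fejer kernel; the mass of the
  kernel outside an arc is compared with the mass of the kernel of one power less.\<close>

lemma step_approximation:
  "\<exists>C>0. \<forall>n a. 1 \<le> n \<longrightarrow> a \<in> {0..pi} \<longrightarrow> (\<exists>T. degree T \<le> Suc d * n \<and>
     (\<forall>\<theta>\<in>{0..pi}. \<bar>poly T (cos \<theta>) - (if a < \<theta> then 1 else 0)\<bar> \<le> C / (1 + (real n * (\<theta> - a))\<^sup>2) ^ d))"
proof -
  \<comment> \<open>The d Fejer factors that decay give \<open>fc ^ d\<close>. The rest is the ratio
    of 2\<pi>/n, the mass of one factor over a period, to the lower bound \<open>Zlow\<close> for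
    the mass of the whole kernel.\<close>
  define C where "C = pi * fc ^ d / (4 / pi\<^sup>2) ^ Suc d"
  have C: "0 < C" unfolding C_def using fc_ge_1 by (intro divide_pos_pos mult_pos_pos zero_less_power) auto
  show ?thesis
  proof (intro exI[of _ C] conjI C allI impI)
    fix n :: nat and a assume n: "1 \<le> n" and a: "a \<in> {0..pi}"
    define N where "N = Suc d * n"
    define K where "K t = fejer n t ^ Suc d" for t
    have "cos_poly N K" unfolding K_def[abs_def] N_def by (intro cos_poly_power cos_poly_fejer)
    then obtain b where b: "\<And>t. K t = (\<Sum>k\<le>N. b k * cos (real k * t))" unfolding cos_poly_def by blast
    define \<Phi> where "\<Phi> t = b 0 * t + (\<Sum>k=1..N. b k * (sin (real k * t) / real k))" for t
    have Kb: "K t = b 0 + (\<Sum>k=1..N. b k * cos (real k * t))" for t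
    proof -
      have "{..N} = insert 0 {1..N}" by auto
      then show ?thesis by (simp add: b)
    qed
    have \<Phi>': "(\<Phi> has_real_derivative K t) (at t)" for t
      unfolding \<Phi>_def[abs_def] Kb by (auto intro!: derivative_eq_intros DERIV_sum sum.cong simp: field_simps)
    have K0: "0 \<le> K t" for t unfolding K_def by (intro zero_le_power fejer_nonneg n)
    have mono: "\<Phi> s \<le> \<Phi> t" if "s \<le> t" for s t
      using antideriv_diff_le[of s t "\<lambda>_. 0" "\<lambda>_. 0" \<Phi> K] that \<Phi>' K0 by auto
    have per: "\<Phi> (t + 2 * pi) = \<Phi> t + 2 * pi * b 0" for t
      unfolding \<Phi>_def sin_add_2pi_nat by (simp add: distrib_left)
    define Z where "Z = 2 * pi * b 0"
    \<comment> \<open>Only the peak |t| <= 1/n is used, where each factor is at least 4/\<pi>^2; it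
      fits into one period.\<close>
    have Zlow: "(4 / pi\<^sup>2) ^ Suc d * (2 / real n) \<le> Z"
    proof -
      have n1: "1 / real n \<le> 1" using n by simp
      have lin: "((\<lambda>t. c * t) has_real_derivative c) (at t)" for c t :: real
        by (auto intro!: derivative_eq_intros)
      have "(\<lambda>t. (4 / pi\<^sup>2) ^ Suc d * t) (1 / real n) - (\<lambda>t. (4 / pi\<^sup>2) ^ Suc d * t) (- (1 / real n)) \<le> \<Phi> (1 / real n) - \<Phi> (- (1 / real n))"
      proof (rule antideriv_diff_le[where K="\<lambda>_. (4 / pi\<^sup>2) ^ Suc d" and F=K])
        fix t assume "t \<in> {- (1 / real n)..1 / real n}"
        then show "(4 / pi\<^sup>2) ^ Suc d \<le> K t" unfolding K_def by (intro power_mono fejer_lower n) (auto simp: abs_le_iff)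
      qed (simp, rule lin, rule \<Phi>')
      also have "\<dots> \<le> \<Phi> (- (1 / real n) + 2 * pi) - \<Phi> (- (1 / real n))"
        using n1 pi_gt3 by (intro diff_right_mono mono, linarith)
      also have "\<dots> = Z" unfolding per Z_def by simp
      finally show ?thesis by (simp add: algebra_simps)
    qed
    have Z0: "0 < Z" by (rule less_le_trans[OF _ Zlow]) (use n in \<open>intro mult_pos_pos zero_less_power, auto\<close>)
    \<comment> \<open>The mass of the kernel on the arc from \<theta> - a to \<theta> + a. It is
      even in \<theta>, hence a cosine polynomial, and 1 - R/Z approximates the step at a.\<close>
    define R where "R \<theta> = \<Phi> (\<theta> + a) - \<Phi> (\<theta> - a)" for \<theta>
    have "R \<theta> = (2 * a * b 0) * cos (real 0 * \<theta>) + (\<Sum>k=1..N. (2 * b k * sin (real k * a) / real k) * cos (real k * \<theta>))" for \<theta>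
    proof -
      have "b k * (sin (real k * (\<theta> + a)) / real k) - b k * (sin (real k * (\<theta> - a)) / real k) = 
         (2 * b k * sin (real k * a) / real k) * cos (real k * \<theta>)" for k
        by (simp add: distrib_left right_diff_distrib sin_add sin_diff diff_divide_distrib add_divide_distrib)
      then have "(\<Sum>k=1..N. b k * (sin (real k * (\<theta> + a)) / real k)) - (\<Sum>k=1..N. b k * (sin (real k * (\<theta> - a)) / real k)) =
        (\<Sum>k=1..N. (2 * b k * sin (real k * a) / real k) * cos (real k * \<theta>))"
        by (simp only: sum_subtractf[symmetric])
      moreover have "b 0 * (\<theta> + a) - b 0 * (\<theta> - a) = (2 * a * b 0) * cos (real 0 * \<theta>)" by (simp add: algebra_simps)
      ultimately show ?thesis unfolding R_def \<Phi>_def by linarith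
    qed
    then have "R = (\<lambda>\<theta>. (2 * a * b 0) * cos (real 0 * \<theta>) + (\<Sum>k=1..N. (2 * b k * sin (real k * a) / real k) * cos (real k * \<theta>)))"
      by (intro ext)
    moreover have "cos_poly N \<dots>" by (intro cos_poly_add cos_poly_sum cos_poly_cmult cos_poly_cos) auto
    ultimately have "cos_poly N R" by (simp only:)
    then have "cos_poly N (\<lambda>\<theta>. 1 * cos (real 0 * \<theta>) + (- 1 / Z) * R \<theta>)" by (intro cos_poly_add cos_poly_cmult cos_poly_cos) auto
    then obtain T where T: "degree T \<le> N" "\<And>\<theta>. 1 * cos (real 0 * \<theta>) + (- 1 / Z) * R \<theta> = poly T (cos \<theta>)"
      unfolding cos_poly_iff by blast
    have T': "poly T (cos \<theta>) = (Z - R \<theta>) / Z" for \<theta> using Z0 by (simp add: T(2)[symmetric] field_simps)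
    \<comment> \<open>On an arc at distance e from the peaks, d factors are bounded by their decay
      and one is kept, whose integral over a period is 2\<pi>/n.\<close>
    have arc: "(\<Phi> t - \<Phi> s) / Z \<le> C / (1 + (real n * e)\<^sup>2) ^ d" if e: "0 \<le> e" "e \<le> s" "s \<le> t" "t \<le> 2 * pi - e" for s t e
    proof -
      define \<delta> where "\<delta> = (fc / (1 + (real n * e)\<^sup>2)) ^ d"
      have \<delta>0: "0 \<le> \<delta>" unfolding \<delta>_def using fc_ge_1 e by (intro zero_le_power divide_nonneg_nonneg add_nonneg_nonneg) auto
      have "\<Phi> t - \<Phi> s \<le> (\<lambda>t. \<delta> * fejer_int n t) t - (\<lambda>t. \<delta> * fejer_int n t) s"
      proof (rule antideriv_diff_le[where F="\<lambda>t. \<delta> * fejer n t" and K=K])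
        fix v assume v: "v \<in> {s..t}"
        have "fejer n v ^ d \<le> \<delta>" unfolding \<delta>_def using v e by (intro power_mono fejer_arc_decay fejer_nonneg n) auto
        then have "fejer n v * fejer n v ^ d \<le> fejer n v * \<delta>" by (intro mult_left_mono fejer_nonneg n)
        then show "K v \<le> \<delta> * fejer n v" by (simp add: K_def mult.commute)
      qed (auto intro!: derivative_eq_intros fejer_int_deriv \<Phi>' e)
      also have "\<dots> = \<delta> * (fejer_int n t - fejer_int n s)" by (simp add: algebra_simps)
      also have "\<dots> \<le> \<delta> * (2 * pi / real n)"
      proof (intro mult_left_mono \<delta>0)
        have "fejer_int n t \<le> fejer_int n (s + 2 * pi)"
          using antideriv_diff_le[of t "s + 2 * pi" "\<lambda>_. 0" "\<lambda>_. 0" "fejer_int n" "fejer n"] e fejer_int_deriv fejer_nonneg[OF n] by auto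
        then show "fejer_int n t - fejer_int n s \<le> 2 * pi / real n" using fejer_int_period[OF n, of s] by simp
      qed
      finally have "(\<Phi> t - \<Phi> s) / Z \<le> \<delta> * (2 * pi / real n) / Z" using Z0 by (intro divide_right_mono) auto
      also have "\<dots> \<le> \<delta> * (2 * pi / real n) / ((4 / pi\<^sup>2) ^ Suc d * (2 / real n))"
        using Zlow Z0 n \<delta>0 by (intro divide_left_mono mult_pos_pos mult_nonneg_nonneg zero_less_power) auto
      also have "\<dots> = \<delta> * pi / (4 / pi\<^sup>2) ^ Suc d" using n by (simp add: field_simps)
      also have "\<dots> = C / (1 + (real n * e)\<^sup>2) ^ d" by (simp add: C_def \<delta>_def power_divide mult_ac)
      finally show ?thesis .
    qed
    show "\<exists>T. degree T \<le> Suc d * n \<and>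
     (\<forall>\<theta>\<in>{0..pi}. \<bar>poly T (cos \<theta>) - (if a < \<theta> then 1 else 0)\<bar> \<le> C / (1 + (real n * (\<theta> - a))\<^sup>2) ^ d)"
    proof (intro exI[of _ T] conjI ballI)
      show "degree T \<le> Suc d * n" using T(1) by (simp add: N_def)
      fix \<theta> assume \<theta>: "\<theta> \<in> {0..pi}"
      have R0: "0 \<le> R \<theta>" unfolding R_def using mono[of "\<theta> - a" "\<theta> + a"] a by auto
      \<comment> \<open>The mass of the complementary arc. For \<theta> <= a it is this arc that
        avoids the peaks, at distance a - \<theta>.\<close>
      have ZR: "Z - R \<theta> = \<Phi> (\<theta> - a + 2 * pi) - \<Phi> (\<theta> + a)" unfolding per R_def Z_def by simp
      have ZR0: "0 \<le> Z - R \<theta>" unfolding ZR using mono[of "\<theta> + a" "\<theta> - a + 2 * pi"] a \<theta> by auto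
      show "\<bar>poly T (cos \<theta>) - (if a < \<theta> then 1 else 0)\<bar> \<le> C / (1 + (real n * (\<theta> - a))\<^sup>2) ^ d"
      proof (cases "a < \<theta>")
        case True
        have "poly T (cos \<theta>) - 1 = - (R \<theta> / Z)" using Z0 by (simp add: T' diff_divide_distrib)
        then have "\<bar>poly T (cos \<theta>) - (if a < \<theta> then 1 else 0)\<bar> = R \<theta> / Z" using True R0 Z0 by simp
        also have "\<dots> \<le> C / (1 + (real n * (\<theta> - a))\<^sup>2) ^ d" unfolding R_def using True a \<theta> by (intro arc) auto
        finally show ?thesis .
      next
        case False
        then have "\<bar>poly T (cos \<theta>) - (if a < \<theta> then 1 else 0)\<bar> = (\<Phi> (\<theta> - a + 2 * pi) - \<Phi> (\<theta> + a)) / Z" 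
          using ZR0 Z0 by (simp add: T' ZR)
        also have "\<dots> \<le> C / (1 + (real n * (a - \<theta>))\<^sup>2) ^ d" using False a \<theta> by (intro arc) auto
        also have "(real n * (a - \<theta>))\<^sup>2 = (real n * (\<theta> - a))\<^sup>2" by (simp add: power_mult_distrib power2_commute)
        finally show ?thesis .
      qed
    qed
  qed
qed

text \<open>The p-th power weakens the decay exponent d to d p, so d is chosen at least e/p; D
  collects the resulting degree.\<close>

lemma step_approximation_pp:
  assumes p: "0 < p" "p \<le> 1"
  shows "\<exists>D. \<exists>C>0. \<forall>n a. 1 \<le> n \<longrightarrow> a \<in> {0..pi} \<longrightarrow> (\<exists>T. degree T \<le> D * n \<and>
     (\<forall>\<theta>\<in>{0..pi}. pp p (poly T (cos \<theta>) - (if a < \<theta> then 1 else 0)) \<le> ennreal (C / (1 + (real n * (\<theta> - a))\<^sup>2) ^ e)))"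
proof -
  obtain d :: nat where d: "real e / p \<le> real d" using real_arch_simple by blast
  then have ed: "real e \<le> real d * p" using p by (simp add: pos_divide_le_eq)
  obtain C where C: "0 < C" and step: "\<And>n a. 1 \<le> n \<Longrightarrow> a \<in> {0..pi} \<Longrightarrow> \<exists>T. degree T \<le> Suc d * n \<and>
     (\<forall>\<theta>\<in>{0..pi}. \<bar>poly T (cos \<theta>) - (if a < \<theta> then 1 else 0)\<bar> \<le> C / (1 + (real n * (\<theta> - a))\<^sup>2) ^ d)"
    using step_approximation[of d] by blast
  have bound: "pp p z \<le> ennreal (C powr p / (1 + (real n * (\<theta> - a))\<^sup>2) ^ e)" if "\<bar>z\<bar> \<le> C / (1 + (real n * (\<theta> - a))\<^sup>2) ^ d" for z n \<theta> a
  proof -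
    let ?E = "1 + (real n * (\<theta> - a))\<^sup>2"
    have E: "1 \<le> ?E" by simp
    have E0: "0 < ?E" by (rule less_le_trans[OF zero_less_one E])
    have "\<bar>z\<bar> powr p \<le> (C / ?E ^ d) powr p" using that p by (intro powr_mono2) auto
    also have "\<dots> = C powr p / (?E ^ d) powr p" using C E0 by (simp add: powr_divide)
    also have "\<dots> \<le> C powr p / ?E ^ e"
    proof (intro divide_left_mono mult_pos_pos zero_less_power E0)
      have "?E ^ e = ?E powr real e" by (rule powr_realpow[OF E0, symmetric])
      also have "\<dots> \<le> ?E powr (real d * p)" using ed E by (intro powr_mono) auto
      also have "\<dots> = (?E powr real d) powr p" by (simp add: powr_powr)
      also have "?E powr real d = ?E ^ d" by (rule powr_realpow[OF E0])
      finally show "?E ^ e \<le> (?E ^ d) powr p" .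
      have "0 < ?E ^ d" by (rule zero_less_power[OF E0])
      then show "0 < (?E ^ d) powr p" by (simp only: powr_gt_zero)
    qed simp
    finally show ?thesis unfolding pp_def by (rule ennreal_leI)
  qed
  show ?thesis
  proof (rule exI[of _ "Suc d"], rule exI[of _ "C powr p"], intro conjI allI impI)
    show "0 < C powr p" using C by simp
    fix n :: nat and a assume "1 \<le> n" "a \<in> {0..pi}"
    from step[OF this] show "\<exists>T. degree T \<le> Suc d * n \<and>
     (\<forall>\<theta>\<in>{0..pi}. pp p (poly T (cos \<theta>) - (if a < \<theta> then 1 else 0)) \<le> ennreal (C powr p / (1 + (real n * (\<theta> - a))\<^sup>2) ^ e))"
      using bound by meson
  qed
qed

section \<open>The direct estimate\<close>

definition tn :: "nat \<Rightarrow> nat \<Rightarrow> real" where "tn N j = real j * pi / real N"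

definition xn :: "nat \<Rightarrow> nat \<Rightarrow> real" where "xn N j = cos (tn N j)"

context
  fixes N :: nat
  assumes N: "1 \<le> N"
begin

lemma tn_bounds: "j \<le> N \<Longrightarrow> tn N j \<in> {0..pi}"
  using N by (auto simp: tn_def divide_le_eq)

lemma tn_mono: "i \<le> j \<Longrightarrow> tn N i \<le> tn N j"
  by (auto simp: tn_def intro!: divide_right_mono)

lemma tn_Suc: "tn N (Suc j) = tn N j + pi / real N"
  by (simp add: tn_def add_divide_distrib algebra_simps)

lemma xn_mono: "i \<le> j \<Longrightarrow> j \<le> N \<Longrightarrow> xn N j \<le> xn N i"
  unfolding xn_def using tn_bounds[of i] tn_bounds[of j] tn_mono[of i j] by (intro cos_monotone_0_pi_le) auto

lemma xn_bounds: "xn N j \<in> {-1..1}"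
  by (simp add: xn_def)

lemma sin_tn_ge:
  assumes "1 \<le> j" "Suc j \<le> N"
  shows "2 / real N \<le> sin (tn N j)"
proof -
  define t where "t = (if tn N j \<le> pi / 2 then tn N j else pi - tn N j)"
  have "pi / real N \<le> tn N j" using assms by (auto simp: tn_def intro!: divide_right_mono)
  moreover have "tn N j \<le> pi - pi / real N" using tn_bounds[of "Suc j"] assms by (simp add: tn_Suc)
  ultimately have t: "pi / real N \<le> t" "t \<le> pi / 2" "sin t = sin (tn N j)" by (auto simp: t_def)
  have N0: "0 < pi / real N" using N by simp
  have "2 / real N = 2 * (pi / real N) / pi" by simp
  also have "\<dots> \<le> 2 * t / pi" using t by (intro divide_right_mono) auto
  also have "\<dots> \<le> sin t" using t N0 by (intro jordan_sin) linarith+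
  finally show ?thesis using t by simp
qed

text \<open>By the product formula again: the sine of the middle angle is at least half of sin t_j,
  and the sine of half the angular width is at least 1/N by Jordan's inequality.\<close>

lemma cell_length:
  assumes "1 \<le> j" "Suc j \<le> N"
  shows "sin (tn N j) \<le> real N * (xn N j - xn N (Suc j))"
proof -
  have S: "sin (tn N j) / 2 \<le> sin ((tn N j + tn N (Suc j)) / 2)"
  proof -
    have "sin (tn N j) + sin (tn N (Suc j)) = 2 * sin ((tn N j + tn N (Suc j)) / 2) * cos ((tn N j - tn N (Suc j)) / 2)" by (rule sin_plus_sin)
    also have "\<dots> \<le> 2 * sin ((tn N j + tn N (Suc j)) / 2) * 1" 
      using tn_bounds[of j] tn_bounds[of "Suc j"] assms by (intro mult_left_mono mult_nonneg_nonneg sin_ge_zero) auto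
    finally show ?thesis using sin_ge_zero[of "tn N (Suc j)"] tn_bounds[of "Suc j"] assms by auto
  qed
  have "1 / real N = 2 * (pi / (2 * real N)) / pi" by simp
  also have "\<dots> \<le> sin (pi / (2 * real N))" using N by (intro jordan_sin) (auto simp: field_simps)
  finally have s1: "1 / real N \<le> sin (pi / (2 * real N))" .
  have "xn N j - xn N (Suc j) = 2 * sin ((tn N j + tn N (Suc j)) / 2) * sin ((tn N (Suc j) - tn N j) / 2)"
    by (simp add: xn_def cos_diff_cos)
  also have "(tn N (Suc j) - tn N j) / 2 = pi / (2 * real N)" by (simp add: tn_Suc)
  finally have eq: "xn N j - xn N (Suc j) = 2 * (sin ((tn N j + tn N (Suc j)) / 2) * sin (pi / (2 * real N)))" by simp
  have s0: "0 \<le> sin (tn N j)" using tn_bounds[of j] assms by (intro sin_ge_zero) auto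
  have "sin (tn N j) / 2 * (1 / real N) \<le> sin ((tn N j + tn N (Suc j)) / 2) * sin (pi / (2 * real N))"
    using S s1 s0 by (intro mult_mono) auto
  then have "sin (tn N j) * (1 / real N) \<le> xn N j - xn N (Suc j)" unfolding eq by simp
  then show ?thesis using N by (simp add: field_simps)
qed

lemma cell_length_pos:
  assumes "1 \<le> j" "Suc j \<le> N"
  shows "xn N (Suc j) < xn N j"
proof -
  have "0 < 2 / real N" using N by simp
  then have "0 < real N * (xn N j - xn N (Suc j))" using sin_tn_ge[OF assms] cell_length[OF assms] by linarith
  then show ?thesis using N by (simp add: zero_less_mult_iff)
qed

lemma abs_cos_diff_le:
  assumes "\<theta> \<in> {0..pi}" "\<tau> \<in> {0..pi}"
  shows "\<bar>cos \<theta> - cos \<tau>\<bar> \<le> \<bar>\<theta> - \<tau>\<bar> * (sin \<tau> + \<bar>\<theta> - \<tau>\<bar>)"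
proof -
  define d where "d = \<bar>\<theta> - \<tau>\<bar>"
  have s: "0 \<le> sin ((\<theta> + \<tau>) / 2)" using assms by (intro sin_ge_zero) auto
  have "\<bar>cos \<theta> - cos \<tau>\<bar> = 2 * (sin ((\<theta> + \<tau>) / 2) * \<bar>sin ((\<tau> - \<theta>) / 2)\<bar>)"
    using s by (simp add: cos_diff_cos abs_mult)
  also have "\<dots> \<le> 2 * ((sin \<tau> + d) * (d / 2))"
  proof (intro mult_left_mono mult_mono)
    have "sin ((\<theta> + \<tau>) / 2) \<le> sin \<tau> + \<bar>(\<theta> + \<tau>) / 2 - \<tau>\<bar>" by (rule sin_le_add)
    also have "(\<theta> + \<tau>) / 2 - \<tau> = (\<theta> - \<tau>) / 2" by (simp add: field_simps)
    finally have "sin ((\<theta> + \<tau>) / 2) \<le> sin \<tau> + \<bar>(\<theta> - \<tau>) / 2\<bar>" .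
    moreover have "\<bar>(\<theta> - \<tau>) / 2\<bar> \<le> d" by (simp add: d_def)
    ultimately show "sin ((\<theta> + \<tau>) / 2) \<le> sin \<tau> + d" by linarith
    show "\<bar>sin ((\<tau> - \<theta>) / 2)\<bar> \<le> d / 2" using abs_sin_x_le_abs_x[of "(\<tau> - \<theta>) / 2"] by (simp add: d_def abs_minus_commute)
    show "0 \<le> sin \<tau> + d" using assms by (auto simp: d_def intro!: add_nonneg_nonneg sin_ge_zero)
  qed auto
  finally show ?thesis by (simp add: d_def mult_ac)
qed

text \<open>Ratios with respect to the cell next to \<open>x\<^sub>j\<close> grow at most polynomially in \<open>N |\<theta> - t\<^sub>j|\<close>.\<close>

lemma cell_ratio:
  assumes j: "1 \<le> j" "Suc j \<le> N" and \<theta>: "\<theta> \<in> {0..pi}"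
  defines "E \<equiv> 1 + (real N * (\<theta> - tn N j))\<^sup>2"
  shows "1 + \<bar>cos \<theta> - xn N (Suc j)\<bar> / (xn N j - xn N (Suc j)) \<le> 4 * E"
    and "sin \<theta> \<le> 2 * real N * (xn N j - xn N (Suc j)) * E"
proof -
  define l where "l = xn N j - xn N (Suc j)"
  define d where "d = \<bar>\<theta> - tn N j\<bar>"
  define y where "y = real N * d"
  have l: "0 < l" using cell_length_pos[OF j] by (simp add: l_def)
  have d0: "0 \<le> d" and y0: "0 \<le> y" by (simp_all add: d_def y_def)
  have E: "E = 1 + y\<^sup>2" by (simp add: E_def y_def d_def power_mult_distrib)
  have tj: "tn N j \<in> {0..pi}" using j by (intro tn_bounds) auto
  note sl = cell_length[OF j, folded l_def]
  have dN: "d \<le> y / 2 * (real N * l)"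
  proof -
    have "2 / real N \<le> real N * l" using sin_tn_ge[OF j] sl by linarith
    then have "y / 2 * (2 / real N) \<le> y / 2 * (real N * l)" using y0 by (intro mult_left_mono) auto
    moreover have "y / 2 * (2 / real N) = d" using N by (simp add: y_def)
    ultimately show ?thesis by linarith
  qed
  have sum: "sin (tn N j) + d \<le> (1 + y / 2) * (real N * l)" using sl dN by (simp add: distrib_right)
  have y2: "2 * y \<le> 1 + y\<^sup>2" using zero_le_power2[of "y - 1"] by (simp add: power2_diff)
  have "\<bar>cos \<theta> - xn N j\<bar> \<le> d * (sin (tn N j) + d)" unfolding xn_def d_def by (rule abs_cos_diff_le[OF \<theta> tj])
  also have "\<dots> \<le> d * ((1 + y / 2) * (real N * l))" using d0 by (intro mult_left_mono sum)
  also have "\<dots> = (y + y\<^sup>2 / 2) * l" by (simp add: y_def power2_eq_square algebra_simps)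
  finally have "\<bar>cos \<theta> - xn N j\<bar> \<le> (y + y\<^sup>2 / 2) * l" .
  then have "\<bar>cos \<theta> - xn N (Suc j)\<bar> \<le> (y + y\<^sup>2 / 2) * l + l" using l_def l by linarith
  then have "\<bar>cos \<theta> - xn N (Suc j)\<bar> / l \<le> (y + y\<^sup>2 / 2 + 1)" using l by (simp add: pos_divide_le_eq distrib_right)
  moreover have "1 + (y + y\<^sup>2 / 2 + 1) \<le> 4 * E" using y2 zero_le_power2[of y] unfolding E distrib_left by linarith
  ultimately show "1 + \<bar>cos \<theta> - xn N (Suc j)\<bar> / (xn N j - xn N (Suc j)) \<le> 4 * E" unfolding l_def[symmetric] by linarith
  have "sin \<theta> \<le> sin (tn N j) + d" unfolding d_def by (rule sin_le_add)
  also have "\<dots> \<le> (1 + y / 2) * (real N * l)" by (rule sum)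
  also have "\<dots> \<le> (2 * E) * (real N * l)"
  proof (intro mult_right_mono)
    show "1 + y / 2 \<le> 2 * E" using y2 y0 zero_le_power2[of y] unfolding E distrib_left by linarith
  qed (use l in auto)
  finally show "sin \<theta> \<le> 2 * real N * (xn N j - xn N (Suc j)) * E" by (simp add: l_def mult_ac)
qed

lemma double_cell_angle:
  assumes j: "1 \<le> j" "Suc j \<le> N" and \<theta>: "\<theta> \<in> {0..pi}"
  shows "cos \<theta> \<in> {xn N (Suc j)..xn N (j - 1)} \<longleftrightarrow> \<bar>\<theta> - tn N j\<bar> \<le> pi / real N"
proof -
  have tS: "tn N (Suc j) = tn N j + pi / real N" "tn N j = tn N (j - 1) + pi / real N"
    using tn_Suc[of j] tn_Suc[of "j - 1"] j by auto
  have b: "tn N (Suc j) \<in> {0..pi}" "tn N (j - 1) \<in> {0..pi}" using j by (auto intro!: tn_bounds simp del: atLeastAtMost_iff)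
  have "cos \<theta> \<in> {xn N (Suc j)..xn N (j - 1)} \<longleftrightarrow> \<theta> \<le> tn N (Suc j) \<and> tn N (j - 1) \<le> \<theta>"
    unfolding xn_def atLeastAtMost_iff using b \<theta> by (simp add: cos_mono_le_eq)
  then show ?thesis using tS by auto
qed

end

text \<open>Summation by parts: a piecewise choice of c is its first value plus its jumps times step
  functions. At \<theta> exactly the jumps to the left are active and telescope to c k. Replacing
  the step functions by polynomials is what the blending consists of.\<close>

lemma spline_select:
  assumes N: "2 \<le> N" and \<theta>: "\<theta> \<in> {0..pi}"
  obtains k where "1 \<le> k" "Suc k \<le> N" "cos \<theta> \<in> {xn N (Suc k)..xn N (k - 1)}"
    "\<And>c :: nat \<Rightarrow> real. c 1 + (\<Sum>j=1..N-2. (c (Suc j) - c j) * (if tn N j < \<theta> then 1 else 0)) = c k"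
proof -
  have N1: "1 \<le> N" using N by simp
  define i where "i = (LEAST i. 1 \<le> i \<and> \<theta> \<le> tn N i)"
  have "1 \<le> N \<and> \<theta> \<le> tn N N" using N \<theta> by (simp add: tn_def)
  then have i: "1 \<le> i" "\<theta> \<le> tn N i" "i \<le> N" 
    unfolding i_def using LeastI[of "\<lambda>i. 1 \<le> i \<and> \<theta> \<le> tn N i" N] Least_le[of "\<lambda>i. 1 \<le> i \<and> \<theta> \<le> tn N i" N] by auto
  have less: "tn N j < \<theta>" if "1 \<le> j" "j < i" for j
    using not_less_Least[of j "\<lambda>i. 1 \<le> i \<and> \<theta> \<le> tn N i"] that by (auto simp: i_def)
  have ge: "\<not> tn N j < \<theta>" if "i \<le> j" for j using tn_mono[OF N1 that] i by simp
  \<comment> \<open>In the last cell i = N, but the double cells are numbered up to N - 1 only; the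
    double cell of N - 1 still reaches t_N, and there is no jump at t_(N-1).\<close>
  define k where "k = min i (N - 1)"
  have k: "1 \<le> k" "Suc k \<le> N" using i N by (auto simp: k_def)
  have "\<bar>\<theta> - tn N k\<bar> \<le> pi / real N"
  proof (cases "i \<le> N - 1")
    case True
    then have ki: "k = i" by (simp add: k_def)
    have "tn N (i - 1) \<le> \<theta>"
    proof (cases "i = 1")
      case True then show ?thesis using \<theta> by (simp add: tn_def)
    next
      case False then have "tn N (i - 1) < \<theta>" using i by (intro less) auto
      then show ?thesis by simp
    qed
    moreover have "tn N i = tn N (i - 1) + pi / real N" using tn_Suc[OF N1, of "i - 1"] i by simp
    ultimately show ?thesis using i ki by auto
  next
    case False
    then have ki: "k = N - 1" "i = N" using i by (auto simp: k_def)
    have "tn N (N - 1) < \<theta>" using less[of "N - 1"] ki N by auto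
    moreover have "tn N N = tn N (N - 1) + pi / real N" using tn_Suc[OF N1, of "N - 1"] N by simp
    ultimately show ?thesis using i ki by auto
  qed
  then have J: "cos \<theta> \<in> {xn N (Suc k)..xn N (k - 1)}" using double_cell_angle[OF N1 k \<theta>] by simp
  have "c 1 + (\<Sum>j=1..N-2. (c (Suc j) - c j) * (if tn N j < \<theta> then 1 else 0)) = c k" for c :: "nat \<Rightarrow> real"
  proof -
    have "(\<Sum>j=1..N-2. (c (Suc j) - c j) * (if tn N j < \<theta> then 1 else 0)) = (\<Sum>j=1..<k. c (Suc j) - c j)"
    proof (rule sum.mono_neutral_cong_right)
      show "{1..<k} \<subseteq> {1..N - 2}" using k by auto
      show "\<forall>j\<in>{1..N - 2} - {1..<k}. (c (Suc j) - c j) * (if tn N j < \<theta> then 1 else 0) = 0"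
        using ge by (auto simp: k_def)
      fix j assume "j \<in> {1..<k}"
      then show "(c (Suc j) - c j) * (if tn N j < \<theta> then 1 else 0) = c (Suc j) - c j"
        using less[of j] by (auto simp: k_def)
    qed simp
    also have "\<dots> = c k - c 1" by (rule sum_Suc_diff') (use k in simp)
    finally show ?thesis by simp
  qed
  then show ?thesis using that k J by blast
qed

text \<open>Let E = 1 + (n (\<theta> - t_j))^2. The growth of q costs r powers of E, the weight s,
  the Jacobian one. The error of T supplies r + s + 2, so 1/E remains, which the Cauchy kernel
  integrates. Passing from scale 8n to n costs 64 = 8^2, whence 256 = 4 * 64 and 1024 = 2 * 8 *
  64.\<close>

lemma correction_term:
  assumes p: "0 < p" "p \<le> 1" and w: "doubling_weight w" and n: "1 \<le> n" and B: "1 \<le> B"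
    and slow: "slow B s n (\<lambda>\<theta>. avg_weight w n (cos \<theta>))"
    and j: "1 \<le> j" "Suc j \<le> 8 * n" and CP: "0 < CP" and CT: "0 < CT"
    and q: "\<And>a b x. a < b \<Longrightarrow> pp p (poly q x) \<le> ennreal (CP * (1 + \<bar>x - a\<bar> / (b - a)) ^ r / (b - a)) * (\<integral>\<^sup>+y\<in>{a..b}. pp p (poly q y) \<partial>lborel)"
    and T: "\<And>\<theta>. \<theta> \<in> {0..pi} \<Longrightarrow> pp p (poly T (cos \<theta>) - (if tn (8 * n) j < \<theta> then 1 else 0)) \<le> ennreal (CT / (1 + (real n * (\<theta> - tn (8 * n) j))\<^sup>2) ^ (r + s + 2))"
  shows "(\<integral>\<^sup>+\<theta>\<in>{0..pi}. pp p (poly q (cos \<theta>)) * pp p (poly T (cos \<theta>) - (if tn (8 * n) j < \<theta> then 1 else 0)) * ennreal (avg_weight w n (cos \<theta>)) * ennreal (sin \<theta>) \<partial>lborel)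
    \<le> ennreal (CP * 256 ^ r * CT * B * 1024 * pi) * (ennreal (avg_weight w n (xn (8 * n) j)) * (\<integral>\<^sup>+y\<in>{xn (8 * n) (Suc j)..xn (8 * n) j}. pp p (poly q y) \<partial>lborel))"
proof -
  let ?N = "8 * n"
  have N1: "1 \<le> ?N" using n by simp
  define l where "l = xn ?N j - xn ?N (Suc j)"
  have l: "0 < l" using cell_length_pos[OF N1 j] by (simp add: l_def)
  define \<tau> where "\<tau> = tn ?N j"
  have \<tau>: "\<tau> \<in> {0..pi}" unfolding \<tau>_def using j by (intro tn_bounds[OF N1]) auto
  define v where "v = avg_weight w n (xn ?N j)"
  have v: "0 \<le> v" unfolding v_def by (intro avg_weight_nonneg w n xn_bounds[OF N1])
  define I where "I = (\<integral>\<^sup>+y\<in>{xn ?N (Suc j)..xn ?N j}. pp p (poly q y) \<partial>lborel)"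
  define A where "A = CP * 256 ^ r * CT * B * 1024"
  have A: "0 \<le> A" using CP CT B by (simp add: A_def)
  have "(\<integral>\<^sup>+\<theta>\<in>{0..pi}. pp p (poly q (cos \<theta>)) * pp p (poly T (cos \<theta>) - (if \<tau> < \<theta> then 1 else 0)) * ennreal (avg_weight w n (cos \<theta>)) * ennreal (sin \<theta>) \<partial>lborel)
    \<le> (\<integral>\<^sup>+\<theta>\<in>{0..pi}. (ennreal (A * v) * I) * ennreal (real n / (1 + (real n * (\<tau> - \<theta>))\<^sup>2)) \<partial>lborel)"
  proof (rule set_nn_integral_mono)
    fix \<theta> assume \<theta>: "\<theta> \<in> {0..pi}"
    define E where "E = 1 + (real n * (\<theta> - \<tau>))\<^sup>2"
    have E1: "1 \<le> E" by (simp add: E_def)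
    have E0: "0 < E" using E1 by linarith
    have EN: "1 + (real ?N * (\<theta> - \<tau>))\<^sup>2 \<le> 64 * E" by (simp add: E_def power_mult_distrib)
    note ratio = cell_ratio[OF N1 j \<theta>, folded l_def \<tau>_def]
    have 1: "pp p (poly q (cos \<theta>)) \<le> ennreal (CP * (256 * E) ^ r / l) * I"
    proof -
      have "pp p (poly q (cos \<theta>)) \<le> ennreal (CP * (1 + \<bar>cos \<theta> - xn ?N (Suc j)\<bar> / l) ^ r / l) * I"
        unfolding I_def l_def by (rule q[OF cell_length_pos[OF N1 j]])
      also have "\<dots> \<le> ennreal (CP * (256 * E) ^ r / l) * I"
      proof (intro mult_right_mono ennreal_leI divide_right_mono mult_left_mono power_mono)
        show "1 + \<bar>cos \<theta> - xn ?N (Suc j)\<bar> / l \<le> 256 * E" using order_trans[OF ratio(1) mult_left_mono[OF EN, of 4]] by simp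
      qed (use l CP in auto)
      finally show ?thesis .
    qed
    have 2: "sin \<theta> \<le> 1024 * real n * l * E"
    proof -
      have "sin \<theta> \<le> 2 * real ?N * l * (1 + (real ?N * (\<theta> - \<tau>))\<^sup>2)" by (rule ratio(2))
      also have "\<dots> \<le> 2 * real ?N * l * (64 * E)" using l EN by (intro mult_left_mono) auto
      finally show ?thesis by simp
    qed
    have 3: "avg_weight w n (cos \<theta>) \<le> B * E ^ s * v"
      using slow \<theta> \<tau> by (auto simp: slow_def E_def v_def xn_def \<tau>_def)
    have w0: "0 \<le> avg_weight w n (cos \<theta>)" by (intro avg_weight_nonneg w n) auto
    have s0: "0 \<le> sin \<theta>" using \<theta> by (intro sin_ge_zero) auto
    have "pp p (poly q (cos \<theta>)) * pp p (poly T (cos \<theta>) - (if \<tau> < \<theta> then 1 else 0)) * ennreal (avg_weight w n (cos \<theta>)) * ennreal (sin \<theta>)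
      \<le> (ennreal (CP * (256 * E) ^ r / l) * I) * ennreal (CT / E ^ (r + s + 2)) * ennreal (B * E ^ s * v) * ennreal (1024 * real n * l * E)"
      using T[OF \<theta>] 1 2 3 by (intro mult_mono ennreal_leI) (auto simp: E_def \<tau>_def)
    also have "\<dots> = ennreal ((CP * (256 * E) ^ r / l) * (CT / E ^ (r + s + 2)) * (B * E ^ s * v) * (1024 * real n * l * E)) * I"
    proof -
      have *: "ennreal a * I * ennreal b * ennreal c * ennreal d = ennreal (a * b * c * d) * I"
        if "0 \<le> a" "0 \<le> b" "0 \<le> c" "0 \<le> d" for a b c d
        using that by (simp add: ennreal_mult mult_ac)
      show ?thesis using CP CT B E0 l v by (intro *) auto
    qed
    also have "(CP * (256 * E) ^ r / l) * (CT / E ^ (r + s + 2)) * (B * E ^ s * v) * (1024 * real n * l * E) = A * v * (real n / E)"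
      using E0 l by (simp add: A_def power_mult_distrib power_add power2_eq_square field_simps)
    also have "ennreal (A * v * (real n / E)) * I = (ennreal (A * v) * I) * ennreal (real n / E)"
    proof -
      have "ennreal (A * v * (real n / E)) = ennreal (A * v) * ennreal (real n / E)" using A v E0 by (intro ennreal_mult) auto
      then show ?thesis by (simp only: mult_ac)
    qed
    also have "E = 1 + (real n * (\<tau> - \<theta>))\<^sup>2" by (simp add: E_def power_mult_distrib power2_commute)
    finally show "pp p (poly q (cos \<theta>)) * pp p (poly T (cos \<theta>) - (if \<tau> < \<theta> then 1 else 0)) * ennreal (avg_weight w n (cos \<theta>)) * ennreal (sin \<theta>)
      \<le> (ennreal (A * v) * I) * ennreal (real n / (1 + (real n * (\<tau> - \<theta>))\<^sup>2))" .
  qed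
  also have "\<dots> = (ennreal (A * v) * I) * (\<integral>\<^sup>+\<theta>\<in>{0..pi}. ennreal (real n / (1 + (real n * (\<tau> - \<theta>))\<^sup>2)) \<partial>lborel)"
    by (subst nn_integral_cmult[symmetric]) (auto simp: mult.assoc)
  also have "\<dots> \<le> (ennreal (A * v) * I) * ennreal pi" by (intro mult_left_mono cauchy_kernel_integral n) auto
  also have "\<dots> = ennreal (A * pi) * (ennreal v * I)" using A v by (simp add: ennreal_mult mult_ac)
  finally show ?thesis unfolding A_def I_def v_def \<tau>_def .
qed

text \<open>Angles in one double cell of the partition with N = 8n differ by at most \<pi>/(8n) from
  its node, less than 1/n; so the comparison factor is at most 2^s.\<close>

lemma slow_near:
  assumes V: "slow B s n V" and n: "1 \<le> n" and B: "0 \<le> B" and \<theta>: "\<theta> \<in> {0..pi}" and \<tau>: "\<tau> \<in> {0..pi}" 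
    and near: "\<bar>\<theta> - \<tau>\<bar> \<le> pi / real (8 * n)"
  shows "V \<theta> \<le> B * 2 ^ s * V \<tau>"
proof -
  have "real n * \<bar>\<theta> - \<tau>\<bar> \<le> real n * (pi / real (8 * n))" using near by (intro mult_left_mono) auto
  also have "\<dots> = pi / 8" using n by simp
  finally have "\<bar>real n * (\<theta> - \<tau>)\<bar> \<le> 1" using pi_less_4 by (simp add: abs_mult)
  then have z: "(real n * (\<theta> - \<tau>))\<^sup>2 \<le> 1" by (simp only: abs_square_le_1)
  have "V \<theta> \<le> B * (1 + (real n * (\<theta> - \<tau>))\<^sup>2) ^ s * V \<tau>" using V \<theta> \<tau> by (auto simp: slow_def)
  also have "\<dots> \<le> B * 2 ^ s * V \<tau>"
    using z B V \<tau> by (intro mult_right_mono mult_left_mono power_mono) (auto simp: slow_def)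
  finally show ?thesis .
qed

text \<open>Write x + d and x - d as cosines of \<alpha> and \<beta>. Then d is the sine of the
  middle angle times the sine of half the gap, and x is a multiple of the cosine of the middle angle
  by a factor at most 1 in absolute value, so the sine of that angle is at most \<phi>(x). Thus a
  step fitting into the cell is h \<phi>(x) with h = O(1/n).\<close>

lemma half_width_le:
  assumes N: "1 \<le> N" and k: "1 \<le> k" "Suc k \<le> N" and d: "0 \<le> d"
    and I: "xn N (Suc k) \<le> x - d" "x + d \<le> xn N (k - 1)"
  shows "d \<le> phi x * (pi / real N)"
proof -
  have b: "tn N (Suc k) \<in> {0..pi}" "tn N (k - 1) \<in> {0..pi}" using k by (auto intro!: tn_bounds[OF N] simp del: atLeastAtMost_iff)
  have c: "- 1 \<le> x - d" "x - d \<le> 1" "-1 \<le> x + d" "x + d \<le> 1" 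
    using I d xn_bounds[OF N, of "Suc k"] xn_bounds[OF N, of "k - 1"] by auto
  define \<alpha> \<beta> where "\<alpha> = arccos (x + d)" and "\<beta> = arccos (x - d)"
  have cos: "cos \<alpha> = x + d" "cos \<beta> = x - d" using c by (simp_all add: \<alpha>_def \<beta>_def)
  have rng: "0 \<le> \<alpha>" "\<alpha> \<le> pi" "0 \<le> \<beta>" "\<beta> \<le> pi" using c by (simp_all add: \<alpha>_def \<beta>_def arccos_lbound arccos_ubound)
  have "\<alpha> \<le> \<beta>" using cos_mono_le_eq[of \<beta> \<alpha>] rng cos d by auto
  moreover have "tn N (k - 1) \<le> \<alpha>" using cos_mono_le_eq[of \<alpha> "tn N (k - 1)"] b rng cos I by (auto simp: xn_def)
  moreover have "\<beta> \<le> tn N (Suc k)" using cos_mono_le_eq[of "tn N (Suc k)" \<beta>] b rng cos I by (auto simp: xn_def)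
  moreover have "tn N (Suc k) = tn N (k - 1) + 2 * (pi / real N)"
    using tn_Suc[OF N, of k] tn_Suc[OF N, of "k - 1"] k by simp
  moreover have "0 \<le> (\<beta> - \<alpha>) / 2 \<and> (\<beta> - \<alpha>) / 2 \<le> e" if "\<alpha> \<le> \<beta>" "t \<le> \<alpha>" "\<beta> \<le> t'" "t' = t + 2 * e" for t t' e
    using that by auto
  ultimately have w: "0 \<le> (\<beta> - \<alpha>) / 2" "(\<beta> - \<alpha>) / 2 \<le> pi / real N" by blast+
  have s0: "0 \<le> sin ((\<alpha> + \<beta>) / 2)" using rng by (intro sin_ge_zero) auto
  have "2 * d = cos \<alpha> - cos \<beta>" using cos by simp
  also have "\<dots> = 2 * sin ((\<alpha> + \<beta>) / 2) * sin ((\<beta> - \<alpha>) / 2)" by (rule cos_diff_cos)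
  finally have "d = sin ((\<alpha> + \<beta>) / 2) * sin ((\<beta> - \<alpha>) / 2)" by simp
  also have "\<dots> \<le> sin ((\<alpha> + \<beta>) / 2) * (pi / real N)"
    using sin_x_le_x[OF w(1)] w(2) s0 by (intro mult_left_mono) linarith+
  finally have d_le: "d \<le> sin ((\<alpha> + \<beta>) / 2) * (pi / real N)" .
  have "sin ((\<alpha> + \<beta>) / 2) \<le> phi x"
  proof -
    have "2 * x = cos \<alpha> + cos \<beta>" using cos by simp
    also have "\<dots> = 2 * cos ((\<alpha> + \<beta>) / 2) * cos ((\<alpha> - \<beta>) / 2)" by (rule cos_plus_cos)
    finally have x: "x = cos ((\<alpha> + \<beta>) / 2) * cos ((\<alpha> - \<beta>) / 2)" by simp
    have "x\<^sup>2 \<le> (cos ((\<alpha> + \<beta>) / 2))\<^sup>2 * 1" 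
      unfolding x power_mult_distrib by (intro mult_left_mono) (auto simp: abs_square_le_1)
    then have "(sin ((\<alpha> + \<beta>) / 2))\<^sup>2 \<le> 1 - x\<^sup>2" using sin_cos_squared_add[of "(\<alpha> + \<beta>) / 2"] by linarith
    then show ?thesis unfolding phi_def by (rule real_le_rsqrt)
  qed
  then have "sin ((\<alpha> + \<beta>) / 2) * (pi / real N) \<le> phi x * (pi / real N)" by (intro mult_right_mono) auto
  with d_le show ?thesis by linarith
qed

text \<open>Such k are integers at distance at most 1 from \<theta> N / \<pi>.\<close>

lemma double_cell_overlap:
  assumes N: "1 \<le> N" and \<theta>: "\<theta> \<in> {0..pi}"
  shows "card {k\<in>{1..N-1}. cos \<theta> \<in> {xn N (Suc k)..xn N (k - 1)}} \<le> 3"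
proof -
  define m where "m = nat \<lfloor>\<theta> * real N / pi\<rfloor>"
  have "0 \<le> \<theta> * real N / pi" using \<theta> by auto
  then have m: "real m \<le> \<theta> * real N / pi" "\<theta> * real N / pi < real m + 1" unfolding m_def by linarith+
  have "{k\<in>{1..N-1}. cos \<theta> \<in> {xn N (Suc k)..xn N (k - 1)}} \<subseteq> {m - 1, m, m + 1}"
  proof
    fix k assume "k \<in> {k\<in>{1..N-1}. cos \<theta> \<in> {xn N (Suc k)..xn N (k - 1)}}"
    then have k: "1 \<le> k" "Suc k \<le> N" and "\<bar>\<theta> - tn N k\<bar> \<le> pi / real N"
      using double_cell_angle[OF N _ _ \<theta>, of k] by auto
    then have "\<bar>\<theta> - tn N k\<bar> * (real N / pi) \<le> pi / real N * (real N / pi)" by (intro mult_right_mono) auto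
    also have "\<dots> = 1" using N by simp
    also have "\<bar>\<theta> - tn N k\<bar> * (real N / pi) = \<bar>(\<theta> - tn N k) * (real N / pi)\<bar>" using N by (simp add: abs_mult)
    also have "(\<theta> - tn N k) * (real N / pi) = \<theta> * real N / pi - real k" using N by (simp add: tn_def field_simps)
    finally have "\<bar>\<theta> * real N / pi - real k\<bar> \<le> 1" .
    then have "real k < real (m + 2)" "real m \<le> real (k + 1)" using m by auto
    then have "k < m + 2" "m \<le> k + 1" using of_nat_less_iff of_nat_le_iff by blast+
    then show "k \<in> {m - 1, m, m + 1}" by auto
  qed
  then have "card {k\<in>{1..N-1}. cos \<theta> \<in> {xn N (Suc k)..xn N (k - 1)}} \<le> card {m - 1, m, m + 1}" by (intro card_mono) auto
  also have "\<dots> \<le> 3" by (auto simp: card_insert_if)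
  finally show ?thesis .
qed

text \<open>With midpoint x = y + r u/2 and u = h \<phi>(x), the forward difference at y becomes the
  symmetric difference at x with parameter h. The substitution brings a factor \<phi>(x), and
  \<phi>(x) / L k = O(n). So each cell contributes n times an integral over 0 <= h <= 1/n, an
  average over h, and the cells overlap boundedly often.\<close>

lemma whitney_cell_sum:
  assumes p: "0 < p" "p \<le> 1" and w: "doubling_weight w" and n: "1 \<le> n" and B: "1 \<le> B" and r: "1 \<le> r"
    and slow: "slow B s n (\<lambda>\<theta>. avg_weight w n (cos \<theta>))"
    and f [measurable]: "f \<in> borel_measurable borel"
    and S: "\<And>h. 0 < h \<Longrightarrow> h \<le> 1 / real n \<Longrightarrow> wint p w n (\<lambda>x. central_difference r (h * phi x) f x) \<le> S"
  defines "L k \<equiv> xn (8 * n) (k - 1) - xn (8 * n) (Suc k)"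
  shows "(\<Sum>k=1..8*n-1. ennreal (avg_weight w n (xn (8 * n) k)) * (ennreal (1 / L k) * 
      (\<integral>\<^sup>+u\<in>{0..L k / real r}. (\<integral>\<^sup>+y\<in>{xn (8 * n) (Suc k)..xn (8 * n) (k - 1) - real r * u}. pp p (fdiff r u f y) \<partial>lborel) \<partial>lborel)))
    \<le> ennreal (B * 2 ^ s * (16 * (1 + pi\<^sup>2)) * 3) * S"
proof -
  let ?N = "8 * n"
  have N1: "1 \<le> ?N" using n by simp
  let ?J = "\<lambda>k. {xn ?N (Suc k)..xn ?N (k - 1)}"
  let ?cd = "\<lambda>h x. central_difference r (h * phi x) f x"
  define A where "A = 16 * (1 + pi\<^sup>2)"
  have A0: "0 \<le> A" by (simp add: A_def)
  define H where "H x = (\<integral>\<^sup>+h\<in>{0..1 / real n}. pp p (?cd h x) \<partial>lborel)" for x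
  have cdm [measurable]: "(\<lambda>(x, h). ?cd h x) \<in> borel_measurable (borel \<Otimes>\<^sub>M borel)"
    unfolding central_difference_def by measurable
  have [measurable]: "H \<in> borel_measurable borel" unfolding H_def by measurable
  have [measurable]: "avg_weight w n \<in> borel_measurable borel" by (rule avg_weight_measurable[OF w])
  have cell: "ennreal (avg_weight w n (xn ?N k)) * (ennreal (1 / L k) * 
      (\<integral>\<^sup>+u\<in>{0..L k / real r}. (\<integral>\<^sup>+y\<in>{xn ?N (Suc k)..xn ?N (k - 1) - real r * u}. pp p (fdiff r u f y) \<partial>lborel) \<partial>lborel))
    \<le> (\<integral>\<^sup>+x\<in>{-1..1}. ennreal (B * 2 ^ s * A * real n) * (H x * ennreal (avg_weight w n x)) * indicator (?J k) x \<partial>lborel)"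
    if k: "1 \<le> k" "Suc k \<le> ?N" for k
  proof -
    let ?a = "xn ?N (Suc k)" and ?b = "xn ?N (k - 1)"
    have lL: "xn ?N k - xn ?N (Suc k) \<le> L k" using xn_mono[OF N1, of "k - 1" k] k by (simp add: L_def)
    have L: "0 < L k" using cell_length_pos[OF N1 k] lL by linarith
    \<comment> \<open>The integrand in terms of the midpoint x instead of the left node, with the
      domain built in so that the order of integration can be exchanged.\<close>
    define G where "G u x = (if u \<in> {0..L k / real r} \<and> x \<in> {?a + real r * u / 2..?b - real r * u / 2} 
       then pp p (fdiff r u f (x - real r * u / 2)) else 0)" for u x
    have [measurable]: "(\<lambda>(u, x). G u x) \<in> borel_measurable (borel \<Otimes>\<^sub>M borel)" 
      unfolding G_def atLeastAtMost_iff by measurable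
    have "(\<integral>\<^sup>+u\<in>{0..L k / real r}. (\<integral>\<^sup>+y\<in>{?a..?b - real r * u}. pp p (fdiff r u f y) \<partial>lborel) \<partial>lborel)
      = (\<integral>\<^sup>+u. (\<integral>\<^sup>+x. G u x \<partial>lborel) \<partial>lborel)"
    proof (intro nn_integral_cong)
      fix u :: real
      have "(\<integral>\<^sup>+y\<in>{?a..?b - real r * u}. pp p (fdiff r u f y) \<partial>lborel) 
         = (\<integral>\<^sup>+x\<in>{?a + real r * u / 2..?b - real r * u / 2}. pp p (fdiff r u f (x + - (real r * u / 2))) \<partial>lborel)"
        by (subst nn_integral_shift) (auto simp: mult.commute[of u])
      then show "(\<integral>\<^sup>+y\<in>{?a..?b - real r * u}. pp p (fdiff r u f y) \<partial>lborel) * indicator {0..L k / real r} u = (\<integral>\<^sup>+x. G u x \<partial>lborel)"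
        by (auto simp: G_def split: split_indicator intro!: nn_integral_cong)
    qed
    also have "\<dots> = (\<integral>\<^sup>+x. (\<integral>\<^sup>+u. G u x \<partial>lborel) \<partial>lborel)" by (rule lborel_Fubini[symmetric]) measurable
    also have "\<dots> \<le> (\<integral>\<^sup>+x. ennreal (phi x) * H x * indicator (?J k) x \<partial>lborel)"
    proof (rule nn_integral_mono_AE)
      \<comment> \<open>At the endpoints \<phi> vanishes and u = h \<phi>(x) is no change of
        variable.\<close>
      have "AE x in lborel. x \<noteq> 1 \<and> x \<noteq> (-1 :: real)" using AE_lborel_singleton[of 1] AE_lborel_singleton[of "-1"] by eventually_elim auto
      then show "AE x in lborel. (\<integral>\<^sup>+u. G u x \<partial>lborel) \<le> ennreal (phi x) * H x * indicator (?J k) x"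
      proof eventually_elim
        case (elim x)
        show ?case
        proof (cases "x \<in> ?J k")
          case False
          have "G u x = 0" for u
          proof (cases "0 \<le> u")
            case True
            have "{?a + e..?b - e} \<subseteq> ?J k" if "0 \<le> e" for e using that by auto
            moreover have "0 \<le> real r * u / 2" using True by simp
            ultimately have "x \<notin> {?a + real r * u / 2..?b - real r * u / 2}" using False by blast
            then show ?thesis by (simp add: G_def del: atLeastAtMost_iff)
          qed (simp add: G_def)
          then show ?thesis by simp
        next
          case True
          then have x: "x \<in> {-1..1}" using xn_bounds[OF N1, of "Suc k"] xn_bounds[OF N1, of "k - 1"] by auto
          then have "\<bar>x\<bar> < 1" using elim by auto
          then have ph: "0 < phi x" by (simp add: phi_def abs_square_less_1)
          have "(\<integral>\<^sup>+u. G u x \<partial>lborel) = (\<integral>\<^sup>+u\<in>{0 + phi x * 0..0 + phi x * (L k / real r / phi x)}. G u x \<partial>lborel)"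
            using ph by (intro nn_integral_cong) (auto simp: G_def split: split_indicator)
          also have "\<dots> = ennreal (phi x) * (ennreal (1 / phi x) * (\<integral>\<^sup>+u\<in>{0 + phi x * 0..0 + phi x * (L k / real r / phi x)}. G u x \<partial>lborel))"
            using ph by (simp add: mult.assoc[symmetric] flip: ennreal_mult)
          also have "\<dots> = ennreal (phi x) * (\<integral>\<^sup>+h\<in>{0..L k / real r / phi x}. G (0 + phi x * h) x \<partial>lborel)"
            using ph by (subst nn_integral_scale) auto
          also have "\<dots> \<le> ennreal (phi x) * H x"
            unfolding H_def
          proof (intro mult_left_mono nn_integral_mono)
            fix h
            show "G (0 + phi x * h) x * indicator {0..L k / real r / phi x} h \<le> pp p (?cd h x) * indicator {0..1 / real n} h"
            proof (cases "h \<in> {0..L k / real r / phi x} \<and> x \<in> {?a + real r * (phi x * h) / 2..?b - real r * (phi x * h) / 2}")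
              case False
              then show ?thesis by (auto simp: G_def)
            next
              case True
              then have h: "0 \<le> h" and I: "?a \<le> x - real r * (phi x * h) / 2" "x + real r * (phi x * h) / 2 \<le> ?b" by auto
              have "real r * (phi x * h) / 2 \<le> phi x * (pi / real ?N)"
                using ph h by (intro half_width_le[OF N1 k _ I]) auto
              then have "phi x * (real r * h / 2) \<le> phi x * (pi / real ?N)" by (simp add: mult_ac)
              then have "real r * h / 2 \<le> pi / real ?N" using ph by (simp only: mult_le_cancel_left_pos)
              moreover have "1 * h \<le> real r * h" using r h by (intro mult_right_mono) auto
              ultimately have "h \<le> 2 * (pi / real ?N)" by linarith
              \<comment> \<open>Here N = 8n matters: h is at most 2\<pi>/(8n), below 1/n, so only
                steps covered by the hypothesis occur.\<close>
              also have "\<dots> = (pi / 4) / real n" by simp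
              also have "\<dots> \<le> 1 / real n" using pi_less_4 by (intro divide_right_mono) auto
              finally have hn: "h \<le> 1 / real n" .
              have "x - real r * (h * phi x) / 2 \<in> {-1..1} \<and> x + real r * (h * phi x) / 2 \<in> {-1..1}"
              proof -
                have "0 \<le> real r * (phi x * h) / 2" using ph h by simp
                then show ?thesis using I xn_bounds[OF N1, of "Suc k"] xn_bounds[OF N1, of "k - 1"] by (auto simp: mult_ac)
              qed
              then have "admissible (real r * h / 2) x" using admissible_cd[OF x h] by simp
              then have "?cd h x = fdiff r (h * phi x) f (x - real r * h / 2 * phi x)"
                using central_difference_eq[OF x h] by simp
              then show ?thesis using h hn by (auto simp: G_def mult_ac split: split_indicator)
            qed
          qed simp
          finally show ?thesis using True by simp
        qed
      qed
    qed
    finally have le: "(\<integral>\<^sup>+u\<in>{0..L k / real r}. (\<integral>\<^sup>+y\<in>{?a..?b - real r * u}. pp p (fdiff r u f y) \<partial>lborel) \<partial>lborel)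
      \<le> (\<integral>\<^sup>+x. ennreal (phi x) * H x * indicator (?J k) x \<partial>lborel)" .
    let ?c = "ennreal (avg_weight w n (xn ?N k)) * ennreal (1 / L k)"
    have "ennreal (avg_weight w n (xn ?N k)) * (ennreal (1 / L k) * 
      (\<integral>\<^sup>+u\<in>{0..L k / real r}. (\<integral>\<^sup>+y\<in>{?a..?b - real r * u}. pp p (fdiff r u f y) \<partial>lborel) \<partial>lborel))
      \<le> ?c * (\<integral>\<^sup>+x. ennreal (phi x) * H x * indicator (?J k) x \<partial>lborel)"
      using mult_left_mono[OF le, of ?c] by (subst mult.assoc[symmetric]) simp
    also have "\<dots> = (\<integral>\<^sup>+x. ?c * (ennreal (phi x) * H x * indicator (?J k) x) \<partial>lborel)"
      by (rule nn_integral_cmult[symmetric]) measurable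
    also have "\<dots> \<le> (\<integral>\<^sup>+x\<in>{-1..1}. ennreal (B * 2 ^ s * A * real n) * (H x * ennreal (avg_weight w n x)) * indicator (?J k) x \<partial>lborel)"
    proof (rule nn_integral_mono)
      fix x
      show "?c * (ennreal (phi x) * H x * indicator (?J k) x) \<le> ennreal (B * 2 ^ s * A * real n) * (H x * ennreal (avg_weight w n x)) * indicator (?J k) x * indicator {-1..1} x"
      proof (cases "x \<in> ?J k")
        case True
        then have x: "x \<in> {-1..1}" using xn_bounds[OF N1, of "Suc k"] xn_bounds[OF N1, of "k - 1"] by auto
        have wn: "0 \<le> avg_weight w n x" "0 \<le> avg_weight w n (xn ?N k)" 
          using avg_weight_nonneg[OF w n] x xn_bounds[OF N1, of k] by auto
        define \<theta> where "\<theta> = arccos x"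
        have \<theta>: "\<theta> \<in> {0..pi}" "cos \<theta> = x" using x by (auto simp: \<theta>_def arccos_lbound arccos_ubound)
        have tk: "tn ?N k \<in> {0..pi}" using k by (intro tn_bounds[OF N1]) auto
        have near: "\<bar>\<theta> - tn ?N k\<bar> \<le> pi / real ?N" using double_cell_angle[OF N1 k \<theta>(1)] \<theta> True by simp
        then have "real ?N * \<bar>\<theta> - tn ?N k\<bar> \<le> real ?N * (pi / real ?N)" by (intro mult_left_mono) auto
        also have "\<dots> = pi" using n by simp
        finally have y: "\<bar>real ?N * (\<theta> - tn ?N k)\<bar> \<le> pi" by (simp add: abs_mult)
        have y2: "(real ?N * (\<theta> - tn ?N k))\<^sup>2 \<le> pi\<^sup>2" using power_mono[OF y, of 2] by simp
        have "phi x = sin \<theta>" using phi_cos[OF \<theta>(1)] \<theta>(2) by simp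
        also have "\<dots> \<le> 2 * real ?N * (xn ?N k - xn ?N (Suc k)) * (1 + (real ?N * (\<theta> - tn ?N k))\<^sup>2)" by (rule cell_ratio(2)[OF N1 k \<theta>(1)])
        also have "\<dots> \<le> 2 * real ?N * L k * (1 + pi\<^sup>2)" using y2 lL L cell_length_pos[OF N1 k] by (intro mult_mono) auto
        also have "\<dots> = A * real n * L k" by (simp add: A_def)
        finally have ph: "phi x / L k \<le> A * real n" using L by (simp add: pos_divide_le_eq)
        have v: "avg_weight w n (xn ?N k) \<le> B * 2 ^ s * avg_weight w n x"
          using slow_near[OF slow n _ tk \<theta>(1)] near B \<theta>(2) by (simp add: xn_def abs_minus_commute)
        have ph0: "0 \<le> phi x" by (rule phi_nonneg[OF x])
        have "?c * (ennreal (phi x) * H x) = ennreal (avg_weight w n (xn ?N k) * (phi x / L k)) * H x"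
        proof -
          have "ennreal (avg_weight w n (xn ?N k) * (1 / L k * phi x)) = ?c * ennreal (phi x)"
            using L ph0 wn by (simp only: ennreal_mult mult.assoc zero_le_divide_1_iff less_imp_le mult_nonneg_nonneg)
          then show ?thesis by (simp add: mult.assoc)
        qed
        also have "\<dots> \<le> ennreal (B * 2 ^ s * avg_weight w n x * (A * real n)) * H x"
          using v ph L B wn ph0 by (intro mult_right_mono ennreal_leI mult_mono) auto
        also have "B * 2 ^ s * avg_weight w n x * (A * real n) = B * 2 ^ s * A * real n * avg_weight w n x" by simp
        also have "ennreal (B * 2 ^ s * A * real n * avg_weight w n x) = ennreal (B * 2 ^ s * A * real n) * ennreal (avg_weight w n x)"
          using B A0 wn by (intro ennreal_mult) auto
        finally show ?thesis using True x by (simp add: mult_ac)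
      qed simp
    qed
    finally show ?thesis .
  qed
  have "(\<Sum>k=1..?N-1. ennreal (avg_weight w n (xn ?N k)) * (ennreal (1 / L k) * 
      (\<integral>\<^sup>+u\<in>{0..L k / real r}. (\<integral>\<^sup>+y\<in>{xn ?N (Suc k)..xn ?N (k - 1) - real r * u}. pp p (fdiff r u f y) \<partial>lborel) \<partial>lborel)))
    \<le> (\<Sum>k=1..?N-1. (\<integral>\<^sup>+x\<in>{-1..1}. ennreal (B * 2 ^ s * A * real n) * (H x * ennreal (avg_weight w n x)) * indicator (?J k) x \<partial>lborel))"
    using n by (intro sum_mono cell) auto
  also have "\<dots> = (\<integral>\<^sup>+x\<in>{-1..1}. (\<Sum>k=1..?N-1. ennreal (B * 2 ^ s * A * real n) * (H x * ennreal (avg_weight w n x)) * indicator (?J k) x) \<partial>lborel)"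
    unfolding sum_distrib_right by (rule nn_integral_sum[symmetric]) measurable
  also have "\<dots> \<le> (\<integral>\<^sup>+x\<in>{-1..1}. ennreal (B * 2 ^ s * A * 3) * (ennreal (real n) * (H x * ennreal (avg_weight w n x))) \<partial>lborel)"
  proof (rule set_nn_integral_mono)
    fix x :: real assume x: "x \<in> {-1..1}"
    have "(\<Sum>k=1..?N-1. indicator (?J k) x :: ennreal) = of_nat (card {k\<in>{1..?N-1}. x \<in> ?J k})"
    proof -
      have "(\<Sum>k=1..?N-1. indicator (?J k) x :: ennreal) = (\<Sum>k\<in>{k\<in>{1..?N-1}. x \<in> ?J k}. 1)"
        by (rule sum.mono_neutral_cong_right) auto
      then show ?thesis by simp
    qed
    also have "\<dots> \<le> of_nat 3"
      using double_cell_overlap[OF N1, of "arccos x"] x arccos_lbound[of x] arccos_ubound[of x] by (intro of_nat_mono) auto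
    finally have "(\<Sum>k=1..?N-1. indicator (?J k) x :: ennreal) \<le> ennreal 3" by simp
    then have "ennreal (B * 2 ^ s * A * real n) * (H x * ennreal (avg_weight w n x)) * (\<Sum>k=1..?N-1. indicator (?J k) x)
      \<le> ennreal (B * 2 ^ s * A * real n) * (H x * ennreal (avg_weight w n x)) * ennreal 3" by (intro mult_left_mono) auto
    also have "\<dots> = (ennreal (B * 2 ^ s * A * real n) * ennreal 3) * (H x * ennreal (avg_weight w n x))" by (simp only: mult_ac)
    also have "ennreal (B * 2 ^ s * A * real n) * ennreal 3 = ennreal (B * 2 ^ s * A * real n * 3)"
      using B A0 by (intro ennreal_mult[symmetric]) auto
    also have "B * 2 ^ s * A * real n * 3 = (B * 2 ^ s * A * 3) * real n" by simp
    also have "ennreal ((B * 2 ^ s * A * 3) * real n) = ennreal (B * 2 ^ s * A * 3) * ennreal (real n)"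
      using B A0 by (intro ennreal_mult) auto
    finally show "(\<Sum>k=1..?N-1. ennreal (B * 2 ^ s * A * real n) * (H x * ennreal (avg_weight w n x)) * indicator (?J k) x)
      \<le> ennreal (B * 2 ^ s * A * 3) * (ennreal (real n) * (H x * ennreal (avg_weight w n x)))"
      by (simp add: sum_distrib_left mult.assoc)
  qed
  also have "\<dots> = ennreal (B * 2 ^ s * A * 3) * (ennreal (real n) * (\<integral>\<^sup>+x\<in>{-1..1}. H x * ennreal (avg_weight w n x) \<partial>lborel))"
    by (simp add: mult.assoc nn_integral_cmult)
  also have "(\<integral>\<^sup>+x\<in>{-1..1}. H x * ennreal (avg_weight w n x) \<partial>lborel) 
    = (\<integral>\<^sup>+h\<in>{0..1 / real n}. wint p w n (?cd h) \<partial>lborel)"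
  proof -
    have "(\<integral>\<^sup>+x\<in>{-1..1}. H x * ennreal (avg_weight w n x) \<partial>lborel) = 
      (\<integral>\<^sup>+x. (\<integral>\<^sup>+h. pp p (?cd h x) * indicator {0..1 / real n} h * (ennreal (avg_weight w n x) * indicator {-1..1} x) \<partial>lborel) \<partial>lborel)"
      unfolding H_def by (subst nn_integral_multc) (auto simp: mult.assoc)
    also have "\<dots> = (\<integral>\<^sup>+h. (\<integral>\<^sup>+x. pp p (?cd h x) * indicator {0..1 / real n} h * (ennreal (avg_weight w n x) * indicator {-1..1} x) \<partial>lborel) \<partial>lborel)"
      by (rule lborel_Fubini) measurable
    also have "\<dots> = (\<integral>\<^sup>+h\<in>{0..1 / real n}. wint p w n (?cd h) \<partial>lborel)"
      unfolding wint_def by (intro nn_integral_cong) (auto simp: mult.assoc split: split_indicator)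
    finally show ?thesis .
  qed
  also have "\<dots> \<le> (\<integral>\<^sup>+h\<in>{0..1 / real n}. S \<partial>lborel)"
  proof (rule nn_integral_mono_AE)
    \<comment> \<open>The hypothesis bounds the differences for h > 0 only; the value h = 0 is a
      null set.\<close>
    show "AE h in lborel. wint p w n (?cd h) * indicator {0..1 / real n} h \<le> S * indicator {0..1 / real n} h"
      using AE_lborel_singleton[of 0] by eventually_elim (auto split: split_indicator intro!: S)
  qed
  also have "\<dots> = S * ennreal (1 / real n)" by (subst set_nn_integral_const) auto
  also have "ennreal (real n) * (S * ennreal (1 / real n)) = S"
  proof -
    have "ennreal (real n) * ennreal (1 / real n) = 1" using n by (simp flip: ennreal_mult)
    then show ?thesis by (metis mult.left_commute mult.right_neutral)
  qed
  finally show ?thesis unfolding A_def by (simp add: mult_left_mono)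
qed

text \<open>With exact step functions in place of T the sum would equal the local polynomial of a
  double cell containing cos \<theta>. The first sum is the error of that polynomial, the second the
  effect of the inexact steps.\<close>

lemma blended_polynomial_pointwise:
  fixes q T :: "nat \<Rightarrow> real poly"
  assumes p: "0 < p" "p \<le> 1" and w: "doubling_weight w" and n: "1 \<le> n" and B: "1 \<le> B"
    and slow: "slow B s n (\<lambda>\<theta>. avg_weight w n (cos \<theta>))" and \<theta>: "\<theta> \<in> {0..pi}"
  defines "N \<equiv> 8 * n"
  defines "P \<equiv> q 1 + (\<Sum>j=1..N-2. (q (Suc j) - q j) * T j)"
  shows "pp p (f (cos \<theta>) - poly P (cos \<theta>)) * ennreal (avg_weight w n (cos \<theta>))
    \<le> (\<Sum>k=1..N-1. ennreal (B * 2 ^ s) * (ennreal (avg_weight w n (xn N k)) * (pp p (f (cos \<theta>) - poly (q k) (cos \<theta>)) * indicator {xn N (Suc k)..xn N (k - 1)} (cos \<theta>))))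
      + (\<Sum>j=1..N-2. pp p (poly (q (Suc j) - q j) (cos \<theta>)) * pp p (poly (T j) (cos \<theta>) - (if tn N j < \<theta> then 1 else 0)) * ennreal (avg_weight w n (cos \<theta>)))"
proof -
  have N: "2 \<le> N" "1 \<le> N" using n by (auto simp: N_def)
  let ?x = "cos \<theta>"
  obtain k where k: "1 \<le> k" "Suc k \<le> N" and J: "?x \<in> {xn N (Suc k)..xn N (k - 1)}"
    and sel: "\<And>c :: nat \<Rightarrow> real. c 1 + (\<Sum>j=1..N-2. (c (Suc j) - c j) * (if tn N j < \<theta> then 1 else 0)) = c k"
    by (rule spline_select[OF N(1) \<theta>, of thesis]) blast
  define d where "d j = poly (q (Suc j) - q j) ?x" for j
  define R where "R j = poly (T j) ?x - (if tn N j < \<theta> then 1 else 0)" for j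
  have "poly P ?x = poly (q 1) ?x + (\<Sum>j=1..N-2. d j * (if tn N j < \<theta> then 1 else 0)) + (\<Sum>j=1..N-2. d j * R j)"
    by (simp add: P_def poly_sum d_def R_def algebra_simps flip: sum.distrib)
  also have "poly (q 1) ?x + (\<Sum>j=1..N-2. d j * (if tn N j < \<theta> then 1 else 0)) = poly (q k) ?x"
    using sel[of "\<lambda>j. poly (q j) ?x"] by (simp add: d_def)
  finally have eq: "f ?x - poly P ?x = (f ?x - poly (q k) ?x) - (\<Sum>j=1..N-2. d j * R j)" by simp
  have "pp p (f ?x - poly P ?x) \<le> pp p (f ?x - poly (q k) ?x) + pp p (\<Sum>j=1..N-2. d j * R j)"
    unfolding eq by (rule pp_diff[OF p])
  also have "\<dots> \<le> pp p (f ?x - poly (q k) ?x) + (\<Sum>j=1..N-2. pp p (d j * R j))"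
    by (intro add_left_mono pp_sum p)
  finally have "pp p (f ?x - poly P ?x) * ennreal (avg_weight w n ?x) \<le>
    (pp p (f ?x - poly (q k) ?x) + (\<Sum>j=1..N-2. pp p (d j * R j))) * ennreal (avg_weight w n ?x)"
    by (rule mult_right_mono) simp
  also have "\<dots> = pp p (f ?x - poly (q k) ?x) * ennreal (avg_weight w n ?x) + (\<Sum>j=1..N-2. pp p (d j) * pp p (R j) * ennreal (avg_weight w n ?x))"
    by (simp add: distrib_right sum_distrib_right pp_mult)
  also have "pp p (f ?x - poly (q k) ?x) * ennreal (avg_weight w n ?x) \<le>
     (\<Sum>k=1..N-1. ennreal (B * 2 ^ s) * (ennreal (avg_weight w n (xn N k)) * (pp p (f ?x - poly (q k) ?x) * indicator {xn N (Suc k)..xn N (k - 1)} ?x)))"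
  proof -
    have "avg_weight w n ?x \<le> B * 2 ^ s * avg_weight w n (cos (tn N k))"
    proof (rule slow_near[OF slow n _ \<theta>])
      show "tn N k \<in> {0..pi}" using k by (intro tn_bounds[OF N(2)]) auto
      show "\<bar>\<theta> - tn N k\<bar> \<le> pi / real (8 * n)" using double_cell_angle[OF N(2) k \<theta>] J by (simp add: N_def)
    qed (use B in auto)
    then have v: "ennreal (avg_weight w n ?x) \<le> ennreal (B * 2 ^ s * avg_weight w n (xn N k))" unfolding xn_def by (rule ennreal_leI)
    also have "\<dots> = ennreal (B * 2 ^ s) * ennreal (avg_weight w n (xn N k))"
      using B avg_weight_nonneg[OF w n xn_bounds[OF N(2)]] by (intro ennreal_mult) auto
    finally have "pp p (f ?x - poly (q k) ?x) * ennreal (avg_weight w n ?x) \<le> 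
      pp p (f ?x - poly (q k) ?x) * (ennreal (B * 2 ^ s) * ennreal (avg_weight w n (xn N k)))" by (rule mult_left_mono) simp
    also have "\<dots> = (\<Sum>k\<in>{k}. ennreal (B * 2 ^ s) * (ennreal (avg_weight w n (xn N k)) * (pp p (f ?x - poly (q k) ?x) * indicator {xn N (Suc k)..xn N (k - 1)} ?x)))"
      using J by (simp add: mult_ac)
    also have "\<dots> \<le> (\<Sum>k=1..N-1. ennreal (B * 2 ^ s) * (ennreal (avg_weight w n (xn N k)) * (pp p (f ?x - poly (q k) ?x) * indicator {xn N (Suc k)..xn N (k - 1)} ?x)))"
      using k by (intro sum_mono2) auto
    finally show ?thesis .
  qed
  finally show ?thesis unfolding d_def R_def by (simp add: add_right_mono)
qed

text \<open>The jump q_(j+1) - q_j is measured on the cell shared by the double cells of j and j +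
  1, where both polynomials approximate f. Its growth elsewhere is absorbed by
  \<open>correction_term\<close>, so each correction costs no more than two neighbouring local
  errors.\<close>

lemma blended_polynomial_error:
  fixes q T :: "nat \<Rightarrow> real poly"
  assumes p: "0 < p" "p \<le> 1" and w: "doubling_weight w" and n: "1 \<le> n" and B: "1 \<le> B" and CP: "0 < CP" and CT: "0 < CT"
    and slow: "slow B s n (\<lambda>\<theta>. avg_weight w n (cos \<theta>))" and [measurable]: "f \<in> borel_measurable borel"
  defines "N \<equiv> 8 * n"
  assumes q: "\<And>j a b x. j \<in> {1..N-2} \<Longrightarrow> a < b \<Longrightarrow> 
      pp p (poly (q (Suc j) - q j) x) \<le> ennreal (CP * (1 + \<bar>x - a\<bar> / (b - a)) ^ r / (b - a)) * (\<integral>\<^sup>+y\<in>{a..b}. pp p (poly (q (Suc j) - q j) y) \<partial>lborel)"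
    and T: "\<And>j \<theta>. j \<in> {1..N-2} \<Longrightarrow> \<theta> \<in> {0..pi} \<Longrightarrow> 
      pp p (poly (T j) (cos \<theta>) - (if tn N j < \<theta> then 1 else 0)) \<le> ennreal (CT / (1 + (real n * (\<theta> - tn N j))\<^sup>2) ^ (r + s + 2))"
  defines "P \<equiv> q 1 + (\<Sum>j=1..N-2. (q (Suc j) - q j) * T j)"
  shows "wint p w n (\<lambda>x. f x - poly P x) \<le> ennreal (B * 2 ^ s + (CP * 256 ^ r * CT * B * 1024 * pi) * (1 + B * 2 ^ s)) *
    (\<Sum>k=1..N-1. ennreal (avg_weight w n (xn N k)) * (\<integral>\<^sup>+x\<in>{xn N (Suc k)..xn N (k - 1)}. pp p (f x - poly (q k) x) \<partial>lborel))"
proof -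
  have N: "2 \<le> N" "1 \<le> N" using n by (auto simp: N_def)
  define K where "K = CP * 256 ^ r * CT * B * 1024 * pi"
  have K: "0 \<le> K" using CP CT B by (simp add: K_def)
  define b where "b = B * 2 ^ s"
  have b: "0 \<le> b" using B by (simp add: b_def)
  define v where "v k = ennreal (avg_weight w n (xn N k))" for k
  define W where "W k = (\<integral>\<^sup>+x\<in>{xn N (Suc k)..xn N (k - 1)}. pp p (f x - poly (q k) x) \<partial>lborel)" for k
  define Y where "Y = (\<Sum>k=1..N-1. v k * W k)"
  have [measurable]: "avg_weight w n \<in> borel_measurable borel" by (rule avg_weight_measurable[OF w])
  have [measurable]: "poly Q \<in> borel_measurable borel" for Q :: "real poly" by (rule poly_measurable)
  let ?A = "\<lambda>x. \<Sum>k=1..N-1. ennreal b * (v k * (pp p (f x - poly (q k) x) * indicator {xn N (Suc k)..xn N (k - 1)} x))"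
  let ?D = "\<lambda>j \<theta>. pp p (poly (q (Suc j) - q j) (cos \<theta>)) * pp p (poly (T j) (cos \<theta>) - (if tn N j < \<theta> then 1 else 0)) * ennreal (avg_weight w n (cos \<theta>)) * ennreal (sin \<theta>)"
  have "wint p w n (\<lambda>x. f x - poly P x) = (\<integral>\<^sup>+\<theta>\<in>{0..pi}. pp p (f (cos \<theta>) - poly P (cos \<theta>)) * ennreal (avg_weight w n (cos \<theta>)) * ennreal (sin \<theta>) \<partial>lborel)"
    unfolding wint_def by (rule nn_integral_cos_subst) measurable
  also have "\<dots> \<le> (\<integral>\<^sup>+\<theta>\<in>{0..pi}. ?A (cos \<theta>) * ennreal (sin \<theta>) + (\<Sum>j=1..N-2. ?D j \<theta>) \<partial>lborel)"
  proof (rule set_nn_integral_mono)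
    fix \<theta> assume \<theta>: "\<theta> \<in> {0..pi}"
    have "pp p (f (cos \<theta>) - poly P (cos \<theta>)) * ennreal (avg_weight w n (cos \<theta>)) * ennreal (sin \<theta>) \<le>
      (?A (cos \<theta>) + (\<Sum>j=1..N-2. pp p (poly (q (Suc j) - q j) (cos \<theta>)) * pp p (poly (T j) (cos \<theta>) - (if tn N j < \<theta> then 1 else 0)) * ennreal (avg_weight w n (cos \<theta>)))) * ennreal (sin \<theta>)"
      using blended_polynomial_pointwise[OF p w n B slow \<theta>, of f q T] unfolding P_def N_def b_def v_def by (rule mult_right_mono) simp
    then show "pp p (f (cos \<theta>) - poly P (cos \<theta>)) * ennreal (avg_weight w n (cos \<theta>)) * ennreal (sin \<theta>) \<le> ?A (cos \<theta>) * ennreal (sin \<theta>) + (\<Sum>j=1..N-2. ?D j \<theta>)"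
      unfolding distrib_right sum_distrib_right .
  qed
  also have "\<dots> = (\<integral>\<^sup>+\<theta>\<in>{0..pi}. ?A (cos \<theta>) * ennreal (sin \<theta>) \<partial>lborel) + (\<integral>\<^sup>+\<theta>\<in>{0..pi}. (\<Sum>j=1..N-2. ?D j \<theta>) \<partial>lborel)"
    by (rule set_nn_integral_add) measurable
  also have "(\<integral>\<^sup>+\<theta>\<in>{0..pi}. ?A (cos \<theta>) * ennreal (sin \<theta>) \<partial>lborel) \<le> ennreal b * Y"
  proof -
    have "(\<integral>\<^sup>+\<theta>\<in>{0..pi}. ?A (cos \<theta>) * ennreal (sin \<theta>) \<partial>lborel) = (\<integral>\<^sup>+x\<in>{-1..1}. ?A x \<partial>lborel)"
      by (rule nn_integral_cos_subst[symmetric]) measurable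
    also have "\<dots> \<le> (\<integral>\<^sup>+x. ?A x \<partial>lborel)" by (intro nn_integral_mono) (auto split: split_indicator)
    also have "\<dots> = (\<Sum>k=1..N-1. \<integral>\<^sup>+x. ennreal b * (v k * (pp p (f x - poly (q k) x) * indicator {xn N (Suc k)..xn N (k - 1)} x)) \<partial>lborel)"
      by (rule nn_integral_sum) measurable
    also have "\<dots> = ennreal b * Y" unfolding Y_def W_def sum_distrib_left
      by (intro sum.cong refl) (simp add: nn_integral_cmult)
    finally show ?thesis .
  qed
  also have "(\<integral>\<^sup>+\<theta>\<in>{0..pi}. (\<Sum>j=1..N-2. ?D j \<theta>) \<partial>lborel) \<le> ennreal (K * (1 + b)) * Y"
  proof -
    have "(\<integral>\<^sup>+\<theta>\<in>{0..pi}. (\<Sum>j=1..N-2. ?D j \<theta>) \<partial>lborel) = (\<Sum>j=1..N-2. \<integral>\<^sup>+\<theta>\<in>{0..pi}. ?D j \<theta> \<partial>lborel)"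
      by (rule set_nn_integral_sum) measurable
    also have "\<dots> \<le> (\<Sum>j=1..N-2. ennreal K * (v j * W j + ennreal b * (v (Suc j) * W (Suc j))))"
    proof (rule sum_mono)
      fix j assume j: "j \<in> {1..N-2}"
      then have j1: "1 \<le> j" "Suc j \<le> N" "Suc (Suc j) \<le> N" using N by auto
      have le: "(\<integral>\<^sup>+y\<in>{xn N (Suc j)..xn N j}. pp p (poly (q (Suc j) - q j) y) \<partial>lborel) \<le> W j + W (Suc j)"
      proof -
        have "(\<integral>\<^sup>+y\<in>{xn N (Suc j)..xn N j}. pp p (poly (q (Suc j) - q j) y) \<partial>lborel) 
          \<le> (\<integral>\<^sup>+y\<in>{xn N (Suc j)..xn N j}. pp p (f y - poly (q j) y) + pp p (f y - poly (q (Suc j)) y) \<partial>lborel)"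
        proof (rule set_nn_integral_mono)
          fix y
          have "pp p (poly (q (Suc j) - q j) y) = pp p ((f y - poly (q j) y) - (f y - poly (q (Suc j)) y))" by simp
          also have "\<dots> \<le> pp p (f y - poly (q j) y) + pp p (f y - poly (q (Suc j)) y)" by (rule pp_diff[OF p])
          finally show "pp p (poly (q (Suc j) - q j) y) \<le> pp p (f y - poly (q j) y) + pp p (f y - poly (q (Suc j)) y)" .
        qed
        also have "\<dots> = (\<integral>\<^sup>+y\<in>{xn N (Suc j)..xn N j}. pp p (f y - poly (q j) y) \<partial>lborel) + (\<integral>\<^sup>+y\<in>{xn N (Suc j)..xn N j}. pp p (f y - poly (q (Suc j)) y) \<partial>lborel)"
          by (rule set_nn_integral_add) measurable
        also have "\<dots> \<le> W j + W (Suc j)"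
          unfolding W_def using xn_mono[OF N(2), of "j - 1" j] xn_mono[OF N(2), of "Suc j" "Suc (Suc j)"] j1
          by (intro add_mono set_nn_integral_mono_set) auto
        finally show ?thesis .
      qed
      \<comment> \<open>The local error of index j + 1 has to be paired with the weight at its own
        node; adjacent nodes have comparable weights.\<close>
      have vj: "v j \<le> ennreal b * v (Suc j)"
      proof -
        have tb: "tn N j \<in> {0..pi}" "tn N (Suc j) \<in> {0..pi}" using j1 by (auto intro!: tn_bounds[OF N(2)] simp del: atLeastAtMost_iff)
        have "avg_weight w n (cos (tn N j)) \<le> B * 2 ^ s * avg_weight w n (cos (tn N (Suc j)))"
          by (rule slow_near[OF slow n _ tb]) (use B n in \<open>auto simp: tn_Suc N_def\<close>)
        then have "v j \<le> ennreal (b * avg_weight w n (xn N (Suc j)))" unfolding v_def b_def xn_def by (rule ennreal_leI)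
        also have "\<dots> = ennreal b * v (Suc j)" unfolding v_def using b avg_weight_nonneg[OF w n xn_bounds[OF N(2)]] by (intro ennreal_mult) auto
        finally show ?thesis .
      qed
      have "(\<integral>\<^sup>+\<theta>\<in>{0..pi}. ?D j \<theta> \<partial>lborel) \<le> ennreal K * (v j * (\<integral>\<^sup>+y\<in>{xn N (Suc j)..xn N j}. pp p (poly (q (Suc j) - q j) y) \<partial>lborel))"
        unfolding K_def v_def N_def
        by (rule correction_term[OF p w n B slow _ _ CP CT]) (use j j1 q T in \<open>auto simp: N_def simp del: poly_diff\<close>)
      also have "\<dots> \<le> ennreal K * (v j * (W j + W (Suc j)))" by (intro mult_left_mono le) auto
      also have "v j * (W j + W (Suc j)) \<le> v j * W j + ennreal b * (v (Suc j) * W (Suc j))"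
        unfolding distrib_left mult.assoc[symmetric] by (intro add_left_mono mult_right_mono vj) auto
      finally show "(\<integral>\<^sup>+\<theta>\<in>{0..pi}. ?D j \<theta> \<partial>lborel) \<le> ennreal K * (v j * W j + ennreal b * (v (Suc j) * W (Suc j)))"
        by (simp add: mult_left_mono)
    qed
    also have "\<dots> = ennreal K * ((\<Sum>j=1..N-2. v j * W j) + ennreal b * (\<Sum>j=1..N-2. v (Suc j) * W (Suc j)))"
      by (simp add: sum.distrib sum_distrib_left distrib_left)
    also have "(\<Sum>j=1..N-2. v (Suc j) * W (Suc j)) = (\<Sum>j\<in>Suc ` {1..N-2}. v j * W j)" by (subst sum.reindex) simp_all
    also have "ennreal K * ((\<Sum>j=1..N-2. v j * W j) + ennreal b * (\<Sum>j\<in>Suc ` {1..N-2}. v j * W j)) \<le> ennreal K * (Y + ennreal b * Y)"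
      unfolding Y_def using N by (intro mult_left_mono add_mono sum_mono2) auto
    also have "\<dots> = ennreal (K * (1 + b)) * Y"
      using K b by (simp add: ennreal_mult distrib_left distrib_right mult.assoc)
    finally show ?thesis .
  qed
  also have "ennreal b * Y + ennreal (K * (1 + b)) * Y = ennreal (b + K * (1 + b)) * Y"
    using K b by (simp add: distrib_right)
  finally show ?thesis unfolding K_def b_def Y_def v_def W_def by (simp add: add_left_mono add_right_mono)
qed

text \<open>The bound S is an arbitrary extended value, so no modulus appears here. The degree
  factor l = r + D combines the local polynomials with the steps. It exceeds the range allowed for
  E_n, which is corrected by a change of index at the end.\<close>

theorem direct_estimate:
  assumes p: "0 < p" "p \<le> 1" and w: "doubling_weight w" and r: "1 \<le> r"
  shows "\<exists>C>0. \<exists>l. \<forall>n f S. 1 \<le> n \<longrightarrow> f \<in> borel_measurable borel \<longrightarrow> (\<integral>\<^sup>+x\<in>{-1..1}. pp p (f x) \<partial>lborel) < \<infinity> \<longrightarrow>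
    (\<forall>h. 0 < h \<longrightarrow> h \<le> 1 / real n \<longrightarrow> wint p w n (\<lambda>x. central_difference r (h * phi x) f x) \<le> S) \<longrightarrow>
    (\<exists>P. degree P \<le> l * n \<and> wint p w n (\<lambda>x. f x - poly P x) \<le> ennreal C * S)"
proof -
  obtain CW where CW: "0 < CW" and whitney: "\<And>f a b. f \<in> borel_measurable borel \<Longrightarrow> a < b \<Longrightarrow>
     (\<integral>\<^sup>+x\<in>{a..b}. pp p (f x) \<partial>lborel) < \<infinity> \<Longrightarrow>
     (\<exists>q\<in>Poly_space r. (\<integral>\<^sup>+x\<in>{a..b}. pp p (f x - poly q x) \<partial>lborel) \<le>
       ennreal (CW / (b - a)) * (\<integral>\<^sup>+u\<in>{0..(b - a) / real r}. (\<integral>\<^sup>+y\<in>{a..b - real r * u}. pp p (fdiff r u f y) \<partial>lborel) \<partial>lborel))"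
    using whitney[OF p r] by blast
  obtain CP where CP: "0 < CP" and growth: "\<And>q a b x. q \<in> Poly_space r \<Longrightarrow> a < b \<Longrightarrow> 
      pp p (poly q x) \<le> ennreal (CP * (1 + \<bar>x - a\<bar> / (b - a)) ^ r / (b - a)) * (\<integral>\<^sup>+y\<in>{a..b}. pp p (poly q y) \<partial>lborel)"
    using poly_Lp_growth[OF p, of r] by blast
  obtain B s where B: "1 \<le> B" and slow: "\<And>n. 1 \<le> n \<Longrightarrow> slow B s n (\<lambda>\<theta>. avg_weight w n (cos \<theta>))"
    by (rule avg_weight_slow[OF w, of thesis]) blast
  obtain D CT where CT: "0 < CT" and step: "\<And>n a. 1 \<le> n \<Longrightarrow> a \<in> {0..pi} \<Longrightarrow> \<exists>T. degree T \<le> D * n \<and>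
     (\<forall>\<theta>\<in>{0..pi}. pp p (poly T (cos \<theta>) - (if a < \<theta> then 1 else 0)) \<le> ennreal (CT / (1 + (real n * (\<theta> - a))\<^sup>2) ^ (r + s + 2)))"
    using step_approximation_pp[OF p, of "r + s + 2"] by blast
  define C1 where "C1 = B * 2 ^ s * (16 * (1 + pi\<^sup>2)) * 3"
  define C2 where "C2 = B * 2 ^ s + (CP * 256 ^ r * CT * B * 1024 * pi) * (1 + B * 2 ^ s)"
  have C1: "0 < C1" using B by (auto simp: C1_def intro!: mult_pos_pos add_pos_nonneg)
  have C2: "0 < C2" using B CP CT by (auto simp: C2_def intro!: mult_pos_pos add_pos_pos)
  have bound: "\<exists>P. degree P \<le> (r + D) * n \<and> wint p w n (\<lambda>x. f x - poly P x) \<le> ennreal (C2 * (CW * C1)) * S"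
    if n: "1 \<le> n" and f [measurable]: "f \<in> borel_measurable borel" and fin: "(\<integral>\<^sup>+x\<in>{-1..1}. pp p (f x) \<partial>lborel) < \<infinity>"
      and S: "\<And>h. 0 < h \<Longrightarrow> h \<le> 1 / real n \<Longrightarrow> wint p w n (\<lambda>x. central_difference r (h * phi x) f x) \<le> S" for n f S
  proof -
    define N where "N = 8 * n"
    have N: "2 \<le> N" "1 \<le> N" using n by (auto simp: N_def)
    define L where "L k = xn N (k - 1) - xn N (Suc k)" for k
    define X where "X k = (\<integral>\<^sup>+u\<in>{0..L k / real r}. (\<integral>\<^sup>+y\<in>{xn N (Suc k)..xn N (k - 1) - real r * u}. pp p (fdiff r u f y) \<partial>lborel) \<partial>lborel)" for k
    have Lpos: "0 < L k" if "k \<in> {1..N-1}" for k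
    proof -
      have "Suc k \<le> N" using that N by auto
      then have "xn N (Suc k) < xn N k" "xn N k \<le> xn N (k - 1)" 
        using that by (auto intro!: cell_length_pos[OF N(2)] xn_mono[OF N(2)])
      then show ?thesis by (simp add: L_def)
    qed
    have "\<exists>q\<in>Poly_space r. (\<integral>\<^sup>+x\<in>{xn N (Suc k)..xn N (k - 1)}. pp p (f x - poly q x) \<partial>lborel) \<le> ennreal (CW / L k) * X k"
      if "k \<in> {1..N-1}" for k
    proof -
      have "(\<integral>\<^sup>+x\<in>{xn N (Suc k)..xn N (k - 1)}. pp p (f x) \<partial>lborel) \<le> (\<integral>\<^sup>+x\<in>{-1..1}. pp p (f x) \<partial>lborel)"
        using xn_bounds[OF N(2), of "Suc k"] xn_bounds[OF N(2), of "k - 1"] by (intro set_nn_integral_mono_set) auto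
      then show ?thesis unfolding L_def X_def
        using whitney[OF f, of "xn N (Suc k)" "xn N (k - 1)"] Lpos[OF that] fin by (auto simp: L_def)
    qed
    then obtain q where q: "\<And>k. k \<in> {1..N-1} \<Longrightarrow> q k \<in> Poly_space r"
      "\<And>k. k \<in> {1..N-1} \<Longrightarrow> (\<integral>\<^sup>+x\<in>{xn N (Suc k)..xn N (k - 1)}. pp p (f x - poly (q k) x) \<partial>lborel) \<le> ennreal (CW / L k) * X k"
      by metis
    have "\<exists>T. degree T \<le> D * n \<and> (\<forall>\<theta>\<in>{0..pi}. pp p (poly T (cos \<theta>) - (if tn N j < \<theta> then 1 else 0)) \<le> ennreal (CT / (1 + (real n * (\<theta> - tn N j))\<^sup>2) ^ (r + s + 2)))"
      if "j \<in> {1..N-2}" for j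
      using that by (intro step n tn_bounds[OF N(2)]) auto
    then obtain T where T: "\<And>j. j \<in> {1..N-2} \<Longrightarrow> degree (T j) \<le> D * n"
      "\<And>j \<theta>. j \<in> {1..N-2} \<Longrightarrow> \<theta> \<in> {0..pi} \<Longrightarrow> pp p (poly (T j) (cos \<theta>) - (if tn N j < \<theta> then 1 else 0)) \<le> ennreal (CT / (1 + (real n * (\<theta> - tn N j))\<^sup>2) ^ (r + s + 2))"
      by metis
    define P where "P = q 1 + (\<Sum>j=1..N-2. (q (Suc j) - q j) * T j)"
    have qd: "degree (q k) \<le> r" if "k \<in> {1..N-1}" for k using q(1)[OF that] by (auto simp: Poly_space_def)
    have "degree P \<le> r + D * n"
      unfolding P_def
    proof (intro degree_add_le degree_sum_le)
      show "degree (q 1) \<le> r + D * n" using N by (intro trans_le_add1 qd) auto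
      fix j assume j: "j \<in> {1..N-2}"
      have "degree (q (Suc j) - q j) \<le> r" using j N by (intro degree_diff_le qd) auto
      then show "degree ((q (Suc j) - q j) * T j) \<le> r + D * n"
        using degree_mult_le[of "q (Suc j) - q j" "T j"] T(1)[OF j] by linarith
    qed simp
    also have "\<dots> \<le> (r + D) * n" using n by (simp add: distrib_right)
    finally have deg: "degree P \<le> (r + D) * n" .
    have "wint p w n (\<lambda>x. f x - poly P x) \<le> ennreal C2 *
      (\<Sum>k=1..N-1. ennreal (avg_weight w n (xn N k)) * (\<integral>\<^sup>+x\<in>{xn N (Suc k)..xn N (k - 1)}. pp p (f x - poly (q k) x) \<partial>lborel))"
      unfolding C2_def P_def N_def
    proof (rule blended_polynomial_error[OF p w n B CP CT slow[OF n] f])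
      fix j :: nat and a b x :: real assume j: "j \<in> {1..8 * n - 2}" "a < b"
      have "q (Suc j) \<in> Poly_space r" "q j \<in> Poly_space r" using j n by (auto intro!: q(1) simp: N_def)
      then have "degree (q (Suc j)) < r" "degree (q j) < r" using r by (auto simp: Poly_space_def)
      then have "q (Suc j) - q j \<in> Poly_space r" by (simp add: Poly_space_def degree_diff_less)
      then show "pp p (poly (q (Suc j) - q j) x) \<le> ennreal (CP * (1 + \<bar>x - a\<bar> / (b - a)) ^ r / (b - a)) * (\<integral>\<^sup>+y\<in>{a..b}. pp p (poly (q (Suc j) - q j) y) \<partial>lborel)"
        using j by (intro growth)
    qed (use T(2) in \<open>simp add: N_def\<close>)
    also have "\<dots> \<le> ennreal C2 * (\<Sum>k=1..N-1. ennreal CW * (ennreal (avg_weight w n (xn N k)) * (ennreal (1 / L k) * X k)))"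
    proof (intro mult_left_mono sum_mono)
      fix k assume k: "k \<in> {1..N-1}"
      have "ennreal (CW / L k) * X k = ennreal CW * (ennreal (1 / L k) * X k)"
        using CW Lpos[OF k] by (simp add: mult.assoc[symmetric] flip: ennreal_mult)
      then show "ennreal (avg_weight w n (xn N k)) * (\<integral>\<^sup>+x\<in>{xn N (Suc k)..xn N (k - 1)}. pp p (f x - poly (q k) x) \<partial>lborel)
        \<le> ennreal CW * (ennreal (avg_weight w n (xn N k)) * (ennreal (1 / L k) * X k))"
        using mult_left_mono[OF q(2)[OF k], of "ennreal (avg_weight w n (xn N k))"] by (simp add: mult.left_commute)
    qed simp
    also have "\<dots> = ennreal C2 * (ennreal CW * (\<Sum>k=1..N-1. ennreal (avg_weight w n (xn N k)) * (ennreal (1 / L k) * X k)))"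
      by (simp add: sum_distrib_left)
    also have "(\<Sum>k=1..N-1. ennreal (avg_weight w n (xn N k)) * (ennreal (1 / L k) * X k)) \<le> ennreal C1 * S"
      unfolding X_def L_def N_def C1_def by (rule whitney_cell_sum[OF p w n B r slow[OF n] f S])
    also have "ennreal C2 * (ennreal CW * (ennreal C1 * S)) = ennreal (C2 * (CW * C1)) * S"
      using C1 C2 CW by (simp add: ennreal_mult mult.assoc)
    finally have "wint p w n (\<lambda>x. f x - poly P x) \<le> ennreal (C2 * (CW * C1)) * S" by (simp add: mult_left_mono)
    then show ?thesis using deg by blast
  qed
  show ?thesis
    by (intro exI[of _ "C2 * (CW * C1)"] conjI exI[of _ "r + D"] allI impI bound) (use C1 C2 CW in auto)
qed

section \<open>The equivalence\<close>

lemma ennreal_powr_le_iff: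
  assumes "0 < p" "0 \<le> c"
  shows "ennreal_powr a (1 / p) \<le> ennreal c \<longleftrightarrow> a \<le> ennreal (c powr p)"
proof (cases a)
  case (real b)
  have "b powr (1 / p) \<le> c \<longleftrightarrow> b \<le> c powr p"
  proof
    assume "b powr (1 / p) \<le> c"
    then have "(b powr (1 / p)) powr p \<le> c powr p" using assms by (intro powr_mono2) auto
    then show "b \<le> c powr p" using real assms by (simp add: powr_powr)
  next
    assume "b \<le> c powr p"
    then have "b powr (1 / p) \<le> (c powr p) powr (1 / p)" using assms real by (intro powr_mono2) auto
    then show "b powr (1 / p) \<le> c" using assms by (simp add: powr_powr)
  qed
  then show ?thesis using real assms by (simp add: ennreal_powr_def)
qed (simp add: ennreal_powr_def top_unique)

text \<open>Removes the root 1/p and, up to a null set, the merely Lebesgue measurable function; all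
  estimates above are for Borel functions.\<close>

lemma Lp_norm_le_iff:
  assumes p: "0 < p" and w: "doubling_weight w" and n: "1 \<le> n" and c: "0 \<le> c"
    and [measurable]: "G \<in> borel_measurable borel" and ae: "AE x in lborel. x \<in> {-1..1} \<longrightarrow> F x = G x"
  shows "Lp_norm p (avg_weight w n) F \<le> ennreal c \<longleftrightarrow> wint p w n G \<le> ennreal (c powr p)"
proof -
  have [measurable]: "avg_weight w n \<in> borel_measurable borel" by (rule avg_weight_measurable[OF w])
  have "(\<integral>\<^sup>+x\<in>{-1..1}. ennreal (\<bar>F x\<bar> powr p * avg_weight w n x) \<partial>lebesgue)
    = (\<integral>\<^sup>+x\<in>{-1..1}. pp p (G x) * ennreal (avg_weight w n x) \<partial>lebesgue)"
  proof (rule nn_integral_cong_AE)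
    have "AE x in lebesgue. x \<in> {-1..1} \<longrightarrow> F x = G x" by (rule AE_completion[OF ae])
    then show "AE x in lebesgue. ennreal (\<bar>F x\<bar> powr p * avg_weight w n x) * indicator {-1..1} x 
      = pp p (G x) * ennreal (avg_weight w n x) * indicator {-1..1} x"
      by eventually_elim (auto simp: pp_def ennreal_mult' split: split_indicator)
  qed
  also have "\<dots> = wint p w n G" unfolding wint_def by (rule nn_integral_completion) measurable
  finally show ?thesis unfolding Lp_norm_def using ennreal_powr_le_iff[OF p c] by simp
qed

text \<open>Each node map pulls the exceptional null set back to a null set: apply
  \<open>shift_subst\<close> to its indicator. There are finitely many nodes.\<close>

lemma central_difference_AE_eq:
  assumes r: "1 \<le> r" and h: "0 < h" and ae: "AE x in lborel. x \<in> {-1..1} \<longrightarrow> f x = g x"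
  shows "AE x in lborel. x \<in> {-1..1} \<longrightarrow> central_difference r (h * phi x) f x = central_difference r (h * phi x) g x"
proof -
  define k where "k = real r * h / 2"
  have k: "0 < k" using r h by (simp add: k_def)
  obtain A where A: "\<And>x. x \<in> space lborel - A \<Longrightarrow> x \<in> {-1..1} \<longrightarrow> f x = g x" "A \<in> null_sets lborel"
    by (rule AE_E3[OF ae, of thesis]) blast
  have [measurable]: "A \<in> sets borel" using A(2) by auto
  have shift: "AE x in lborel. admissible k x \<longrightarrow> x + (real i * h - k) * phi x \<notin> A" if i: "i \<le> r" for i
  proof -
    have "real i * h \<le> real r * h" "0 \<le> real i * h" using i h by (auto intro: mult_right_mono)
    then have c: "\<bar>real i * h - k\<bar> \<le> k" unfolding k_def by linarith
    have "(\<integral>\<^sup>+x. (if admissible k x then indicator A (x + (real i * h - k) * phi x) else 0) \<partial>lborel) \<le> 2 * (\<integral>\<^sup>+x\<in>{-1..1}. indicator A x \<partial>lborel)"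
      by (rule shift_subst[OF _ k c]) measurable
    also have "(\<integral>\<^sup>+x\<in>{-1..1}. indicator A x \<partial>lborel) \<le> (\<integral>\<^sup>+x. indicator A x \<partial>lborel)"
      by (intro nn_integral_mono) (auto split: split_indicator)
    also have "\<dots> = 0" using A(2) by auto
    finally have "(\<integral>\<^sup>+x. (if admissible k x then indicator A (x + (real i * h - k) * phi x) else 0) \<partial>lborel) = 0"
      by (simp add: mult_left_mono)
    then have "AE x in lborel. (if admissible k x then indicator A (x + (real i * h - k) * phi x) else 0 :: ennreal) = 0"
      by (subst (asm) nn_integral_0_iff_AE) measurable
    then show ?thesis by eventually_elim (auto split: if_splits)
  qed
  have "AE x in lborel. \<forall>i\<in>{..r}. admissible k x \<longrightarrow> x + (real i * h - k) * phi x \<notin> A"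
    by (rule AE_finite_allI) (use shift in auto)
  then show ?thesis
  proof eventually_elim
    case (elim x)
    show ?case
    proof
      assume x: "x \<in> {-1..1}"
      have "f (x - real r * (h * phi x) / 2 + real i * (h * phi x)) = g (x - real r * (h * phi x) / 2 + real i * (h * phi x))"
        if adm: "admissible k x" and i: "i \<le> r" for i
      proof -
        have "real i * h \<le> real r * h" "0 \<le> real i * h" using i h by (auto intro: mult_right_mono)
        then have "\<bar>real i * h - k\<bar> \<le> k" unfolding k_def by linarith
        from admissible_point[OF adm this] have "x + (real i * h - k) * phi x \<in> {-1..1}" .
        moreover have "x + (real i * h - k) * phi x \<notin> A" using elim adm i by auto
        ultimately have "f (x + (real i * h - k) * phi x) = g (x + (real i * h - k) * phi x)" using A(1) by simp
        moreover have "x + (real i * h - k) * phi x = x - real r * (h * phi x) / 2 + real i * (h * phi x)"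
          by (simp add: k_def field_simps)
        ultimately show ?thesis by simp
      qed
      then show "central_difference r (h * phi x) f x = central_difference r (h * phi x) g x"
        unfolding central_difference_def using admissible_cd[OF x, of h r] h by (auto simp: k_def intro!: sum.cong)
    qed
  qed
qed

text \<open>Borel functions are closed under composition with the node maps and fit the product
  measurability that Fubini asks for.\<close>

lemma in_Lp_borel_representative:
  assumes "in_Lp p f"
  obtains g where "g \<in> borel_measurable borel" "AE x in lborel. x \<in> {-1..1} \<longrightarrow> f x = g x"
    "(\<integral>\<^sup>+x\<in>{-1..1}. pp p (g x) \<partial>lborel) < \<infinity>"
proof -
  have m: "(\<lambda>x. indicator {-1..1} x *\<^sub>R f x) \<in> borel_measurable (completion lborel)"
    using assms by (simp add: in_Lp_def set_borel_measurable_def)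
  obtain g where g: "g \<in> borel_measurable lborel" and ae: "AE x in lborel. indicator {-1..1} x *\<^sub>R f x = g x"
    using completion_ex_borel_measurable_real[OF m] by blast
  have gm [measurable]: "g \<in> borel_measurable borel" using g by simp
  have ae': "AE x in lborel. x \<in> {-1..1} \<longrightarrow> f x = g x" using ae by eventually_elim auto
  have "(\<integral>\<^sup>+x\<in>{-1..1}. pp p (g x) \<partial>lborel) = (\<integral>\<^sup>+x\<in>{-1..1}. pp p (g x) \<partial>lebesgue)"
    by (rule nn_integral_completion[symmetric]) measurable
  also have "\<dots> = (\<integral>\<^sup>+x. ennreal (norm (indicator {-1..1} x *\<^sub>R (\<bar>f x\<bar> powr p))) \<partial>lebesgue)"
  proof (rule nn_integral_cong_AE)
    show "AE x in lebesgue. pp p (g x) * indicator {-1..1} x = ennreal (norm (indicator {-1..1} x *\<^sub>R (\<bar>f x\<bar> powr p)))"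
      using AE_completion[OF ae'] by eventually_elim (auto simp: pp_def split: split_indicator)
  qed
  also have "\<dots> < \<infinity>" using assms unfolding in_Lp_def set_integrable_def integrable_iff_bounded by blast
  finally show ?thesis using that gm ae' by blast
qed

theorem corollary7p13:
  fixes w f :: "real \<Rightarrow> real" and p \<alpha> :: real and r :: nat
  assumes "doubling_weight w"
    and "0 < p" and "p < 1"
    and "in_Lp p f"
    and "real r > 1 / p"
    and "0 < \<alpha>" and "\<alpha> < real r - 1 / p"
  shows "ennreal_bigo (\<lambda>n. best_approx n f p (avg_weight w n)) (\<lambda>n. real n powr (- \<alpha>))
     \<longleftrightarrow> ennreal_bigo (\<lambda>n. modulus r f (1 / real n) p (avg_weight w n)) (\<lambda>n. real n powr (- \<alpha>))"
proof -
  note w = assms(1)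
  have p: "0 < p" "p \<le> 1" using assms by auto
  have "0 < 1 / p" using p by simp
  then have "0 < real r" using assms(5) by linarith
  then have r: "1 \<le> r" by simp
  obtain g where gm [measurable]: "g \<in> borel_measurable borel" and ae: "AE x in lborel. x \<in> {-1..1} \<longrightarrow> f x = g x"
    and fin: "(\<integral>\<^sup>+x\<in>{-1..1}. pp p (g x) \<partial>lborel) < \<infinity>"
    by (rule in_Lp_borel_representative[OF assms(4)])
  \<comment> \<open>The rate for p-th powers; \<alpha> < r - 1/p becomes \<gamma> < r p - 1.\<close>
  define \<gamma> where "\<gamma> = \<alpha> * p"
  have "\<alpha> * p < (real r - 1 / p) * p" using assms p by (intro mult_strict_right_mono) auto
  also have "\<dots> = real r * p - 1" using p by (simp add: left_diff_distrib)
  finally have \<gamma>: "0 < \<gamma>" "\<gamma> < real r * p - 1" using assms p by (auto simp: \<gamma>_def)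
  have rate: "(C * real n powr (- \<alpha>)) powr p = C powr p * real n powr (- \<gamma>)" if "0 \<le> C" for C n
    using that by (simp add: powr_mult powr_powr \<gamma>_def)
  have rate': "(C powr (1 / p) * real n powr (- \<alpha>)) powr p = C * real n powr (- \<gamma>)" if "0 \<le> C" for C n
    using that p by (simp add: rate powr_powr)
  have poly_iff: "Lp_norm p (avg_weight w n) (\<lambda>x. f x - poly P x) \<le> ennreal c \<longleftrightarrow> wint p w n (\<lambda>x. g x - poly P x) \<le> ennreal (c powr p)"
    if "1 \<le> n" "0 \<le> c" for n P c
  proof (rule Lp_norm_le_iff[OF p(1) w that])
    show "AE x in lborel. x \<in> {-1..1} \<longrightarrow> f x - poly P x = g x - poly P x" using ae by eventually_elim auto
  qed measurable
  have cd_iff: "Lp_norm p (avg_weight w n) (\<lambda>x. central_difference r (h * phi x) f x) \<le> ennreal c \<longleftrightarrow>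
      wint p w n (\<lambda>x. central_difference r (h * phi x) g x) \<le> ennreal (c powr p)"
    if "1 \<le> n" "0 \<le> c" "0 < h" for n h c
    by (rule Lp_norm_le_iff[OF p(1) w that(1,2) _ central_difference_AE_eq[OF r that(3) ae]]) measurable
  show ?thesis
  proof
    assume "ennreal_bigo (\<lambda>n. best_approx n f p (avg_weight w n)) (\<lambda>n. real n powr (- \<alpha>))"
    then obtain C N where C: "0 < C" and best: "\<And>n. N \<le> n \<Longrightarrow> best_approx n f p (avg_weight w n) \<le> ennreal (C * \<bar>real n powr (- \<alpha>)\<bar>)"
      unfolding ennreal_bigo_def eventually_sequentially by blast
    define N0 where "N0 = max N 1"
    have N0: "1 \<le> N0" by (simp add: N0_def)
    have "\<exists>P\<in>Poly_space n. wint p w n (\<lambda>x. g x - poly P x) \<le> ennreal ((2 * C) powr p * real n powr (- \<gamma>))" if n: "N0 \<le> n" for n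
    proof -
      have n1: "1 \<le> n" "N \<le> n" using n by (auto simp: N0_def)
      have "best_approx n f p (avg_weight w n) \<le> ennreal (C * real n powr (- \<alpha>))" using best[OF n1(2)] by simp
      \<comment> \<open>The infimum need not be attained. Doubling the constant gives a strict
        inequality, since n >= 1 makes the power positive.\<close>
      also have "\<dots> < ennreal (2 * C * real n powr (- \<alpha>))" using C n1 by (intro ennreal_lessI) auto
      finally obtain P where P: "P \<in> Poly_space n" "Lp_norm p (avg_weight w n) (\<lambda>x. f x - poly P x) \<le> ennreal (2 * C * real n powr (- \<alpha>))"
        unfolding best_approx_def INF_less_iff using less_imp_le by blast
      then show ?thesis using poly_iff[OF n1(1), of "2 * C * real n powr (- \<alpha>)" P] C rate[of "2 * C" n] by auto
    qed
    then obtain P where P: "\<And>n. N0 \<le> n \<Longrightarrow> P n \<in> Poly_space n"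
      "\<And>n. N0 \<le> n \<Longrightarrow> wint p w n (\<lambda>x. g x - poly (P n) x) \<le> ennreal ((2 * C) powr p * real n powr (- \<gamma>))"
      by metis
    obtain K where K: "0 \<le> K" and inv: "\<And>n h. N0 \<le> n \<Longrightarrow> 0 < h \<Longrightarrow> h \<le> 1 / real n \<Longrightarrow>
        wint p w n (\<lambda>x. central_difference r (h * phi x) g x) \<le> ennreal (K * real n powr (- \<gamma>))"
      using inverse_estimate[OF p w \<gamma> gm N0 _ P] by auto
    \<comment> \<open>The added 1 keeps the constant positive when K = 0.\<close>
    have "modulus r f (1 / real n) p (avg_weight w n) \<le> ennreal ((K powr (1 / p) + 1) * \<bar>real n powr (- \<alpha>)\<bar>)" if n: "N0 \<le> n" for n
      unfolding modulus_def
    proof (rule SUP_least)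
      fix h assume h: "h \<in> {0<..1 / real n}"
      have n1: "1 \<le> n" using n N0 by simp
      have "Lp_norm p (avg_weight w n) (\<lambda>x. central_difference r (h * phi x) f x) \<le> ennreal (K powr (1 / p) * real n powr (- \<alpha>))"
        using cd_iff[OF n1, of "K powr (1 / p) * real n powr (- \<alpha>)" h] inv[OF n, of h] h rate'[OF K, of n] by simp
      also have "\<dots> \<le> ennreal ((K powr (1 / p) + 1) * \<bar>real n powr (- \<alpha>)\<bar>)" by (intro ennreal_leI) (simp add: mult_right_mono)
      finally show "Lp_norm p (avg_weight w n) (\<lambda>x. central_difference r (h * phi x) f x) \<le> ennreal ((K powr (1 / p) + 1) * \<bar>real n powr (- \<alpha>)\<bar>)" .
    qed
    then show "ennreal_bigo (\<lambda>n. modulus r f (1 / real n) p (avg_weight w n)) (\<lambda>n. real n powr (- \<alpha>))"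
      unfolding ennreal_bigo_def eventually_sequentially
      by (intro exI[of _ "K powr (1 / p) + 1"] conjI exI[of _ N0]) (auto intro: add_nonneg_pos)
  next
    assume "ennreal_bigo (\<lambda>n. modulus r f (1 / real n) p (avg_weight w n)) (\<lambda>n. real n powr (- \<alpha>))"
    then obtain C N where C: "0 < C" and md: "\<And>n. N \<le> n \<Longrightarrow> modulus r f (1 / real n) p (avg_weight w n) \<le> ennreal (C * \<bar>real n powr (- \<alpha>)\<bar>)"
      unfolding ennreal_bigo_def eventually_sequentially by blast
    obtain C2 l where C2: "0 < C2" and direct: "\<And>n S. 1 \<le> n \<Longrightarrow>
        (\<And>h. 0 < h \<Longrightarrow> h \<le> 1 / real n \<Longrightarrow> wint p w n (\<lambda>x. central_difference r (h * phi x) g x) \<le> S) \<Longrightarrow>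
        \<exists>P. degree P \<le> l * n \<and> wint p w n (\<lambda>x. g x - poly P x) \<le> ennreal C2 * S"
      using direct_estimate[OF p w r] gm fin by blast
    \<comment> \<open>With n = m div (l + 1) and n >= 1 one has m < (l + 1)(n + 1) <= 2 (l + 1)
      n.\<close>
    define K where "K = 2 * (l + 1)"
    define C3 where "C3 = (real K)\<^sup>2 * (C2 * (C powr p * real K powr \<gamma>))"
    have C3: "0 < C3" using C C2 by (simp add: C3_def K_def)
    have "best_approx m f p (avg_weight w m) \<le> ennreal (C3 powr (1 / p) * \<bar>real m powr (- \<alpha>)\<bar>)" if m: "(l + 1) * max N 1 \<le> m" for m
    proof -
      \<comment> \<open>This choice gives l n < m, so a polynomial of degree at most l n belongs to
        \<open>Poly_space m\<close>, while m stays within the factor K of n and the weights remain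
        comparable.\<close>
      define n where "n = m div (l + 1)"
      have "max N 1 \<le> n" unfolding n_def using m by (subst less_eq_div_iff_mult_less_eq) (auto simp: mult.commute)
      then have n: "N \<le> n" "1 \<le> n" by auto
      have le: "(l + 1) * n \<le> m" unfolding n_def by (rule times_div_less_eq_dividend)
      have "m < (l + 1) * (n + 1)" unfolding n_def using dividend_less_times_div[of "l + 1" m] by (simp add: algebra_simps)
      also have "\<dots> \<le> (l + 1) * (2 * n)" using n by (intro mult_left_mono) auto
      finally have mK: "m \<le> K * n" by (simp add: K_def)
      have nm: "n \<le> m" "l * n < m" using le n by auto
      have "wint p w n (\<lambda>x. central_difference r (h * phi x) g x) \<le> ennreal (C powr p * real n powr (- \<gamma>))"
        if h: "0 < h" "h \<le> 1 / real n" for h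
      proof -
        have "Lp_norm p (avg_weight w n) (\<lambda>x. central_difference r (h * phi x) f x) \<le> modulus r f (1 / real n) p (avg_weight w n)"
          unfolding modulus_def using h by (intro SUP_upper) auto
        also have "\<dots> \<le> ennreal (C * real n powr (- \<alpha>))" using md[OF n(1)] by simp
        finally show ?thesis using cd_iff[OF n(2), of "C * real n powr (- \<alpha>)" h] h C rate[of C n] by simp
      qed
      from direct[OF n(2) this] obtain P where P: "degree P \<le> l * n"
        "wint p w n (\<lambda>x. g x - poly P x) \<le> ennreal C2 * ennreal (C powr p * real n powr (- \<gamma>))" by blast
      have "real n powr (- \<gamma>) \<le> real K powr \<gamma> * real m powr (- \<gamma>)"
      proof -
        have "real m powr \<gamma> \<le> (real K * real n) powr \<gamma>" using mK \<gamma> by (intro powr_mono2) (auto simp flip: of_nat_mult)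
        also have "\<dots> = real K powr \<gamma> * real n powr \<gamma>" by (simp add: powr_mult)
        finally show ?thesis using n nm by (simp add: powr_minus field_simps)
      qed
      then have "C2 * (C powr p * real n powr (- \<gamma>)) \<le> C2 * (C powr p * (real K powr \<gamma> * real m powr (- \<gamma>)))"
        using C2 by (intro mult_left_mono) auto
      then have rate_n: "(real K)\<^sup>2 * (C2 * (C powr p * real n powr (- \<gamma>))) \<le> C3 * real m powr (- \<gamma>)"
        using mult_left_mono[of _ _ "(real K)\<^sup>2"] by (fastforce simp: C3_def mult.assoc)
      have "wint p w m (\<lambda>x. g x - poly P x) \<le> ennreal ((real K)\<^sup>2) * wint p w n (\<lambda>x. g x - poly P x)"
        by (rule wint_compare_const[OF w n(2) nm(1) mK]) measurable
      also have "\<dots> \<le> ennreal ((real K)\<^sup>2) * (ennreal C2 * ennreal (C powr p * real n powr (- \<gamma>)))"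
        by (intro mult_left_mono P) auto
      also have "\<dots> = ennreal ((real K)\<^sup>2 * (C2 * (C powr p * real n powr (- \<gamma>))))"
        using C2 by (simp add: ennreal_mult)
      also have "\<dots> \<le> ennreal (C3 * real m powr (- \<gamma>))" by (rule ennreal_leI[OF rate_n])
      also have "C3 * real m powr (- \<gamma>) = (C3 powr (1 / p) * real m powr (- \<alpha>)) powr p" using C3 by (simp add: rate')
      finally have "Lp_norm p (avg_weight w m) (\<lambda>x. f x - poly P x) \<le> ennreal (C3 powr (1 / p) * real m powr (- \<alpha>))"
        using poly_iff[of m "C3 powr (1 / p) * real m powr (- \<alpha>)" P] n nm by auto
      moreover have "P \<in> Poly_space m" using P(1) nm by (simp add: Poly_space_def)
      ultimately show ?thesis unfolding best_approx_def by (auto intro: INF_lower2)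
    qed
    then show "ennreal_bigo (\<lambda>n. best_approx n f p (avg_weight w n)) (\<lambda>n. real n powr (- \<alpha>))"
      unfolding ennreal_bigo_def eventually_sequentially
      using C3 by (intro exI[of _ "C3 powr (1 / p)"] conjI exI[of _ "(l + 1) * max N 1"]) auto
  qed
qed

end
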